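(* Let $K\ge2$, $b\in\mathbb{R}$, and suppose Assumption A1 holds and Assumption A2 holds for a Borel set $I\subset\mathbb{R}$. Then the random canopy operator $H_{\mathcal{C}}$ almost surely has only pure point spectrum in $I$.
   Context: $\mathcal{T}$ is the rooted tree in which every vertex has $K$ neighbors away from the root $0$; $\mathcal{T}_L=\{x:\mathrm{dist}(0,x)\le L\}$; $H_{\mathcal{T}_L}=A+V+B$ on $\ell^2(\mathcal{T}_L)$ with $A$ the adjacency operator, $V$ multiplication by i.i.d. random $\omega_x$, $B$ multiplication by $b$ on $\{x:\mathrm{dist}(0,x)=L\}$. The canopy graph $\mathcal{C}$: starting from an infinite outermost layer $\partial\mathcal{C}$, each layer is partitioned into sets of $K$ elements, the elements of each set being joined to a common vertex of the next layer, recursively for infinitely many layers. $H_{\mathcal{C}}=A+V+B$ on $\ell^2(\mathcal{C})$, with $A$ the adjacency operator of $\mathcal{C}$, $V$ multiplication by i.i.d. $\{\omega_x\}_{x\in\mathcal{C}}$ with the same single-site distribution, and $B$ multiplication by $b$ on $\partial\mathcal{C}$. Assumption A1: the single-site distribution has a bounded density $\varrho$ with $\int|\omega|^\tau\varrho(\omega)d\omega<\infty$ for some $\tau>0$. Assumption A2 (for $I$): the functions $E\mapsto\mathbb{E}[\ln|\langle\delta_0,(H_{\mathcal{T}_L}-E)^{-1}\delta_0\rangle|]$, $L\in\mathbb{N}$, are equicontinuous on $I$. *)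

theory Defs
  imports "HOL-Probability.Probability"
begin

definition site_dist :: "(real \<Rightarrow> real) \<Rightarrow> real measure" where
  "site_dist \<rho> = density lborel (\<lambda>w. ennreal (\<rho> w))"

text \<open>Vertices of T_L: words over {0..K-1} of length at most L; the root 0 is the
  empty word, the K forward neighbours of xs are xs @ [i], and dist(0,xs) = length xs.\<close>

definition tree_verts :: "nat \<Rightarrow> nat \<Rightarrow> nat list set" where
  "tree_verts K L = {xs. set xs \<subseteq> {..<K} \<and> length xs \<le> L}"

definition tree_H :: "nat \<Rightarrow> nat \<Rightarrow> real \<Rightarrow> (nat list \<Rightarrow> real) \<Rightarrow> (nat list \<Rightarrow> real)
    \<Rightarrow> nat list \<Rightarrow> real" where
  "tree_H K L b \<omega> \<psi> xs =
     (if xs = [] then 0 else \<psi> (butlast xs))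
   + (if length xs < L then (\<Sum>i<K. \<psi> (xs @ [i])) else 0)
   + (\<omega> xs + (if length xs = L then b else 0)) * \<psi> xs"

text \<open>The root entry of the resolvent (H_{T_L} - E)^{-1}; it is the root value of the unique
  solution psi of (H - E) psi = delta_0 on T_L (set to 0 when H - E is singular).\<close>

definition tree_sol :: "nat \<Rightarrow> nat \<Rightarrow> real \<Rightarrow> (nat list \<Rightarrow> real) \<Rightarrow> real
    \<Rightarrow> (nat list \<Rightarrow> real) \<Rightarrow> bool" where
  "tree_sol K L b \<omega> E \<psi> \<longleftrightarrow>
     (\<forall>xs. xs \<notin> tree_verts K L \<longrightarrow> \<psi> xs = 0) \<and>
     (\<forall>xs\<in>tree_verts K L. tree_H K L b \<omega> \<psi> xs - E * \<psi> xs = (if xs = [] then 1 else 0))"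

definition tree_green :: "nat \<Rightarrow> nat \<Rightarrow> real \<Rightarrow> (nat list \<Rightarrow> real) \<Rightarrow> real \<Rightarrow> real" where
  "tree_green K L b \<omega> E =
     (if \<exists>!\<psi>. tree_sol K L b \<omega> E \<psi> then (THE \<psi>. tree_sol K L b \<omega> E \<psi>) [] else 0)"

definition tree_avg_log :: "nat \<Rightarrow> nat \<Rightarrow> real \<Rightarrow> (real \<Rightarrow> real) \<Rightarrow> real \<Rightarrow> real" where
  "tree_avg_log K L b \<rho> E =
     (\<integral>\<omega>. ln \<bar>tree_green K L b \<omega> E\<bar> \<partial>(PiM (tree_verts K L) (\<lambda>_. site_dist \<rho>)))"

text \<open>Vertices of C: pairs (n, j); n is the layer (n = 0 is the outermost layer \<partial>C),
  j indexes the (countably infinite) layer. The layer-n vertices {(n, K*j + i) | i < K}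
  are joined to the common vertex (n+1, j) of the next layer.\<close>

type_synonym cvert = "nat \<times> nat"

definition canopy_H :: "nat \<Rightarrow> real \<Rightarrow> (cvert \<Rightarrow> real) \<Rightarrow> (cvert \<Rightarrow> complex)
    \<Rightarrow> cvert \<Rightarrow> complex" where
  "canopy_H K b \<omega> \<psi> v =
     \<psi> (fst v + 1, snd v div K)
   + (if fst v = 0 then 0 else (\<Sum>i<K. \<psi> (fst v - 1, K * snd v + i)))
   + complex_of_real (\<omega> v + (if fst v = 0 then b else 0)) * \<psi> v"

definition l2 :: "(cvert \<Rightarrow> complex) \<Rightarrow> bool" where
  "l2 \<psi> \<longleftrightarrow> (\<lambda>v. (cmod (\<psi> v))\<^sup>2) summable_on UNIV"

text \<open>Green function <delta_x, (H_C - z)^{-1} delta_x> for non-real z: the value at x of the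
  (unique) l^2 solution psi of (H_C - z) psi = delta_x.\<close>

definition canopy_green :: "nat \<Rightarrow> real \<Rightarrow> (cvert \<Rightarrow> real) \<Rightarrow> cvert \<Rightarrow> complex \<Rightarrow> complex" where
  "canopy_green K b \<omega> x z =
     (THE g. \<exists>\<psi>. l2 \<psi> \<and> (\<forall>v. canopy_H K b \<omega> \<psi> v - z * \<psi> v = (if v = x then 1 else 0))
                \<and> g = \<psi> x)"

text \<open>H_C has only pure point spectrum in I: for every x the spectral measure mu_x of delta_x
  (the finite Borel measure whose Borel transform is the Green function) restricted to I is
  pure point, i.e. concentrated on a countable set. Since the delta_x span l^2(C), this says
  that the spectral subspace of I is contained in the pure point subspace.\<close>

definition canopy_pure_point_in :: "nat \<Rightarrow> real \<Rightarrow> (cvert \<Rightarrow> real) \<Rightarrow> real set \<Rightarrow> bool" where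
  "canopy_pure_point_in K b \<omega> I \<longleftrightarrow>
     (\<forall>x. \<exists>\<mu>. finite_measure \<mu> \<and> sets \<mu> = sets borel \<and>
        (\<forall>z. Im z \<noteq> 0 \<longrightarrow> canopy_green K b \<omega> x z = (\<integral>E. 1 / (complex_of_real E - z) \<partial>\<mu>)) \<and>
        (\<exists>S. countable S \<and> emeasure \<mu> (I - S) = 0))"

definition canopy_prob :: "(real \<Rightarrow> real) \<Rightarrow> (cvert \<Rightarrow> real) measure" where
  "canopy_prob \<rho> = PiM UNIV (\<lambda>_. site_dist \<rho>)"

end

theory Submission
  imports Defs "HOL-Computational_Algebra.Fundamental_Theorem_Algebra" "HOL-Real_Asymp.Real_Asymp"
begin

text \<open>The Green function of the subtree below a vertex satisfies a recursion along the layers.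
  For non-real energies, concavity of the logarithm together with the anticoncentration given by
  the bounded density makes the mean of its logarithm lie, on average over the layers, strictly
  below minus half the logarithm of K. Assumption A2 carries this bound to the real energies of I
  at which I has density one: the mean at a point of the half plane is the Poisson average of the
  means on the line. An Efron-Stein variance bound then yields almost sure decay of the products
  of subtree Green functions along the path from a vertex towards infinity, faster than the
  inverse square root of the number of vertices below the path.

  The finite-volume Green function of a vertex is a rational Herglotz function, so its derivative
  is a sum of squared Green function entries along that path, which the decay bounds uniformly in
  the volume for almost every energy in I. The mass of an atom of the finite-volume spectral
  measure is the inverse of a derivative that does not depend on the potential at the vertex.
  Averaging over that potential (as Simon and Wolff do) shows that atoms of small mass carry
  little of the spectral measure near I, uniformly in the volume. A weak limit of such measures is
  pure point on I, and it is the spectral measure of the canopy operator because an energy flux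
  identity makes the square summable solution of the resolvent equation unique.\<close>

text \<open>The gap below minus half of ln K originates in \<open>im_gam_eq\<close>: the imaginary
  part of a Green function is its squared modulus times a sum that contains the K imaginary parts
  one layer further out. The logarithm of a sum of K positive terms exceeds the mean of their
  logarithms by at least ln K, with equality only for equal terms; two children have independent
  Green functions, and the bounded density keeps them apart with probability at least 1/2. The value
  ln K / 2 is what the end of the argument demands. A subtree of height n carries at most of the
  order of K^n atoms, and at almost every energy its Green function has a derivative growing at most
  at rate ln K. The square root of that growth, K^(n/2), meets the products along the path, so
  products smaller than K^(-n/2) by an exponential factor make the contributions summable. Two
  uniformities shape the estimates. The gap must not shrink as the energy approaches the real axis,
  hence moment bounds that see only the modulus of the energy. The distance at which the axis is
  approached must not depend on the layer, and this is what equicontinuity provides.\<close>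

lemma nn_integral_abs_powr_unit:
  fixes r :: real
  assumes r: "0 < r" "r < 1"
  shows "(\<integral>\<^sup>+u. ennreal (indicator {-1..1} u * \<bar>u\<bar> powr (-r)) \<partial>lborel) = ennreal (2 / (1 - r))"
proof -
  have "((%x. x powr (-r)) has_integral (1 powr (-r + 1) / (-r + 1))) {0..1::real}"
    by (rule has_integral_powr_from_0) (use r in auto)
  then have hi: "((%x. \<bar>x\<bar> powr (-r)) has_integral (1 / (1 - r))) {0..1::real}"
    by (subst has_integral_cong[where g = "%x. x powr (-r)"]) (auto simp: algebra_simps)
  have half: "(\<integral>\<^sup>+u. ennreal (indicator {0..1} u * \<bar>u\<bar> powr (-r)) \<partial>lborel) = ennreal (1 / (1 - r))"
    by (rule nn_integral_has_integral_lebesgue[OF _ hi]) auto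
  have "(\<integral>\<^sup>+u. ennreal (indicator {-1..0} u * \<bar>u\<bar> powr (-r)) \<partial>lborel) =
      ennreal \<bar>-1\<bar> * (\<integral>\<^sup>+u. ennreal (indicator {-1..0} (0 + (-1) * u) * \<bar>0 + (-1) * u\<bar> powr (-r)) \<partial>lborel)"
    by (rule nn_integral_real_affine) auto
  also have "... = (\<integral>\<^sup>+u. ennreal (indicator {0..1} u * \<bar>u\<bar> powr (-r)) \<partial>lborel)"
    by (auto intro!: nn_integral_cong simp: indicator_def)
  finally have neg: "(\<integral>\<^sup>+u. ennreal (indicator {-1..0} u * \<bar>u\<bar> powr (-r)) \<partial>lborel) = ennreal (1 / (1 - r))"
    using half by simp
  have "(\<integral>\<^sup>+u. ennreal (indicator {-1..1} u * \<bar>u\<bar> powr (-r)) \<partial>lborel) =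
     (\<integral>\<^sup>+u. ennreal (indicator {-1..0} u * \<bar>u\<bar> powr (-r)) + ennreal (indicator {0..1} u * \<bar>u\<bar> powr (-r)) \<partial>lborel)"
    by (intro nn_integral_cong) (auto simp: indicator_def)
  also have "... = ennreal (1 / (1 - r)) + ennreal (1 / (1 - r))"
    by (subst nn_integral_add) (auto simp: half neg)
  also have "... = ennreal (2 / (1 - r))"
    using r by (subst ennreal_plus[symmetric]) (auto simp: field_simps)
  finally show ?thesis .
qed

lemma abs_powr_neg_le:
  fixes u r :: real
  assumes "0 < r"
  shows "\<bar>u\<bar> powr (-r) \<le> 1 + indicator {-1..1} u * \<bar>u\<bar> powr (-r)"
proof (cases "u \<in> {-1..1}")
  case False
  then have "\<bar>u\<bar> \<ge> 1" by auto
  then have "\<bar>u\<bar> powr (-r) \<le> 1 powr (-r)"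
    using assms by (intro powr_mono2') auto
  with False show ?thesis by (simp add: indicator_def)
qed auto

section \<open>The disorder measure and the resampling of sites\<close>

text \<open>The exponent \<open>s\<close> has two duties: the potential has a finite moment of order
  \<open>s\<close>, and inverse powers of order \<open>s\<close> are integrable against a bounded
  density, which calls for an exponent below 1.\<close>

locale canopy_model =
  fixes K :: nat and b :: real and \<rho> :: "real => real" and M s :: real
  assumes K2: "K \<ge> 2"
    and rho_meas [measurable]: "\<rho> \<in> borel_measurable borel"
    and rho_nonneg: "\<And>w. 0 \<le> \<rho> w"
    and rho_prob: "(\<integral>\<^sup>+ w. ennreal (\<rho> w) \<partial>lborel) = 1"
    and rho_le: "\<And>w. \<rho> w \<le> M"
    and s_pos: "0 < s" and s_half: "s \<le> 1 / 2"
    and s_moment: "(\<integral>\<^sup>+ w. ennreal (\<bar>w\<bar> powr s) \<partial>site_dist \<rho>) < \<infinity>"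
begin

abbreviation D where "D \<equiv> site_dist \<rho>"
abbreviation Q where "Q \<equiv> canopy_prob \<rho>"

lemma M_nonneg: "0 \<le> M"
  using rho_nonneg[of 0] rho_le[of 0] by simp

lemma sets_D [measurable_cong, simp]: "sets D = sets borel"
  by (simp add: site_dist_def)

lemma measurable_D_eq [simp]: "measurable D N = measurable borel N" "measurable N D = measurable N borel"
  by (rule measurable_cong_sets[OF sets_D refl] measurable_cong_sets[OF refl sets_D])+

lemma space_D [simp]: "space D = UNIV"
  by (simp add: site_dist_def)

lemma nn_D: "f \<in> borel_measurable borel ==> (\<integral>\<^sup>+v. f v \<partial>D) = (\<integral>\<^sup>+v. ennreal (\<rho> v) * f v \<partial>lborel)"
  unfolding site_dist_def by (rule nn_integral_density) auto

sublocale D: prob_space D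
proof
  have "emeasure D (space D) = (\<integral>\<^sup>+v. 1 \<partial>D)" by simp
  also have "... = 1" by (subst nn_D) (auto simp: rho_prob)
  finally show "emeasure D (space D) = 1" .
qed

lemma nn_D_le:
  assumes [measurable]: "f \<in> borel_measurable borel"
  shows "(\<integral>\<^sup>+v. f v \<partial>D) \<le> ennreal M * (\<integral>\<^sup>+v. f v \<partial>lborel)"
  unfolding nn_D[OF assms]
  by (subst nn_integral_cmult[symmetric])
    (auto intro!: nn_integral_mono mult_right_mono ennreal_leI rho_le)

lemma sets_Q [measurable_cong]: "sets Q = sets (PiM UNIV (%_. borel))"
  unfolding canopy_prob_def by (rule sets_PiM_cong) auto

lemma space_Q [simp]: "space Q = UNIV"
  by (auto simp: canopy_prob_def space_PiM)

sublocale QP: product_prob_space "%_::cvert. D" UNIV ..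

sublocale Q: prob_space Q
  unfolding canopy_prob_def by (rule QP.prob_space_axioms)

sublocale QQ: pair_prob_space Q Q ..
sublocale QD: pair_prob_space Q D ..
sublocale QL: pair_sigma_finite Q lborel ..
sublocale LQ: pair_sigma_finite lborel Q ..

lemma Q_component [measurable]: "(%om. om v) \<in> borel_measurable Q"
  by measurable

lemma measurable_into_Q:
  assumes "\<And>v. (%x. f x v) \<in> borel_measurable N"
  shows "f \<in> measurable N Q"
proof -
  have "f \<in> measurable N (PiM UNIV (%_. borel))"
    by (rule measurable_PiM_single') (use assms in auto)
  then show ?thesis by (simp add: measurable_cong_sets[OF refl sets_Q])
qed

text \<open>With an independent second configuration this realises conditioning on the sites outside
  J: freeze the first argument and integrate over the second.\<close>

definition mrg :: "cvert set => (cvert => real) => (cvert => real) => cvert => real" where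
  "mrg J om om' = (%v. if v \<in> J then om' v else om v)"

lemma mrg_measurable [measurable]:
  "(%p. mrg J (fst p) (snd p)) \<in> measurable (Q \<Otimes>\<^sub>M Q) Q"
  by (rule measurable_into_Q) (simp add: mrg_def, measurable)

text \<open>The two laws agree on finite-dimensional cylinders: the coordinates of a cylinder split
  into those in J, drawn from the second factor, and the others, drawn from the first.\<close>

lemma distr_mrg: "distr (Q \<Otimes>\<^sub>M Q) Q (%p. mrg J (fst p) (snd p)) = Q"
proof -
  have "distr (Q \<Otimes>\<^sub>M Q) Q (%p. mrg J (fst p) (snd p)) = PiM UNIV (%_. D)"
  proof (rule measure_eqI_PiM_infinite)
    show "sets (distr (Q \<Otimes>\<^sub>M Q) Q (%p. mrg J (fst p) (snd p))) = sets (PiM UNIV (%_. D))"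
      by (simp add: canopy_prob_def)
    show "finite_measure (distr (Q \<Otimes>\<^sub>M Q) Q (%p. mrg J (fst p) (snd p)))"
      by (intro prob_space.finite_measure QQ.prob_space_distr) measurable
    fix A :: "cvert => real set" and F :: "cvert set"
    assume F: "finite F" "F \<subseteq> UNIV" and A: "\<And>i. i \<in> F ==> A i \<in> sets D"
    let ?e = "%F. prod_emb UNIV (%_. D) F (Pi\<^sub>E F A)"
    have e_sets: "?e G \<in> sets Q" if "G \<subseteq> F" for G
      unfolding canopy_prob_def using that F A by (intro sets_PiM_I) (auto intro: finite_subset)
    have e_meas: "emeasure Q (?e G) = (\<Prod>i\<in>G. emeasure D (A i))" if "G \<subseteq> F" for G
      unfolding canopy_prob_def using that F A
      by (intro QP.emeasure_PiM_emb) (auto intro: finite_subset)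
    have e_eq: "?e G = {x. \<forall>i\<in>G. x i \<in> A i}" for G
      by (auto simp: prod_emb_def space_PiM PiE_def Pi_iff)
    have "emeasure (distr (Q \<Otimes>\<^sub>M Q) Q (%p. mrg J (fst p) (snd p))) (?e F)
        = emeasure (Q \<Otimes>\<^sub>M Q) ((%p. mrg J (fst p) (snd p)) -` ?e F \<inter> space (Q \<Otimes>\<^sub>M Q))"
      by (intro emeasure_distr e_sets) auto
    also have "(%p. mrg J (fst p) (snd p)) -` ?e F \<inter> space (Q \<Otimes>\<^sub>M Q) = ?e (F - J) \<times> ?e (F \<inter> J)"
      unfolding e_eq by (auto simp: mrg_def space_pair_measure)
    also have "emeasure (Q \<Otimes>\<^sub>M Q) (?e (F - J) \<times> ?e (F \<inter> J)) = emeasure Q (?e (F - J)) * emeasure Q (?e (F \<inter> J))"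
      by (intro Q.emeasure_pair_measure_Times e_sets) auto
    also have "... = (\<Prod>i\<in>F-J. emeasure D (A i)) * (\<Prod>i\<in>F\<inter>J. emeasure D (A i))"
      by (simp add: e_meas)
    also have "... = (\<Prod>i\<in>F. emeasure D (A i))"
      using F by (subst prod.union_disjoint[symmetric]) (auto intro!: prod.cong)
    also have "... = emeasure (PiM UNIV (%_. D)) (?e F)"
      using e_meas[of F] by (simp add: canopy_prob_def)
    finally show "emeasure (distr (Q \<Otimes>\<^sub>M Q) Q (%p. mrg J (fst p) (snd p))) (?e F) = emeasure (PiM UNIV (%_. D)) (?e F)" .
  qed simp
  then show ?thesis by (simp add: canopy_prob_def)
qed

lemma nn_resample:
  assumes [measurable]: "g \<in> borel_measurable Q"
  shows "(\<integral>\<^sup>+om. g om \<partial>Q) = (\<integral>\<^sup>+om. \<integral>\<^sup>+om'. g (mrg J om om') \<partial>Q \<partial>Q)"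
proof -
  have "(\<integral>\<^sup>+om. g om \<partial>Q) = (\<integral>\<^sup>+om. g om \<partial>distr (Q \<Otimes>\<^sub>M Q) Q (%p. mrg J (fst p) (snd p)))"
    by (simp add: distr_mrg)
  also have "... = (\<integral>\<^sup>+p. g (mrg J (fst p) (snd p)) \<partial>(Q \<Otimes>\<^sub>M Q))"
    by (rule nn_integral_distr) auto
  also have "... = (\<integral>\<^sup>+om. \<integral>\<^sup>+om'. g (mrg J om om') \<partial>Q \<partial>Q)"
    by (subst Q.nn_integral_fst[symmetric]) (auto simp: comp_def)
  finally show ?thesis .
qed

lemma distr_component: "distr Q D (%om. om v) = D"
  unfolding canopy_prob_def by (rule QP.PiM_component) simp

lemma upd_measurable [measurable]:
  "(%p. (fst p)(x := snd p)) \<in> measurable (Q \<Otimes>\<^sub>M D) Q"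
  by (rule measurable_into_Q) (simp add: fun_upd_def, measurable)

text \<open>Integrating a single site first, with all others frozen, is the way the bounded density
  enters: as functions of one site potential the Green functions are explicit.\<close>

lemma nn_resample1:
  assumes [measurable]: "g \<in> borel_measurable Q"
  shows "(\<integral>\<^sup>+om. g om \<partial>Q) = (\<integral>\<^sup>+om. \<integral>\<^sup>+v. g (fun_upd om x v) \<partial>D \<partial>Q)"
proof -
  have "(\<integral>\<^sup>+om'. g (mrg {x} om om') \<partial>Q) = (\<integral>\<^sup>+v. g (fun_upd om x v) \<partial>D)" for om
  proof -
    have m: "(%v. g (fun_upd om x v)) \<in> borel_measurable D"
      using measurable_compose[OF measurable_Pair1'[of om Q D] measurable_compose[OF upd_measurable[of x] assms]]
      by simp
    have "(\<integral>\<^sup>+om'. g (mrg {x} om om') \<partial>Q) = (\<integral>\<^sup>+om'. g (fun_upd om x (om' x)) \<partial>Q)"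
      by (auto simp: mrg_def fun_upd_def intro!: nn_integral_cong arg_cong[of _ _ g])
    also have "... = (\<integral>\<^sup>+v. g (fun_upd om x v) \<partial>distr Q D (%om. om x))"
      by (rule nn_integral_distr[symmetric]) (use m in auto)
    finally show ?thesis by (simp add: distr_component)
  qed
  then show ?thesis using nn_resample[OF assms, of "{x}"] by simp
qed

end

lemma powr_add_le:
  fixes x y s :: real
  assumes "0 \<le> x" "0 \<le> y" "0 < s" "s \<le> 1"
  shows "(x + y) powr s \<le> x powr s + y powr s"
proof (cases "x + y = 0")
  case False
  then have p: "x + y > 0" using assms by simp
  have *: "t \<le> t powr s" if "0 \<le> t" "t \<le> 1" for t :: real
    using powr_mono'[of s 1 t] that assms by simp
  have "1 = x / (x + y) + y / (x + y)"
    using p by (simp add: add_divide_distrib[symmetric])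
  also have "... \<le> (x / (x + y)) powr s + (y / (x + y)) powr s"
    by (intro add_mono *) (use assms p in auto)
  also have "... = (x powr s + y powr s) / (x + y) powr s"
    using assms p by (simp add: powr_divide add_divide_distrib)
  finally show ?thesis using p by (simp add: field_simps)
qed (use assms in auto)

lemma powr_sum_le:
  fixes f :: "'a => real"
  assumes "finite A" "\<And>i. i \<in> A ==> 0 \<le> f i" "0 < s" "s \<le> 1"
  shows "(\<Sum>i\<in>A. f i) powr s \<le> (\<Sum>i\<in>A. f i powr s)"
  using assms(1,2)
proof (induction A rule: finite_induct)
  case (insert a A)
  have "(f a + (\<Sum>i\<in>A. f i)) powr s \<le> f a powr s + (\<Sum>i\<in>A. f i) powr s"
    using insert.prems by (intro powr_add_le assms(3,4) sum_nonneg) auto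
  with insert show ?case by auto
qed simp

section \<open>Green functions by recursion along the layers, and their fractional moments\<close>

context canopy_model
begin

text \<open>The Green function at (n, j) of the subtree below (n, j), where z is the energy. It lives in any real normed field so that real and complex energies share one recursion.\<close>

primrec gam :: "(cvert => real) => 'a::real_normed_field => nat => nat => 'a" where
  "gam om z 0 = (%j. inverse (of_real (om (0, j)) - z - (- of_real b)))"
| "gam om z (Suc n) =
     (%j. inverse (of_real (om (Suc n, j)) - z - (\<Sum>i<K. gam om z n (K * j + i))))"

text \<open>The self-energy from below. On the outermost layer the boundary term is stored as a
  fictitious child sum \<open>- b\<close>, so that one formula, \<open>gam_eq\<close>, covers all
  layers.\<close>

definition cs :: "(cvert => real) => 'a::real_normed_field => nat => nat => 'a" where
  "cs om z n j = (case n of 0 => - of_real b | Suc m => (\<Sum>i<K. gam om z m (K * j + i)))"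

definition sib :: "(cvert => real) => 'a::real_normed_field => nat => nat => 'a" where
  "sib om z n j = (\<Sum>i\<in>{..<K} - {j mod K}. gam om z n (K * (j div K) + i))"

text \<open>The Green function at the parent of (n, j), in the part of the canopy cut d layers above (n, j) that remains when the subtree below (n, j) is removed.\<close>

primrec up :: "(cvert => real) => 'a::real_normed_field => nat => nat => nat => 'a" where
  "up om z 0 = (%n j. 0)"
| "up om z (Suc d) = (%n j. inverse (of_real (om (Suc n, j div K)) - z
     - (sib om z n j + up om z d (Suc n) (j div K))))"

text \<open>The diagonal Green function at (n, j) of the finite canopy cut d layers above that
  vertex, as a Schur complement with one self-energy from below and one from above.\<close>

definition gF :: "(cvert => real) => 'a::real_normed_field => nat => nat => nat => 'a" where
  "gF om z d n j = inverse (of_real (om (n, j)) - z - (cs om z n j + up om z d n j))"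

text \<open>Division by K leads from an index to its parent, so \<open>i div K ^ (n - m)\<close> is
  the ancestor of (m, i) in layer n: the set is the subtree below (n, j).\<close>

definition desc :: "nat => nat => cvert set" where
  "desc n j = {(m, i). m \<le> n \<and> i div K ^ (n - m) = j}"

lemma K_pos [simp]: "0 < K" "K \<noteq> 0"
  using K2 by auto

lemma gam_eq: "gam om z n j = inverse (of_real (om (n, j)) - z - cs om z n j)"
  by (cases n) (auto simp: cs_def)

lemma cs_0 [simp]: "cs om z 0 j = - of_real b"
  by (simp add: cs_def)

lemma cs_Suc: "cs om z (Suc n) j = (\<Sum>i<K. gam om z n (K * j + i))"
  by (simp add: cs_def)

lemma cs_parent: "cs om z (Suc n) (j div K) = gam om z n j + sib om z n j"
proof -
  have "(\<Sum>i<K. gam om z n (K * (j div K) + i)) =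
      gam om z n (K * (j div K) + j mod K) + (\<Sum>i\<in>{..<K} - {j mod K}. gam om z n (K * (j div K) + i))"
    by (rule sum.remove) auto
  then show ?thesis by (simp add: cs_Suc sib_def)
qed

lemma gF_0: "gF om z 0 n j = gam om z n j"
  by (simp add: gF_def gam_eq)

lemma of_real_gam: "gam om (of_real E) n j = of_real (gam om E n j)"
  by (induction n arbitrary: j) (auto simp: of_real_inverse)

lemma of_real_cs: "cs om (of_real E) n j = of_real (cs om E n j)"
  by (cases n) (auto simp: cs_def of_real_gam)

lemma of_real_sib: "sib om (of_real E) n j = of_real (sib om E n j)"
  by (auto simp: sib_def of_real_gam)

lemma of_real_up: "up om (of_real E) d n j = of_real (up om E d n j)"
  by (induction d arbitrary: n j) (auto simp: of_real_inverse of_real_sib)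

lemma of_real_gF: "gF om (of_real E) d n j = of_real (gF om E d n j)"
  by (simp add: gF_def of_real_inverse of_real_cs of_real_up)

lemma desc_self: "(n, j) \<in> desc n j"
  by (simp add: desc_def)

lemma desc_child: "i < K ==> desc n (K * j + i) \<subseteq> desc (Suc n) j"
  by (auto simp: desc_def Suc_diff_le div_mult2_eq mult.commute[of K])

lemma desc_parent: "desc n j \<subseteq> desc (Suc n) (j div K)"
  using desc_child[of "j mod K" n "j div K"] by simp

lemma desc_disjoint: "j \<noteq> j' ==> desc n j \<inter> desc n j' = {}"
  by (auto simp: desc_def)

lemma parent_notin_desc: "(Suc n, i) \<notin> desc n j"
  by (simp add: desc_def)

text \<open>Locality in this form, together with resampling, takes the place of independent
  sigma-algebras. The same holds for the other congruence rules below.\<close>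

lemma gam_cong:
  "(\<And>v. v \<in> desc n j ==> om v = om' v) ==> gam om z n j = gam om' z n j"
proof (induction n arbitrary: j)
  case 0
  then show ?case using desc_self[of 0 j] by simp
next
  case (Suc n)
  have "gam om z n (K * j + i) = gam om' z n (K * j + i)" if "i < K" for i
    by (rule Suc.IH, rule Suc.prems) (use desc_child[OF that] in auto)
  moreover have "om (Suc n, j) = om' (Suc n, j)"
    by (rule Suc.prems, rule desc_self)
  ultimately show ?case by simp
qed

lemma cs_cong:
  assumes "\<And>v. v \<in> desc n j ==> v \<noteq> (n, j) ==> om v = om' v"
  shows "cs om z n j = cs om' z n j"
proof (cases n)
  case (Suc m)
  have "gam om z m (K * j + i) = gam om' z m (K * j + i)" if "i < K" for i
    by (rule gam_cong, rule assms) (use desc_child[OF that, of m j] Suc in \<open>auto simp: desc_def\<close>)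
  then show ?thesis by (simp add: Suc cs_Suc)
qed simp

lemma sib_cong:
  assumes "\<And>v. v \<in> desc (Suc n) (j div K) ==> v \<notin> desc n j ==> v \<noteq> (Suc n, j div K) ==> om v = om' v"
  shows "sib om z n j = sib om' z n j"
  unfolding sib_def
proof (intro sum.cong refl gam_cong)
  fix i v assume i: "i \<in> {..<K} - {j mod K}" and v: "v \<in> desc n (K * (j div K) + i)"
  have "K * (j div K) + i \<noteq> j"
    using i by (metis DiffE add_left_cancel mult_div_mod_eq singletonI)
  with v have "v \<notin> desc n j" using desc_disjoint[of "K * (j div K) + i" j n] by blast
  moreover have "v \<in> desc (Suc n) (j div K)" using desc_child[of i n "j div K"] i v by auto
  moreover have "v \<noteq> (Suc n, j div K)" using v parent_notin_desc by metis
  ultimately show "om v = om' v" using assms by blast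
qed

lemma up_cong:
  "(\<And>v. v \<notin> desc n j ==> om v = om' v) ==> up om z d n j = up om' z d n j"
proof (induction d arbitrary: n j)
  case (Suc d)
  have "up om z d (Suc n) (j div K) = up om' z d (Suc n) (j div K)"
    by (rule Suc.IH, rule Suc.prems) (use desc_parent in auto)
  moreover have "sib om z n j = sib om' z n j"
    by (rule sib_cong, rule Suc.prems)
  moreover have "om (Suc n, j div K) = om' (Suc n, j div K)"
    by (rule Suc.prems) (rule parent_notin_desc)
  ultimately show ?case by simp
qed simp

lemma gam_measurable [measurable (raw)]:
  assumes [measurable]: "f \<in> measurable N Q" "g \<in> borel_measurable N"
  shows "(%x. gam (f x) (g x :: 'a::{real_normed_field,euclidean_space}) n j) \<in> borel_measurable N"
proof (induction n arbitrary: j)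
  case 0
  show ?case by simp
next
  case (Suc n)
  note Suc[measurable]
  show ?case by simp
qed

lemma cs_measurable [measurable (raw)]:
  assumes [measurable]: "f \<in> measurable N Q" "g \<in> borel_measurable N"
  shows "(%x. cs (f x) (g x :: 'a::{real_normed_field,euclidean_space}) n j) \<in> borel_measurable N"
  by (cases n) (auto simp: cs_def)

lemma sib_measurable [measurable (raw)]:
  assumes [measurable]: "f \<in> measurable N Q" "g \<in> borel_measurable N"
  shows "(%x. sib (f x) (g x :: 'a::{real_normed_field,euclidean_space}) n j) \<in> borel_measurable N"
  by (auto simp: sib_def)

lemma up_measurable [measurable (raw)]:
  assumes [measurable]: "f \<in> measurable N Q" "g \<in> borel_measurable N"
  shows "(%x. up (f x) (g x :: 'a::{real_normed_field,euclidean_space}) d n j) \<in> borel_measurable N"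
proof (induction d arbitrary: n j)
  case (Suc n)
  note Suc[measurable]
  show ?case by simp
qed simp

lemma gF_measurable [measurable (raw)]:
  assumes [measurable]: "f \<in> measurable N Q" "g \<in> borel_measurable N"
  shows "(%x. gF (f x) (g x :: 'a::{real_normed_field,euclidean_space}) d n j) \<in> borel_measurable N"
  by (auto simp: gF_def)

text \<open>Replacing w by its real part only brings it closer to the real v, and the remaining
  singularity is integrable against a density bounded by M. The bound does not depend on w, which is
  what later makes all moments uniform in layer, energy and volume.\<close>

lemma neg_moment:
  assumes r: "0 < r" "r < 1"
  shows "(\<integral>\<^sup>+v. ennreal (norm (of_real v - w :: complex) powr (-r)) \<partial>D) \<le> ennreal (1 + 2 * M / (1 - r))"
proof -
  define c where "c = Re w"
  have "(\<integral>\<^sup>+v. ennreal (norm (of_real v - w) powr (-r)) \<partial>D)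
     \<le> (\<integral>\<^sup>+v. 1 + ennreal (indicator {-1..1} (v - c) * \<bar>v - c\<bar> powr (-r)) \<partial>D)"
  proof (rule nn_integral_mono_AE)
    have "AE v in lborel. v \<noteq> c" by (rule AE_lborel_singleton)
    then have "AE v in D. v \<noteq> c"
      unfolding site_dist_def by (subst AE_density) auto
    then show "AE v in D. ennreal (norm (of_real v - w) powr (-r))
      \<le> 1 + ennreal (indicator {-1..1} (v - c) * \<bar>v - c\<bar> powr (-r))"
    proof eventually_elim
      case (elim v)
      have "\<bar>v - c\<bar> \<le> norm (of_real v - w)"
        using abs_Re_le_cmod[of "of_real v - w"] by (simp add: c_def)
      then have "norm (of_real v - w) powr (-r) \<le> \<bar>v - c\<bar> powr (-r)"
        using elim r by (intro powr_mono2') auto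
      also have "... \<le> 1 + indicator {-1..1} (v - c) * \<bar>v - c\<bar> powr (-r)"
        by (rule abs_powr_neg_le) (use r in auto)
      finally show ?case
        by (metis (no_types, lifting) ennreal_1 ennreal_leI ennreal_plus indicator_pos_le
            mult_nonneg_nonneg powr_ge_zero zero_le_one)
    qed
  qed
  also have "... = 1 + (\<integral>\<^sup>+v. ennreal (indicator {-1..1} (v - c) * \<bar>v - c\<bar> powr (-r)) \<partial>D)"
    by (subst nn_integral_add) (auto simp: D.emeasure_space_1[simplified])
  also have "(\<integral>\<^sup>+v. ennreal (indicator {-1..1} (v - c) * \<bar>v - c\<bar> powr (-r)) \<partial>D)
    \<le> ennreal M * (\<integral>\<^sup>+v. ennreal (indicator {-1..1} (v - c) * \<bar>v - c\<bar> powr (-r)) \<partial>lborel)"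
    by (rule nn_D_le) auto
  also have "(\<integral>\<^sup>+v. ennreal (indicator {-1..1} (v - c) * \<bar>v - c\<bar> powr (-r)) \<partial>lborel)
     = (\<integral>\<^sup>+v. ennreal (indicator {-1..1} v * \<bar>v\<bar> powr (-r)) \<partial>lborel)"
    using nn_integral_real_affine[of "%v. ennreal (indicator {-1..1} (v - c) * \<bar>v - c\<bar> powr (-r))" 1 c]
    by simp
  also have "... = ennreal (2 / (1 - r))" by (rule nn_integral_abs_powr_unit[OF r])
  also have "1 + ennreal M * ennreal (2 / (1 - r)) = ennreal (1 + 2 * M / (1 - r))"
    using r M_nonneg by (simp add: ennreal_mult[symmetric] mult.commute flip: ennreal_plus ennreal_1)
  finally show ?thesis by (simp add: add_left_mono)
qed

definition A :: "real => real" where "A r = 1 + 2 * M / (1 - r)"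

lemma A_pos: "r < 1 ==> 1 \<le> A r"
  using M_nonneg by (simp add: A_def)

text \<open>Integrate over the site x first: h is constant there by \<open>indep\<close>, and
  \<open>neg_moment\<close> does not care about its value.\<close>

lemma fractional_moment:
  fixes h :: "(cvert => real) => complex"
  assumes r: "0 < r" "r < 1" and [measurable]: "h \<in> borel_measurable Q"
    and indep: "\<And>om v. h (fun_upd om x v) = h om"
  shows "(\<integral>\<^sup>+om. ennreal (norm (inverse (of_real (om x) - h om)) powr r) \<partial>Q) \<le> ennreal (A r)"
proof -
  have *: "norm (inverse u) powr r = norm u powr (-r)" for u :: complex
    by (simp add: norm_inverse powr_minus inverse_powr)
  have "(\<integral>\<^sup>+om. ennreal (norm (inverse (of_real (om x) - h om)) powr r) \<partial>Q) =
    (\<integral>\<^sup>+om. \<integral>\<^sup>+v. ennreal (norm (of_real v - h om) powr (-r)) \<partial>D \<partial>Q)"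
    by (subst nn_resample1[where x = x]) (auto simp: * indep)
  also have "... \<le> (\<integral>\<^sup>+om. ennreal (A r) \<partial>Q)"
    unfolding A_def by (intro nn_integral_mono neg_moment r)
  also have "... = ennreal (A r)" by (simp add: Q.emeasure_space_1[simplified])
  finally show ?thesis .
qed

lemma cs_upd: "cs (fun_upd om (n, j) v) z n j = cs om z n j"
  by (rule cs_cong) auto

lemma up_upd: "up (fun_upd om (n, j) v) z d n j = up om z d n j"
  by (rule up_cong) (use desc_self in auto)

lemma sib_upd: "sib (fun_upd om (Suc n, j div K) v) z n j = sib om z n j"
  by (rule sib_cong) auto

lemma gam_moment:
  assumes r: "0 < r" "r < 1"
  shows "(\<integral>\<^sup>+om. ennreal (norm (gam om (z::complex) n j) powr r) \<partial>Q) \<le> ennreal (A r)"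
  using fractional_moment[OF r, of "%om. z + cs om z n j" "(n, j)"]
  by (simp add: gam_eq cs_upd diff_diff_eq)

lemma up_moment:
  assumes r: "0 < r" "r < 1"
  shows "(\<integral>\<^sup>+om. ennreal (norm (up om (z::complex) d n j) powr r) \<partial>Q) \<le> ennreal (A r)"
proof (cases d)
  case (Suc d')
  then show ?thesis
  using fractional_moment[OF r, of "%om. z + (sib om z n j + up om z d' (Suc n) (j div K))" "(Suc n, j div K)"]
  by (simp add: sib_upd up_upd diff_diff_eq)
qed simp

definition Bs :: real where "Bs = enn2real (\<integral>\<^sup>+ w. ennreal (\<bar>w\<bar> powr s) \<partial>D)"

lemma Bs: "(\<integral>\<^sup>+ w. ennreal (\<bar>w\<bar> powr s) \<partial>D) = ennreal Bs"
  using s_moment by (simp add: Bs_def)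

lemma Bs_nonneg: "0 \<le> Bs" by (simp add: Bs_def)

lemma site_moment: "(\<integral>\<^sup>+ om. ennreal (\<bar>om x\<bar> powr s) \<partial>Q) = ennreal Bs"
proof -
  have "(\<integral>\<^sup>+ w. ennreal (\<bar>w\<bar> powr s) \<partial>distr Q D (%om. om x)) = (\<integral>\<^sup>+ om. ennreal (\<bar>om x\<bar> powr s) \<partial>Q)"
    by (rule nn_integral_distr) (simp_all add: measurable_cong_sets[OF sets_D refl] measurable_cong_sets[OF refl sets_D])
  then show ?thesis by (simp add: distr_component Bs)
qed

definition B0 :: real where "B0 = Bs + \<bar>b\<bar> powr s + real K * A s + A s"

lemma s_lt1: "s < 1" using s_half by simp

lemma B0_nonneg: "0 \<le> B0"
  using Bs_nonneg A_pos[OF s_lt1] by (simp add: B0_def)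

text \<open>The reciprocal of a Green function is a sum of the site potential, the energy and
  neighbouring Green functions. Each has a moment of order \<open>s\<close>, and powers with
  exponent below 1 are subadditive.\<close>

lemma inverse_moment:
  fixes u :: "(cvert => real) => complex"
  assumes [measurable]: "u \<in> borel_measurable Q"
    and u: "(\<integral>\<^sup>+om. ennreal (norm (u om) powr s) \<partial>Q) \<le> ennreal (A s)"
  shows "(\<integral>\<^sup>+om. ennreal (norm (of_real (om (n, j)) - z - (cs om z n j + u om)) powr s) \<partial>Q)
     \<le> ennreal (B0 + norm z powr s)"
proof -
  \<comment> \<open>For n = 0 the truncated \<open>n - 1\<close> contributes nonnegative terms that
    do no harm, so one majorant serves both the boundary and the inner layers.\<close>
  let ?c = "%om. \<bar>b\<bar> powr s + (\<Sum>i<K. norm (gam om z (n - 1) (K * j + i)) powr s)"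
  have c: "norm (cs om z n j) powr s \<le> ?c om" for om
  proof (cases n)
    case (Suc m)
    have "norm (cs om z n j) powr s \<le> (\<Sum>i<K. norm (gam om z m (K * j + i))) powr s"
      using s_pos unfolding Suc cs_Suc by (intro powr_mono2 norm_sum) auto
    also have "... \<le> (\<Sum>i<K. norm (gam om z m (K * j + i)) powr s)"
      by (rule powr_sum_le) (use s_pos s_half in auto)
    finally show ?thesis by (simp add: Suc add_increasing)
  qed (auto intro!: sum_nonneg)
  have le: "norm (of_real (om (n, j)) - z - (cs om z n j + u om)) powr s
    \<le> \<bar>om (n, j)\<bar> powr s + norm z powr s + ?c om + norm (u om) powr s" for om
  proof -
    have "norm (of_real (om (n, j)) - z - (cs om z n j + u om)) \<le> \<bar>om (n, j)\<bar> + norm z + norm (cs om z n j) + norm (u om)"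
      by (smt (verit) norm_of_real norm_triangle_ineq norm_triangle_ineq4)
    then have "norm (of_real (om (n, j)) - z - (cs om z n j + u om)) powr s \<le> (\<bar>om (n, j)\<bar> + norm z + norm (cs om z n j) + norm (u om)) powr s"
      using s_pos by (intro powr_mono2) auto
    also have "... \<le> \<bar>om (n, j)\<bar> powr s + norm z powr s + norm (cs om z n j) powr s + norm (u om) powr s"
      using s_pos s_lt1 by (intro order_trans[OF powr_add_le] add_mono powr_add_le order_refl) auto
    finally show ?thesis using c[of om] by linarith
  qed
  have "(\<integral>\<^sup>+om. ennreal (norm (of_real (om (n, j)) - z - (cs om z n j + u om)) powr s) \<partial>Q)
    \<le> (\<integral>\<^sup>+om. ennreal (\<bar>om (n, j)\<bar> powr s) + ennreal (norm z powr s) + (ennreal (\<bar>b\<bar> powr s)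
       + (\<Sum>i<K. ennreal (norm (gam om z (n - 1) (K * j + i)) powr s))) + ennreal (norm (u om) powr s) \<partial>Q)"
  proof (rule nn_integral_mono)
    fix om
    have "ennreal (\<bar>om (n, j)\<bar> powr s) + ennreal (norm z powr s) + (ennreal (\<bar>b\<bar> powr s)
       + (\<Sum>i<K. ennreal (norm (gam om z (n - 1) (K * j + i)) powr s))) + ennreal (norm (u om) powr s)
      = ennreal (\<bar>om (n, j)\<bar> powr s + norm z powr s + ?c om + norm (u om) powr s)"
      by (simp add: sum_ennreal sum_nonneg flip: ennreal_plus)
    then show "ennreal (norm (of_real (om (n, j)) - z - (cs om z n j + u om)) powr s) \<le>
       ennreal (\<bar>om (n, j)\<bar> powr s) + ennreal (norm z powr s) + (ennreal (\<bar>b\<bar> powr s)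
       + (\<Sum>i<K. ennreal (norm (gam om z (n - 1) (K * j + i)) powr s))) + ennreal (norm (u om) powr s)"
      using le[of om] by (simp add: ennreal_leI)
  qed
  also have "... = ennreal Bs + ennreal (norm z powr s) + (ennreal (\<bar>b\<bar> powr s)
       + (\<Sum>i<K. \<integral>\<^sup>+om. ennreal (norm (gam om z (n - 1) (K * j + i)) powr s) \<partial>Q)) + (\<integral>\<^sup>+om. ennreal (norm (u om) powr s) \<partial>Q)"
    by (simp add: nn_integral_add nn_integral_sum site_moment Q.emeasure_space_1[simplified] del: sum_ennreal)
  also have "... \<le> ennreal Bs + ennreal (norm z powr s) + (ennreal (\<bar>b\<bar> powr s) + (\<Sum>i<K. ennreal (A s))) + ennreal (A s)"
    by (intro add_mono order_refl sum_mono gam_moment s_pos s_lt1 u)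
  also have "... = ennreal (B0 + norm z powr s)"
  proof -
    have "(\<Sum>i<K. ennreal (A s)) = ennreal (real K * A s)"
      using A_pos[OF s_lt1] by (simp add: ennreal_of_nat_eq_real_of_nat ennreal_mult)
    moreover have "0 \<le> A s" "0 \<le> real K * A s"
      using A_pos[OF s_lt1] by auto
    ultimately show ?thesis
      using Bs_nonneg by (simp add: B0_def add_ac flip: ennreal_plus)
  qed
  finally show ?thesis .
qed

lemma gam_inverse_moment:
  "(\<integral>\<^sup>+om. ennreal (norm (inverse (gam om (z::complex) n j)) powr s) \<partial>Q) \<le> ennreal (B0 + norm z powr s)"
  using inverse_moment[of "%_. 0" n j z] A_pos[OF s_lt1] by (simp add: gam_eq)

lemma gF_inverse_moment:
  "(\<integral>\<^sup>+om. ennreal (norm (inverse (gF om (z::complex) d n j)) powr s) \<partial>Q) \<le> ennreal (B0 + norm z powr s)"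
  using inverse_moment[of "%om. up om z d n j" n j z] up_moment[OF s_pos s_lt1, of z d n j] by (simp add: gF_def)

end

section \<open>Measurability of solutions of finite linear systems\<close>

text \<open>The Green function of the finite tree is given by a definite description, so its
  measurability has to be derived. Rows and columns are indexed by separate sets because elimination
  removes one of each, with unrelated labels.\<close>

definition lin_sol :: "'r set => 'c set => ('r => 'c => real) => ('r => real) => ('c => real) => bool" where
  "lin_sol R C a e \<psi> \<longleftrightarrow> (\<forall>c. c \<notin> C --> \<psi> c = 0) \<and> (\<forall>r\<in>R. (\<Sum>c\<in>C. a r c * \<psi> c) = e r)"

definition lin_val :: "'r set => 'c set => ('r => 'c => real) => ('r => real) => 'c => real" where
  "lin_val R C a e c = (if \<exists>!\<psi>. lin_sol R C a e \<psi> then (THE \<psi>. lin_sol R C a e \<psi>) c else 0)"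

text \<open>One step of Gaussian elimination: row r determines the unknown at c, and subtracting
  multiples of row r removes that unknown from the other rows.\<close>

lemma lin_sol_pivot:
  fixes a :: "'r => 'c => real" and e :: "'r => real"
  assumes C: "finite C" "c \<notin> C" and r: "r \<in> R" "a r c \<noteq> 0"
  defines "a' \<equiv> %q d. a q d - a q c / a r c * a r d"
    and "e' \<equiv> %q. e q - a q c / a r c * e r"
    and "t \<equiv> %\<psi>. (e r - (\<Sum>d\<in>C. a r d * \<psi> d)) / a r c"
  shows "lin_sol R (insert c C) a e \<psi> \<longleftrightarrow> lin_sol (R - {r}) C a' e' (\<psi>(c := 0)) \<and> \<psi> c = t \<psi>"
proof -
  have sumc: "(\<Sum>d\<in>insert c C. a q d * \<psi> d) = a q c * \<psi> c + (\<Sum>d\<in>C. a q d * \<psi> d)" for q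
    using C by simp
  have sum': "(\<Sum>d\<in>C. a' q d * (\<psi>(c := 0)) d) = (\<Sum>d\<in>C. a q d * \<psi> d) - a q c / a r c * (\<Sum>d\<in>C. a r d * \<psi> d)" for q
  proof -
    have "(\<Sum>d\<in>C. a' q d * (\<psi>(c := 0)) d) = (\<Sum>d\<in>C. a q d * \<psi> d - a q c / a r c * (a r d * \<psi> d))"
      using C by (intro sum.cong) (auto simp: a'_def algebra_simps)
    then show ?thesis by (simp add: sum_subtractf sum_distrib_left)
  qed
  have piv: "a r c * \<psi> c + (\<Sum>d\<in>C. a r d * \<psi> d) = e r \<longleftrightarrow> \<psi> c = t \<psi>"
    using r by (auto simp: t_def field_simps)
  have row: "a q c * \<psi> c + (\<Sum>d\<in>C. a q d * \<psi> d) = e q \<longleftrightarrow>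
      (\<Sum>d\<in>C. a q d * \<psi> d) - a q c / a r c * (\<Sum>d\<in>C. a r d * \<psi> d) = e' q" if "\<psi> c = t \<psi>" for q
    using r unfolding that t_def e'_def by (auto simp: field_simps)
  show ?thesis
    unfolding lin_sol_def sumc sum' using r piv row C by (auto split: if_splits)
qed

lemma lin_val_pivot:
  fixes a :: "'r => 'c => real" and e :: "'r => real"
  assumes C: "finite C" "c \<notin> C" and r: "r \<in> R" "a r c \<noteq> 0"
  defines "a' \<equiv> %q d. a q d - a q c / a r c * a r d"
    and "e' \<equiv> %q. e q - a q c / a r c * e r"
  shows "(\<exists>!\<psi>. lin_sol R (insert c C) a e \<psi>) \<longleftrightarrow> (\<exists>!\<psi>. lin_sol (R - {r}) C a' e' \<psi>)" (is ?th1)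
    and "d \<noteq> c ==> lin_val R (insert c C) a e d = lin_val (R - {r}) C a' e' d"
    and "(\<exists>!\<psi>. lin_sol R (insert c C) a e \<psi>) ==> lin_val R (insert c C) a e c
       = (e r - (\<Sum>d\<in>C. a r d * lin_val (R - {r}) C a' e' d)) / a r c"
proof -
  let ?t = "%\<psi>. (e r - (\<Sum>d\<in>C. a r d * \<psi> d)) / a r c"
  note piv = lin_sol_pivot[where c = c and r = r and a = a and R = R and C = C and e = e, OF C r, folded a'_def e'_def]
  have t_upd: "?t (\<psi>(c := x)) = ?t \<psi>" for \<psi> x
  proof -
    have "(\<Sum>d\<in>C. a r d * (\<psi>(c := x)) d) = (\<Sum>d\<in>C. a r d * \<psi> d)"
      using C by (intro sum.cong) auto
    then show ?thesis by simp
  qed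
  have zero: "\<psi> c = 0" if "lin_sol (R - {r}) C a' e' \<psi>" for \<psi>
    using that C by (auto simp: lin_sol_def)
  have bck: "lin_sol R (insert c C) a e (\<psi>(c := ?t \<psi>))" if "lin_sol (R - {r}) C a' e' \<psi>" for \<psi>
    unfolding piv t_upd using that zero[OF that] by (auto simp: fun_upd_idem)
  have forw: "lin_sol (R - {r}) C a' e' (\<psi>(c := 0))" "\<psi> = (\<psi>(c := 0))(c := ?t (\<psi>(c := 0)))"
    if "lin_sol R (insert c C) a e \<psi>" for \<psi>
    using that unfolding piv t_upd by (auto simp: fun_upd_idem)
  show ?th1
  proof
    assume "\<exists>!\<psi>. lin_sol R (insert c C) a e \<psi>"
    then obtain \<psi> where p: "lin_sol R (insert c C) a e \<psi>" and u: "\<And>\<phi>. lin_sol R (insert c C) a e \<phi> ==> \<phi> = \<psi>" by blast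
    show "\<exists>!\<psi>. lin_sol (R - {r}) C a' e' \<psi>"
    proof (rule ex1I)
      show "lin_sol (R - {r}) C a' e' (\<psi>(c := 0))" by (rule forw[OF p])
      fix \<phi> assume ph: "lin_sol (R - {r}) C a' e' \<phi>"
      have "\<phi> = (\<phi>(c := ?t \<phi>))(c := 0)" using zero[OF ph] by (simp add: fun_upd_idem)
      then show "\<phi> = \<psi>(c := 0)" using u[OF bck[OF ph]] by simp
    qed
  next
    assume "\<exists>!\<psi>. lin_sol (R - {r}) C a' e' \<psi>"
    then obtain \<psi> where p: "lin_sol (R - {r}) C a' e' \<psi>" and u: "\<And>\<phi>. lin_sol (R - {r}) C a' e' \<phi> ==> \<phi> = \<psi>" by blast
    show "\<exists>!\<psi>. lin_sol R (insert c C) a e \<psi>"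
    proof (rule ex1I)
      show "lin_sol R (insert c C) a e (\<psi>(c := ?t \<psi>))" by (rule bck[OF p])
      fix \<phi> assume ph: "lin_sol R (insert c C) a e \<phi>"
      show "\<phi> = \<psi>(c := ?t \<psi>)" using forw(2)[OF ph] u[OF forw(1)[OF ph]] by simp
    qed
  qed
  note th1 = this
  have val: "lin_val R (insert c C) a e = (lin_val (R - {r}) C a' e')(c := ?t (lin_val (R - {r}) C a' e'))"
    if ex: "\<exists>!\<psi>. lin_sol R (insert c C) a e \<psi>"
  proof -
    have ex': "\<exists>!\<psi>. lin_sol (R - {r}) C a' e' \<psi>" using ex th1 by simp
    have "lin_val (R - {r}) C a' e' = (THE \<psi>. lin_sol (R - {r}) C a' e' \<psi>)"
      using ex' by (auto simp: lin_val_def fun_eq_iff)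
    then have s: "lin_sol (R - {r}) C a' e' (lin_val (R - {r}) C a' e')"
      using theI'[OF ex'] by simp
    have "lin_val R (insert c C) a e = (THE \<psi>. lin_sol R (insert c C) a e \<psi>)"
      using ex by (auto simp: lin_val_def fun_eq_iff)
    also have "... = (lin_val (R - {r}) C a' e')(c := ?t (lin_val (R - {r}) C a' e'))"
      using bck[OF s] ex by (intro the1_equality)
    finally show ?thesis .
  qed
  show "lin_val R (insert c C) a e d = lin_val (R - {r}) C a' e' d" if "d \<noteq> c"
  proof (cases "\<exists>!\<psi>. lin_sol R (insert c C) a e \<psi>")
    case True
    then show ?thesis using that by (subst val) auto
  next
    case False
    moreover from this have "\<not> (\<exists>!\<psi>. lin_sol (R - {r}) C a' e' \<psi>)" using th1 by simp
    ultimately show ?thesis by (simp only: lin_val_def if_False)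
  qed
  show "lin_val R (insert c C) a e c = (e r - (\<Sum>d\<in>C. a r d * lin_val (R - {r}) C a' e' d)) / a r c"
    if "\<exists>!\<psi>. lin_sol R (insert c C) a e \<psi>"
    by (subst val[OF that]) simp
qed

text \<open>With a zero column the unknown at c can be changed freely, so a solution is never unique
  and \<open>lin_val\<close> takes its default value 0.\<close>

lemma lin_sol_no_pivot:
  assumes C: "finite C" "c \<notin> C" and r: "\<And>r. r \<in> R ==> a r c = 0"
  shows "\<not> (\<exists>!\<psi>. lin_sol R (insert c C) a e \<psi>)"
proof
  assume "\<exists>!\<psi>. lin_sol R (insert c C) a e \<psi>"
  then obtain \<psi> where p: "lin_sol R (insert c C) a e \<psi>" and u: "\<And>\<phi>. lin_sol R (insert c C) a e \<phi> ==> \<phi> = \<psi>" by blast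
  have "(\<Sum>d\<in>C. a r d * (\<psi>(c := x)) d) = (\<Sum>d\<in>C. a r d * \<psi> d)" for r x
    using C by (intro sum.cong) auto
  then have "lin_sol R (insert c C) a e (\<psi>(c := \<psi> c + 1))"
    using p r C by (auto simp: lin_sol_def)
  from u[OF this] show False by (metis add_cancel_right_right fun_upd_same zero_neq_one)
qed

text \<open>Elimination is a finite sequence of arithmetic operations once the pivots are chosen.
  The space is cut into the finitely many measurable pieces on which a given row can serve as pivot,
  and the induction removes one column at a time.\<close>

lemma lin_val_measurable:
  fixes a :: "'w => 'r => 'c => real"
  assumes "finite C" "finite R"
    and "\<And>r c. (%w. a w r c) \<in> borel_measurable N" "\<And>r. (%w. e w r) \<in> borel_measurable N"
  shows "Measurable.pred N (%w. \<exists>!\<psi>. lin_sol R C (a w) (e w) \<psi>) \<and>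
    (\<forall>c. (%w. lin_val R C (a w) (e w) c) \<in> borel_measurable N)"
  using assms
proof (induction C arbitrary: R a e rule: finite_induct)
  case empty
  have "(\<exists>!\<psi>. lin_sol R {} (a w) (e w) \<psi>) \<longleftrightarrow> (\<forall>r\<in>R. e w r = 0)" for w
    by (auto simp: lin_sol_def fun_eq_iff)
  moreover have "lin_val R {} (a w) (e w) c = 0" for w c
  proof (cases "\<exists>!\<psi>. lin_sol R {} (a w) (e w) \<psi>")
    case True
    have "\<forall>\<phi>. lin_sol R {} (a w) (e w) \<phi> --> \<phi> c = 0" by (simp add: lin_sol_def)
    with theI'[OF True] True show ?thesis by (simp add: lin_val_def)
  qed (simp only: lin_val_def if_False)
  ultimately show ?case using empty by simp
next
  case (insert c C)
  note [measurable] = insert.prems(2,3)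
  define a' where "a' r = (%w q d. a w q d - a w q c / a w r c * a w r d)" for r
  define e' where "e' r = (%w q. e w q - a w q c / a w r c * e w r)" for r
  have IH: "Measurable.pred N (%w. \<exists>!\<psi>. lin_sol (R - {r}) C (a' r w) (e' r w) \<psi>)"
    "(%w. lin_val (R - {r}) C (a' r w) (e' r w) d) \<in> borel_measurable N" for r d
  proof -
    have "Measurable.pred N (%w. \<exists>!\<psi>. lin_sol (R - {r}) C (a' r w) (e' r w) \<psi>) \<and>
     (\<forall>d. (%w. lin_val (R - {r}) C (a' r w) (e' r w) d) \<in> borel_measurable N)"
      by (rule insert.IH) (use insert.prems(1) in \<open>auto simp: a'_def e'_def\<close>)
    note * = this
    show "Measurable.pred N (%w. \<exists>!\<psi>. lin_sol (R - {r}) C (a' r w) (e' r w) \<psi>)"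
      by (rule conjunct1[OF *])
    show "(%w. lin_val (R - {r}) C (a' r w) (e' r w) d) \<in> borel_measurable N"
      by (rule spec[OF conjunct2[OF *]])
  qed
  note IH[measurable]
  note piv = lin_val_pivot[where c = c and C = C, OF insert.hyps]
  have ex: "(\<exists>!\<psi>. lin_sol R (insert c C) (a w) (e w) \<psi>) \<longleftrightarrow>
    (\<exists>r\<in>R. a w r c \<noteq> 0 \<and> (\<exists>!\<psi>. lin_sol (R - {r}) C (a' r w) (e' r w) \<psi>))" for w
  proof -
    have *: "P \<longleftrightarrow> (\<exists>r\<in>R. n r \<and> P' r)"
      if "\<And>r. r \<in> R ==> n r ==> P \<longleftrightarrow> P' r" "(\<And>r. r \<in> R ==> \<not> n r) ==> \<not> P" for P P' n
      using that by blast
    show ?thesis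
    proof (rule *)
      fix r assume "r \<in> R" "a w r c \<noteq> 0"
      then show "(\<exists>!\<psi>. lin_sol R (insert c C) (a w) (e w) \<psi>) \<longleftrightarrow> (\<exists>!\<psi>. lin_sol (R - {r}) C (a' r w) (e' r w) \<psi>)"
        unfolding a'_def e'_def by (rule piv(1))
    next
      assume "\<And>r. r \<in> R ==> \<not> a w r c \<noteq> 0"
      then show "\<not> (\<exists>!\<psi>. lin_sol R (insert c C) (a w) (e w) \<psi>)"
        by (intro lin_sol_no_pivot insert.hyps) blast
    qed
  qed
  have m1: "Measurable.pred N (%w. \<exists>!\<psi>. lin_sol R (insert c C) (a w) (e w) \<psi>)"
    unfolding ex using insert.prems(1) by measurable
  define f where "f d r = (%w. if \<exists>!\<psi>. lin_sol R (insert c C) (a w) (e w) \<psi> then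
     (if d = c then (e w r - (\<Sum>d\<in>C. a w r d * lin_val (R - {r}) C (a' r w) (e' r w) d)) / a w r c
      else lin_val (R - {r}) C (a' r w) (e' r w) d) else 0)" for d r
  have fm: "f d r \<in> borel_measurable N" for d r
    unfolding f_def using m1 by measurable
  have fv: "lin_val R (insert c C) (a w) (e w) d = f d r w" if "r \<in> R" "a w r c \<noteq> 0" for d r w
  proof (cases "\<exists>!\<psi>. lin_sol R (insert c C) (a w) (e w) \<psi>")
    case True
    then show ?thesis
      using piv(2)[where a = "a w" and e = "e w" and R = R and r = r and d = d] piv(3)[where a = "a w" and e = "e w" and R = R and r = r] that
      unfolding f_def a'_def e'_def by (simp split: if_split)
  qed (simp only: f_def lin_val_def if_False)
  have m2: "(%w. lin_val R (insert c C) (a w) (e w) d) \<in> borel_measurable N" for d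
  proof -
    \<comment> \<open>The pieces for different pivots may overlap; this is consistent because the
      unique solution does not depend on the pivot.\<close>
    define S where "S r = {w \<in> space N. a w r c \<noteq> 0}" for r
    define S0 where "S0 = {w \<in> space N. \<forall>r\<in>R. a w r c = 0}"
    have S: "S r \<in> sets N" for r unfolding S_def by measurable
    have S0: "S0 \<in> sets N" unfolding S0_def using insert.prems(1) by measurable
    show ?thesis
    proof (rule measurable_piecewise_restrict[of "insert S0 (S ` R)"])
      show "countable (insert S0 (S ` R))" using insert.prems(1) by (auto intro: countable_finite)
      show "\<And>\<Omega>. \<Omega> \<in> insert S0 (S ` R) ==> \<Omega> \<inter> space N \<in> sets N" using S S0 by auto
      show "space N \<subseteq> \<Union> (insert S0 (S ` R))" by (auto simp: S_def S0_def)
      fix \<Omega> assume "\<Omega> \<in> insert S0 (S ` R)"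
      then consider "\<Omega> = S0" | r where "r \<in> R" "\<Omega> = S r" by auto
      then show "(%w. lin_val R (insert c C) (a w) (e w) d) \<in> borel_measurable (restrict_space N \<Omega>)"
      proof cases
        case 1
        have "lin_val R (insert c C) (a w) (e w) d = 0" if "w \<in> S0" for w
          using that lin_sol_no_pivot[where R = R and a = "a w" and e = "e w", OF insert.hyps]
          by (auto simp: lin_val_def S0_def)
        then show ?thesis
          by (subst measurable_cong[where g = "%_. 0"]) (auto simp: 1 space_restrict_space)
      next
        case 2
        have "(%w. f d r w) \<in> borel_measurable (restrict_space N \<Omega>)"
          by (rule measurable_restrict_space1[OF fm])
        then show ?thesis
          by (subst measurable_cong[where g = "f d r"]) (auto simp: 2 space_restrict_space S_def fv)
      qed
    qed
  qed
  show ?case by (intro conjI allI m1 m2)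
qed

lemma finite_tree_verts: "finite (tree_verts K L)"
proof -
  have "tree_verts K L = {xs. set xs \<subseteq> {..<K} \<and> length xs \<le> L}" by (simp add: tree_verts_def)
  then show ?thesis using finite_lists_length_le[of "{..<K}" L] by simp
qed

lemma tree_sol_lin_sol:
  fixes K L b E
  defines "a \<equiv> %om r c. tree_H K L b om (%x. if x = c then 1 else 0) r - E * (if r = c then 1 else 0)"
  shows "tree_sol K L b om E = lin_sol (tree_verts K L) (tree_verts K L) (a om) (%r. if r = [] then 1 else 0)"
proof (rule ext)
  fix \<psi>
  have "(\<Sum>c\<in>tree_verts K L. a om r c * \<psi> c) = tree_H K L b om \<psi> r - E * \<psi> r"
    if "\<forall>c. c \<notin> tree_verts K L --> \<psi> c = 0" "r \<in> tree_verts K L" for r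
  proof -
    have d: "(\<Sum>c\<in>tree_verts K L. (if x = c then 1 else 0) * \<psi> c) = \<psi> x" for x
      using that(1) finite_tree_verts[of K L] by (cases "x \<in> tree_verts K L") (auto simp: if_distrib if_distribR sum.delta cong: if_cong)
    define x where "x c = (if r = [] then 0 else if butlast r = c then 1 else (0::real))" for c
    define y where "y c = (if length r < L then (\<Sum>i<K. if r @ [i] = c then 1 else (0::real)) else 0)" for c
    define z where "z c = (if r = c then 1 else (0::real))" for c
    define W where "W = om r + (if length r = L then b else 0)"
    have "a om r c = x c + y c + W * z c - E * z c" for c
      by (simp add: a_def tree_H_def x_def y_def z_def W_def)
    note * = this
    have "(\<Sum>c\<in>tree_verts K L. a om r c * \<psi> c) =
      (\<Sum>c\<in>tree_verts K L. x c * \<psi> c + y c * \<psi> c + W * (z c * \<psi> c) - E * (z c * \<psi> c))"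
      by (intro sum.cong refl, subst *) (simp add: algebra_simps)
    also have "... = (\<Sum>c\<in>tree_verts K L. x c * \<psi> c) + (\<Sum>c\<in>tree_verts K L. y c * \<psi> c)
      + W * (\<Sum>c\<in>tree_verts K L. z c * \<psi> c) - E * (\<Sum>c\<in>tree_verts K L. z c * \<psi> c)"
      by (simp only: sum.distrib sum_subtractf sum_distrib_left)
    also have "(\<Sum>c\<in>tree_verts K L. x c * \<psi> c) = (if r = [] then 0 else \<psi> (butlast r))"
      using d[of "butlast r"] by (simp add: x_def)
    also have "(\<Sum>c\<in>tree_verts K L. y c * \<psi> c) = (if length r < L then (\<Sum>i<K. \<psi> (r @ [i])) else 0)"
    proof -
      have "(\<Sum>c\<in>tree_verts K L. (\<Sum>i<K. if r @ [i] = c then 1 else 0) * \<psi> c)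
        = (\<Sum>i<K. \<Sum>c\<in>tree_verts K L. (if r @ [i] = c then 1 else 0) * \<psi> c)"
        by (subst sum.swap) (simp only: sum_distrib_right)
      then show ?thesis by (simp only: y_def d) simp
    qed
    also have "(\<Sum>c\<in>tree_verts K L. z c * \<psi> c) = \<psi> r"
      using d[of r] by (simp only: z_def)
    finally show ?thesis by (simp only: tree_H_def W_def)
  qed
  then show "tree_sol K L b om E \<psi> = lin_sol (tree_verts K L) (tree_verts K L) (a om) (%r. if r = [] then 1 else 0) \<psi>"
    unfolding tree_sol_def lin_sol_def by auto
qed

lemma tree_green_measurable:
  assumes "\<And>v. v \<in> tree_verts K L ==> (%x. f x v) \<in> borel_measurable N"
  shows "(%x. tree_green K L b (f x) E) \<in> borel_measurable N"
proof -
  let ?T = "tree_verts K L"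
  define a where "a om r c = tree_H K L b om (%x. if x = c then 1 else 0) r - E * (if r = c then 1 else (0::real))"
    for om and r c :: "nat list"
  \<comment> \<open>Rows outside the tree never enter the system, and measurability of the potential
    is available at tree vertices only, so their coefficients are set to 0.\<close>
  define a' where "a' om r c = (if r \<in> ?T then a om r c else 0)" for om r c
  have "lin_sol ?T ?T (a om) e = lin_sol ?T ?T (a' om) e" for om e
    by (auto simp: lin_sol_def a'_def fun_eq_iff)
  then have "tree_green K L b om E = lin_val ?T ?T (a' om) (%r. if r = [] then 1 else 0) []" for om
    by (simp add: tree_green_def lin_val_def tree_sol_lin_sol flip: a_def)
  moreover have "(%x. lin_val ?T ?T (a' (f x)) (%r. if r = [] then 1 else 0) []) \<in> borel_measurable N"
  proof (rule lin_val_measurable[OF finite_tree_verts finite_tree_verts, THEN conjunct2, rule_format])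
    show "(%w. a' (f w) r c) \<in> borel_measurable N" for r c
    proof (cases "r \<in> ?T")
      case True
      then have [measurable]: "(%x. f x r) \<in> borel_measurable N" by (rule assms)
      show ?thesis using True by (simp add: a'_def a_def tree_H_def)
    qed (simp add: a'_def)
  qed simp
  ultimately show ?thesis by simp
qed

section \<open>Logarithmic moments, stationarity and the rooted tree\<close>

text \<open>Converts moments of t and of its reciprocal into second moments of the logarithm; the
  exponent is halved before squaring. At t = 0 the convention \<open>ln 0 = 0\<close> makes the
  claim trivial.\<close>

lemma ln_sq_le:
  fixes t r :: real
  assumes t: "0 \<le> t" and r: "0 < r"
  shows "(ln t)\<^sup>2 \<le> 4 / r\<^sup>2 * (t powr r + inverse t powr r)"
proof (cases "t = 0")
  case False
  then have t: "t > 0" using t by simp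
  have *: "(ln u)\<^sup>2 \<le> 4 / r\<^sup>2 * u powr r" if "u \<ge> 1" for u :: real
  proof -
    have "ln u \<le> u powr (r/2) / (r/2)" by (rule ln_powr_bound) (use that r in auto)
    then have "(ln u)\<^sup>2 \<le> (u powr (r/2) / (r/2))\<^sup>2" using that by (intro power_mono) auto
    also have "... = 4 / r\<^sup>2 * u powr r"
      using that by (simp add: power_divide power2_eq_square powr_add[symmetric])
    finally show ?thesis .
  qed
  show ?thesis
  proof (cases "t \<ge> 1")
    case True
    have "4 / r\<^sup>2 * t powr r \<le> 4 / r\<^sup>2 * (t powr r + inverse t powr r)"
      by (intro mult_left_mono) auto
    with *[OF True] show ?thesis by linarith
  next
    case False
    then have "inverse t \<ge> 1" using t by (simp add: one_le_inverse)
    from *[OF this] have "(ln t)\<^sup>2 \<le> 4 / r\<^sup>2 * inverse t powr r" using t by (simp add: ln_inverse)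
    also have "... \<le> 4 / r\<^sup>2 * (t powr r + inverse t powr r)"
      by (intro mult_left_mono) auto
    finally show ?thesis .
  qed
qed simp

context canopy_model
begin

lemma lnsq_moment:
  fixes u :: "(cvert => real) => complex"
  assumes [measurable]: "u \<in> borel_measurable Q"
    and 1: "(\<integral>\<^sup>+om. ennreal (norm (u om) powr s) \<partial>Q) \<le> ennreal a"
    and 2: "(\<integral>\<^sup>+om. ennreal (norm (inverse (u om)) powr s) \<partial>Q) \<le> ennreal c"
    and nn: "0 \<le> a" "0 \<le> c"
  shows "(\<integral>\<^sup>+om. ennreal ((ln (norm (u om)))\<^sup>2) \<partial>Q) \<le> ennreal (4 / s\<^sup>2 * (a + c))"
proof -
  have "(\<integral>\<^sup>+om. ennreal ((ln (norm (u om)))\<^sup>2) \<partial>Q) \<le>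
    (\<integral>\<^sup>+om. ennreal (4 / s\<^sup>2) * (ennreal (norm (u om) powr s) + ennreal (norm (inverse (u om)) powr s)) \<partial>Q)"
  proof (rule nn_integral_mono)
    fix om
    show "ennreal ((ln (norm (u om)))\<^sup>2) \<le>
      ennreal (4 / s\<^sup>2) * (ennreal (norm (u om) powr s) + ennreal (norm (inverse (u om)) powr s))"
      using ln_sq_le[of "norm (u om)" s] s_pos
      by (simp add: norm_inverse ennreal_mult[symmetric] ennreal_leI flip: ennreal_plus)
  qed
  also have "... = ennreal (4 / s\<^sup>2) * ((\<integral>\<^sup>+om. ennreal (norm (u om) powr s) \<partial>Q) + (\<integral>\<^sup>+om. ennreal (norm (inverse (u om)) powr s) \<partial>Q))"
    by (simp add: nn_integral_cmult nn_integral_add)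
  also have "... \<le> ennreal (4 / s\<^sup>2) * (ennreal a + ennreal c)"
    by (intro mult_left_mono add_mono 1 2) auto
  also have "... = ennreal (4 / s\<^sup>2 * (a + c))"
    using nn by (simp add: ennreal_mult[symmetric] flip: ennreal_plus)
  finally show ?thesis .
qed

definition lng :: "(cvert => real) => complex => nat => nat => real" where
  "lng om z n j = ln (norm (gam om z n j))"

lemma lng_measurable [measurable (raw)]:
  "f \<in> measurable N Q ==> g \<in> borel_measurable N ==> (%x. lng (f x) (g x) n j) \<in> borel_measurable N"
  by (simp add: lng_def)

definition Cl :: "complex => real" where "Cl z = 4 / s\<^sup>2 * (A s + (B0 + norm z powr s))"

lemma Cl_nonneg: "0 \<le> Cl z"
  using A_pos[OF s_lt1] B0_nonneg by (simp add: Cl_def)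

lemma lng_sq: "(\<integral>\<^sup>+om. ennreal ((lng om z n j)\<^sup>2) \<partial>Q) \<le> ennreal (Cl z)"
  unfolding lng_def Cl_def
  by (rule lnsq_moment[OF _ gam_moment gam_inverse_moment])
    (use s_pos s_lt1 A_pos[OF s_lt1] B0_nonneg in auto)

lemma integrable_lng_sq: "integrable Q (%om. (lng om z n j)\<^sup>2)"
  by (rule integrableI_nonneg) (auto intro: le_less_trans[OF lng_sq ennreal_less_top])

lemma integrable_of_sq:
  fixes u :: "'x => real"
  assumes "finite_measure N" and [measurable]: "u \<in> borel_measurable N" and "integrable N (%x. (u x)\<^sup>2)"
  shows "integrable N u"
proof -
  interpret finite_measure N by fact
  show ?thesis
  proof (rule Bochner_Integration.integrable_bound)
    show "integrable N (%x. 1 + (u x)\<^sup>2)" using assms by auto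
    show "AE x in N. norm (u x) \<le> norm (1 + (u x)\<^sup>2)"
    proof (rule AE_I2)
      fix x
      have "\<bar>u x\<bar> \<le> 1 + (u x)\<^sup>2"
        using zero_le_power2[of "\<bar>u x\<bar> - 1"] by (simp add: power2_eq_square algebra_simps)
      then show "norm (u x) \<le> norm (1 + (u x)\<^sup>2)" by simp
    qed
  qed simp
qed

lemma integrable_lng: "integrable Q (%om. lng om z n j)"
  by (rule integrable_of_sq[OF Q.finite_measure_axioms _ integrable_lng_sq]) simp

definition fL :: "nat => complex => real" where
  "fL n z = (\<integral>om. lng om z n 0 \<partial>Q)"

lemma distr_reindex:
  fixes p :: "cvert => cvert"
  assumes "inj p"
  shows "distr Q Q (%om. om \<circ> p) = Q"
proof -
  have "distr (PiM UNIV (%_. D)) (PiM UNIV (%_. D)) (%om. \<lambda>n\<in>UNIV. om (p n)) = PiM UNIV (%_. D)"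
    by (rule distr_PiM_reindex) (use assms D.prob_space_axioms in auto)
  then show ?thesis by (simp add: canopy_prob_def comp_def restrict_def)
qed

text \<open>Carries the subtree below (n, 0) onto the one below (n, j), each layer m being
  translated by \<open>K ^ (n - m) * j\<close>. Above layer n the truncated exponent leaves a
  translation by j, which keeps the map injective.\<close>

definition shift :: "nat => nat => cvert => cvert" where
  "shift n j v = (fst v, snd v + K ^ (n - fst v) * j)"

lemma inj_shift: "inj (shift n j)"
  by (auto simp: inj_def shift_def)

lemma gam_shift: "m \<le> n ==> gam (om \<circ> shift n j) z m i = gam om z m (i + K ^ (n - m) * j)"
proof (induction m arbitrary: i)
  case 0
  then show ?case by (simp add: shift_def)
next
  case (Suc m)
  then have *: "K ^ (n - m) = K * K ^ (n - Suc m)" by (metis Suc_diff_Suc Suc_le_lessD power_Suc)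
  show ?case using Suc by (simp add: shift_def * algebra_simps)
qed

lemma reindex_measurable: "(%om. om \<circ> p) \<in> measurable Q Q"
  by (rule measurable_into_Q) simp

lemma integral_gam_stationary:
  fixes \<phi> :: "complex => real"
  assumes [measurable]: "\<phi> \<in> borel_measurable borel"
  shows "(\<integral>om. \<phi> (gam om z n j) \<partial>Q) = (\<integral>om. \<phi> (gam om z n 0) \<partial>Q)"
proof -
  have "(\<integral>om. \<phi> (gam om z n 0) \<partial>Q) = (\<integral>om. \<phi> (gam om z n 0) \<partial>distr Q Q (%om. om \<circ> shift n j))"
    by (simp add: distr_reindex inj_shift)
  also have "... = (\<integral>om. \<phi> (gam (om \<circ> shift n j) z n 0) \<partial>Q)"
    by (rule integral_distr[OF reindex_measurable]) simp
  finally show ?thesis by (simp add: gam_shift)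
qed

lemma fL_eq: "(\<integral>om. lng om z n j \<partial>Q) = fL n z"
  unfolding fL_def lng_def by (rule integral_gam_stationary) simp

text \<open>With all other sites frozen, at most one value of the potential at x is excluded, and a
  measure with a density does not charge it.\<close>

lemma AE_site_neq:
  fixes h :: "(cvert => real) => complex"
  assumes [measurable]: "h \<in> borel_measurable Q" and indep: "\<And>om v. h (fun_upd om x v) = h om"
  shows "AE om in Q. of_real (om x) - h om \<noteq> 0"
proof -
  have z: "(\<integral>\<^sup>+v. indicator {0::complex} (of_real v - h om) \<partial>D) = 0" for om
  proof -
    have "(\<integral>\<^sup>+v. indicator {0::complex} (of_real v - h om) \<partial>lborel) \<le> (\<integral>\<^sup>+v. indicator {Re (h om)} v \<partial>lborel)"
      by (intro nn_integral_mono) (auto simp: indicator_def complex_eq_iff)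
    then have "(\<integral>\<^sup>+v. indicator {0::complex} (of_real v - h om) \<partial>lborel) = 0" by simp
    moreover have "(%v. indicator {0::complex} (of_real v - h om) :: ennreal) \<in> borel_measurable borel"
      by measurable
    ultimately show ?thesis using nn_D_le[of "%v. indicator {0::complex} (of_real v - h om)"] by simp
  qed
  have "(\<integral>\<^sup>+om. indicator {0::complex} (of_real (om x) - h om) \<partial>Q) = 0"
    by (subst nn_resample1[where x = x]) (simp_all add: indep z)
  then have "AE om in Q. indicator {0::complex} (of_real (om x) - h om) = (0::ennreal)"
    by (subst (asm) nn_integral_0_iff_AE) auto
  then show ?thesis by eventually_elim (auto simp: indicator_def)
qed

lemma AE_gam_neq: "AE om in Q. gam om (z::complex) n j \<noteq> 0"
  using AE_site_neq[of "%om. z + cs om z n j" "(n, j)"]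
  by (simp add: gam_eq cs_upd diff_diff_eq)

lemma AE_gam_real_neq: "AE om in Q. \<forall>n j. gam om (E::real) n j \<noteq> 0"
  unfolding AE_all_countable
proof (intro allI)
  fix n j
  show "AE om in Q. gam om E n j \<noteq> 0"
    using AE_gam_neq[of "of_real E" n j] by (simp add: of_real_gam)
qed

text \<open>A word read as a number in base K with the leading letter most significant: appending i
  passes to \<open>K * a + i\<close>, which is the canopy's numbering of children.\<close>

definition word_idx :: "nat list => nat" where
  "word_idx xs = foldl (%a i. K * a + i) 0 xs"

lemma word_idx_simps [simp]: "word_idx [] = 0" "word_idx (xs @ [i]) = K * word_idx xs + i"
  by (auto simp: word_idx_def)

text \<open>Identifies the tree of depth L with the canopy subtree below (L, 0): the root lies in
  layer L, and the words of length L are on the outermost layer, where the term b sits in both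
  models.\<close>

definition word_vert :: "nat => nat list => cvert" where
  "word_vert L xs = (L - length xs, word_idx xs)"

lemma word_idx_inj:
  "set xs \<subseteq> {..<K} ==> set ys \<subseteq> {..<K} ==> length xs = length ys ==> word_idx xs = word_idx ys ==> xs = ys"
proof (induction xs arbitrary: ys rule: rev_induct)
  case (snoc x xs)
  then obtain y ys' where ys: "ys = ys' @ [y]" by (metis length_0_conv rev_exhaust snoc_eq_iff_butlast)
  have lt: "x < K" "y < K" using snoc.prems ys by auto
  have eq: "K * word_idx xs + x = K * word_idx ys' + y" using snoc.prems ys by simp
  have "(K * word_idx xs + x) div K = word_idx xs" "(K * word_idx ys' + y) div K = word_idx ys'"
    "(K * word_idx xs + x) mod K = x" "(K * word_idx ys' + y) mod K = y"
    using lt by auto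
  then have "word_idx xs = word_idx ys'" "x = y" using eq by auto
  then show ?case using snoc.IH[of ys'] snoc.prems ys by auto
qed simp

lemma inj_word_vert: "inj_on (word_vert L) (tree_verts K L)"
  by (rule inj_onI) (auto simp: word_vert_def tree_verts_def intro!: word_idx_inj)

text \<open>Elimination from the leaves: the equation at a vertex, once its children have been
  expressed through it, ties the vertex to its parent by the factor minus its subtree Green
  function. The root has no parent and receives the source 1.\<close>

lemma tree_sol_iff:
  assumes reg: "\<And>n j. gam om (E::real) n j \<noteq> 0"
    and w: "\<And>xs. xs \<in> tree_verts K L ==> w xs = om (word_vert L xs)"
  defines "g \<equiv> %xs. gam om E (L - length xs) (word_idx xs)"
  shows "tree_sol K L b w E \<psi> \<longleftrightarrow> (\<forall>xs. xs \<notin> tree_verts K L --> \<psi> xs = 0) \<and> \<psi> [] = g [] \<and>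
    (\<forall>xs i. xs @ [i] \<in> tree_verts K L --> \<psi> (xs @ [i]) = - g (xs @ [i]) * \<psi> xs)"
    (is "?L \<longleftrightarrow> ?R")
proof -
  let ?T = "tree_verts K L"
  have gi: "inverse (g xs) = w xs - E - (if length xs = L then - b else (\<Sum>i<K. g (xs @ [i])))" if "xs \<in> ?T" for xs
  proof -
    have l: "length xs \<le> L" using that by (simp add: tree_verts_def)
    have "inverse (g xs) = om (word_vert L xs) - E - cs om E (L - length xs) (word_idx xs)"
      by (simp add: g_def gam_eq word_vert_def)
    also have "cs om E (L - length xs) (word_idx xs) = (if length xs = L then - b else (\<Sum>i<K. g (xs @ [i])))"
    proof (cases "length xs = L")
      case False
      then have "L - length xs = Suc (L - Suc (length xs))" using l by simp
      then show ?thesis using False by (simp add: cs_Suc g_def)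
    qed simp
    finally show ?thesis using w[OF that] by simp
  qed
  have eqn: "tree_H K L b w \<psi> xs - E * \<psi> xs = (if xs = [] then 0 else \<psi> (butlast xs)) + inverse (g xs) * \<psi> xs"
    if xs: "xs \<in> ?T" and ch: "\<And>i. i < K ==> length xs < L ==> \<psi> (xs @ [i]) = - g (xs @ [i]) * \<psi> xs" for xs
  proof -
    have "(\<Sum>i<K. \<psi> (xs @ [i])) = - (\<Sum>i<K. g (xs @ [i])) * \<psi> xs" if "length xs < L"
      using ch that by (simp add: sum_distrib_right sum_negf)
    then show ?thesis using xs unfolding tree_H_def gi[OF xs]
      by (auto simp: tree_verts_def algebra_simps)
  qed
  have gn: "g xs \<noteq> 0" for xs using reg by (simp add: g_def)
  have memb: "xs \<in> ?T \<and> i < K \<and> length xs < L" if "xs @ [i] \<in> ?T" for xs i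
    using that by (auto simp: tree_verts_def)
  have memb': "xs @ [i] \<in> ?T" if "xs \<in> ?T" "i < K" "length xs < L" for xs i
    using that by (auto simp: tree_verts_def)
  show ?thesis
  proof
    assume L: ?L
    \<comment> \<open>Induction on the distance d from the leaves, so that the children are already
      settled.\<close>
    have step: "length xs = L - d ==> d \<le> L ==> xs \<in> ?T ==> xs \<noteq> [] ==> \<psi> xs = - g xs * \<psi> (butlast xs)" for d xs
    proof (induction d arbitrary: xs)
      case 0
      have "tree_H K L b w \<psi> xs - E * \<psi> xs = 0" using L 0 by (simp add: tree_sol_def)
      then have "\<psi> (butlast xs) + inverse (g xs) * \<psi> xs = 0" using eqn[of xs] 0 by simp
      then have "\<psi> (butlast xs) = - inverse (g xs) * \<psi> xs" by simp
      then show ?case using gn[of xs] by simp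
    next
      case (Suc d)
      have "tree_H K L b w \<psi> xs - E * \<psi> xs = 0" using L Suc.prems by (simp add: tree_sol_def)
      moreover have "\<psi> (xs @ [i]) = - g (xs @ [i]) * \<psi> xs" if "i < K" "length xs < L" for i
        using Suc.IH[of "xs @ [i]"] Suc.prems memb'[of xs i] that by auto
      ultimately have "\<psi> (butlast xs) + inverse (g xs) * \<psi> xs = 0" using eqn[of xs] Suc.prems by simp
      then have "\<psi> (butlast xs) = - inverse (g xs) * \<psi> xs" by simp
      then show ?case using gn[of xs] by simp
    qed
    have st: "\<psi> (xs @ [i]) = - g (xs @ [i]) * \<psi> xs" if "xs @ [i] \<in> ?T" for xs i
    proof -
      have "length (xs @ [i]) \<le> L" using that by (simp add: tree_verts_def)
      then show ?thesis using step[of "xs @ [i]" "L - length (xs @ [i])"] that by auto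
    qed
    have root: "[] \<in> ?T" by (simp add: tree_verts_def)
    have "tree_H K L b w \<psi> [] - E * \<psi> [] = 1" using L root by (simp add: tree_sol_def)
    moreover have "tree_H K L b w \<psi> [] - E * \<psi> [] = inverse (g []) * \<psi> []"
      using eqn[of "[]"] root st[of "[]"] memb'[of "[]"] by simp
    ultimately have "\<psi> [] = g []" using gn[of "[]"] by (simp add: field_simps)
    then show ?R using L st by (simp add: tree_sol_def)
  next
    assume R: ?R
    have "tree_H K L b w \<psi> xs - E * \<psi> xs = (if xs = [] then 1 else 0)" if xs: "xs \<in> ?T" for xs
    proof -
      have "tree_H K L b w \<psi> xs - E * \<psi> xs = (if xs = [] then 0 else \<psi> (butlast xs)) + inverse (g xs) * \<psi> xs"
        using R memb'[OF xs] by (intro eqn[OF xs]) auto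
      also have "... = (if xs = [] then 1 else 0)"
      proof (cases xs rule: rev_cases)
        case Nil
        then show ?thesis using R gn[of "[]"] by simp
      next
        case (snoc ys y)
        then have "\<psi> xs = - g xs * \<psi> ys" using R xs by auto
        then show ?thesis using snoc gn[of xs] by simp
      qed
      finally show ?thesis .
    qed
    then show ?L using R by (simp add: tree_sol_def)
  qed
qed

lemma tree_green_eq:
  assumes reg: "\<And>n j. gam om (E::real) n j \<noteq> 0"
    and w: "\<And>xs. xs \<in> tree_verts K L ==> w xs = om (word_vert L xs)"
  shows "tree_green K L b w E = gam om E L 0"
proof -
  let ?T = "tree_verts K L"
  let ?g = "%xs. gam om E (L - length xs) (word_idx xs)"
  have iff: "tree_sol K L b w E \<psi> \<longleftrightarrow> (\<forall>xs. xs \<notin> ?T --> \<psi> xs = 0) \<and> \<psi> [] = ?g [] \<and>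
    (\<forall>xs i. xs @ [i] \<in> ?T --> \<psi> (xs @ [i]) = - ?g (xs @ [i]) * \<psi> xs)" for \<psi>
    by (rule tree_sol_iff[OF reg w])
  \<comment> \<open>The outer sign cancels the one of the root factor; every further letter
    contributes one factor minus \<open>?g\<close>.\<close>
  define \<psi> where "\<psi> xs = (if xs \<in> ?T then - (\<Prod>k\<le>length xs. - ?g (take k xs)) else 0)" for xs
  have memb: "xs \<in> ?T" if "xs @ [i] \<in> ?T" for xs i
    using that by (auto simp: tree_verts_def)
  have sol: "tree_sol K L b w E \<psi>"
    unfolding iff
  proof (intro conjI allI impI)
    show "\<psi> [] = ?g []" by (simp add: \<psi>_def tree_verts_def)
    fix xs i assume "xs @ [i] \<in> ?T"
    moreover have "(\<Prod>k\<le>length xs. - ?g (take k (xs @ [i]))) = (\<Prod>k\<le>length xs. - ?g (take k xs))"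
      by (intro prod.cong) auto
    ultimately show "\<psi> (xs @ [i]) = - ?g (xs @ [i]) * \<psi> xs"
      using memb[of xs i] by (simp add: \<psi>_def mult.commute)
  qed (simp add: \<psi>_def)
  have "\<phi> xs = \<psi> xs" if ph: "tree_sol K L b w E \<phi>" for \<phi> xs
  proof (induction xs rule: rev_induct)
    case Nil
    show ?case using ph sol unfolding iff by simp
  next
    case (snoc i xs)
    then show ?case using ph sol unfolding iff by (cases "xs @ [i] \<in> ?T") auto
  qed
  then have ex: "\<exists>!\<psi>. tree_sol K L b w E \<psi>" using sol by (intro ex1I[of _ \<psi>]) auto
  then have "(THE \<psi>. tree_sol K L b w E \<psi>) = \<psi>" using sol by (intro the1_equality)
  then have "tree_green K L b w E = \<psi> []" using ex by (simp add: tree_green_def)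
  also have "\<psi> [] = gam om E L 0" using sol unfolding iff by simp
  finally show ?thesis .
qed

text \<open>The potential read off along \<open>word_vert\<close> has the product law on the tree,
  and potentials for which some subtree Green function vanishes form a null set. Through this
  identity assumption A2 becomes a statement about \<open>fL\<close>.\<close>

lemma tree_avg_log_eq: "tree_avg_log K L b \<rho> E = fL L (of_real E)"
proof -
  let ?T = "tree_verts K L"
  let ?r = "%om. \<lambda>xs\<in>?T. om (word_vert L xs)"
  have r_meas: "?r \<in> measurable Q (PiM ?T (%_. D))"
    by (intro measurable_restrict) simp
  have d: "distr Q (PiM ?T (%_. D)) ?r = PiM ?T (%_. D)"
    unfolding canopy_prob_def
    by (rule distr_PiM_reindex) (use inj_word_vert D.prob_space_axioms in auto)
  have tg: "(%w. tree_green K L b w E) \<in> borel_measurable (PiM ?T (%_. D))"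
    by (rule tree_green_measurable) (simp flip: measurable_D_eq)
  have "tree_avg_log K L b \<rho> E = (\<integral>w. ln \<bar>tree_green K L b w E\<bar> \<partial>distr Q (PiM ?T (%_. D)) ?r)"
    by (simp add: tree_avg_log_def d)
  also have "... = (\<integral>om. ln \<bar>tree_green K L b (?r om) E\<bar> \<partial>Q)"
    by (rule integral_distr[OF r_meas]) (use tg in measurable)
  also have "... = (\<integral>om. lng om (of_real E) L 0 \<partial>Q)"
  proof (rule integral_cong_AE)
    show "(%om. ln \<bar>tree_green K L b (?r om) E\<bar>) \<in> borel_measurable Q"
      using measurable_compose[OF r_meas tg] by measurable
    show "AE om in Q. ln \<bar>tree_green K L b (?r om) E\<bar> = lng om (of_real E) L 0"
      using AE_gam_real_neq[of E]
    proof eventually_elim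
      case (elim om)
      then have "tree_green K L b (?r om) E = gam om E L 0"
        by (intro tree_green_eq) auto
      then show ?case by (simp add: lng_def of_real_gam)
    qed
  qed simp
  finally show ?thesis by (simp add: fL_def)
qed

end

section \<open>Strict concavity and the logarithmic gap off the real axis\<close>

lemma sum_ln_le:
  fixes y :: "nat => real"
  assumes K: "K > 0" and y: "\<And>i. i < K ==> 0 < y i"
  shows "(\<Sum>i<K. ln (y i)) \<le> real K * ln ((\<Sum>i<K. y i) / real K)"
proof -
  define S where "S = (\<Sum>i<K. y i) / real K"
  have Sp: "S > 0" unfolding S_def using assms by (intro divide_pos_pos sum_pos) auto
  have "(\<Sum>i<K. ln (y i) - ln S) \<le> (\<Sum>i<K. y i / S - 1)"
  proof (rule sum_mono)
    fix i assume "i \<in> {..<K}"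
    then have "0 < y i" using y by simp
    then show "ln (y i) - ln S \<le> y i / S - 1"
      using ln_le_minus_one[of "y i / S"] Sp by (simp add: ln_div)
  qed
  also have "... = 0"
  proof -
    have "(\<Sum>i<K. y i) = real K * S" using K by (simp add: S_def)
    then show ?thesis using Sp by (simp add: sum_subtractf sum_divide_distrib[symmetric])
  qed
  finally show ?thesis by (simp add: sum_subtractf S_def[symmetric])
qed

text \<open>The inequality between the means with an explicit remainder. Replacing the first two
  entries by their arithmetic mean keeps the sum, and since the mean of two exponentials is the
  exponential of the mean exponent times the \<open>cosh\<close> of half their difference, it raises
  the sum of logarithms by twice that \<open>ln cosh\<close>.\<close>

lemma ln_sum_ge:
  fixes x :: "nat => real"
  assumes K: "K \<ge> 2" and x: "\<And>i. i < K ==> 0 < x i"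
  shows "ln (\<Sum>i<K. x i) \<ge> ln (real K) + (\<Sum>i<K. ln (x i)) / real K
     + 2 / real K * ln (cosh ((ln (x 0) - ln (x 1)) / 2))"
proof -
  define m where "m = (x 0 + x 1) / 2"
  define y where "y i = (if i < 2 then m else x i)" for i
  have x01: "0 < x 0" "0 < x 1" using x K by auto
  have y: "0 < y i" if "i < K" for i using x01 x[OF that] by (simp add: y_def m_def)
  obtain k where k: "K = Suc (Suc k)" using K by (metis add_2_eq_Suc le_Suc_ex)
  have sy: "(\<Sum>i<K. y i) = (\<Sum>i<K. x i)"
    by (simp only: k sum.lessThan_Suc_shift) (simp add: y_def m_def field_simps)
  have lm: "ln m = (ln (x 0) + ln (x 1)) / 2 + ln (cosh ((ln (x 0) - ln (x 1)) / 2))"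
  proof -
    have "exp ((ln (x 0) + ln (x 1)) / 2) * cosh ((ln (x 0) - ln (x 1)) / 2) = (exp (ln (x 0)) + exp (ln (x 1))) / 2"
      by (simp only: cosh_def) (simp add: scaleR_conv_of_real ring_distribs field_simps flip: exp_add)
    also have "... = m" using x01 by (simp add: m_def)
    finally have "ln (exp ((ln (x 0) + ln (x 1)) / 2) * cosh ((ln (x 0) - ln (x 1)) / 2)) = ln m" by simp
    then show ?thesis by (subst (asm) ln_mult) (auto simp: cosh_real_pos)
  qed
  have sl: "(\<Sum>i<K. ln (y i)) = (\<Sum>i<K. ln (x i)) + 2 * ln (cosh ((ln (x 0) - ln (x 1)) / 2))"
    by (simp only: k sum.lessThan_Suc_shift) (simp add: y_def lm field_simps)
  have Sp: "0 < (\<Sum>i<K. x i)" using x K by (intro sum_pos) (auto simp: lessThan_empty_iff)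
  have "(\<Sum>i<K. ln (y i)) \<le> real K * (ln (\<Sum>i<K. x i) - ln (real K))"
    using sum_ln_le[of K y] y K Sp by (simp add: sy ln_div)
  then have "(\<Sum>i<K. ln (y i)) / real K \<le> ln (\<Sum>i<K. x i) - ln (real K)"
    using K by (simp add: pos_divide_le_eq mult.commute)
  then show ?thesis unfolding sl by (simp add: add_divide_distrib)
qed

lemma emeasure_sq_annulus:
  fixes A0 B :: real
  assumes B: "0 \<le> B"
  shows "emeasure lborel {t. A0 < t\<^sup>2 \<and> t\<^sup>2 < A0 + B} \<le> ennreal (2 * sqrt B)"
proof -
  \<comment> \<open>A0 may be negative; then the lower constraint is void and the set is an interval
    around 0.\<close>
  define a where "a = sqrt (max A0 0)"
  define c where "c = sqrt (max A0 0 + B)"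
  have ac: "0 \<le> a" "a \<le> c" using B by (auto simp: a_def c_def)
  have "c \<le> a + sqrt B" unfolding a_def c_def by (rule sqrt_add_le_add_sqrt) (use B in auto)
  have sub: "{t. A0 < t\<^sup>2 \<and> t\<^sup>2 < A0 + B} \<subseteq> {-c..-a} \<union> {a..c}"
  proof
    fix t assume "t \<in> {t. A0 < t\<^sup>2 \<and> t\<^sup>2 < A0 + B}"
    then have t: "A0 < t\<^sup>2" "t\<^sup>2 < A0 + B" by auto
    have "a \<le> \<bar>t\<bar>" unfolding a_def using t by (intro real_le_lsqrt) auto
    moreover have "\<bar>t\<bar> \<le> c" unfolding c_def using t by (intro real_le_rsqrt) auto
    ultimately show "t \<in> {-c..-a} \<union> {a..c}" by auto
  qed
  have "emeasure lborel {t. A0 < t\<^sup>2 \<and> t\<^sup>2 < A0 + B} \<le> emeasure lborel ({-c..-a} \<union> {a..c})"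
    by (rule emeasure_mono[OF sub]) auto
  also have "... \<le> emeasure lborel {-c..-a} + emeasure lborel {a..c}"
    by (rule emeasure_subadditive) auto
  also have "... = ennreal (2 * (c - a))"
    using ac by (simp flip: ennreal_plus)
  also have "... \<le> ennreal (2 * sqrt B)"
    using \<open>c \<le> a + sqrt B\<close> by (intro ennreal_leI) auto
  finally show ?thesis .
qed

context canopy_model
begin

lemma sets_Collect_Q: "Measurable.pred Q P ==> {om. P om} \<in> sets Q"
  by (simp add: pred_def)

lemma im_gam_cs:
  assumes z: "0 < Im z"
  shows "0 < Im (gam om z n j)" "0 \<le> Im (cs om z n j)"
proof -
  have step: "0 < Im (gam om z n j)" if "0 \<le> Im (cs om z n j)" for n j
  proof -
    let ?u = "of_real (om (n, j)) - z - cs om z n j"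
    have i: "Im ?u < 0" using that z by simp
    then have "?u \<noteq> 0" by (metis less_irrefl zero_complex.sel(2))
    then show ?thesis using i by (simp add: gam_eq Im_inverse divide_pos_pos sum_power2_gt_zero_iff complex_eq_iff)
  qed
  have both: "0 \<le> Im (cs om z n j) \<and> 0 < Im (gam om z n j)" for j
  proof (induction n arbitrary: j)
    case 0
    then show ?case using step[of 0 j] by simp
  next
    case (Suc n)
    then have "0 \<le> Im (cs om z (Suc n) j)" by (simp add: cs_Suc sum_nonneg less_imp_le)
    then show ?case using step by blast
  qed
  show "0 < Im (gam om z n j)" "0 \<le> Im (cs om z n j)" using both by auto
qed

text \<open>The balance of imaginary parts from which the gap is derived: its logarithm relates the
  modulus at one layer to the imaginary parts at two consecutive layers.\<close>

lemma im_gam_eq: "Im (gam om z n j) = (norm (gam om z n j))\<^sup>2 * (Im z + Im (cs om z n j))"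
proof -
  have "Im (inverse u) = (norm (inverse u))\<^sup>2 * (- Im u)" for u :: complex
    by (simp add: norm_inverse power_inverse cmod_power2[symmetric] Im_inverse) (simp add: cmod_power2 divide_inverse)
  from this[of "of_real (om (n, j)) - z - cs om z n j"] show ?thesis by (simp add: gam_eq)
qed

lemma norm_gam_le: "0 < Im z ==> norm (gam om z n j) \<le> 1 / Im z"
proof -
  assume z: "0 < Im z"
  let ?u = "of_real (om (n, j)) - z - cs om z n j"
  have "Im z \<le> \<bar>Im ?u\<bar>" using z im_gam_cs(2)[OF z, of om n j] by simp
  also have "... \<le> norm ?u" by (rule abs_Im_le_cmod)
  finally show ?thesis using z by (simp add: gam_eq norm_inverse divide_inverse le_imp_inverse_le)
qed

definition lni :: "(cvert => real) => complex => nat => nat => real" where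
  "lni om z n j = ln (Im (gam om z n j))"

lemma lni_measurable [measurable]: "(%om. lni om z n j) \<in> borel_measurable Q"
  by (simp add: lni_def)

lemma lni_eq:
  assumes z: "0 < Im z"
  shows "lni om z n j = 2 * lng om z n j + ln (Im z + Im (cs om z n j))"
proof -
  have "gam om z n j \<noteq> 0" using im_gam_cs(1)[OF z, of om n j] by auto
  then show ?thesis
    using z im_gam_cs(2)[OF z, of om n j]
    by (simp add: lni_def im_gam_eq lng_def ln_mult ln_realpow)
qed

lemma lni_bounds:
  assumes z: "0 < Im z"
  shows "lni om z n j \<le> - ln (Im z)" "2 * lng om z n j + ln (Im z) \<le> lni om z n j"
proof -
  have "Im (gam om z n j) \<le> 1 / Im z"
    using norm_gam_le[OF z, of om n j] abs_Im_le_cmod[of "gam om z n j"] by linarith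
  then have "lni om z n j \<le> ln (1 / Im z)"
    using im_gam_cs(1)[OF z, of om n j] z by (simp add: lni_def)
  then show "lni om z n j \<le> - ln (Im z)" using z by (simp add: ln_div)
  show "2 * lng om z n j + ln (Im z) \<le> lni om z n j"
    using z im_gam_cs(2)[OF z, of om n j] by (simp add: lni_eq)
qed

lemma integrable_lni:
  assumes z: "0 < Im z"
  shows "integrable Q (%om. lni om z n j)"
proof (rule Bochner_Integration.integrable_bound)
  show "integrable Q (%om. \<bar>2 * lng om z n j + ln (Im z)\<bar> + \<bar>ln (Im z)\<bar>)"
    using integrable_lng by auto
  show "AE om in Q. norm (lni om z n j) \<le> norm (\<bar>2 * lng om z n j + ln (Im z)\<bar> + \<bar>ln (Im z)\<bar>)"
  proof (rule AE_I2)
    fix om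
    show "norm (lni om z n j) \<le> norm (\<bar>2 * lng om z n j + ln (Im z)\<bar> + \<bar>ln (Im z)\<bar>)"
      using lni_bounds[OF z, of om n j] by (simp add: abs_le_iff) linarith
  qed
qed simp

lemma lni_stationary: "(\<integral>om. lni om z n j \<partial>Q) = (\<integral>om. lni om z n 0 \<partial>Q)"
  unfolding lni_def by (rule integral_gam_stationary) simp

text \<open>Given all sites but (n, j), the value at j' is fixed, and the one at j is explicit in
  the potential v: it is ln y minus twice ln |v - w|. For the two to be within \<kappa>, the square
  of v - Re w must fall into a short interval, which the bounded density makes unlikely as long as
  |v - w| is at most R. The complement of the latter is controlled by the inverse moment; the two
  assumptions on R and \<kappa> make each part at most 1/4.\<close>

lemma lni_anticoncentration:
  assumes z: "0 < Im z" and R: "0 < R" and k: "0 < \<kappa>" and j: "j \<noteq> j'"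
    and R1: "(B0 + norm z powr s) / R powr s \<le> 1 / 4"
    and k1: "2 * M * R * sqrt (exp (2 * \<kappa>) - 1) \<le> 1 / 4"
  shows "Q.prob {om. \<kappa> \<le> \<bar>lni om z n j - lni om z n j'\<bar>} \<ge> 1 / 2"
proof -
  let ?w = "%om. z + cs om z n j"
  define G where "G = {om. \<bar>lni om z n j - lni om z n j'\<bar> < \<kappa>}"
  define F where "F = {om. norm (of_real (om (n, j)) - ?w om) > R}"
  have G: "G \<in> sets Q" unfolding G_def by (rule sets_Collect_Q) measurable
  have F: "F \<in> sets Q" unfolding F_def by (rule sets_Collect_Q) measurable
  have eF: "emeasure Q F \<le> ennreal (1 / 4)"
  proof -
    have "emeasure Q F \<le> (\<integral>\<^sup>+om. ennreal (1 / R powr s) * ennreal (norm (inverse (gam om z n j)) powr s) \<partial>Q)"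
    proof (subst nn_integral_indicator[OF F, symmetric], rule nn_integral_mono)
      fix om
      show "indicator F om \<le> ennreal (1 / R powr s) * ennreal (norm (inverse (gam om z n j)) powr s)"
      proof (cases "om \<in> F")
        case True
        then have "R powr s \<le> norm (inverse (gam om z n j)) powr s"
          using R s_pos by (intro powr_mono2) (auto simp: F_def gam_eq diff_diff_eq)
        then have "1 \<le> 1 / R powr s * norm (inverse (gam om z n j)) powr s" using R by (simp add: field_simps)
        then have "ennreal 1 \<le> ennreal (1 / R powr s * norm (inverse (gam om z n j)) powr s)" by (rule ennreal_leI)
        also have "... = ennreal (1 / R powr s) * ennreal (norm (inverse (gam om z n j)) powr s)"
          by (rule ennreal_mult) auto
        finally show ?thesis using True by simp
      qed simp
    qed
    also have "... = ennreal (1 / R powr s) * (\<integral>\<^sup>+om. ennreal (norm (inverse (gam om z n j)) powr s) \<partial>Q)"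
      by (simp add: nn_integral_cmult)
    also have "... \<le> ennreal (1 / R powr s) * ennreal (B0 + norm z powr s)"
      by (intro mult_left_mono gam_inverse_moment) auto
    also have "... = ennreal ((B0 + norm z powr s) / R powr s)"
      using B0_nonneg by (simp add: ennreal_mult[symmetric] flip: ennreal_plus)
    also have "... \<le> ennreal (1 / 4)" by (rule ennreal_leI[OF R1])
    finally show ?thesis .
  qed
  have inner: "(\<integral>\<^sup>+v. indicator (G - F) (fun_upd om (n, j) v) \<partial>D) \<le> ennreal (1 / 4)" for om
  proof -
    define w where "w = ?w om"
    define y where "y = Im z + Im (cs om z n j)"
    define l where "l = lni om z n j'"
    \<comment> \<open>Lower end of the window: the two logarithms differ by less than \<kappa>
      exactly when |v - w| lies between \<open>a\<close> and
      \<open>a * exp \<kappa>\<close>.\<close>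
    define a where "a = exp ((ln y - l - \<kappa>) / 2)"
    have y: "0 < y" using z im_gam_cs(2)[OF z, of om n j] by (simp add: y_def)
    have wi: "Im w = y" by (simp add: w_def y_def)
    have l': "lni (fun_upd om (n, j) v) z n j' = l" for v
    proof -
      have "gam (fun_upd om (n, j) v) z n j' = gam om z n j'"
        by (rule gam_cong) (use j in \<open>auto simp: desc_def\<close>)
      then show ?thesis by (simp add: lni_def l_def)
    qed
    have li: "lni (fun_upd om (n, j) v) z n j = ln y - 2 * ln (norm (of_real v - w))" for v
      using lni_eq[OF z, of "fun_upd om (n, j) v" n j]
      by (simp add: cs_upd y_def lng_def gam_eq norm_inverse ln_inverse diff_diff_eq w_def)
    define B where "B = R\<^sup>2 * (exp (2 * \<kappa>) - 1)"
    have B: "0 \<le> B" using k by (simp add: B_def)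
    have sub: "indicator (G - F) (fun_upd om (n, j) v) \<le> (indicator {t. a\<^sup>2 - y\<^sup>2 < t\<^sup>2 \<and> t\<^sup>2 < (a\<^sup>2 - y\<^sup>2) + B} (v - Re w) :: ennreal)" for v
    proof (cases "fun_upd om (n, j) v \<in> G - F")
      case True
      let ?q = "norm (of_real v - w)"
      have q: "0 < ?q" using wi y by (auto simp: complex_eq_iff)
      have 1: "\<bar>ln y - 2 * ln ?q - l\<bar> < \<kappa>" using True by (simp add: G_def l' li)
      have 2: "?q \<le> R" using True by (simp add: F_def cs_upd w_def)
      have lo: "(ln y - l - \<kappa>) / 2 < ln ?q" using 1 unfolding abs_less_iff by (simp add: field_simps)
      have hi: "ln ?q < (ln y - l - \<kappa>) / 2 + \<kappa>" using 1 unfolding abs_less_iff by (simp add: field_simps)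
      have "a < exp (ln ?q)" unfolding a_def by (subst exp_less_cancel_iff) (rule lo)
      moreover have "exp (ln ?q) < a * exp \<kappa>"
        unfolding a_def exp_add[symmetric] by (subst exp_less_cancel_iff) (rule hi)
      ultimately have 3: "a < ?q" "?q < a * exp \<kappa>" using q by auto
      have a: "0 < a" by (simp add: a_def)
      have "a\<^sup>2 < ?q\<^sup>2" using 3 a by (intro power_strict_mono) auto
      moreover have "?q\<^sup>2 < (a * exp \<kappa>)\<^sup>2" using 3 q by (intro power_strict_mono) auto
      moreover have "(a * exp \<kappa>)\<^sup>2 = a\<^sup>2 + a\<^sup>2 * (exp (2 * \<kappa>) - 1)"
        unfolding exp_double by (simp add: power_mult_distrib algebra_simps)
      moreover have "a\<^sup>2 * (exp (2 * \<kappa>) - 1) \<le> B"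
        unfolding B_def using 2 3 a k by (intro mult_right_mono power_mono) auto
      moreover have "?q\<^sup>2 = (v - Re w)\<^sup>2 + y\<^sup>2" by (simp add: cmod_power2 wi)
      ultimately show ?thesis by (auto simp: indicator_def)
    qed simp
    have "(\<integral>\<^sup>+v. indicator (G - F) (fun_upd om (n, j) v) \<partial>D)
       \<le> (\<integral>\<^sup>+v. indicator {t. a\<^sup>2 - y\<^sup>2 < t\<^sup>2 \<and> t\<^sup>2 < (a\<^sup>2 - y\<^sup>2) + B} (v - Re w) \<partial>D)"
      by (intro nn_integral_mono sub)
    also have "... \<le> ennreal M * (\<integral>\<^sup>+v. indicator {t. a\<^sup>2 - y\<^sup>2 < t\<^sup>2 \<and> t\<^sup>2 < (a\<^sup>2 - y\<^sup>2) + B} (v - Re w) \<partial>lborel)"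
      by (rule nn_D_le) measurable
    also have "(\<integral>\<^sup>+v. indicator {t. a\<^sup>2 - y\<^sup>2 < t\<^sup>2 \<and> t\<^sup>2 < (a\<^sup>2 - y\<^sup>2) + B} (v - Re w) \<partial>lborel)
      = (\<integral>\<^sup>+v. indicator {t. a\<^sup>2 - y\<^sup>2 < t\<^sup>2 \<and> t\<^sup>2 < (a\<^sup>2 - y\<^sup>2) + B} v \<partial>lborel)"
      using nn_integral_real_affine[of "%v. indicator {t. a\<^sup>2 - y\<^sup>2 < t\<^sup>2 \<and> t\<^sup>2 < (a\<^sup>2 - y\<^sup>2) + B} (v - Re w) :: ennreal" 1 "Re w"]
      by (simp add: borel_measurable_indicator' cong: measurable_cong_sets)
    also have "... = emeasure lborel {t. a\<^sup>2 - y\<^sup>2 < t\<^sup>2 \<and> t\<^sup>2 < (a\<^sup>2 - y\<^sup>2) + B}"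
      by (rule nn_integral_indicator) measurable
    also have "... \<le> ennreal (2 * sqrt B)" by (rule emeasure_sq_annulus[OF B])
    also have "ennreal M * ennreal (2 * sqrt B) = ennreal (2 * M * R * sqrt (exp (2 * \<kappa>) - 1))"
      using M_nonneg R B k by (simp add: ennreal_mult[symmetric] B_def real_sqrt_mult)
    also have "... \<le> ennreal (1 / 4)" by (rule ennreal_leI[OF k1])
    finally show ?thesis by (simp add: mult_left_mono fun_upd_def)
  qed
  have "emeasure Q (G - F) = (\<integral>\<^sup>+om. indicator (G - F) om \<partial>Q)"
    using G F by (intro nn_integral_indicator[symmetric]) auto
  also have "... = (\<integral>\<^sup>+om. \<integral>\<^sup>+v. indicator (G - F) (fun_upd om (n, j) v) \<partial>D \<partial>Q)"
    by (rule nn_resample1) (use G F in auto)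
  also have "... \<le> (\<integral>\<^sup>+om. ennreal (1 / 4) \<partial>Q)"
    by (intro nn_integral_mono inner)
  finally have eGF: "emeasure Q (G - F) \<le> ennreal (1 / 4)" by (simp add: Q.emeasure_space_1[simplified])
  have "emeasure Q G \<le> emeasure Q ((G - F) \<union> F)"
    using G F by (intro emeasure_mono) auto
  also have "... \<le> emeasure Q (G - F) + emeasure Q F"
    using G F by (intro emeasure_subadditive) auto
  also have "... \<le> ennreal (1 / 4) + ennreal (1 / 4)" by (intro add_mono eF eGF)
  also have "... = ennreal (1 / 2)" by (simp flip: ennreal_plus)
  finally have "ennreal (Q.prob G) \<le> ennreal (1 / 2)" by (simp only: Q.emeasure_eq_measure)
  then have "Q.prob G \<le> 1 / 2" by (subst (asm) ennreal_le_iff) auto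
  moreover have "Q.prob {om. \<kappa> \<le> \<bar>lni om z n j - lni om z n j'\<bar>} = 1 - Q.prob G"
    using Q.prob_compl[OF G] by (simp add: G_def not_less Compl_eq_Diff_UNIV[symmetric] Collect_neg_eq[symmetric])
  ultimately show ?thesis by simp
qed

text \<open>Take the mean of \<open>lni_eq\<close> at layer n + 1 and bound the logarithm of the
  child sum by \<open>ln_sum_ge\<close>. By stationarity the K children contribute one layer-n mean,
  and the remainder counts on an event of probability at least 1/2. The right-hand side is left as a
  difference so that it telescopes in n.\<close>

lemma fL_step:
  assumes z: "0 < Im z" and k: "0 < \<kappa>"
    and anti: "Q.prob {om. \<kappa> \<le> \<bar>lni om z n 0 - lni om z n 1\<bar>} \<ge> 1 / 2"
  shows "2 * fL (Suc n) z + ln (real K) + ln (cosh (\<kappa> / 2)) / real K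
     \<le> (\<integral>om. lni om z (Suc n) 0 \<partial>Q) - (\<integral>om. lni om z n 0 \<partial>Q)"
proof -
  define P where "P = {om. \<kappa> \<le> \<bar>lni om z n 0 - lni om z n 1\<bar>}"
  have P [measurable]: "P \<in> sets Q" unfolding P_def by (rule sets_Collect_Q) measurable
  let ?c = "ln (cosh (\<kappa> / 2))"
  have c: "0 \<le> ?c" using cosh_real_ge_1 by simp
  have pt: "2 * lng om z (Suc n) 0 + (ln (real K) + (\<Sum>i<K. lni om z n i) / real K + 2 / real K * ?c * indicator P om) \<le> lni om z (Suc n) 0" for om
  proof -
    have xp: "0 < Im (gam om z n i)" for i by (rule im_gam_cs(1)[OF z])
    have "?c * indicator P om \<le> ln (cosh ((lni om z n 0 - lni om z n 1) / 2))"
    proof (cases "om \<in> P")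
      case True
      then have "cosh (\<kappa> / 2) \<le> cosh \<bar>(lni om z n 0 - lni om z n 1) / 2\<bar>"
        using k by (intro cosh_real_nonneg_le_iff[THEN iffD2]) (auto simp: P_def)
      then show ?thesis unfolding cosh_real_abs using True by (simp add: cosh_real_pos)
    qed (use cosh_real_ge_1 in simp)
    then have "2 / real K * (?c * indicator P om) \<le> 2 / real K * ln (cosh ((lni om z n 0 - lni om z n 1) / 2))"
      by (intro mult_left_mono) auto
    moreover have "ln (\<Sum>i<K. Im (gam om z n i)) \<ge> ln (real K) + (\<Sum>i<K. lni om z n i) / real K
       + 2 / real K * ln (cosh ((lni om z n 0 - lni om z n 1) / 2))"
      unfolding lni_def by (rule ln_sum_ge[OF K2]) (rule xp)
    moreover have "ln (\<Sum>i<K. Im (gam om z n i)) \<le> ln (Im z + Im (cs om z (Suc n) 0))"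
    proof -
      have "0 < (\<Sum>i<K. Im (gam om z n i))" by (intro sum_pos xp) (auto simp: lessThan_empty_iff)
      then show ?thesis using z by (simp add: cs_Suc)
    qed
    ultimately show ?thesis unfolding lni_eq[OF z, of om "Suc n"] by (simp add: mult.assoc)
  qed
  have intP: "integrable Q (%om. indicator P om :: real)" by (rule integrable_real_indicator) (auto simp: Q.emeasure_eq_measure)
  have "(\<integral>om. 2 * lng om z (Suc n) 0 + (ln (real K) + (\<Sum>i<K. lni om z n i) / real K + 2 / real K * ?c * indicator P om) \<partial>Q)
    \<le> (\<integral>om. lni om z (Suc n) 0 \<partial>Q)"
    by (intro integral_mono pt Bochner_Integration.integrable_add integrable_mult_right integrable_lng integrable_lni[OF z]
        integrable_divide Bochner_Integration.integrable_sum intP integrable_const Q.integrable_const)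
  moreover have "(\<integral>om. 2 * lng om z (Suc n) 0 + (ln (real K) + (\<Sum>i<K. lni om z n i) / real K + 2 / real K * ?c * indicator P om) \<partial>Q)
    = 2 * fL (Suc n) z + (ln (real K) + (\<Sum>i<K. \<integral>om. lni om z n i \<partial>Q) / real K + 2 / real K * ?c * Q.prob P)"
    by (subst Bochner_Integration.integral_add, (intro Bochner_Integration.integrable_add integrable_mult_right integrable_lng integrable_lni[OF z]
        integrable_divide Bochner_Integration.integrable_sum intP Q.integrable_const; fail)+)+
      (simp add: fL_eq integrable_lng integrable_lni[OF z] Q.prob_space[simplified])
  moreover have "(\<Sum>i<K. \<integral>om. lni om z n i \<partial>Q) / real K = (\<integral>om. lni om z n 0 \<partial>Q)"
    by (subst lni_stationary) simp
  moreover have "2 / real K * ?c * Q.prob P \<ge> 2 / real K * ?c * (1 / 2)"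
    using anti c unfolding P_def by (intro mult_left_mono) auto
  ultimately show ?thesis by (simp add: mult.commute)
qed

text \<open>After telescoping, only the last mean remains, bounded by minus ln (Im z). That term
  goes into C, while the gap c depends on Z alone and not on Im z. This order of quantifiers allows
  the distance to the axis to be chosen after c.\<close>

lemma lyapunov_complex:
  assumes Z: "0 \<le> Z"
  shows "\<exists>c>0. \<forall>z. 0 < Im z --> norm z \<le> Z -->
    (\<exists>C. \<forall>N. (\<Sum>n<N. fL (Suc n) z) \<le> C - real N * (ln (real K) / 2 + c))"
proof -
  \<comment> \<open>R makes the Markov bound for large inverse Green functions at most 1/4. Then
    \<theta> makes \<open>2 * M * R * \<theta>\<close> at most 1/4, with \<open>M + 1\<close> in the
    denominator guarding the division, and \<kappa> solves sqrt (exp (2 \<kappa>) - 1) =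
    \<theta>.\<close>
  define R where "R = (4 * (B0 + Z powr s) + 1) powr (1 / s)"
  define \<theta> where "\<theta> = 1 / (8 * (M + 1) * R)"
  define \<kappa> where "\<kappa> = ln (1 + \<theta>\<^sup>2) / 2"
  define c where "c = ln (cosh (\<kappa> / 2)) / real K / 2"
  have p: "0 < 4 * (B0 + Z powr s) + 1"
    using B0_nonneg by (intro add_nonneg_pos mult_nonneg_nonneg add_nonneg_nonneg) auto
  have R: "0 < R" using p by (simp add: R_def)
  have Rs: "R powr s = 4 * (B0 + Z powr s) + 1"
    using s_pos p by (simp add: R_def powr_powr)
  have th: "0 < \<theta>" using R M_nonneg by (simp add: \<theta>_def)
  have k: "0 < \<kappa>" using th ln_gt_zero[of "1 + \<theta>\<^sup>2"] by (simp add: \<kappa>_def del: ln_gt_zero)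
  have ek: "sqrt (exp (2 * \<kappa>) - 1) = \<theta>" using th by (simp add: \<kappa>_def add_pos_nonneg)
  have "cosh (0::real) < cosh (\<kappa> / 2)" using k by (intro cosh_real_nonneg_less_iff[THEN iffD2]) auto
  then have c: "0 < c" by (simp add: c_def)
  have k1: "2 * M * R * sqrt (exp (2 * \<kappa>) - 1) \<le> 1 / 4"
  proof -
    have "2 * M * R * \<theta> = (M / (M + 1)) / 4" using R by (simp add: \<theta>_def divide_simps)
    also have "... \<le> 1 / 4" using M_nonneg by (intro divide_right_mono) auto
    finally show ?thesis unfolding ek .
  qed
  show ?thesis
  proof (rule exI[of _ c], intro conjI c allI impI)
    fix z assume z: "0 < Im z" "norm z \<le> Z"
    have "norm z powr s \<le> Z powr s" using z s_pos by (intro powr_mono2) auto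
    then have R1: "(B0 + norm z powr s) / R powr s \<le> 1 / 4"
      unfolding Rs by (subst pos_divide_le_eq[OF p]) simp
    have step: "2 * fL (Suc n) z + ln (real K) + 2 * c \<le> (\<integral>om. lni om z (Suc n) 0 \<partial>Q) - (\<integral>om. lni om z n 0 \<partial>Q)" for n
      using fL_step[OF z(1) k lni_anticoncentration[OF z(1) R k _ R1 k1, of 0 1 n]] by (simp add: c_def)
    have "(\<Sum>n<N. 2 * fL (Suc n) z + ln (real K) + 2 * c) \<le> (\<integral>om. lni om z N 0 \<partial>Q) - (\<integral>om. lni om z 0 0 \<partial>Q)" for N
    proof -
      have "(\<Sum>n<N. 2 * fL (Suc n) z + ln (real K) + 2 * c) \<le> (\<Sum>n<N. (\<integral>om. lni om z (Suc n) 0 \<partial>Q) - (\<integral>om. lni om z n 0 \<partial>Q))"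
        by (intro sum_mono step)
      also have "... = (\<integral>om. lni om z N 0 \<partial>Q) - (\<integral>om. lni om z 0 0 \<partial>Q)"
        by (rule sum_lessThan_telescope)
      finally show ?thesis .
    qed
    moreover have "(\<integral>om. lni om z N 0 \<partial>Q) \<le> - ln (Im z)" for N
    proof -
      have "(\<integral>om. lni om z N 0 \<partial>Q) \<le> (\<integral>om. - ln (Im z) \<partial>Q)"
        by (intro integral_mono integrable_lni z lni_bounds(1)) auto
      then show ?thesis by (simp add: Q.prob_space[simplified])
    qed
    ultimately have "(\<Sum>n<N. 2 * fL (Suc n) z + ln (real K) + 2 * c) \<le> - ln (Im z) - (\<integral>om. lni om z 0 0 \<partial>Q)" for N
      by (smt (verit))
    note * = this
    have "(\<Sum>n<N. fL (Suc n) z) \<le> (- ln (Im z) - (\<integral>om. lni om z 0 0 \<partial>Q)) / 2 - real N * (ln (real K) / 2 + c)" for N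
      using *[of N] by (simp add: sum.distrib sum_distrib_left[symmetric] field_simps) 
    then show "\<exists>C. \<forall>N. (\<Sum>n<N. fL (Suc n) z) \<le> C - real N * (ln (real K) / 2 + c)" by blast
  qed
qed

end

section \<open>Borel transforms of finite atomic measures under inversion\<close>

text \<open>The Borel transform of the measure with mass \<open>w t\<close> at the points t of La;
  \<open>dstj\<close> is its derivative on the real line. At an atom the quotient by zero is 0 by
  convention, so the identities below exclude the poles.\<close>

definition stj :: "real set => (real => real) => complex => complex" where
  "stj La w z = (\<Sum>t\<in>La. of_real (w t) / (of_real t - z))"

definition dstj :: "real set => (real => real) => real => real" where
  "dstj La w E = (\<Sum>t\<in>La. w t / (t - E)\<^sup>2)"

lemma stj_of_real: "stj La w (of_real E) = of_real (\<Sum>t\<in>La. w t / (t - E))"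
  by (simp add: stj_def)

lemma dstj_nonneg: "(\<And>t. t \<in> La ==> 0 \<le> w t) ==> 0 \<le> dstj La w E"
  by (auto simp: dstj_def intro!: sum_nonneg)

lemma stj_deriv:
  assumes "finite La" "z \<notin> of_real ` La"
  shows "(stj La w has_field_derivative (\<Sum>t\<in>La. of_real (w t) / (of_real t - z)\<^sup>2)) (at z)"
proof -
  have "((%z. of_real (w t) / (of_real t - z)) has_field_derivative of_real (w t) / (of_real t - z)\<^sup>2) (at z)"
    if "t \<in> La" for t
  proof -
    have "of_real t - z \<noteq> 0" using that assms by auto
    then show ?thesis by (auto intro!: derivative_eq_intros simp: power2_eq_square)
  qed
  then have "((%z. \<Sum>t\<in>La. of_real (w t) / (of_real t - z)) has_field_derivative (\<Sum>t\<in>La. of_real (w t) / (of_real t - z)\<^sup>2)) (at z)"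
    by (rule DERIV_sum)
  then show ?thesis by (simp add: stj_def[abs_def])
qed

lemma Im_stj:
  "Im (stj La w z) = Im z * (\<Sum>t\<in>La. w t / (cmod (of_real t - z))\<^sup>2)"
proof -
  have "Im (of_real c / u) = - c * Im u / (cmod u)\<^sup>2" for c :: real and u :: complex
    by (simp add: Im_divide cmod_power2)
  then show ?thesis by (simp add: stj_def sum_distrib_left mult.commute)
qed

lemma open_compl_finite_reals: "finite S ==> open (- (of_real ` S :: complex set))"
  by (intro open_Compl finite_imp_closed) auto

text \<open>The denominator c - z - stj is a quotient q / p of polynomials, with deg q = deg p + 1.
  Its imaginary part has the sign opposite to Im z, so its zeros are real; its derivative at a zero
  is -(1 + dstj), so they are simple. The partial fraction expansion of p / q then has one pole per
  zero, and the masses are reciprocals of 1 + dstj.\<close>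

lemma stj_resolvent:
  fixes w :: "real => real" and c :: real
  assumes fin: "finite La" and pos: "\<And>t. t \<in> La ==> 0 < w t"
  shows "\<exists>La' w'. finite La' \<and> card La' = Suc (card La) \<and> (\<forall>t\<in>La'. 0 < w' t) \<and> (\<Sum>t\<in>La'. w' t) = 1 \<and>
    (\<forall>z. z \<notin> of_real ` (La \<union> La') --> of_real c - z - stj La w z \<noteq> 0 \<and>
       inverse (of_real c - z - stj La w z) = stj La' w' z \<and>
       norm (stj La' w' z) = (\<Prod>t\<in>La. norm (of_real t - z)) / (\<Prod>t\<in>La'. norm (of_real t - z))) \<and>
    (\<forall>E. E \<notin> La \<union> La' --> dstj La' w' E = (cmod (stj La' w' (of_real E)))\<^sup>2 * (1 + dstj La w E)) \<and>
    (\<forall>t\<in>La'. t \<notin> La \<and> w' t = 1 / (1 + dstj La w t))"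
proof -
  define N where "N = card La"
  define p :: "complex poly" where "p = (\<Prod>t\<in>La. [:of_real t, -1:])"
  define r :: "complex poly" where "r = (\<Sum>t\<in>La. smult (of_real (w t)) (\<Prod>\<mu>\<in>La-{t}. [:of_real \<mu>, -1:]))"
  define q where "q = [:of_real c, -1:] * p - r"
  define H where "H z = of_real c - z - stj La w z" for z
  have pp: "poly p z = (\<Prod>t\<in>La. of_real t - z)" for z by (simp add: p_def poly_prod)
  have pnz: "poly p z \<noteq> 0" if "z \<notin> of_real ` La" for z using that fin by (auto simp: pp)
  have pr: "poly r z = poly p z * stj La w z" if "z \<notin> of_real ` La" for z
  proof -
    have "of_real (w t) * (\<Prod>\<mu>\<in>La-{t}. of_real \<mu> - z) = poly p z * (of_real (w t) / (of_real t - z))" if l: "t \<in> La" for t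
    proof -
      have "of_real t - z \<noteq> 0" using l \<open>z \<notin> of_real ` La\<close> by auto
      moreover have "poly p z = (of_real t - z) * (\<Prod>\<mu>\<in>La-{t}. of_real \<mu> - z)"
        unfolding pp using fin l by (rule prod.remove)
      ultimately show ?thesis by simp
    qed
    then show ?thesis by (simp add: r_def poly_sum poly_prod stj_def sum_distrib_left)
  qed
  have pq: "poly q z = poly p z * H z" if "z \<notin> of_real ` La" for z
    using pr[OF that] by (simp add: q_def H_def algebra_simps)
  have degp: "degree p = N" "lead_coeff p = (-1) ^ N" "p \<noteq> 0"
    unfolding p_def N_def lead_coeff_prod using fin by (auto simp: degree_prod_sum_eq)
  have degr: "degree r \<le> N"
    unfolding r_def
  proof (rule degree_sum_le[OF fin])
    fix t assume "t \<in> La"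
    have "degree (\<Prod>\<mu>\<in>La-{t}. [:of_real \<mu>, -1:] :: complex poly) = card (La - {t})"
      by (subst degree_prod_sum_eq) auto
    also have "... \<le> N" unfolding N_def using fin by (intro card_mono) auto
    finally show "degree (smult (of_real (w t)) (\<Prod>\<mu>\<in>La-{t}. [:of_real \<mu>, -1:]) :: complex poly) \<le> N"
      using degree_smult_le order_trans by blast
  qed
  have degcp: "degree ([:of_real c, -1:] * p) = Suc N"
    using degp by (subst degree_mult_eq) auto
  have lccp: "lead_coeff ([:of_real c, -1:] * p) = - ((-1) ^ N)"
    unfolding lead_coeff_mult degp(2) by simp
  have degq: "degree q = Suc N"
  proof -
    have "degree q = degree ([:of_real c, -1:] * p)"
      unfolding q_def diff_conv_add_uminus using degr degcp by (intro degree_add_eq_left) simp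
    then show ?thesis using degcp by simp
  qed
  have lcq: "lead_coeff q = - ((-1) ^ N)"
  proof -
    have "coeff r (Suc N) = 0" using degr by (intro coeff_eq_0) simp
    then show ?thesis using lccp unfolding degq degcp by (simp only: q_def coeff_diff) simp
  qed
  have q0: "q \<noteq> 0" using degq by auto
  \<comment> \<open>At a pole of the transform, p vanishes and q equals the negative residue term,
    which is nonzero because the weight is positive. So old poles are never new ones.\<close>
  have root_real: "\<exists>x. z = of_real x \<and> x \<notin> La" if z: "poly q z = 0" for z
  proof (cases "z \<in> of_real ` La")
    case True
    then obtain t where l: "t \<in> La" "z = of_real t" by auto
    have "poly p z = 0" using l fin by (auto simp: pp)
    then have "poly r z = 0" using z by (simp add: q_def)
    moreover have "poly r z = of_real (w t) * (\<Prod>\<mu>\<in>La-{t}. of_real \<mu> - z)"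
    proof -
      have "(\<Prod>\<mu>\<in>La-{\<nu>}. of_real \<mu> - z) = 0" if "\<nu> \<in> La - {t}" for \<nu>
        using that l fin by (intro prod_zero) auto
      then have "(\<Sum>\<nu>\<in>La. of_real (w \<nu>) * (\<Prod>\<mu>\<in>La-{\<nu>}. of_real \<mu> - z)) = of_real (w t) * (\<Prod>\<mu>\<in>La-{t}. of_real \<mu> - z)"
        by (subst sum.remove[OF fin l(1)]) simp
      then show ?thesis by (simp add: r_def poly_sum poly_prod)
    qed
    ultimately have "w t = 0 \<or> (\<exists>\<mu>\<in>La-{t}. complex_of_real \<mu> - z = 0)" using fin by auto
    then show ?thesis using pos[OF l(1)] l by auto
  next
    case False
    then have H0: "H z = 0" using z pq pnz by simp
    have "Im (H z) = - Im z * (1 + (\<Sum>t\<in>La. w t / (cmod (of_real t - z))\<^sup>2))"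
      by (simp add: H_def Im_stj algebra_simps)
    moreover have "0 \<le> (\<Sum>t\<in>La. w t / (cmod (of_real t - z))\<^sup>2)"
      using pos by (intro sum_nonneg divide_nonneg_nonneg) (auto intro: less_imp_le)
    ultimately have "Im z = 0" using H0 by (auto simp: add_nonneg_eq_0_iff)
    then have "z = of_real (Re z)" by (simp add: complex_eq_iff)
    then show ?thesis using False by auto
  qed
  define La' where "La' = {x. poly q (of_real x) = 0}"
  define Z where "Z = {z. poly q z = 0}"
  have ZL: "Z = of_real ` La'" using root_real by (auto simp: Z_def La'_def)
  have finZ: "finite Z" unfolding Z_def using q0 by (rule poly_roots_finite)
  then have finL': "finite La'" unfolding ZL by (rule finite_imageD) (simp add: inj_on_def)
  have disj: "x \<notin> La" if "x \<in> La'" for x using root_real[of "of_real x"] that by (auto simp: La'_def)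
  have dH: "(H has_field_derivative (- 1 - (\<Sum>t\<in>La. of_real (w t) / (of_real t - z)\<^sup>2))) (at z)" if "z \<notin> of_real ` La" for z
    unfolding H_def[abs_def] by (rule derivative_eq_intros stj_deriv[OF fin that] refl)+ simp
  have dq: "poly (pderiv q) (of_real x) = - poly p (of_real x) * of_real (1 + dstj La w x)" if x: "x \<in> La'" for x
  proof -
    let ?z = "complex_of_real x"
    have xn: "?z \<notin> of_real ` La" using disj[OF x] by auto
    have H0: "H ?z = 0" using x pq[OF xn] pnz[OF xn] by (simp add: La'_def)
    have "((%z. poly p z * H z) has_field_derivative (poly (pderiv p) ?z * H ?z + (- 1 - (\<Sum>t\<in>La. of_real (w t) / (of_real t - ?z)\<^sup>2)) * poly p ?z)) (at ?z)"
      by (rule DERIV_mult[OF poly_DERIV dH[OF xn]])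
    then have "(poly q has_field_derivative (poly (pderiv p) ?z * H ?z + (- 1 - (\<Sum>t\<in>La. of_real (w t) / (of_real t - ?z)\<^sup>2)) * poly p ?z)) (at ?z)"
      by (rule has_field_derivative_transform_within_open[OF _ open_compl_finite_reals[OF fin]]) (use xn pq in auto)
    then have "poly (pderiv q) ?z = poly (pderiv p) ?z * H ?z + (- 1 - (\<Sum>t\<in>La. of_real (w t) / (of_real t - ?z)\<^sup>2)) * poly p ?z"
      by (rule DERIV_unique[OF poly_DERIV])
    then show ?thesis unfolding H0 by (simp add: dstj_def algebra_simps)
  qed
  have ds_pos: "0 < 1 + dstj La w x" for x using dstj_nonneg[of La w x] pos by (simp add: less_imp_le add_pos_nonneg)
  have dq0: "poly (pderiv q) (of_real x) \<noteq> 0" if x: "x \<in> La'" for x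
  proof -
    have "complex_of_real x \<notin> of_real ` La" using disj[OF x] by auto
    then show ?thesis using dq[OF x] pnz ds_pos[of x] by (metis mult_eq_0_iff neg_equal_0_iff_equal of_real_eq_0_iff less_irrefl)
  qed
  have sqf: "rsquarefree q"
    unfolding rsquarefree_roots
  proof (intro allI notI)
    fix z assume "poly q z = 0 \<and> poly (pderiv q) z = 0"
    then show False using root_real[of z] dq0 by (auto simp: La'_def)
  qed
  define lc where "lc = lead_coeff q"
  have lc0: "lc \<noteq> 0" "norm lc = 1" unfolding lc_def lcq by (auto simp: norm_power)
  have qdec: "q = smult lc (\<Prod>z\<in>Z. [:-z, 1:])"
    using complex_poly_decompose_rsquarefree[OF sqf] by (simp add: Z_def lc_def)
  have cardZ: "card Z = Suc N"
  proof -
    have "degree q = degree (\<Prod>z\<in>Z. [:-z, 1:])" using lc0 by (subst qdec) simp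
    also have "... = card Z" by (subst degree_prod_sum_eq) auto
    finally show ?thesis using degq by simp
  qed
  have cardL': "card La' = Suc N"
    using cardZ unfolding ZL by (subst (asm) card_image) (auto simp: inj_on_def)
  define qr where "qr z = smult lc (\<Prod>\<sigma>\<in>Z-{z}. [:-\<sigma>, 1:])" for z
  have q_split: "q = [:-z, 1:] * qr z" if "z \<in> Z" for z
    using finZ that by (subst qdec) (simp add: qr_def prod.remove mult_smult_right)
  have dqr: "poly (pderiv q) z = poly (qr z) z" if "z \<in> Z" for z
  proof -
    have "pderiv q = [:-z, 1:] * pderiv (qr z) + qr z * pderiv [:-z, 1:]"
      by (subst q_split[OF that]) (rule pderiv_mult)
    then show ?thesis by (simp add: pderiv_pCons)
  qed
  have qr0: "poly (qr z) \<sigma> = 0" if "\<sigma> \<in> Z" "\<sigma> \<noteq> z" for z \<sigma>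
    using that finZ by (auto simp: qr_def poly_prod)
  have degqr: "degree (qr z) = N" "lead_coeff (qr z) = lc" if "z \<in> Z" for z
  proof -
    have "degree (\<Prod>\<sigma>\<in>Z-{z}. [:-\<sigma>, 1:]) = card (Z - {z})" by (subst degree_prod_sum_eq) auto
    then show "degree (qr z) = N" using lc0 finZ that cardZ by (simp add: qr_def)
    show "lead_coeff (qr z) = lc" unfolding qr_def lead_coeff_smult lead_coeff_prod by simp
  qed
  \<comment> \<open>Lagrange interpolation of p at the zeros of q. Both polynomials have degree at
    most N and agree at N + 1 points, which is the partial fraction expansion in disguise.\<close>
  define L where "L = (\<Sum>z\<in>Z. smult (poly p z / poly (pderiv q) z) (qr z))"
  have Lp: "L = p"
  proof (rule poly_eqI_degree[of Z])
    fix \<sigma> assume s: "\<sigma> \<in> Z"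
    have z0: "poly (qr k) \<sigma> = 0" if "k \<in> Z - {\<sigma>}" for k using qr0[OF s, of k] that by auto
    have "poly L \<sigma> = poly p \<sigma> / poly (pderiv q) \<sigma> * poly (qr \<sigma>) \<sigma>"
      unfolding L_def poly_sum by (subst sum.remove[OF finZ s]) (simp add: z0)
    also have "... = poly p \<sigma>" using dqr[OF s] dq0 s by (auto simp: ZL)
    finally show "poly L \<sigma> = poly p \<sigma>" .
  next
    have "degree L \<le> N" unfolding L_def
      by (rule degree_sum_le[OF finZ]) (use degqr degree_smult_le order_trans in fastforce)
    then show "degree L < card Z" using cardZ by simp
    show "degree p < card Z" using cardZ degp by simp
  qed
  define w' where "w' x = 1 / (1 + dstj La w x)" for x
  have coef: "poly p (of_real x) / poly (pderiv q) (of_real x) = - of_real (w' x)" if "x \<in> La'" for x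
  proof -
    have "complex_of_real x \<notin> of_real ` La" using disj[OF that] by auto
    then show ?thesis using dq[OF that] pnz ds_pos[of x] by (simp add: w'_def divide_simps)
  qed
  \<comment> \<open>Compare the coefficients of degree N in \<open>L = p\<close>.\<close>
  have sumw: "(\<Sum>x\<in>La'. w' x) = 1"
  proof -
    have "(-1) ^ N = coeff L N" using degp by (simp add: Lp)
    also have "... = (\<Sum>z\<in>Z. poly p z / poly (pderiv q) z * lc)"
      unfolding L_def coeff_sum by (intro sum.cong refl) (metis coeff_smult degqr)
    also have "... = (\<Sum>x\<in>La'. poly p (of_real x) / poly (pderiv q) (of_real x) * lc)"
      unfolding ZL by (subst sum.reindex) (auto simp: inj_on_def)
    also have "... = (\<Sum>x\<in>La'. - of_real (w' x) * lc)"
      by (intro sum.cong refl) (subst coef, assumption, rule refl)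
    also have "... = (\<Sum>x\<in>La'. of_real (w' x)) * (-1) ^ N"
      unfolding lc_def lcq by (simp add: sum_distrib_right)
    finally have "complex_of_real (\<Sum>x\<in>La'. w' x) = 1" by simp
    then show ?thesis by (metis of_real_eq_1_iff)
  qed
  have notU: "z \<notin> of_real ` La" "z \<notin> Z" if "z \<notin> complex_of_real ` (La \<union> La')" for z
    using that by (auto simp: ZL)
  have inv: "H z \<noteq> 0 \<and> inverse (H z) = stj La' w' z \<and>
       norm (stj La' w' z) = (\<Prod>t\<in>La. norm (of_real t - z)) / (\<Prod>t\<in>La'. norm (of_real t - z))"
    if z: "z \<notin> complex_of_real ` (La \<union> La')" for z
  proof -
    have qz: "poly q z \<noteq> 0" using notU[OF z] by (simp add: Z_def)
    have H0: "H z \<noteq> 0" using qz pq[OF notU(1)[OF z]] by auto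
    have iH: "inverse (H z) = poly p z / poly q z" using pq[OF notU(1)[OF z]] pnz[OF notU(1)[OF z]] by (simp add: field_simps)
    also have "poly p z / poly q z = (\<Sum>\<sigma>\<in>Z. poly p \<sigma> / poly (pderiv q) \<sigma> / (z - \<sigma>))"
    proof -
      have "poly (qr \<sigma>) z / poly q z = 1 / (z - \<sigma>)" if "\<sigma> \<in> Z" for \<sigma>
      proof -
        have "z - \<sigma> \<noteq> 0" using that notU[OF z] by auto
        moreover have "poly q z = (z - \<sigma>) * poly (qr \<sigma>) z"
          using arg_cong[OF q_split[OF that], of "%q. poly q z"] by (simp add: algebra_simps)
        ultimately show ?thesis using qz by (simp add: field_simps)
      qed
      then show ?thesis
        by (subst Lp[symmetric], unfold L_def poly_sum sum_divide_distrib poly_smult, intro sum.cong refl)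
          (metis (no_types) mult.right_neutral times_divide_eq_right)
    qed
    also have "... = stj La' w' z"
    proof -
      have "poly p (of_real x) / poly (pderiv q) (of_real x) / (z - of_real x) = of_real (w' x) / (of_real x - z)" if "x \<in> La'" for x
        unfolding coef[OF that] by (metis minus_diff_eq minus_divide_divide minus_divide_left)
      then show ?thesis unfolding ZL stj_def by (subst sum.reindex) (auto simp: inj_on_def)
    qed
    finally have eq: "inverse (H z) = stj La' w' z" .
    have "norm (poly q z) = (\<Prod>t\<in>La'. norm (of_real t - z))"
      unfolding qdec ZL by (subst prod.reindex) (auto simp: inj_on_def poly_prod norm_mult lc0 norm_minus_commute prod_norm[symmetric] comp_def)
    moreover have "norm (poly p z) = (\<Prod>t\<in>La. norm (of_real t - z))"
      by (simp add: pp prod_norm)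
    ultimately show ?thesis using H0 eq iH norm_divide[of "poly p z" "poly q z"] by simp
  qed
  have dd: "dstj La' w' E = (cmod (stj La' w' (of_real E)))\<^sup>2 * (1 + dstj La w E)" if E: "E \<notin> La \<union> La'" for E
  proof -
    let ?z = "complex_of_real E"
    have z: "?z \<notin> of_real ` (La \<union> La')" using E by auto
    have z1: "?z \<notin> of_real ` La" and z2: "?z \<notin> of_real ` La'" using E by auto
    have H0: "H ?z \<noteq> 0" using inv[OF z] by simp
    have "((%z. inverse (H z)) has_field_derivative - (inverse (H ?z) * (- 1 - (\<Sum>t\<in>La. of_real (w t) / (of_real t - ?z)\<^sup>2)) * inverse (H ?z))) (at ?z)"
      by (rule DERIV_inverse'[OF dH[OF z1] H0])
    then have "(stj La' w' has_field_derivative - (inverse (H ?z) * (- 1 - (\<Sum>t\<in>La. of_real (w t) / (of_real t - ?z)\<^sup>2)) * inverse (H ?z))) (at ?z)"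
      by (rule has_field_derivative_transform_within_open[OF _ open_compl_finite_reals[of "La \<union> La'"]])
        (use fin finL' z inv in auto)
    from DERIV_unique[OF stj_deriv[OF finL' z2] this]
    have "(\<Sum>t\<in>La'. of_real (w' t) / (of_real t - ?z)\<^sup>2) = (stj La' w' ?z)\<^sup>2 * (1 + (\<Sum>t\<in>La. of_real (w t) / (of_real t - ?z)\<^sup>2))"
      using inv[OF z] by (simp add: power2_eq_square algebra_simps)
    then have "complex_of_real (dstj La' w' E) = of_real ((\<Sum>t\<in>La'. w' t / (t - E))\<^sup>2 * (1 + dstj La w E))"
      by (simp add: dstj_def stj_of_real)
    then have "dstj La' w' E = (\<Sum>t\<in>La'. w' t / (t - E))\<^sup>2 * (1 + dstj La w E)"
      by (simp only: of_real_eq_iff)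
    then show ?thesis by (simp add: stj_of_real del: of_real_sum)
  qed
  show ?thesis
    by (rule exI[of _ La'], rule exI[of _ w'])
      (use finL' cardL' sumw inv dd disj ds_pos in \<open>auto simp: N_def H_def w'_def\<close>)
qed

section \<open>The Cauchy law and its logarithmic potential\<close>

text \<open>Below pi/3 the derivative of the sine is at least 1/2; above, the sine is at least sqrt
  3 / 2, which exceeds pi/4. The bound reduces negative powers of the sine to those of the
  angle.\<close>

lemma half_le_sin:
  assumes "0 \<le> x" "x \<le> pi / 2"
  shows "x / 2 \<le> sin (x::real)"
proof (cases "x \<le> pi / 3")
  case True
  have "pi / 3 \<le> pi" "0 \<le> pi / 3" by auto
  show ?thesis
  proof (cases "x = 0")
    case False
    then have "\<exists>l>0. l < x \<and> sin x - sin 0 = (x - 0) * cos l"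
      using assms by (intro MVT2) (auto intro!: derivative_eq_intros)
    then obtain l where l: "0 < l" "l < x" "sin x = x * cos l" by auto
    have "1 / 2 \<le> cos l"
      using cos_monotone_0_pi_le[of l "pi / 3"] l True \<open>pi / 3 \<le> pi\<close> by (simp add: cos_60)
    then have "x * (1 / 2) \<le> x * cos l" using assms by (intro mult_left_mono) auto
    then show ?thesis using l by simp
  qed simp
next
  case False
  have "sin (pi / 3) \<le> sin x" using False assms by (intro sin_monotone_2pi_le) auto
  moreover have "x / 2 \<le> sqrt 3 / 2"
  proof -
    have "pi / 2 \<le> 8 / 5" using pi_less_4 pi_approx by simp
    also have "8 / 5 \<le> sqrt 3" by (rule real_le_rsqrt) (simp add: power2_eq_square)
    finally show ?thesis using assms by simp
  qed
  ultimately show ?thesis by (simp add: sin_60)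
qed

text \<open>The Cauchy distribution is obtained as the law of the tangent of a uniform angle: its logarithmic moments then reduce to rotation invariance.\<close>

definition angle :: "real measure" where
  "angle = density lborel (%t. ennreal (indicator {-(pi/2)..<pi/2} t / pi))"

definition cauchy :: "real measure" where
  "cauchy = distr angle borel tan"

lemma tan_measurable [measurable]: "(tan :: real => real) \<in> borel_measurable borel"
  unfolding tan_def by measurable

lemma sets_angle [measurable_cong, simp]: "sets angle = sets borel" by (simp add: angle_def)
lemma sets_cauchy [measurable_cong, simp]: "sets cauchy = sets borel" by (simp add: cauchy_def)
lemma space_cauchy [simp]: "space cauchy = UNIV" by (simp add: cauchy_def)

lemma nn_angle:
  "f \<in> borel_measurable borel ==> (\<integral>\<^sup>+t. f t \<partial>angle) = (\<integral>\<^sup>+t. ennreal (1 / pi) * (f t * indicator {-(pi/2)..<pi/2} t) \<partial>lborel)"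
  unfolding angle_def by (subst nn_integral_density) (auto intro!: nn_integral_cong simp: indicator_def)

text \<open>Rotation invariance: for a shift within one period the part that leaves the interval is
  moved back by pi, and a general shift is first reduced modulo pi.\<close>

lemma nn_angle_periodic:
  fixes f :: "real => ennreal"
  assumes [measurable]: "f \<in> borel_measurable borel" and per: "\<And>t. f (t + pi) = f t"
  shows "(\<integral>\<^sup>+t. f (t + c) \<partial>angle) = (\<integral>\<^sup>+t. f t \<partial>angle)"
proof -
  have main: "(\<integral>\<^sup>+t. f (t + c) * indicator {-(pi/2)..<pi/2} t \<partial>lborel) = (\<integral>\<^sup>+t. f t * indicator {-(pi/2)..<pi/2} t \<partial>lborel)"
    if c: "0 \<le> c" "c < pi" for c
  proof -
    have "(\<integral>\<^sup>+t. f (t + c) * indicator {-(pi/2)..<pi/2} t \<partial>lborel) =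
        ennreal \<bar>1\<bar> * (\<integral>\<^sup>+t. f ((-c + 1 * t) + c) * indicator {-(pi/2)..<pi/2} (-c + 1 * t) \<partial>lborel)"
      by (rule nn_integral_real_affine) auto
    also have "... = (\<integral>\<^sup>+t. f ((-c + 1 * t) + c) * indicator {-(pi/2)..<pi/2} (-c + 1 * t) \<partial>lborel)"
      by simp
    also have "... = (\<integral>\<^sup>+t. f t * indicator {-(pi/2) + c..<pi/2 + c} t \<partial>lborel)"
      by (intro nn_integral_cong) (auto simp: indicator_def)
    also have "... = (\<integral>\<^sup>+t. f t * indicator {-(pi/2) + c..<pi/2} t + f t * indicator {pi/2..<pi/2 + c} t \<partial>lborel)"
      using c by (intro nn_integral_cong) (auto simp: indicator_def)
    also have "... = (\<integral>\<^sup>+t. f t * indicator {-(pi/2) + c..<pi/2} t \<partial>lborel) + (\<integral>\<^sup>+t. f t * indicator {pi/2..<pi/2 + c} t \<partial>lborel)"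
      by (rule nn_integral_add) auto
    also have "(\<integral>\<^sup>+t. f t * indicator {pi/2..<pi/2 + c} t \<partial>lborel) = (\<integral>\<^sup>+t. f t * indicator {-(pi/2)..<-(pi/2) + c} t \<partial>lborel)"
    proof -
      have "(\<integral>\<^sup>+t. f t * indicator {pi/2..<pi/2 + c} t \<partial>lborel) =
        ennreal \<bar>1\<bar> * (\<integral>\<^sup>+t. f (pi + 1 * t) * indicator {pi/2..<pi/2 + c} (pi + 1 * t) \<partial>lborel)"
        by (rule nn_integral_real_affine) auto
      also have "... = (\<integral>\<^sup>+t. f (pi + 1 * t) * indicator {pi/2..<pi/2 + c} (pi + 1 * t) \<partial>lborel)"
        by simp
      also have "... = (\<integral>\<^sup>+t. f t * indicator {-(pi/2)..<-(pi/2) + c} t \<partial>lborel)"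
      proof (rule nn_integral_cong)
        fix t :: real
        have "f (pi + 1 * t) = f t" using per[of t] by (simp add: add.commute)
        then show "f (pi + 1 * t) * indicator {pi/2..<pi/2 + c} (pi + 1 * t) = f t * indicator {-(pi/2)..<-(pi/2) + c} t"
          by (simp add: indicator_def) linarith
      qed
      finally show ?thesis .
    qed
    also have "(\<integral>\<^sup>+t. f t * indicator {-(pi/2) + c..<pi/2} t \<partial>lborel) + (\<integral>\<^sup>+t. f t * indicator {-(pi/2)..<-(pi/2) + c} t \<partial>lborel)
      = (\<integral>\<^sup>+t. f t * indicator {-(pi/2) + c..<pi/2} t + f t * indicator {-(pi/2)..<-(pi/2) + c} t \<partial>lborel)"
      by (rule nn_integral_add[symmetric]) auto
    also have "... = (\<integral>\<^sup>+t. f t * indicator {-(pi/2)..<pi/2} t \<partial>lborel)"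
      using c by (intro nn_integral_cong) (auto simp: indicator_def)
    finally show ?thesis .
  qed
  define k where "k = \<lfloor>c / pi\<rfloor>"
  have k: "0 \<le> c - pi * k" "c - pi * k < pi"
    using floor_divide_lower[of pi c] floor_divide_upper[of pi c] by (auto simp: k_def algebra_simps)
  have pern: "f (t + pi * real n) = f t" for t n
  proof (induction n)
    case (Suc n)
    then show ?case using per[of "t + pi * real n"] by (simp add: algebra_simps)
  qed simp
  have fk: "f (t + c) = f (t + (c - pi * k))" for t
  proof (cases "0 \<le> k")
    case True
    then have "t + (c - pi * k) + pi * real (nat k) = t + c" by (simp add: algebra_simps)
    then show ?thesis using pern[of "t + (c - pi * k)" "nat k"] by metis
  next
    case False
    then have "t + c + pi * real (nat (- k)) = t + (c - pi * k)" by (simp add: algebra_simps)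
    then show ?thesis using pern[of "t + c" "nat (- k)"] by metis
  qed
  have "(\<integral>\<^sup>+t. f (t + c) \<partial>angle) = (\<integral>\<^sup>+t. f (t + (c - pi * k)) \<partial>angle)"
    by (rule nn_integral_cong) (rule fk)
  also have "... = ennreal (1 / pi) * (\<integral>\<^sup>+t. f (t + (c - pi * k)) * indicator {-(pi/2)..<pi/2} t \<partial>lborel)"
    by (subst nn_angle, measurable) (rule nn_integral_cmult, measurable)
  also have "... = ennreal (1 / pi) * (\<integral>\<^sup>+t. f t * indicator {-(pi/2)..<pi/2} t \<partial>lborel)"
    by (simp only: main[OF k])
  also have "... = (\<integral>\<^sup>+t. f t \<partial>angle)"
    by (subst nn_angle, measurable) (rule nn_integral_cmult[symmetric], measurable)
  finally show ?thesis .
qed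

lemma prob_space_angle: "prob_space angle"
proof
  have "emeasure angle (space angle) = (\<integral>\<^sup>+t. 1 \<partial>angle)" by simp
  also have "... = ennreal (1 / pi) * emeasure lborel {-(pi/2)..<pi/2}"
    by (subst nn_angle) (auto simp: nn_integral_cmult)
  also have "... = 1" by (simp add: ennreal_mult[symmetric])
  finally show "emeasure angle (space angle) = 1" .
qed

lemma prob_space_cauchy: "prob_space cauchy"
  unfolding cauchy_def by (rule prob_space.prob_space_distr[OF prob_space_angle]) measurable

lemma nn_cauchy: "f \<in> borel_measurable borel ==> (\<integral>\<^sup>+u. f u \<partial>cauchy) = (\<integral>\<^sup>+t. f (tan t) \<partial>angle)"
  unfolding cauchy_def by (rule nn_integral_distr) auto

lemma nn_angle_sin_powr:
  assumes r: "0 < r" "r < 1"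
  shows "(\<integral>\<^sup>+t. ennreal (\<bar>sin (t + c)\<bar> powr (-r)) \<partial>angle) < \<infinity>"
proof -
  have "(\<integral>\<^sup>+t. ennreal (\<bar>sin (t + c)\<bar> powr (-r)) \<partial>angle) = (\<integral>\<^sup>+t. ennreal (\<bar>sin t\<bar> powr (-r)) \<partial>angle)"
    by (rule nn_angle_periodic[of "%t. ennreal (\<bar>sin t\<bar> powr (-r))"]) auto
  also have "... = (\<integral>\<^sup>+t. ennreal (1 / pi) * (ennreal (\<bar>sin t\<bar> powr (-r)) * indicator {-(pi/2)..<pi/2} t) \<partial>lborel)"
    by (rule nn_angle) auto
  also have "... \<le> (\<integral>\<^sup>+t. ennreal (1 / pi) * ennreal (indicator {-1..1} (0 + (1/2) * t) * \<bar>0 + (1/2) * t\<bar> powr (-r)) \<partial>lborel)"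
  proof (intro nn_integral_mono mult_left_mono)
    fix t :: real
    show "ennreal (\<bar>sin t\<bar> powr (-r)) * indicator {-(pi/2)..<pi/2} t \<le> ennreal (indicator {-1..1} (0 + (1/2) * t) * \<bar>0 + (1/2) * t\<bar> powr (-r))"
    proof (cases "t \<in> {-(pi/2)..<pi/2} \<and> t \<noteq> 0")
      case True
      have "0 \<le> sin \<bar>t\<bar>" using True by (intro sin_ge_zero) (auto simp: abs_if)
      then have "\<bar>sin t\<bar> = sin \<bar>t\<bar>" by (cases "0 \<le> t") auto
      then have "\<bar>t\<bar> / 2 \<le> \<bar>sin t\<bar>" using half_le_sin[of "\<bar>t\<bar>"] True by (auto simp: abs_if split: if_splits)
      then have "\<bar>sin t\<bar> powr (-r) \<le> (\<bar>t\<bar> / 2) powr (-r)" using True r by (intro powr_mono2') auto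
      moreover have "\<bar>t / 2\<bar> \<le> 1" using True pi_less_4 by (auto simp: abs_le_iff)
      moreover have "indicator {-(pi/2)..<pi/2} t = (1::ennreal)" using True by simp
      moreover have "indicator {-1..1} (0 + (1/2) * t) = (1::real)"
        using \<open>\<bar>t / 2\<bar> \<le> 1\<close> unfolding abs_le_iff by simp
      ultimately show ?thesis by (simp only: mult_1 mult_1_right) (simp add: ennreal_leI)
    next
      case False
      then consider "t \<notin> {-(pi/2)..<pi/2}" | "t = 0" by blast
      then show ?thesis by cases simp_all
    qed
  qed auto
  also have "... = ennreal (1 / pi) * (\<integral>\<^sup>+t. ennreal (indicator {-1..1} (0 + (1/2) * t) * \<bar>0 + (1/2) * t\<bar> powr (-r)) \<partial>lborel)"
    by (rule nn_integral_cmult) auto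
  also have "(\<integral>\<^sup>+t. ennreal (indicator {-1..1} (0 + (1/2) * t) * \<bar>0 + (1/2) * t\<bar> powr (-r)) \<partial>lborel)
     = 2 * (\<integral>\<^sup>+u. ennreal (indicator {-1..1} u * \<bar>u\<bar> powr (-r)) \<partial>lborel)"
  proof -
    have "(\<integral>\<^sup>+u. ennreal (indicator {-1..1} u * \<bar>u\<bar> powr (-r)) \<partial>lborel)
      = ennreal (1 / 2) * (\<integral>\<^sup>+t. ennreal (indicator {-1..1} (0 + (1/2) * t) * \<bar>0 + (1/2) * t\<bar> powr (-r)) \<partial>lborel)"
      using nn_integral_real_affine[of "%u. ennreal (indicator {-1..1} u * \<bar>u\<bar> powr (-r))" "1/2" 0] by simp
    moreover have "2 * ennreal (1 / 2) = 1"
      using ennreal_mult[of 2 "1/2"] by simp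
    ultimately show ?thesis by (simp only: mult.assoc[symmetric]) simp
  qed
  also have "... = 2 * ennreal (2 / (1 - r))" by (simp only: nn_integral_abs_powr_unit[OF r])
  also have "ennreal (1 / pi) * (2 * ennreal (2 / (1 - r))) < \<infinity>"
    by (simp add: ennreal_mult_less_top)
  finally show ?thesis .
qed

lemma cauchy_moment:
  assumes r: "0 < r" "r < 1"
  shows "(\<integral>\<^sup>+u. ennreal (\<bar>u\<bar> powr r) \<partial>cauchy) < \<infinity>"
proof -
  have "(\<integral>\<^sup>+u. ennreal (\<bar>u\<bar> powr r) \<partial>cauchy) = (\<integral>\<^sup>+t. ennreal (\<bar>tan t\<bar> powr r) \<partial>angle)"
    by (rule nn_cauchy) auto
  also have "... \<le> (\<integral>\<^sup>+t. ennreal (\<bar>sin (t + pi/2)\<bar> powr (-r)) \<partial>angle)"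
  proof (intro nn_integral_mono ennreal_leI)
    fix t :: real
    have "\<bar>tan t\<bar> powr r \<le> (1 / \<bar>cos t\<bar>) powr r"
      using r by (intro powr_mono2) (auto simp: tan_def abs_divide divide_right_mono)
    also have "... = \<bar>cos t\<bar> powr (-r)" by (simp add: inverse_powr powr_minus divide_inverse)
    finally show "\<bar>tan t\<bar> powr r \<le> \<bar>sin (t + pi/2)\<bar> powr (-r)" by (simp add: sin_add)
  qed
  also have "... < \<infinity>" by (rule nn_angle_sin_powr[OF r])
  finally show ?thesis .
qed

lemma AE_angle_finite:
  assumes "finite A"
  shows "AE t in angle. t \<in> {-(pi/2)<..<pi/2} - A"
proof -
  have "AE t in lborel. t \<notin> insert (-(pi/2)) A"
    by (rule AE_not_in, rule countable_imp_null_set_lborel) (use assms in \<open>auto intro: countable_finite\<close>)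
  then have "AE t in lborel. 0 < ennreal (indicator {-(pi/2)..<pi/2} t / pi) --> t \<in> {-(pi/2)<..<pi/2} - A"
    by eventually_elim (auto simp: indicator_def split: if_splits)
  then show ?thesis
    unfolding angle_def by (subst AE_density) simp_all
qed

lemma AE_cauchy_finite:
  assumes "finite A"
  shows "AE u in cauchy. u \<notin> A"
proof -
  have "AE t in angle. tan t \<notin> A"
    using AE_angle_finite[OF finite_imageI[OF assms], of arctan]
  proof eventually_elim
    case (elim t)
    show ?case
    proof
      assume "tan t \<in> A"
      then have "arctan (tan t) \<in> arctan ` A" by (rule imageI)
      with elim show False by (simp add: arctan_tan)
    qed
  qed
  moreover have A [measurable]: "A \<in> sets borel" by (simp add: assms finite_imp_closed borel_closed)
  ultimately show ?thesis unfolding cauchy_def by (subst AE_distr_iff) simp_all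
qed

lemma ln_sin_integrable: "integrable angle (%t. ln \<bar>sin (t + c)\<bar>)"
proof (rule integrableI_bounded)
  have "(\<integral>\<^sup>+t. ennreal (norm (ln \<bar>sin (t + c)\<bar>)) \<partial>angle) \<le> (\<integral>\<^sup>+t. ennreal 2 * ennreal (\<bar>sin (t + c)\<bar> powr (-(1/2))) \<partial>angle)"
  proof (intro nn_integral_mono)
    fix t :: real
    let ?x = "\<bar>sin (t + c)\<bar>"
    have "\<bar>ln ?x\<bar> \<le> 2 * ?x powr (-(1/2))"
    proof (cases "?x = 0")
      case False
      then have x: "0 < ?x" "?x \<le> 1" by auto
      have "ln (inverse ?x) \<le> inverse ?x powr (1/2) / (1/2)"
        by (rule ln_powr_bound) (use x in \<open>auto simp: one_le_inverse_iff\<close>)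
      then show ?thesis using x by (simp add: ln_inverse powr_minus inverse_powr)
    qed simp
    then show "ennreal (norm (ln ?x)) \<le> ennreal 2 * ennreal (?x powr (-(1/2)))"
      using ennreal_leI
      by (simp only: real_norm_def ennreal_mult[of 2 "?x powr -(1/2)", OF zero_le_numeral powr_ge_zero, symmetric])
  qed
  also have "... = ennreal 2 * (\<integral>\<^sup>+t. ennreal (\<bar>sin (t + c)\<bar> powr (-(1/2))) \<partial>angle)"
    by (rule nn_integral_cmult) auto
  also have "... < \<infinity>"
    using nn_angle_sin_powr[of "1/2" c] by (simp add: ennreal_mult_less_top)
  finally show "(\<integral>\<^sup>+t. ennreal (norm (ln \<bar>sin (t + c)\<bar>)) \<partial>angle) < \<infinity>" .
qed auto

lemma ln_sin_integral: "(\<integral>t. ln \<bar>sin (t + c)\<bar> \<partial>angle) = (\<integral>t. ln \<bar>sin t\<bar> \<partial>angle)"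
proof -
  have le: "0 \<le> - ln \<bar>sin (t::real)\<bar>" for t by (cases "sin t = 0") (auto simp: ln_le_zero_iff)
  have eq: "(\<integral>t. - ln \<bar>sin (t + c)\<bar> \<partial>angle) = enn2real (\<integral>\<^sup>+t. ennreal (- ln \<bar>sin (t + c)\<bar>) \<partial>angle)" for c
    by (rule integral_eq_nn_integral) (measurable, intro AE_I2 le)
  have "(\<integral>\<^sup>+t. ennreal (- ln \<bar>sin (t + c)\<bar>) \<partial>angle) = (\<integral>\<^sup>+t. ennreal (- ln \<bar>sin t\<bar>) \<partial>angle)"
    by (rule nn_angle_periodic[of "%t. ennreal (- ln \<bar>sin t\<bar>)"]) auto
  then have "(\<integral>t. - ln \<bar>sin (t + c)\<bar> \<partial>angle) = (\<integral>t. - ln \<bar>sin t\<bar> \<partial>angle)"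
    using eq[of c] eq[of 0] by simp
  then show ?thesis by simp
qed

text \<open>With a = tan t0, tan t - a is sin (t - t0) divided by cos t cos t0. By rotation
  invariance the logarithms of |sin (t - t0)| and |cos t| have equal means and cancel; only minus ln
  (cos t0) is left, and cos t0 = 1 / sqrt (1 + a^2).\<close>

lemma cauchy_ln_std:
  "integrable cauchy (%u. ln \<bar>u - a\<bar>)" "(\<integral>u. ln \<bar>u - a\<bar> \<partial>cauchy) = ln (1 + a\<^sup>2) / 2"
proof -
  define t0 where "t0 = arctan a"
  let ?g = "%t. ln (1 + a\<^sup>2) / 2 + ln \<bar>sin (t + (- t0))\<bar> - ln \<bar>sin (t + pi/2)\<bar>"
  interpret prob_space angle by (rule prob_space_angle)
  have eq: "AE t in angle. ln \<bar>tan t - a\<bar> = ?g t"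
    using AE_angle_finite[OF finite.insertI[OF finite.emptyI], of t0]
  proof eventually_elim
    case (elim t)
    then have t: "t \<noteq> t0" "- (pi / 2) < t" "t * 2 < pi" by auto
    have ct: "0 < cos t" by (rule cos_gt_zero_pi) (use t in auto)
    have c0: "0 < cos t0" unfolding t0_def by (rule cos_gt_zero_pi) (use arctan_lbound arctan_ubound in auto)
    have a: "a = sin t0 / cos t0" using tan_arctan[of a] by (simp add: t0_def tan_def)
    have 1: "tan t - a = sin (t - t0) / (cos t * cos t0)"
      using ct c0 by (simp add: a tan_def sin_diff field_simps)
    have 2: "cos t0 = 1 / sqrt (1 + a\<^sup>2)" by (simp add: t0_def cos_arctan)
    have 3: "sin (t - t0) \<noteq> 0"
    proof
      assume "sin (t - t0) = 0"
      moreover have "\<bar>t - t0\<bar> < pi"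
        using t arctan_lbound[of a] arctan_ubound[of a] unfolding t0_def by linarith
      then have "- pi < t - t0" "t - t0 < pi" by linarith+
      ultimately show False using sin_eq_0_pi[of "t - t0"] t by auto
    qed
    have p: "0 < 1 + a\<^sup>2" by (simp add: add_pos_nonneg)
    have "ln \<bar>tan t - a\<bar> = ln (\<bar>sin (t - t0)\<bar> / (cos t * cos t0))"
      unfolding 1 using ct c0 by (simp add: abs_mult)
    also have "... = ln \<bar>sin (t - t0)\<bar> - (ln (cos t) + ln (cos t0))"
      using 3 ct c0 by (simp add: ln_div ln_mult)
    also have "ln (cos t0) = - ln (1 + a\<^sup>2) / 2"
      unfolding 2 using p by (simp add: ln_div ln_sqrt)
    finally show "ln \<bar>tan t - a\<bar> = ?g t"
      using ct by (simp add: sin_add)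
  qed
  have ig: "integrable angle ?g"
    by (intro Bochner_Integration.integrable_add Bochner_Integration.integrable_diff ln_sin_integrable integrable_const)
  have "integrable angle (%t. ln \<bar>tan t - a\<bar>)"
    by (rule integrable_cong_AE_imp[OF ig]) (use eq in \<open>auto elim!: eventually_mono\<close>)
  then show "integrable cauchy (%u. ln \<bar>u - a\<bar>)"
    unfolding cauchy_def by (subst integrable_distr_eq) auto
  have "(\<integral>u. ln \<bar>u - a\<bar> \<partial>cauchy) = (\<integral>t. ln \<bar>tan t - a\<bar> \<partial>angle)"
    unfolding cauchy_def by (rule integral_distr) auto
  also have "... = (\<integral>t. ?g t \<partial>angle)"
    by (rule integral_cong_AE) (use eq in auto)
  also have "... = ln (1 + a\<^sup>2) / 2 + (\<integral>t. ln \<bar>sin (t + (- t0))\<bar> \<partial>angle) - (\<integral>t. ln \<bar>sin (t + pi/2)\<bar> \<partial>angle)"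
  proof -
    have "integrable angle (%t. ln (1 + a\<^sup>2) / 2 + ln \<bar>sin (t + (- t0))\<bar>)"
      by (intro Bochner_Integration.integrable_add ln_sin_integrable integrable_const)
    note * = Bochner_Integration.integral_diff[OF this ln_sin_integrable]
    show ?thesis
      unfolding * unfolding Bochner_Integration.integral_add[OF integrable_const ln_sin_integrable]
      by (simp add: prob_space[simplified])
  qed
  also have "... = ln (1 + a\<^sup>2) / 2" unfolding ln_sin_integral by simp
  finally show "(\<integral>u. ln \<bar>u - a\<bar> \<partial>cauchy) = ln (1 + a\<^sup>2) / 2" .
qed

text \<open>The Poisson formula for one logarithmic singularity on the real line. It stays valid for
  a singularity on the boundary of the half plane, and finite sums of such terms are all that is
  needed here.\<close>

lemma cauchy_ln:
  assumes e: "0 < e"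
  shows "integrable cauchy (%u. ln (norm (of_real l - of_real (E + e * u) :: complex)))"
    "(\<integral>u. ln (norm (of_real l - of_real (E + e * u) :: complex)) \<partial>cauchy) = ln (norm (of_real l - Complex E e))"
proof -
  interpret prob_space cauchy by (rule prob_space_cauchy)
  define a where "a = (l - E) / e"
  have eq: "AE u in cauchy. ln (norm (of_real l - of_real (E + e * u) :: complex)) = ln e + ln \<bar>u - a\<bar>"
    using AE_cauchy_finite[OF finite.insertI[OF finite.emptyI], of a]
  proof eventually_elim
    case (elim u)
    then have u: "u \<noteq> a" by simp
    have "norm (of_real l - of_real (E + e * u) :: complex) = \<bar>l - (E + e * u)\<bar>"
      by (metis norm_of_real of_real_diff)
    also have "l - (E + e * u) = e * (a - u)" using e by (simp add: a_def field_simps)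
    finally have "norm (of_real l - of_real (E + e * u) :: complex) = e * \<bar>u - a\<bar>"
      using e by (simp add: abs_mult abs_minus_commute)
    then show "ln (norm (of_real l - of_real (E + e * u) :: complex)) = ln e + ln \<bar>u - a\<bar>"
      using u e by (simp add: ln_mult)
  qed
  have ig: "integrable cauchy (%u. ln e + ln \<bar>u - a\<bar>)"
    by (intro Bochner_Integration.integrable_add integrable_const cauchy_ln_std)
  show "integrable cauchy (%u. ln (norm (of_real l - of_real (E + e * u) :: complex)))"
    by (rule integrable_cong_AE_imp[OF ig]) (use eq in \<open>auto elim!: eventually_mono\<close>)
  have "(\<integral>u. ln (norm (of_real l - of_real (E + e * u) :: complex)) \<partial>cauchy) = (\<integral>u. ln e + ln \<bar>u - a\<bar> \<partial>cauchy)"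
    by (rule integral_cong_AE) (use eq in auto)
  also have "... = ln e + ln (1 + a\<^sup>2) / 2"
    by (subst Bochner_Integration.integral_add) (auto simp: cauchy_ln_std prob_space[simplified])
  also have "... = ln (norm (of_real l - Complex E e))"
  proof -
    have "(norm (of_real l - Complex E e))\<^sup>2 = e\<^sup>2 * (1 + a\<^sup>2)"
      using e by (simp add: cmod_power2 a_def field_simps)
    then have "norm (of_real l - Complex E e) = sqrt (e\<^sup>2 * (1 + a\<^sup>2))"
      by (metis norm_ge_zero real_sqrt_unique)
    also have "... = e * sqrt (1 + a\<^sup>2)" using e by (simp add: real_sqrt_mult)
    finally have "norm (of_real l - Complex E e) = e * sqrt (1 + a\<^sup>2)" .
    moreover have "0 < sqrt (1 + a\<^sup>2)" by (simp add: add_pos_nonneg)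
    ultimately have "ln (norm (of_real l - Complex E e)) = ln e + ln (sqrt (1 + a\<^sup>2))"
      using e by (simp only: ln_mult_pos)
    then show ?thesis by (simp add: ln_sqrt add_pos_nonneg)
  qed
  finally show "(\<integral>u. ln (norm (of_real l - of_real (E + e * u) :: complex)) \<partial>cauchy) = ln (norm (of_real l - Complex E e))" .
qed

lemma measurable_cauchy_eq [simp]: "measurable cauchy N = measurable borel N"
  by (rule measurable_cong_sets[OF sets_cauchy refl])

lemma line_measurable [measurable]: "(%u. complex_of_real (E + e * u)) \<in> borel_measurable borel"
  by (intro borel_measurable_continuous_onI continuous_intros)

section \<open>Green functions as rational functions of the energy, with their derivatives\<close>

text \<open>Beyond the poles La, the finite set X collects energies at which some intermediate Green
  function of the recursion has a pole: there \<open>inverse 0 = 0\<close> takes over and the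
  recursively defined value may differ from the rational function.\<close>

definition rat :: "(complex => complex) => (real => real) => real set => (real => real) => real set => bool" where
  "rat g dg La w X \<longleftrightarrow> finite La \<and> finite X \<and> La \<subseteq> X \<and> (\<forall>t\<in>La. 0 < w t) \<and>
     (\<forall>z. z \<notin> of_real ` X --> g z = stj La w z) \<and> (\<forall>E. E \<notin> X --> dg E = dstj La w E)"

lemma rat_zero: "rat (%_. 0) (%_. 0) {} (%_. 1) {}"
  by (simp add: rat_def stj_def dstj_def)

lemma rat_add:
  assumes g: "rat g dg La w X" and g': "rat g' dg' La' w' X'"
  shows "\<exists>w''. rat (%z. g z + g' z) (%E. dg E + dg' E) (La \<union> La') w'' (X \<union> X')"
proof -
  define w'' where "w'' t = (if t \<in> La then w t else 0) + (if t \<in> La' then w' t else 0)" for t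
  have fin: "finite La" "finite La'" using g g' by (auto simp: rat_def)
  have s1: "(\<Sum>t\<in>La \<union> La'. f (w'' t) t) = (\<Sum>t\<in>La. f (w t) t) + (\<Sum>t\<in>La'. f (w' t) t)"
    if f: "\<And>x y t. f (x + y) t = f x t + f y t" "\<And>t. f 0 t = 0" for f :: "real => real => 'a::comm_monoid_add"
  proof -
    have "(\<Sum>t\<in>La \<union> La'. f (w'' t) t) = (\<Sum>t\<in>La \<union> La'. f (if t \<in> La then w t else 0) t) + (\<Sum>t\<in>La \<union> La'. f (if t \<in> La' then w' t else 0) t)"
      by (simp add: w''_def f(1) sum.distrib)
    also have "(\<Sum>t\<in>La \<union> La'. f (if t \<in> La then w t else 0) t) = (\<Sum>t\<in>La. f (w t) t)"
      by (rule sum.mono_neutral_cong_right) (use fin f(2) in auto)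
    also have "(\<Sum>t\<in>La \<union> La'. f (if t \<in> La' then w' t else 0) t) = (\<Sum>t\<in>La'. f (w' t) t)"
      by (rule sum.mono_neutral_cong_right) (use fin f(2) in auto)
    finally show ?thesis .
  qed
  have st: "stj (La \<union> La') w'' z = stj La w z + stj La' w' z" for z
    unfolding stj_def by (rule s1) (auto simp: add_divide_distrib)
  have dt: "dstj (La \<union> La') w'' z = dstj La w z + dstj La' w' z" for z
    unfolding dstj_def by (rule s1) (auto simp: add_divide_distrib)
  have pos: "0 < w'' t" if "t \<in> La \<union> La'" for t
    using that g g' by (auto simp: w''_def rat_def intro: add_pos_pos)
  have nz: "z \<notin> of_real ` X" "z \<notin> of_real ` X'" if "z \<notin> complex_of_real ` (X \<union> X')" for z
    using that by auto
  show ?thesis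
    by (rule exI[of _ w''], unfold rat_def, intro conjI)
      (use g g' pos st dt nz in \<open>auto simp: rat_def\<close>)
qed

lemma rat_sum:
  assumes "finite I" "\<And>i. i \<in> I ==> \<exists>La w X. rat (g i) (dg i) La w X \<and> card La \<le> m"
  shows "\<exists>La w X. rat (%z. \<Sum>i\<in>I. g i z) (%E. \<Sum>i\<in>I. dg i E) La w X \<and> card La \<le> card I * m"
  using assms
proof (induction I rule: finite_induct)
  case empty
  show ?case by (intro exI[of _ "{}"] exI[of _ "%_. 1"] conjI) (simp_all add: rat_zero)
next
  case (insert i I)
  obtain La w X where 1: "rat (%z. \<Sum>i\<in>I. g i z) (%E. \<Sum>i\<in>I. dg i E) La w X" "card La \<le> card I * m"
    using insert by auto
  obtain La' w' X' where 2: "rat (g i) (dg i) La' w' X'" "card La' \<le> m"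
    using insert.prems[of i] by blast
  obtain w'' where 3: "rat (%z. g i z + (\<Sum>i\<in>I. g i z)) (%E. dg i E + (\<Sum>i\<in>I. dg i E)) (La' \<union> La) w'' (X' \<union> X)"
    using rat_add[OF 2(1) 1(1)] by blast
  have "card (La' \<union> La) \<le> card (insert i I) * m"
    using card_Un_le[of La' La] 1(2) 2(2) insert.hyps by simp
  then show ?case using 3 insert.hyps by auto
qed

lemma rat_resolvent:
  assumes g: "rat g dg La w X"
  shows "\<exists>La' w' X'. rat (%z. inverse (of_real c - z - g z))
      (%E. (cmod (inverse (of_real c - of_real E - g (of_real E))))\<^sup>2 * (1 + dg E)) La' w' X' \<and>
    X \<subseteq> X' \<and> card La' = Suc (card La) \<and> (\<Sum>t\<in>La'. w' t) = 1 \<and>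
    (\<forall>z. z \<notin> of_real ` X' --> inverse (of_real c - z - g z) \<noteq> 0 \<and>
       norm (inverse (of_real c - z - g z)) = (\<Prod>t\<in>La. norm (of_real t - z)) / (\<Prod>t\<in>La'. norm (of_real t - z))) \<and>
    (\<forall>t\<in>La'. t \<notin> La \<and> w' t = 1 / (1 + dstj La w t))"
proof -
  have fin: "finite La" "finite X" and pos: "\<And>t. t \<in> La ==> 0 < w t"
    and gz: "\<And>z. z \<notin> of_real ` X ==> g z = stj La w z" and dgE: "\<And>E. E \<notin> X ==> dg E = dstj La w E"
    using g by (auto simp: rat_def)
  obtain La' w' where L: "finite La'" "card La' = Suc (card La)" "\<And>t. t \<in> La' ==> 0 < w' t" "(\<Sum>t\<in>La'. w' t) = 1"
    and z: "\<And>z. z \<notin> of_real ` (La \<union> La') ==> of_real c - z - stj La w z \<noteq> 0 \<and>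
       inverse (of_real c - z - stj La w z) = stj La' w' z \<and>
       norm (stj La' w' z) = (\<Prod>t\<in>La. norm (of_real t - z)) / (\<Prod>t\<in>La'. norm (of_real t - z))"
    and d: "\<And>E. E \<notin> La \<union> La' ==> dstj La' w' E = (cmod (stj La' w' (of_real E)))\<^sup>2 * (1 + dstj La w E)"
    and wt: "\<And>t. t \<in> La' ==> t \<notin> La \<and> w' t = 1 / (1 + dstj La w t)"
    using stj_resolvent[where La = La and w = w and c = c, OF fin(1) pos] by blast
  define X' where "X' = X \<union> La \<union> La'"
  have nX: "z \<notin> of_real ` X" "z \<notin> of_real ` (La \<union> La')" if "z \<notin> complex_of_real ` X'" for z
    using that by (auto simp: X'_def)
  have inv: "inverse (of_real c - z - g z) = stj La' w' z" if "z \<notin> complex_of_real ` X'" for z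
    using nX[OF that] gz z by simp
  have nz: "inverse (of_real c - z - g z) \<noteq> 0" if "z \<notin> complex_of_real ` X'" for z
    unfolding gz[OF nX(1)[OF that]]
    by (rule nonzero_imp_inverse_nonzero) (rule conjunct1[OF z[OF nX(2)[OF that]]])
  have dr: "(cmod (inverse (of_real c - of_real E - g (of_real E))))\<^sup>2 * (1 + dg E) = dstj La' w' E" if E: "E \<notin> X'" for E
  proof -
    have "complex_of_real E \<notin> of_real ` X'" using E by auto
    from inv[OF this] show ?thesis using d[of E] dgE[of E] E by (simp add: X'_def)
  qed
  show ?thesis
  proof (rule exI[of _ La'], rule exI[of _ w'], rule exI[of _ X'], intro conjI)
    show "rat (%z. inverse (of_real c - z - g z))
      (%E. (cmod (inverse (of_real c - of_real E - g (of_real E))))\<^sup>2 * (1 + dg E)) La' w' X'"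
      unfolding rat_def using L fin inv dr by (auto simp: X'_def)
    show "\<forall>z. z \<notin> of_real ` X' --> inverse (of_real c - z - g z) \<noteq> 0 \<and>
       norm (inverse (of_real c - z - g z)) = (\<Prod>t\<in>La. norm (of_real t - z)) / (\<Prod>t\<in>La'. norm (of_real t - z))"
    proof (intro allI impI)
      fix u assume u: "u \<notin> complex_of_real ` X'"
      show "inverse (of_real c - u - g u) \<noteq> 0 \<and>
        norm (inverse (of_real c - u - g u)) = (\<Prod>t\<in>La. norm (of_real t - u)) / (\<Prod>t\<in>La'. norm (of_real t - u))"
        using nz[OF u] z[OF nX(2)[OF u]] unfolding inv[OF u] by simp
    qed
  qed (use L wt in \<open>auto simp: X'_def\<close>)
qed

context canopy_model
begin

text \<open>Energy derivatives obtained by differentiating the recursion: the derivative of 1 / (v -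
  E - S) is its square times 1 + S'. Defined algebraically, they are jointly measurable and
  nonnegative at every energy, and \<open>rat_gam'\<close> shows them to be true derivatives off a
  finite set.\<close>

primrec dgam :: "(cvert => real) => real => nat => nat => real" where
  "dgam om E 0 = (%j. (gam om E 0 j)\<^sup>2)"
| "dgam om E (Suc n) = (%j. (gam om E (Suc n) j)\<^sup>2 * (1 + (\<Sum>i<K. dgam om E n (K * j + i))))"

definition dcs :: "(cvert => real) => real => nat => nat => real" where
  "dcs om E n j = (case n of 0 => 0 | Suc m => (\<Sum>i<K. dgam om E m (K * j + i)))"

definition dsib :: "(cvert => real) => real => nat => nat => real" where
  "dsib om E n j = (\<Sum>i\<in>{..<K} - {j mod K}. dgam om E n (K * (j div K) + i))"

primrec dup :: "(cvert => real) => real => nat => nat => nat => real" where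
  "dup om E 0 = (%n j. 0)"
| "dup om E (Suc d) = (%n j. (up om E (Suc d) n j)\<^sup>2 * (1 + (dsib om E n j + dup om E d (Suc n) (j div K))))"

text \<open>The energy derivative of minus the inverse of gF; it does not involve the potential at (n, j), and at an atom it is the inverse of the mass.\<close>

definition dh :: "(cvert => real) => real => nat => nat => nat => real" where
  "dh om E d n j = 1 + (dcs om E n j + dup om E d n j)"

definition bo :: "nat => real" where "bo n = (if n = 0 then b else 0)"

text \<open>The constant \<open>- b\<close> hidden in \<open>cs\<close> is not a Borel transform, so
  the boundary term is moved into the site potential by \<open>bo\<close>.\<close>

definition cs' :: "(cvert => real) => complex => nat => nat => complex" where
  "cs' om z n j = (case n of 0 => 0 | Suc m => (\<Sum>i<K. gam om z m (K * j + i)))"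

lemma cs_cs': "cs om z n j = cs' om z n j - of_real (bo n)"
  by (cases n) (auto simp: cs_def cs'_def bo_def)

lemma gam_eq': "gam om z n j = inverse (of_real (om (n, j) + bo n) - z - cs' om z n j)"
  by (simp add: gam_eq cs_cs' algebra_simps)

lemma gF_eq': "gF om z d n j = inverse (of_real (om (n, j) + bo n) - z - (cs' om z n j + up om z d n j))"
  by (simp add: gF_def cs_cs' algebra_simps)

lemma dgam_eq: "dgam om E n j = (gam om E n j)\<^sup>2 * (1 + dcs om E n j)"
  by (cases n) (auto simp: dcs_def)

lemma cmod_gam: "cmod (gam om (of_real E) n j) = \<bar>gam om E n j\<bar>"
  by (simp add: of_real_gam)

lemma dgam_nonneg: "0 \<le> dgam om E n j"
  by (induction n arbitrary: j) (auto intro!: mult_nonneg_nonneg add_nonneg_nonneg sum_nonneg)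


lemma dsib_nonneg: "0 \<le> dsib om E n j"
  by (auto simp: dsib_def intro!: sum_nonneg dgam_nonneg)


lemma dcs_parent: "dcs om E (Suc n) (j div K) = dgam om E n j + dsib om E n j"
proof -
  have "(\<Sum>i<K. dgam om E n (K * (j div K) + i)) =
      dgam om E n (K * (j div K) + j mod K) + (\<Sum>i\<in>{..<K} - {j mod K}. dgam om E n (K * (j div K) + i))"
    by (rule sum.remove) auto
  then show ?thesis by (simp add: dcs_def dsib_def)
qed

lemma dgam_measurable [measurable (raw)]:
  assumes [measurable]: "f \<in> measurable N Q" "g \<in> borel_measurable N"
  shows "(%x. dgam (f x) (g x) n j) \<in> borel_measurable N"
proof (induction n arbitrary: j)
  case 0
  show ?case by simp
next
  case (Suc n)
  note Suc[measurable]
  show ?case unfolding dgam.simps by measurable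
qed

lemma dcs_measurable [measurable (raw)]:
  assumes [measurable]: "f \<in> measurable N Q" "g \<in> borel_measurable N"
  shows "(%x. dcs (f x) (g x) n j) \<in> borel_measurable N"
  by (cases n) (auto simp: dcs_def)

lemma dsib_measurable [measurable (raw)]:
  assumes [measurable]: "f \<in> measurable N Q" "g \<in> borel_measurable N"
  shows "(%x. dsib (f x) (g x) n j) \<in> borel_measurable N"
  by (auto simp: dsib_def)

lemma dup_measurable [measurable (raw)]:
  assumes [measurable]: "f \<in> measurable N Q" "g \<in> borel_measurable N"
  shows "(%x. dup (f x) (g x) d n j) \<in> borel_measurable N"
proof (induction d arbitrary: n j)
  case 0
  show ?case by simp
next
  case (Suc n)
  note Suc[measurable]
  show ?case unfolding dup.simps by measurable
qed

lemma dh_measurable [measurable (raw)]: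
  assumes [measurable]: "f \<in> measurable N Q" "g \<in> borel_measurable N"
  shows "(%x. dh (f x) (g x) d n j) \<in> borel_measurable N"
  by (auto simp: dh_def)

text \<open>Three facts are carried through one induction. The number of atoms is below K^(n+1),
  since each inversion adds one and each layer multiplies by K. The total mass is 1. The modulus is
  a quotient of products over real points, which is the form in which the Poisson formula applies to
  its logarithm.\<close>

lemma rat_gam':
  "\<exists>La w X. rat (%z. gam om z n j) (%E. dgam om E n j) La w X \<and> Suc (card La) \<le> K ^ Suc n \<and> (\<Sum>t\<in>La. w t) = 1 \<and>
    (\<exists>La0 \<subseteq> X. \<forall>z::complex. z \<notin> of_real ` X --> gam om z n j \<noteq> 0 \<and>
       norm (gam om z n j) = (\<Prod>t\<in>La0. norm (of_real t - z)) / (\<Prod>t\<in>La. norm (of_real t - z)))" (is "?P n j")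
  and rat_cs': "\<exists>La w X. rat (%z. cs' om z n j) (%E. dcs om E n j) La w X \<and> Suc (Suc (card La)) \<le> K ^ Suc n" (is "?C n j")
proof -
  have step: "?P n j" if C: "?C n j" for n j
  proof -
    obtain La w X where r: "rat (%z. cs' om z n j) (%E. dcs om E n j) La w X" and c: "Suc (Suc (card La)) \<le> K ^ Suc n"
      using C by blast
    obtain La' w' X' where R: "rat (%z. inverse (of_real (om (n, j) + bo n) - z - cs' om z n j))
       (%E. (cmod (inverse (of_real (om (n, j) + bo n) - of_real E - cs' om (of_real E) n j)))\<^sup>2 * (1 + dcs om E n j)) La' w' X'"
       "X \<subseteq> X'" "card La' = Suc (card La)" "(\<Sum>t\<in>La'. w' t) = 1"
       "\<forall>z. z \<notin> of_real ` X' --> inverse (of_real (om (n, j) + bo n) - z - cs' om z n j) \<noteq> 0 \<and>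
       norm (inverse (of_real (om (n, j) + bo n) - z - cs' om z n j)) = (\<Prod>t\<in>La. norm (of_real t - z)) / (\<Prod>t\<in>La'. norm (of_real t - z))"
      using rat_resolvent[OF r, of "om (n, j) + bo n"] by blast
    have "rat (%z. gam om z n j) (%E. dgam om E n j) La' w' X'"
      using R(1) unfolding gam_eq'[symmetric] by (simp add: cmod_gam dgam_eq)
    moreover have "La \<subseteq> X'" using r R(2) by (auto simp: rat_def)
    moreover have "Suc (card La') \<le> K ^ Suc n" using R(3) c by simp
    ultimately show ?thesis using R(4,5) unfolding gam_eq'[symmetric] by blast
  qed
  have CP: "?C n j" for j
  proof (induction n arbitrary: j)
    case 0
    have "rat (%z. cs' om z 0 j) (%E. dcs om E 0 j) {} (%_. 1) {}"
      using rat_zero by (simp add: cs'_def dcs_def)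
    then show ?case using K2 by (intro exI[of _ "{}"] exI[of _ "%_. 1"] conjI) auto
  next
    case (Suc n)
    let ?m = "K ^ Suc n - 1"
    have "\<exists>La w X. rat (%z. \<Sum>i<K. gam om z n (K * j + i)) (%E. \<Sum>i<K. dgam om E n (K * j + i)) La w X \<and> card La \<le> card {..<K} * ?m"
    proof (rule rat_sum)
      fix i
      obtain La w X where "rat (%z. gam om z n (K * j + i)) (%E. dgam om E n (K * j + i)) La w X" "Suc (card La) \<le> K ^ Suc n"
        using step[OF Suc.IH, of "K * j + i"] by blast
      then show "\<exists>La w X. rat (%z. gam om z n (K * j + i)) (%E. dgam om E n (K * j + i)) La w X \<and> card La \<le> ?m"
        by (intro exI[of _ La] exI[of _ w] exI[of _ X]) auto
    qed simp
    then obtain La w X where 1: "rat (%z. \<Sum>i<K. gam om z n (K * j + i)) (%E. \<Sum>i<K. dgam om E n (K * j + i)) La w X"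
      and 2: "card La \<le> K * ?m" by auto
    \<comment> \<open>K (K^(n+1) - 1) + 2 is at most K^(n+2) because K is at least 2; the spare unit
      pays for the atom created by the next inversion.\<close>
    have "1 \<le> K ^ Suc n" using K2 by (intro one_le_power) simp
    then have 3: "K * 1 \<le> K * K ^ Suc n" by (rule mult_le_mono2)
    have 4: "card La \<le> K * K ^ Suc n - K * 1" using 2 by (simp only: diff_mult_distrib2)
    have "Suc (Suc (card La)) \<le> K * K ^ Suc n" using 3 4 K2 by linarith
    then have "Suc (Suc (card La)) \<le> K ^ Suc (Suc n)" by (simp only: power_Suc)
    then show ?case using 1 by (auto simp: cs'_def dcs_def)
  qed
  show "?C n j" by (rule CP)
  show "?P n j" by (rule step[OF CP])
qed

lemma rat_sib: "\<exists>La w X. rat (%z. sib om z n j) (%E. dsib om E n j) La w X"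
proof -
  have "\<exists>La w X. rat (%z. \<Sum>i\<in>{..<K} - {j mod K}. gam om z n (K * (j div K) + i))
     (%E. \<Sum>i\<in>{..<K} - {j mod K}. dgam om E n (K * (j div K) + i)) La w X \<and> card La \<le> card ({..<K} - {j mod K}) * K ^ Suc n"
  proof (rule rat_sum)
    fix i
    obtain La w X where "rat (%z. gam om z n (K * (j div K) + i)) (%E. dgam om E n (K * (j div K) + i)) La w X" "Suc (card La) \<le> K ^ Suc n"
      using rat_gam'[of om n "K * (j div K) + i"] by blast
    then show "\<exists>La w X. rat (%z. gam om z n (K * (j div K) + i)) (%E. dgam om E n (K * (j div K) + i)) La w X \<and> card La \<le> K ^ Suc n"
      by (intro exI[of _ La] exI[of _ w] exI[of _ X]) auto
  qed simp
  then show ?thesis by (auto simp: sib_def dsib_def)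
qed

lemma rat_up: "\<exists>La w X. rat (%z. up om z d n j) (%E. dup om E d n j) La w X \<and>
   (0 < d --> (\<forall>z::complex. z \<notin> of_real ` X --> up om z d n j \<noteq> 0))"
proof (induction d arbitrary: n j)
  case 0
  have "rat (%z. up om z 0 n j) (%E. dup om E 0 n j) {} (%_. 1) {}"
    using rat_zero by simp
  then show ?case by (intro exI[of _ "{}"] exI[of _ "%_. 1"] conjI) auto
next
  case (Suc d)
  obtain La1 w1 X1 where 1: "rat (%z. sib om z n j) (%E. dsib om E n j) La1 w1 X1" using rat_sib by blast
  obtain La2 w2 X2 where 2: "rat (%z. up om z d (Suc n) (j div K)) (%E. dup om E d (Suc n) (j div K)) La2 w2 X2"
    using Suc.IH by blast
  obtain w3 where 3: "rat (%z. sib om z n j + up om z d (Suc n) (j div K)) (%E. dsib om E n j + dup om E d (Suc n) (j div K)) (La1 \<union> La2) w3 (X1 \<union> X2)"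
    using rat_add[OF 1 2] by blast
  obtain La w X where 4: "rat (%z. inverse (of_real (om (Suc n, j div K)) - z - (sib om z n j + up om z d (Suc n) (j div K))))
      (%E. (cmod (inverse (of_real (om (Suc n, j div K)) - of_real E - (sib om (of_real E) n j + up om (of_real E) d (Suc n) (j div K)))))\<^sup>2 *
         (1 + (dsib om E n j + dup om E d (Suc n) (j div K)))) La w X"
    "\<forall>z::complex. z \<notin> of_real ` X --> inverse (of_real (om (Suc n, j div K)) - z - (sib om z n j + up om z d (Suc n) (j div K))) \<noteq> 0"
    using rat_resolvent[OF 3, of "om (Suc n, j div K)"] by blast
  have e: "cmod (inverse (of_real (om (Suc n, j div K)) - of_real E - (sib om (of_real E) n j + up om (of_real E) d (Suc n) (j div K))))
     = \<bar>up om E (Suc d) n j\<bar>" for E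
  proof -
    have "inverse (of_real (om (Suc n, j div K)) - of_real E - (sib om (of_real E) n j + up om (of_real E) d (Suc n) (j div K)))
      = up om (complex_of_real E) (Suc d) n j" by simp
    also have "... = of_real (up om E (Suc d) n j)" by (rule of_real_up)
    finally show ?thesis by (simp only: norm_of_real)
  qed
  have "rat (%z. up om z (Suc d) n j) (%E. dup om E (Suc d) n j) La w X"
    using 4(1) unfolding e by (simp only: up.simps dup.simps power2_abs)
  then show ?case using 4(2) unfolding up.simps by blast
qed

text \<open>Two measures are kept: La with w stands for the self-energy, whose derivative gives
  \<open>dh\<close>, and La' with w' for the Green function itself. The masses w' are tied to the
  transform over La and not to \<open>dh\<close> directly, because the atoms belong to the
  exceptional set X', where \<open>dh\<close> is not known to agree with it.\<close>

lemma rat_gF: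
  "\<exists>La w La' w' X'. rat (%z. gF om z d n j) (%E. (gF om E d n j)\<^sup>2 * dh om E d n j) La' w' X' \<and>
    (\<Sum>t\<in>La'. w' t) = 1 \<and> finite La \<and> (\<forall>t\<in>La. 0 < w t) \<and> (\<forall>t\<in>La'. t \<notin> La \<and> w' t = 1 / (1 + dstj La w t)) \<and>
    (\<forall>E. E \<notin> X' --> dh om E d n j = 1 + dstj La w E) \<and> (\<forall>z::complex. z \<notin> of_real ` X' --> gF om z d n j \<noteq> 0)"
proof -
  obtain La1 w1 X1 where 1: "rat (%z. cs' om z n j) (%E. dcs om E n j) La1 w1 X1" using rat_cs' by blast
  obtain La2 w2 X2 where 2: "rat (%z. up om z d n j) (%E. dup om E d n j) La2 w2 X2"
    using rat_up by blast
  obtain w where 3: "rat (%z. cs' om z n j + up om z d n j) (%E. dcs om E n j + dup om E d n j) (La1 \<union> La2) w (X1 \<union> X2)"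
    using rat_add[OF 1 2] by blast
  let ?c = "om (n, j) + bo n"
  obtain La' w' X' where 4: "rat (%z. inverse (of_real ?c - z - (cs' om z n j + up om z d n j)))
      (%E. (cmod (inverse (of_real ?c - of_real E - (cs' om (of_real E) n j + up om (of_real E) d n j))))\<^sup>2 *
         (1 + (dcs om E n j + dup om E d n j))) La' w' X'" "X1 \<union> X2 \<subseteq> X'" "(\<Sum>t\<in>La'. w' t) = 1"
    "\<forall>z. z \<notin> of_real ` X' --> inverse (of_real ?c - z - (cs' om z n j + up om z d n j)) \<noteq> 0"
    "\<forall>t\<in>La'. t \<notin> La1 \<union> La2 \<and> w' t = 1 / (1 + dstj (La1 \<union> La2) w t)"
    using rat_resolvent[OF 3, of ?c] by blast
  have "rat (%z. gF om z d n j) (%E. (gF om E d n j)\<^sup>2 * dh om E d n j) La' w' X'"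
    using 4(1) unfolding gF_eq'[symmetric] by (simp add: of_real_gF dh_def)
  moreover have "dh om E d n j = 1 + dstj (La1 \<union> La2) w E" if "E \<notin> X'" for E
    using 3 4(2) that by (auto simp: dh_def rat_def)
  moreover have "finite (La1 \<union> La2)" "\<forall>t\<in>La1 \<union> La2. 0 < w t" using 3 by (auto simp: rat_def)
  moreover have "\<forall>z::complex. z \<notin> of_real ` X' --> gF om z d n j \<noteq> 0"
    using 4(4) unfolding gF_eq'[symmetric] .
  ultimately show ?thesis using 4(3,5) by blast
qed

text \<open>Off finitely many real points, ln |gam| is a difference of finite sums of ln |t - z|
  with real t, and \<open>cauchy_ln\<close> averages each term. There is no correction from zeros
  inside the half plane, since they are all real.\<close>

lemma poisson_lng:
  assumes e: "0 < e"
  shows "integrable cauchy (%u. lng om (of_real (E + e * u)) n j)"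
    "(\<integral>u. lng om (of_real (E + e * u)) n j \<partial>cauchy) = lng om (Complex E e) n j"
proof -
  obtain La w X La0 where r: "rat (%z. gam om z n j) (%E. dgam om E n j) La w X" and sub: "La0 \<subseteq> X"
    and pr': "\<forall>z::complex. z \<notin> of_real ` X --> gam om z n j \<noteq> 0 \<and>
       norm (gam om z n j) = (\<Prod>t\<in>La0. norm (of_real t - z)) / (\<Prod>t\<in>La. norm (of_real t - z))"
    using rat_gam'[of om n j] by (elim exE conjE) (rule that)
  have pr: "norm (gam om z n j) = (\<Prod>t\<in>La0. norm (of_real t - z)) / (\<Prod>t\<in>La. norm (of_real t - z))"
    if "z \<notin> of_real ` X" for z :: complex using pr'[rule_format, OF that] by (rule conjunct2)
  have fX: "finite X" "La \<subseteq> X" using r by (auto simp: rat_def)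
  have fin: "finite La0" "finite La" using fX sub by (auto intro: finite_subset)
  have eq: "lng om z n j = (\<Sum>t\<in>La0. ln (norm (of_real t - z))) - (\<Sum>t\<in>La. ln (norm (of_real t - z)))"
    if z: "z \<notin> of_real ` X" for z
  proof -
    have nz: "norm (of_real t - z) > 0" if "t \<in> X" for t using z that by auto
    have "ln ((\<Prod>t\<in>La0. norm (of_real t - z)) / (\<Prod>t\<in>La. norm (of_real t - z)))
      = ln (\<Prod>t\<in>La0. norm (of_real t - z)) - ln (\<Prod>t\<in>La. norm (of_real t - z))"
      using nz sub fX by (intro ln_divide_pos prod_pos) auto
    also have "... = (\<Sum>t\<in>La0. ln (norm (of_real t - z))) - (\<Sum>t\<in>La. ln (norm (of_real t - z)))"
      using nz sub fX fin by (subst (1 2) ln_prod) auto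
    finally show ?thesis by (simp only: lng_def pr[OF z])
  qed
  let ?f = "%t u. ln (norm (of_real t - of_real (E + e * u) :: complex))"
  have ae: "AE u in cauchy. (\<Sum>t\<in>La0. ?f t u) - (\<Sum>t\<in>La. ?f t u) = lng om (of_real (E + e * u)) n j"
    using AE_cauchy_finite[OF finite_imageI[OF fX(1)], of "%x. (x - E) / e"]
  proof eventually_elim
    case (elim u)
    have "complex_of_real (E + e * u) \<notin> of_real ` X"
    proof
      assume "complex_of_real (E + e * u) \<in> of_real ` X"
      then obtain x where "x \<in> X" "E + e * u = x" by (metis imageE of_real_eq_iff)
      then have "u = (x - E) / e" using e by (auto simp: field_simps)
      with elim \<open>x \<in> X\<close> show False by blast
    qed
    from eq[OF this] show ?case by simp
  qed
  have ig: "integrable cauchy (%u. (\<Sum>t\<in>La0. ?f t u) - (\<Sum>t\<in>La. ?f t u))"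
    by (intro Bochner_Integration.integrable_diff Bochner_Integration.integrable_sum cauchy_ln[OF e])
  have mf: "(%u. lng om (of_real (E + e * u)) n j) \<in> borel_measurable cauchy"
    by (rule lng_measurable) (auto simp: line_measurable simp del: of_real_add of_real_mult)
  show "integrable cauchy (%u. lng om (of_real (E + e * u)) n j)"
    by (rule integrable_cong_AE_imp[OF ig mf]) (use ae in eventually_elim, simp)
  have "(\<integral>u. lng om (of_real (E + e * u)) n j \<partial>cauchy) = (\<integral>u. (\<Sum>t\<in>La0. ?f t u) - (\<Sum>t\<in>La. ?f t u) \<partial>cauchy)"
  proof (rule integral_cong_AE[OF mf borel_measurable_integrable[OF ig]])
    show "AE u in cauchy. lng om (of_real (E + e * u)) n j = (\<Sum>t\<in>La0. ?f t u) - (\<Sum>t\<in>La. ?f t u)"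
      using ae by eventually_elim (rule sym)
  qed
  also have "... = (\<Sum>t\<in>La0. \<integral>u. ?f t u \<partial>cauchy) - (\<Sum>t\<in>La. \<integral>u. ?f t u \<partial>cauchy)"
  proof -
    have int_sum: "integrable cauchy (%u. \<Sum>t\<in>L. ?f t u)" "(\<integral>u. (\<Sum>t\<in>L. ?f t u) \<partial>cauchy) = (\<Sum>t\<in>L. \<integral>u. ?f t u \<partial>cauchy)" for L
      by (rule Bochner_Integration.integrable_sum[OF cauchy_ln(1)[OF e]], rule Bochner_Integration.integral_sum[OF cauchy_ln(1)[OF e]])
    show ?thesis
      by (simp only: Bochner_Integration.integral_diff[OF int_sum(1) int_sum(1)] int_sum(2))
  qed
  also have "... = (\<Sum>t\<in>La0. ln (norm (of_real t - Complex E e))) - (\<Sum>t\<in>La. ln (norm (of_real t - Complex E e)))"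
    by (simp only: cauchy_ln(2)[OF e])
  also have "... = lng om (Complex E e) n j"
  proof -
    have "Complex E e \<notin> of_real ` X" using e by (auto simp: complex_eq_iff)
    then show ?thesis by (simp add: eq)
  qed
  finally show "(\<integral>u. lng om (of_real (E + e * u)) n j \<partial>cauchy) = lng om (Complex E e) n j" .
qed

end

section \<open>The Efron-Stein inequality by resampling\<close>

lemma ennreal_add_le: "ennreal (a + b) \<le> ennreal a + ennreal b"
proof -
  consider "0 \<le> a" "0 \<le> b" | "a < 0" | "b < 0" by linarith
  then show ?thesis
  proof cases
    case 1
    then show ?thesis by simp
  next
    case 2
    then show ?thesis by (simp add: ennreal_neg ennreal_leI)
  next
    case 3
    then show ?thesis by (simp add: ennreal_neg ennreal_leI)
  qed
qed

text \<open>The variance is nonnegative. The form with an extended right-hand side holds for every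
  measurable u: a non-integrable u has integral 0 by convention, and a non-integrable square makes
  the right-hand side infinite.\<close>

lemma (in prob_space) sq_integral_le:
  fixes u :: "'a => real"
  assumes [measurable]: "u \<in> borel_measurable M"
  shows "ennreal ((\<integral>x. u x \<partial>M)\<^sup>2) \<le> (\<integral>\<^sup>+x. ennreal ((u x)\<^sup>2) \<partial>M)"
proof (cases "integrable M u \<and> integrable M (%x. (u x)\<^sup>2)")
  case True
  then have i: "integrable M u" "integrable M (%x. (u x)\<^sup>2)" by auto
  define c where "c = (\<integral>x. u x \<partial>M)"
  have "0 \<le> (\<integral>x. (u x - c)\<^sup>2 \<partial>M)" by simp
  also have "... = (\<integral>x. (u x)\<^sup>2 - 2 * c * u x + c\<^sup>2 \<partial>M)"
    by (intro Bochner_Integration.integral_cong) (auto simp: power2_eq_square algebra_simps)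
  also have "... = (\<integral>x. (u x)\<^sup>2 \<partial>M) - 2 * c * c + c\<^sup>2"
    using i by (simp add: c_def prob_space)
  finally have "c\<^sup>2 \<le> (\<integral>x. (u x)\<^sup>2 \<partial>M)" by (simp add: power2_eq_square)
  then have "ennreal (c\<^sup>2) \<le> ennreal (\<integral>x. (u x)\<^sup>2 \<partial>M)" by (rule ennreal_leI)
  also have "... = (\<integral>\<^sup>+x. ennreal ((u x)\<^sup>2) \<partial>M)"
    using i(2) by (intro nn_integral_eq_integral[symmetric]) auto
  finally show ?thesis by (simp add: c_def)
next
  case False
  show ?thesis
  proof (cases "integrable M u")
    case True
    then have "\<not> integrable M (%x. (u x)\<^sup>2)" using False by simp
    then have "(\<integral>\<^sup>+x. ennreal ((u x)\<^sup>2) \<partial>M) = \<infinity>"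
      by (subst (asm) integrable_iff_bounded) (auto simp: less_top[symmetric])
    then show ?thesis by simp
  qed (simp add: not_integrable_integral_eq)
qed

context canopy_model
begin


text \<open>The conditional expectation given the sites outside J.\<close>

definition EJ :: "cvert set => ((cvert => real) => real) => (cvert => real) => real" where
  "EJ J f om = (\<integral>om'. f (mrg J om om') \<partial>Q)"

text \<open>For square integrable f this is twice the mean conditional variance of f given the sites
  outside J.\<close>

definition DJ :: "cvert set => ((cvert => real) => real) => ennreal" where
  "DJ J f = (\<integral>\<^sup>+om. \<integral>\<^sup>+om'. ennreal ((f om - f (mrg J om om'))\<^sup>2) \<partial>Q \<partial>Q)"

lemma mrg_meas2 [measurable (raw)]:
  assumes [measurable]: "f \<in> measurable N Q" "g \<in> measurable N Q"
  shows "(%x. mrg J (f x) (g x)) \<in> measurable N Q"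
proof -
  have "(%x. (f x, g x)) \<in> measurable N (Q \<Otimes>\<^sub>M Q)" by measurable
  from measurable_compose[OF this mrg_measurable] show ?thesis by simp
qed

lemma EJ_measurable [measurable]:
  assumes [measurable]: "f \<in> borel_measurable Q"
  shows "EJ J f \<in> borel_measurable Q"
proof -
  have "(%p. f (mrg J (fst p) (snd p))) \<in> borel_measurable (Q \<Otimes>\<^sub>M Q)" by measurable
  then have "(%(om, om'). f (mrg J om om')) \<in> borel_measurable (Q \<Otimes>\<^sub>M Q)" by (simp add: case_prod_beta')
  then show ?thesis unfolding EJ_def[abs_def] by (rule Q.borel_measurable_lebesgue_integral)
qed

lemma integrable_mrg:
  fixes f :: "(cvert => real) => real"
  assumes f: "integrable Q f"
  shows "integrable (Q \<Otimes>\<^sub>M Q) (%p. f (mrg J (fst p) (snd p)))"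
    "(\<integral>p. f (mrg J (fst p) (snd p)) \<partial>(Q \<Otimes>\<^sub>M Q)) = (\<integral>om. f om \<partial>Q)"
proof -
  have [measurable]: "f \<in> borel_measurable Q" using f by simp
  have "integrable (distr (Q \<Otimes>\<^sub>M Q) Q (%p. mrg J (fst p) (snd p))) f" using f by (simp add: distr_mrg)
  then show "integrable (Q \<Otimes>\<^sub>M Q) (%p. f (mrg J (fst p) (snd p)))"
    by (subst (asm) integrable_distr_eq) auto
  have "(\<integral>om. f om \<partial>Q) = (\<integral>om. f om \<partial>distr (Q \<Otimes>\<^sub>M Q) Q (%p. mrg J (fst p) (snd p)))"
    by (simp add: distr_mrg)
  also have "... = (\<integral>p. f (mrg J (fst p) (snd p)) \<partial>(Q \<Otimes>\<^sub>M Q))"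
    by (rule integral_distr) auto
  finally show "(\<integral>p. f (mrg J (fst p) (snd p)) \<partial>(Q \<Otimes>\<^sub>M Q)) = (\<integral>om. f om \<partial>Q)" by simp
qed

lemma EJ_facts:
  assumes f: "integrable Q f"
  shows "integrable Q (EJ J f)" "(\<integral>om. EJ J f om \<partial>Q) = (\<integral>om. f om \<partial>Q)"
    "AE om in Q. integrable Q (%om'. f (mrg J om om'))"
proof -
  have i: "integrable (Q \<Otimes>\<^sub>M Q) (%(om, om'). f (mrg J om om'))"
    using integrable_mrg(1)[OF f, of J] by (simp add: case_prod_beta')
  show "integrable Q (EJ J f)" unfolding EJ_def[abs_def] using QQ.integrable_fst[OF i] by simp
  show "(\<integral>om. EJ J f om \<partial>Q) = (\<integral>om. f om \<partial>Q)"
    unfolding EJ_def[abs_def] using QQ.integral_fst[OF i] integrable_mrg(2)[OF f, of J] by (simp add: case_prod_beta')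
  show "AE om in Q. integrable Q (%om'. f (mrg J om om'))"
    using QQ.AE_integrable_fst[OF i] by simp
qed

lemma EJ_sq:
  assumes [measurable]: "f \<in> borel_measurable Q" and f2: "integrable Q (%om. (f om)\<^sup>2)"
  shows "integrable Q (%om. (EJ J f om)\<^sup>2)"
proof (rule integrableI_nonneg)
  have "(\<integral>\<^sup>+om. ennreal ((EJ J f om)\<^sup>2) \<partial>Q) \<le> (\<integral>\<^sup>+om. \<integral>\<^sup>+om'. ennreal ((f (mrg J om om'))\<^sup>2) \<partial>Q \<partial>Q)"
    unfolding EJ_def by (intro nn_integral_mono Q.sq_integral_le) measurable
  also have "... = (\<integral>\<^sup>+om. ennreal ((f om)\<^sup>2) \<partial>Q)"
    by (rule nn_resample[symmetric]) measurable
  also have "... < \<infinity>" using f2 by (simp add: integrable_iff_bounded)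
  finally show "(\<integral>\<^sup>+om. ennreal ((EJ J f om)\<^sup>2) \<partial>Q) < \<infinity>" .
qed auto

lemma EJ_const:
  assumes "\<And>v. v \<notin> J ==> om v = om' v"
  shows "EJ J f om = EJ J f om'"
proof -
  have "mrg J om om'' = mrg J om' om''" for om'' using assms by (auto simp: mrg_def fun_eq_iff)
  then show ?thesis by (simp add: EJ_def)
qed

lemma sq_prod_integrable:
  fixes f g :: "'x => real"
  assumes [measurable]: "f \<in> borel_measurable N" "g \<in> borel_measurable N"
    and "integrable N (%x. (f x)\<^sup>2)" "integrable N (%x. (g x)\<^sup>2)"
  shows "integrable N (%x. f x * g x)"
proof (rule Bochner_Integration.integrable_bound)
  show "integrable N (%x. (f x)\<^sup>2 + (g x)\<^sup>2)" using assms by auto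
  have "\<bar>x * y\<bar> \<le> x\<^sup>2 + y\<^sup>2" for x y :: real
  proof -
    have "2 * (\<bar>x\<bar> * \<bar>y\<bar>) \<le> x\<^sup>2 + y\<^sup>2"
      using sum_squares_bound[of "\<bar>x\<bar>" "\<bar>y\<bar>"] by (simp add: mult.assoc)
    moreover have "0 \<le> \<bar>x\<bar> * \<bar>y\<bar>" by simp
    ultimately show ?thesis unfolding abs_mult by linarith
  qed
  then show "AE x in N. norm (f x * g x) \<le> norm ((f x)\<^sup>2 + (g x)\<^sup>2)" by (intro AE_I2) simp
qed measurable

text \<open>Expand the square. Both squared terms have the mean of f^2 because resampling preserves
  the law, and in the mixed term f may be replaced by its conditional expectation.\<close>

lemma DJ_eq:
  assumes [measurable]: "f \<in> borel_measurable Q" and f2: "integrable Q (%om. (f om)\<^sup>2)"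
  shows "DJ J f = ennreal (2 * ((\<integral>om. (f om)\<^sup>2 \<partial>Q) - (\<integral>om. (EJ J f om)\<^sup>2 \<partial>Q)))"
proof -
  let ?h = "EJ J f" and ?PP = "Q \<Otimes>\<^sub>M Q" and ?m = "%p. mrg J (fst p) (snd p)"
  have f1: "integrable Q f" by (rule integrable_of_sq[OF Q.finite_measure_axioms _ f2]) simp
  have h2: "integrable Q (%om. (?h om)\<^sup>2)" by (rule EJ_sq[OF _ f2]) simp
  have i1: "integrable ?PP (%p. (f (fst p))\<^sup>2)" and e1: "(\<integral>p. (f (fst p))\<^sup>2 \<partial>?PP) = (\<integral>om. (f om)\<^sup>2 \<partial>Q)"
    using integrable_mrg[OF f2, of "{}"] by (simp_all add: mrg_def)
  have i2: "integrable ?PP (%p. (f (?m p))\<^sup>2)" and e2: "(\<integral>p. (f (?m p))\<^sup>2 \<partial>?PP) = (\<integral>om. (f om)\<^sup>2 \<partial>Q)"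
    using integrable_mrg[OF f2, of J] by auto
  have i3: "integrable ?PP (%p. f (fst p) * f (?m p))"
    by (rule sq_prod_integrable) (use i1 i2 in auto)
  have fh: "integrable Q (%om. f om * ?h om)"
    by (rule sq_prod_integrable) (use f2 h2 in auto)
  have e3: "(\<integral>p. f (fst p) * f (?m p) \<partial>?PP) = (\<integral>om. f om * ?h om \<partial>Q)"
  proof -
    have "(\<integral>p. f (fst p) * f (?m p) \<partial>?PP) = (\<integral>om. \<integral>om'. f om * f (mrg J om om') \<partial>Q \<partial>Q)"
      using QQ.integral_fst[of "%om om'. f om * f (mrg J om om')"] i3 by (simp add: case_prod_beta')
    then show ?thesis by (simp add: EJ_def)
  qed
  have e4: "(\<integral>om. f om * ?h om \<partial>Q) = (\<integral>om. (?h om)\<^sup>2 \<partial>Q)"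
  proof -
    have hm: "?h (mrg J om om') = ?h om" for om om' by (rule EJ_const) (simp add: mrg_def)
    have i: "integrable ?PP (%p. f (?m p) * ?h (?m p))" using integrable_mrg(1)[OF fh, of J] .
    have "(\<integral>om. f om * ?h om \<partial>Q) = (\<integral>p. f (?m p) * ?h (?m p) \<partial>?PP)" using integrable_mrg(2)[OF fh, of J] by simp
    also have "... = (\<integral>om. \<integral>om'. f (mrg J om om') * ?h om \<partial>Q \<partial>Q)"
      using QQ.integral_fst[of "%om om'. f (mrg J om om') * ?h (mrg J om om')"] i by (simp add: case_prod_beta' hm)
    finally show ?thesis by (simp add: EJ_def power2_eq_square)
  qed
  have "DJ J f = (\<integral>\<^sup>+p. ennreal ((f (fst p) - f (?m p))\<^sup>2) \<partial>?PP)"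
    unfolding DJ_def by (subst Q.nn_integral_fst[symmetric]) auto
  also have "... = (\<integral>\<^sup>+p. ennreal ((f (fst p))\<^sup>2 - 2 * (f (fst p) * f (?m p)) + (f (?m p))\<^sup>2) \<partial>?PP)"
    by (intro nn_integral_cong arg_cong[of _ _ ennreal]) (simp add: power2_eq_square algebra_simps)
  also have "... = ennreal (\<integral>p. (f (fst p))\<^sup>2 - 2 * (f (fst p) * f (?m p)) + (f (?m p))\<^sup>2 \<partial>?PP)"
  proof (rule nn_integral_eq_integral)
    show "integrable ?PP (%p. (f (fst p))\<^sup>2 - 2 * (f (fst p) * f (?m p)) + (f (?m p))\<^sup>2)"
      using i1 i2 i3 by auto
    have "(f (fst p))\<^sup>2 - 2 * (f (fst p) * f (?m p)) + (f (?m p))\<^sup>2 = (f (fst p) - f (?m p))\<^sup>2" for p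
      by (simp add: power2_eq_square algebra_simps)
    then show "AE p in ?PP. 0 \<le> (f (fst p))\<^sup>2 - 2 * (f (fst p) * f (?m p)) + (f (?m p))\<^sup>2" by simp
  qed
  also have "(\<integral>p. (f (fst p))\<^sup>2 - 2 * (f (fst p) * f (?m p)) + (f (?m p))\<^sup>2 \<partial>?PP)
     = 2 * ((\<integral>om. (f om)\<^sup>2 \<partial>Q) - (\<integral>om. (?h om)\<^sup>2 \<partial>Q))"
    using i1 i2 i3 by (simp add: e1 e2 e3 e4)
  finally show ?thesis .
qed

text \<open>Resampling over disjoint sets commutes, so the change of \<open>EJ J f\<close> under J'
  is the J-average of the change of f. Jensen's inequality for the square and the invariance of the
  law under resampling J give the bound.\<close>

lemma DJ_EJ_le:
  assumes [measurable]: "f \<in> borel_measurable Q" and f1: "integrable Q f" and disj: "J \<inter> J' = {}"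
  shows "DJ J' (EJ J f) \<le> DJ J' f"
proof -
  have comm: "mrg J (mrg J' om om') om'' = mrg J' (mrg J om om'') om'" for om om' om''
    using disj by (auto simp: mrg_def fun_eq_iff)
  let ?PP = "Q \<Otimes>\<^sub>M Q"
  note good = EJ_facts(3)[OF f1, of J]
  \<comment> \<open>Splitting the integral of a difference requires both sections to be integrable.
    This holds for almost every configuration, hence also for its resampled version, which has the
    same law.\<close>
  have good1: "AE p in ?PP. integrable Q (%om''. f (mrg J (fst p) om''))"
  proof -
    have "AE om in distr ?PP Q (%p. mrg {} (fst p) (snd p)). integrable Q (%om''. f (mrg J om om''))"
      unfolding distr_mrg by (rule good)
    from AE_distrD[OF _ this] show ?thesis by (simp add: mrg_def)
  qed
  have good2: "AE p in ?PP. integrable Q (%om''. f (mrg J (mrg J' (fst p) (snd p)) om''))"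
  proof -
    have "AE om in distr ?PP Q (%p. mrg J' (fst p) (snd p)). integrable Q (%om''. f (mrg J om om''))"
      unfolding distr_mrg by (rule good)
    from AE_distrD[OF _ this] show ?thesis by simp
  qed
  have "DJ J' (EJ J f) = (\<integral>\<^sup>+p. ennreal ((EJ J f (fst p) - EJ J f (mrg J' (fst p) (snd p)))\<^sup>2) \<partial>?PP)"
    unfolding DJ_def by (subst Q.nn_integral_fst[symmetric]) auto
  also have "... \<le> (\<integral>\<^sup>+p. \<integral>\<^sup>+om''. ennreal ((f (mrg J (fst p) om'') - f (mrg J' (mrg J (fst p) om'') (snd p)))\<^sup>2) \<partial>Q \<partial>?PP)"
  proof (rule nn_integral_mono_AE)
    show "AE p in ?PP. ennreal ((EJ J f (fst p) - EJ J f (mrg J' (fst p) (snd p)))\<^sup>2)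
      \<le> (\<integral>\<^sup>+om''. ennreal ((f (mrg J (fst p) om'') - f (mrg J' (mrg J (fst p) om'') (snd p)))\<^sup>2) \<partial>Q)"
      using good1 good2
    proof eventually_elim
      case (elim p)
      have "EJ J f (fst p) - EJ J f (mrg J' (fst p) (snd p)) = (\<integral>om''. f (mrg J (fst p) om'') - f (mrg J' (mrg J (fst p) om'') (snd p)) \<partial>Q)"
        unfolding EJ_def using elim by (simp add: comm)
      moreover have "(%om''. f (mrg J (fst p) om'') - f (mrg J' (mrg J (fst p) om'') (snd p))) \<in> borel_measurable Q"
        by (intro borel_measurable_diff measurable_compose[OF _ assms(1)] mrg_meas2) auto
      ultimately show ?case using Q.sq_integral_le by simp
    qed
  qed
  also have "... = (\<integral>\<^sup>+om. \<integral>\<^sup>+om'. \<integral>\<^sup>+om''. ennreal ((f (mrg J om om'') - f (mrg J' (mrg J om om'') om'))\<^sup>2) \<partial>Q \<partial>Q \<partial>Q)"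
    by (subst Q.nn_integral_fst[symmetric]) auto
  also have "... = (\<integral>\<^sup>+om'. \<integral>\<^sup>+om. \<integral>\<^sup>+om''. ennreal ((f (mrg J om om'') - f (mrg J' (mrg J om om'') om'))\<^sup>2) \<partial>Q \<partial>Q \<partial>Q)"
    by (rule QQ.Fubini'[symmetric]) measurable
  also have "... = (\<integral>\<^sup>+om'. \<integral>\<^sup>+om. ennreal ((f om - f (mrg J' om om'))\<^sup>2) \<partial>Q \<partial>Q)"
    by (intro nn_integral_cong nn_resample[symmetric]) measurable
  also have "... = DJ J' f"
    unfolding DJ_def by (rule QQ.Fubini') measurable
  finally show ?thesis .
qed

text \<open>Conditioning removes one block at a time. The variance of f is the variance of its
  conditional expectation plus half of \<open>DJ\<close> for the removed block; the conditional
  expectation depends on the other blocks only, and by \<open>DJ_EJ_le\<close> its remaining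
  influences have not grown.\<close>

lemma efron_stein:
  fixes N :: nat
  assumes "f \<in> borel_measurable Q" "integrable Q (%om. (f om)\<^sup>2)"
    and "\<forall>om om'. (\<forall>m<N. \<forall>v\<in>J m. om v = om' v) --> f om = f om'"
    and disj: "\<And>m m'. m \<noteq> m' ==> J m \<inter> J m' = {}"
  shows "ennreal ((\<integral>om. (f om)\<^sup>2 \<partial>Q) - (\<integral>om. f om \<partial>Q)\<^sup>2) \<le> (\<Sum>m<N. ennreal (1/2) * DJ (J m) f)"
  using assms(1-3)
proof (induction N arbitrary: f)
  case 0
  have "f om = f undefined" for om using "0.prems"(3) by blast
  then have "f = (%_. f undefined)" by (rule ext)
  then obtain c where "f = (%_. c)" by blast
  then show ?case by (simp add: Q.prob_space[simplified])
next
  case (Suc N)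
  note [measurable] = Suc.prems(1)
  let ?h = "EJ (J N) f"
  have f1: "integrable Q f" by (rule integrable_of_sq[OF Q.finite_measure_axioms _ Suc.prems(2)]) simp
  have h2: "integrable Q (%om. (?h om)\<^sup>2)" by (rule EJ_sq[OF _ Suc.prems(2)]) simp
  have IH: "ennreal ((\<integral>om. (?h om)\<^sup>2 \<partial>Q) - (\<integral>om. ?h om \<partial>Q)\<^sup>2) \<le> (\<Sum>m<N. ennreal (1/2) * DJ (J m) ?h)"
  proof (rule Suc.IH[OF _ h2])
    show "\<forall>om om'. (\<forall>m<N. \<forall>v\<in>J m. om v = om' v) --> ?h om = ?h om'"
    proof (intro allI impI)
      fix om om' :: "cvert => real" assume eq: "\<forall>m<N. \<forall>v\<in>J m. om v = om' v"
      have "f (mrg (J N) om om'') = f (mrg (J N) om' om'')" for om''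
        by (rule Suc.prems(3)[rule_format]) (use eq in \<open>auto simp: mrg_def less_Suc_eq\<close>)
      then show "?h om = ?h om'" by (simp add: EJ_def)
    qed
  qed measurable
  have D: "ennreal (1/2) * DJ (J N) f = ennreal ((\<integral>om. (f om)\<^sup>2 \<partial>Q) - (\<integral>om. (?h om)\<^sup>2 \<partial>Q))"
  proof -
    have "ennreal (1/2) * ennreal (2 * x) = ennreal x" for x
      using ennreal_mult'[of "1/2" "2 * x"] by simp
    then show ?thesis unfolding DJ_eq[OF Suc.prems(1,2)] .
  qed
  have "(\<integral>om. (f om)\<^sup>2 \<partial>Q) - (\<integral>om. f om \<partial>Q)\<^sup>2 = ((\<integral>om. (?h om)\<^sup>2 \<partial>Q) - (\<integral>om. ?h om \<partial>Q)\<^sup>2) + ((\<integral>om. (f om)\<^sup>2 \<partial>Q) - (\<integral>om. (?h om)\<^sup>2 \<partial>Q))"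
    by (simp add: EJ_facts(2)[OF f1])
  then have "ennreal ((\<integral>om. (f om)\<^sup>2 \<partial>Q) - (\<integral>om. f om \<partial>Q)\<^sup>2) \<le> ennreal ((\<integral>om. (?h om)\<^sup>2 \<partial>Q) - (\<integral>om. ?h om \<partial>Q)\<^sup>2) + ennreal ((\<integral>om. (f om)\<^sup>2 \<partial>Q) - (\<integral>om. (?h om)\<^sup>2 \<partial>Q))"
    by (simp only: ennreal_add_le)
  also have "... \<le> (\<Sum>m<N. ennreal (1/2) * DJ (J m) ?h) + ennreal (1/2) * DJ (J N) f"
    unfolding D by (intro add_mono IH order_refl)
  also have "... \<le> (\<Sum>m<N. ennreal (1/2) * DJ (J m) f) + ennreal (1/2) * DJ (J N) f"
    by (intro add_mono order_refl sum_mono mult_left_mono DJ_EJ_le f1 disj) auto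
  finally show ?case by simp
qed

end

section \<open>Density points and the passage to real energies\<close>

lemma measurable_into_cauchy_eq [simp]: "measurable N cauchy = measurable N borel"
  by (rule measurable_cong_sets[OF refl sets_cauchy])

text \<open>Enclose A in an open U with small excess. A point of A stays in U under small shifts, so
  the part that leaves U tends to measure 0, and the part that lands in U - A is bounded by the
  excess whatever the shift is.\<close>

lemma measurable_translation_null:
  fixes A :: "real set"
  assumes A: "A \<in> sets borel" "emeasure lborel A < \<infinity>" and t: "t \<longlonglongrightarrow> 0"
  shows "(%m. emeasure lborel {E \<in> A. E + t m \<notin> A}) \<longlonglongrightarrow> 0"
proof -
  have ev: "\<forall>\<^sub>F m in sequentially. emeasure lborel {E \<in> A. E + t m \<notin> A} \<le> ennreal e" if e: "0 < e" for e
  proof -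
    obtain U where U: "open U" "A \<subseteq> U" "emeasure lborel (U - A) < ennreal (e/2)"
      using outer_regular_lborel[OF A(1), of "e/2"] e by auto
    have Um [measurable]: "U \<in> sets borel" using U(1) by simp
    note A(1)[measurable]
    have "(%m. \<integral>\<^sup>+E. indicator {E \<in> A. E + t m \<notin> U} E \<partial>lborel) \<longlonglongrightarrow> (\<integral>\<^sup>+E. 0 \<partial>(lborel :: real measure))"
    proof (rule nn_integral_dominated_convergence[where w = "indicator A"])
      show "AE E in lborel. (%m. indicator {E \<in> A. E + t m \<notin> U} E :: ennreal) \<longlonglongrightarrow> 0"
      proof (rule AE_I2)
        fix E :: real
        show "(%m. indicator {E \<in> A. E + t m \<notin> U} E :: ennreal) \<longlonglongrightarrow> 0"
        proof (cases "E \<in> A")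
          case True
          have "(%m. E + t m) \<longlonglongrightarrow> E + 0" by (intro tendsto_intros t)
          then have "\<forall>\<^sub>F m in sequentially. E + t m \<in> U"
            using U True by (intro topological_tendstoD[of _ E]) auto
          then show ?thesis by (intro tendsto_eventually) (auto elim!: eventually_mono)
        qed simp
      qed
      show "(\<integral>\<^sup>+E. indicator A E \<partial>lborel) < \<infinity>" using A by simp
      show "AE E in lborel. indicator {E \<in> A. E + t m \<notin> U} E \<le> (indicator A E :: ennreal)" for m
        by (rule AE_I2) (simp add: indicator_def)
    qed measurable
    then have "\<forall>\<^sub>F m in sequentially. (\<integral>\<^sup>+E. indicator {E \<in> A. E + t m \<notin> U} E \<partial>lborel) < ennreal (e/2)"
      using e by (intro order_tendstoD(2)) auto
    then show "\<forall>\<^sub>F m in sequentially. emeasure lborel {E \<in> A. E + t m \<notin> A} \<le> ennreal e"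
    proof eventually_elim
      case (elim m)
      have "emeasure lborel {E \<in> A. E + t m \<notin> A} = (\<integral>\<^sup>+E. indicator {E \<in> A. E + t m \<notin> A} E \<partial>lborel)"
        by (rule nn_integral_indicator[symmetric]) measurable
      also have "... \<le> (\<integral>\<^sup>+E. indicator {E \<in> A. E + t m \<notin> U} E + indicator (U - A) (t m + 1 * E) \<partial>lborel)"
        by (intro nn_integral_mono) (auto simp: indicator_def add.commute)
      also have "... = (\<integral>\<^sup>+E. indicator {E \<in> A. E + t m \<notin> U} E \<partial>lborel) + (\<integral>\<^sup>+E. indicator (U - A) (t m + 1 * E) \<partial>lborel)"
        by (rule nn_integral_add) measurable
      also have "(\<integral>\<^sup>+E. indicator (U - A) (t m + 1 * E) \<partial>lborel) = emeasure lborel (U - A)"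
        using nn_integral_real_affine[of "indicator (U - A)" 1 "t m"] by simp
      also have "(\<integral>\<^sup>+E. indicator {E \<in> A. E + t m \<notin> U} E \<partial>lborel) + emeasure lborel (U - A) \<le> ennreal (e/2) + ennreal (e/2)"
        using elim U(3) by (intro add_mono) auto
      also have "... = ennreal e" using e by (simp flip: ennreal_plus)
      finally show ?case .
    qed
  qed
  show ?thesis
  proof (rule order_tendstoI)
    fix a :: ennreal assume "0 < a"
    then obtain e where e: "0 < e" "ennreal e < a"
    proof (cases a)
      case (real r)
      then show ?thesis using \<open>0 < a\<close> that[of "r / 2"] by (simp add: ennreal_less_iff)
    next
      case top
      then show ?thesis using that[of 1] by simp
    qed
    show "\<forall>\<^sub>F m in sequentially. emeasure lborel {E \<in> A. E + t m \<notin> A} < a"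
      using ev[OF e(1)] by eventually_elim (use e(2) in auto)
  qed simp
qed

text \<open>A density theorem for the Poisson kernel. Averaged over E in A, the Cauchy mass outside
  A at scale 1/(m+1) tends to 0, by Fubini and continuity of translations. Fatou then gives a
  vanishing lower limit at almost every E, hence arbitrarily small good scales, though not all small
  ones; one good scale is all that the application asks for.\<close>

lemma cauchy_density_points_bounded:
  fixes A :: "real set"
  assumes A: "A \<in> sets borel" "emeasure lborel A < \<infinity>"
  shows "AE E in lborel. E \<in> A --> (\<forall>\<epsilon>>0. \<forall>\<delta>>0. \<exists>e. 0 < e \<and> e < \<delta> \<and> measure cauchy {u. E + e * u \<notin> A} < \<epsilon>)"
proof -
  interpret C: prob_space cauchy by (rule prob_space_cauchy)
  interpret P: pair_sigma_finite lborel cauchy ..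
  note A(1)[measurable]
  define t where "t m = 1 / real (Suc m)" for m
  have t0: "t \<longlonglongrightarrow> 0" unfolding t_def by (rule LIMSEQ_Suc[OF lim_1_over_n])
  define g where "g m E = emeasure cauchy {u. E + t m * u \<notin> A}" for m E
  have em: "emeasure lborel {E \<in> A. E + x \<notin> A} = (\<integral>\<^sup>+E. indicator A E * indicator (- A) (E + x) \<partial>lborel)" for x
  proof -
    have "emeasure lborel {E \<in> A. E + x \<notin> A} = (\<integral>\<^sup>+E. indicator {E \<in> A. E + x \<notin> A} E \<partial>lborel)"
      by (rule nn_integral_indicator[symmetric]) measurable
    also have "... = (\<integral>\<^sup>+E. indicator A E * indicator (- A) (E + x) \<partial>lborel)"
      by (intro nn_integral_cong) (simp add: indicator_def)
    finally show ?thesis .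
  qed
  have pm [measurable]: "(%p. fst p + t m * snd p) \<in> borel_measurable (lborel \<Otimes>\<^sub>M cauchy)" for m
  proof -
    have "snd \<in> borel_measurable (lborel \<Otimes>\<^sub>M cauchy)" using measurable_snd[of "lborel :: real measure" cauchy] by simp
    moreover have "fst \<in> borel_measurable (lborel \<Otimes>\<^sub>M cauchy)" using measurable_fst[of "lborel :: real measure" cauchy] by simp
    ultimately show ?thesis by (intro borel_measurable_add borel_measurable_times) auto
  qed
  have im: "(%p. indicator (- A) (fst p + t m * snd p) :: ennreal) \<in> borel_measurable (lborel \<Otimes>\<^sub>M cauchy)" for m
    by (rule measurable_compose[OF pm]) simp
  have im2 [measurable]: "(%(E, u). indicator (- A) (E + t m * u) :: ennreal) \<in> borel_measurable (lborel \<Otimes>\<^sub>M cauchy)" for m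
    using im[of m] by (simp add: case_prod_beta')
  have iam: "(%(E, u). indicator A E * indicator (- A) (E + t m * u) :: ennreal) \<in> borel_measurable (lborel \<Otimes>\<^sub>M cauchy)" for m
  proof -
    have "(%p. indicator A (fst p) :: ennreal) \<in> borel_measurable (lborel \<Otimes>\<^sub>M cauchy)"
      by (rule measurable_compose[OF measurable_fst]) simp
    then show ?thesis using im[of m] by (simp add: case_prod_beta')
  qed
  have gm: "g m E = (\<integral>\<^sup>+u. indicator (- A) (E + t m * u) \<partial>cauchy)" for m E
  proof -
    have "g m E = (\<integral>\<^sup>+u. indicator {u. E + t m * u \<notin> A} u \<partial>cauchy)"
      unfolding g_def by (rule nn_integral_indicator[symmetric]) simp
    also have "... = (\<integral>\<^sup>+u. indicator (- A) (E + t m * u) \<partial>cauchy)"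
      by (intro nn_integral_cong) (simp add: indicator_def)
    finally show ?thesis .
  qed
  have gmeas [measurable]: "g m \<in> borel_measurable lborel" for m
    unfolding gm[abs_def] by (rule C.borel_measurable_nn_integral[OF im2])
  have "(%m. \<integral>\<^sup>+E. indicator A E * g m E \<partial>lborel) = (%m. \<integral>\<^sup>+u. emeasure lborel {E \<in> A. E + t m * u \<notin> A} \<partial>cauchy)"
  proof
    fix m
    have "(\<integral>\<^sup>+E. indicator A E * g m E \<partial>lborel) = (\<integral>\<^sup>+E. \<integral>\<^sup>+u. indicator A E * indicator (- A) (E + t m * u) \<partial>cauchy \<partial>lborel)"
      unfolding gm by (intro nn_integral_cong nn_integral_cmult[symmetric]) simp
    also have "... = (\<integral>\<^sup>+u. \<integral>\<^sup>+E. indicator A E * indicator (- A) (E + t m * u) \<partial>lborel \<partial>cauchy)"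
      by (rule P.Fubini'[symmetric]) (rule iam)
    also have "... = (\<integral>\<^sup>+u. emeasure lborel {E \<in> A. E + t m * u \<notin> A} \<partial>cauchy)"
      by (simp only: em)
    finally show "(\<integral>\<^sup>+E. indicator A E * g m E \<partial>lborel) = (\<integral>\<^sup>+u. emeasure lborel {E \<in> A. E + t m * u \<notin> A} \<partial>cauchy)" .
  qed
  moreover have "(%m. \<integral>\<^sup>+u. emeasure lborel {E \<in> A. E + t m * u \<notin> A} \<partial>cauchy) \<longlonglongrightarrow> (\<integral>\<^sup>+u. 0 \<partial>cauchy)"
  proof (rule nn_integral_dominated_convergence[where w = "%_. emeasure lborel A"])
    show "(%u. emeasure lborel {E \<in> A. E + t m * u \<notin> A}) \<in> borel_measurable cauchy" for m
    proof -
      have "(%u. \<integral>\<^sup>+E. indicator A E * indicator (- A) (E + t m * u) \<partial>lborel) \<in> borel_measurable cauchy"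
        by (rule lborel.borel_measurable_nn_integral) (use measurable_pair_swap[OF iam[of m]] in \<open>simp add: case_prod_beta'\<close>)
      then show ?thesis by (simp only: em)
    qed
    show "AE u in cauchy. (%m. emeasure lborel {E \<in> A. E + t m * u \<notin> A}) \<longlonglongrightarrow> 0"
    proof (rule AE_I2)
      fix u :: real
      have "(%m. t m * u) \<longlonglongrightarrow> 0 * u" by (intro tendsto_intros t0)
      then show "(%m. emeasure lborel {E \<in> A. E + t m * u \<notin> A}) \<longlonglongrightarrow> 0"
        by (intro measurable_translation_null A) simp
    qed
    show "AE u in cauchy. emeasure lborel {E \<in> A. E + t m * u \<notin> A} \<le> emeasure lborel A" for m
      by (intro AE_I2 emeasure_mono) auto
  qed (use A in \<open>auto simp: C.emeasure_space_1[simplified]\<close>)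
  ultimately have lim: "(%m. \<integral>\<^sup>+E. indicator A E * g m E \<partial>lborel) \<longlonglongrightarrow> 0" by simp
  have "(\<integral>\<^sup>+E. liminf (%m. indicator A E * g m E) \<partial>lborel) \<le> liminf (%m. \<integral>\<^sup>+E. indicator A E * g m E \<partial>lborel)"
    by (rule nn_integral_liminf) measurable
  also have "... = 0" using lim by (intro lim_imp_Liminf) auto
  finally have "(\<integral>\<^sup>+E. liminf (%m. indicator A E * g m E) \<partial>lborel) = 0" by simp
  then have "AE E in lborel. liminf (%m. indicator A E * g m E) = 0"
    by (subst (asm) nn_integral_0_iff_AE) measurable
  then show ?thesis
  proof eventually_elim
    case (elim E)
    show ?case
    proof (intro impI allI)
      fix \<epsilon> \<delta> :: real assume E: "E \<in> A" and ep: "0 < \<epsilon>" and de: "0 < \<delta>"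
      have "liminf (%m. g m E) = 0" using elim E by simp
      then have "liminf (%m. g m E) < ennreal \<epsilon>" using ep by simp
      then have fr: "\<exists>\<^sub>F m in sequentially. g m E < ennreal \<epsilon>"
      proof (rule contrapos_pp)
        assume "\<not> (\<exists>\<^sub>F m in sequentially. g m E < ennreal \<epsilon>)"
        then have "\<forall>\<^sub>F m in sequentially. ennreal \<epsilon> \<le> g m E" by (simp add: not_frequently not_less)
        then have "ennreal \<epsilon> \<le> liminf (%m. g m E)" by (rule Liminf_bounded)
        then show "\<not> liminf (%m. g m E) < ennreal \<epsilon>" by (simp add: not_less)
      qed
      have "\<forall>\<^sub>F m in sequentially. t m < \<delta>" using order_tendstoD(2)[OF t0 de] .
      with fr have "\<exists>\<^sub>F m in sequentially. t m < \<delta> \<and> g m E < ennreal \<epsilon>"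
        by (rule frequently_eventually_conj)
      then obtain m where m: "g m E < ennreal \<epsilon>" "t m < \<delta>" by (auto dest!: frequently_ex)
      have "measure cauchy {u. E + t m * u \<notin> A} < \<epsilon>"
        using m(1) ep unfolding g_def C.emeasure_eq_measure by (subst (asm) ennreal_less_iff) auto
      then show "\<exists>e. 0 < e \<and> e < \<delta> \<and> measure cauchy {u. E + e * u \<notin> A} < \<epsilon>"
        using m(2) by (intro exI[of _ "t m"]) (auto simp: t_def)
    qed
  qed
qed

lemma cauchy_density_points:
  fixes I :: "real set"
  assumes I: "I \<in> sets borel"
  shows "AE E in lborel. E \<in> I --> (\<forall>\<epsilon>>0. \<forall>\<delta>>0. \<exists>e. 0 < e \<and> e < \<delta> \<and> measure cauchy {u. E + e * u \<notin> I} < \<epsilon>)"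
proof -
  interpret C: prob_space cauchy by (rule prob_space_cauchy)
  note I[measurable]
  let ?P = "%A E. \<forall>\<epsilon>>0. \<forall>\<delta>>0. \<exists>e. 0 < e \<and> e < \<delta> \<and> measure cauchy {u. E + e * u \<notin> A} < (\<epsilon>::real)"
  have "AE E in lborel. \<forall>k::nat. E \<in> I \<inter> {-real k..real k} --> ?P (I \<inter> {-real k..real k}) E"
    unfolding AE_all_countable
  proof (intro allI cauchy_density_points_bounded)
    fix k :: nat
    have "emeasure lborel (I \<inter> {-real k..real k}) \<le> emeasure lborel {-real k..real k}"
      by (intro emeasure_mono) auto
    also have "... < \<infinity>" by simp
    finally show "emeasure lborel (I \<inter> {-real k..real k}) < \<infinity>" .
  qed simp
  then show ?thesis
  proof eventually_elim
    case (elim E)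
    show ?case
    proof
      assume E: "E \<in> I"
      obtain k :: nat where "\<bar>E\<bar> \<le> real k" using real_arch_simple by blast
      then have "?P (I \<inter> {-real k..real k}) E" using elim E by (auto simp: abs_le_iff)
      moreover have "measure cauchy {u. E + e * u \<notin> I} \<le> measure cauchy {u. E + e * u \<notin> I \<inter> {-real k..real k}}" for e
        by (intro C.finite_measure_mono) auto
      ultimately show "?P I E" by (meson le_less_trans)
    qed
  qed
qed

context canopy_model
begin

lemma nn_abs_lng: "(\<integral>\<^sup>+om. ennreal \<bar>lng om z n j\<bar> \<partial>Q) \<le> ennreal (1 + Cl z)"
proof -
  have "(\<integral>\<^sup>+om. ennreal \<bar>lng om z n j\<bar> \<partial>Q) \<le> (\<integral>\<^sup>+om. 1 + ennreal ((lng om z n j)\<^sup>2) \<partial>Q)"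
  proof (rule nn_integral_mono)
    fix om
    have "\<bar>x\<bar> \<le> 1 + x\<^sup>2" for x :: real
      using zero_le_power2[of "\<bar>x\<bar> - 1"] by (simp add: power2_eq_square algebra_simps)
    then have "ennreal \<bar>lng om z n j\<bar> \<le> ennreal (1 + (lng om z n j)\<^sup>2)" by (rule ennreal_leI)
    then show "ennreal \<bar>lng om z n j\<bar> \<le> 1 + ennreal ((lng om z n j)\<^sup>2)" by simp
  qed
  also have "... = 1 + (\<integral>\<^sup>+om. ennreal ((lng om z n j)\<^sup>2) \<partial>Q)"
    by (subst nn_integral_add) (auto simp: Q.emeasure_space_1[simplified])
  also have "... \<le> 1 + ennreal (Cl z)" by (intro add_mono lng_sq order_refl)
  also have "... = ennreal (1 + Cl z)" using Cl_nonneg by simp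
  finally show ?thesis .
qed

lemma abs_fL_le: "\<bar>fL n z\<bar> \<le> 1 + Cl z"
proof -
  have "ennreal \<bar>fL n z\<bar> \<le> ennreal (\<integral>om. \<bar>lng om z n 0\<bar> \<partial>Q)"
    unfolding fL_def by (intro ennreal_leI integral_abs_bound)
  also have "... = (\<integral>\<^sup>+om. ennreal \<bar>lng om z n 0\<bar> \<partial>Q)"
    by (intro nn_integral_eq_integral[symmetric] integrable_abs integrable_lng AE_I2 abs_ge_zero)
  also have "... \<le> ennreal (1 + Cl z)" by (rule nn_abs_lng)
  finally show ?thesis using Cl_nonneg[of z] by (subst (asm) ennreal_le_iff) auto
qed

lemma Cl_line: "Cl (of_real (E + t)) \<le> Cl (of_real E) + 4 / s\<^sup>2 * \<bar>t\<bar> powr s"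
proof -
  have "\<bar>E + t\<bar> powr s \<le> (\<bar>E\<bar> + \<bar>t\<bar>) powr s" using s_pos by (intro powr_mono2) auto
  also have "... \<le> \<bar>E\<bar> powr s + \<bar>t\<bar> powr s" using s_pos s_lt1 by (intro powr_add_le) auto
  finally have "4 / s\<^sup>2 * (A s + (B0 + \<bar>E + t\<bar> powr s)) \<le> 4 / s\<^sup>2 * (A s + (B0 + (\<bar>E\<bar> powr s + \<bar>t\<bar> powr s)))"
    by (intro mult_left_mono) auto
  also have "... = 4 / s\<^sup>2 * (A s + (B0 + \<bar>E\<bar> powr s)) + 4 / s\<^sup>2 * \<bar>t\<bar> powr s"
    by (simp add: ring_distribs)
  finally show ?thesis unfolding Cl_def norm_of_real .
qed

lemma cauchy_s_integrable: "integrable cauchy (%u. \<bar>u\<bar> powr s)"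
  by (rule integrableI_nonneg) (use cauchy_moment[OF s_pos s_lt1] in auto)

lemma fL_measurable [measurable]: "(%u. fL n (of_real (E + e * u))) \<in> borel_measurable cauchy"
proof -
  have "(%(u, om). lng om (of_real (E + e * u)) n 0) \<in> borel_measurable (cauchy \<Otimes>\<^sub>M Q)" by measurable
  then show ?thesis unfolding fL_def by (rule Q.borel_measurable_lebesgue_integral)
qed

text \<open>The mean of |lng| at energy E + e u grows at most like |u|^s, which the Cauchy law
  integrates because s is below 1. This justifies exchanging the averages over the disorder and the
  energy in \<open>poisson_lng\<close>.\<close>

lemma fL_poisson:
  assumes e: "0 < e"
  shows "integrable cauchy (%u. fL n (of_real (E + e * u)))"
    "fL n (Complex E e) = (\<integral>u. fL n (of_real (E + e * u)) \<partial>cauchy)"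
proof -
  interpret C: prob_space cauchy by (rule prob_space_cauchy)
  interpret QC: pair_sigma_finite Q cauchy ..
  let ?g = "%om u. lng om (of_real (E + e * u)) n 0"
  have m [measurable]: "(%(om, u). ?g om u) \<in> borel_measurable (Q \<Otimes>\<^sub>M cauchy)" by measurable
  have i: "integrable (Q \<Otimes>\<^sub>M cauchy) (%(om, u). ?g om u)"
  proof (rule integrableI_bounded[OF m])
    have "(\<integral>\<^sup>+p. ennreal (norm (case p of (om, u) => ?g om u)) \<partial>(Q \<Otimes>\<^sub>M cauchy)) = (\<integral>\<^sup>+u. \<integral>\<^sup>+om. ennreal \<bar>?g om u\<bar> \<partial>Q \<partial>cauchy)"
      by (subst QC.nn_integral_snd[symmetric]) auto
    also have "... \<le> (\<integral>\<^sup>+u. ennreal (1 + Cl (of_real E)) + ennreal (4 / s\<^sup>2 * e powr s) * ennreal (\<bar>u\<bar> powr s) \<partial>cauchy)"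
    proof (rule nn_integral_mono)
      fix u
      have "(\<integral>\<^sup>+om. ennreal \<bar>?g om u\<bar> \<partial>Q) \<le> ennreal (1 + Cl (of_real (E + e * u)))" by (rule nn_abs_lng)
      also have "... \<le> ennreal (1 + Cl (of_real E) + 4 / s\<^sup>2 * e powr s * \<bar>u\<bar> powr s)"
        using Cl_line[of E "e * u"] e by (intro ennreal_leI) (simp add: abs_mult powr_mult)
      also have "... = ennreal (1 + Cl (of_real E)) + ennreal (4 / s\<^sup>2 * e powr s) * ennreal (\<bar>u\<bar> powr s)"
      proof -
        have "0 \<le> 1 + Cl (of_real E)" "0 \<le> 4 / s\<^sup>2 * e powr s * \<bar>u\<bar> powr s" using Cl_nonneg[of "of_real E"] by auto
        then have "ennreal (1 + Cl (of_real E) + 4 / s\<^sup>2 * e powr s * \<bar>u\<bar> powr s) = ennreal (1 + Cl (of_real E)) + ennreal (4 / s\<^sup>2 * e powr s * \<bar>u\<bar> powr s)"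
          by (rule ennreal_plus)
        also have "ennreal (4 / s\<^sup>2 * e powr s * \<bar>u\<bar> powr s) = ennreal (4 / s\<^sup>2 * e powr s) * ennreal (\<bar>u\<bar> powr s)"
          by (rule ennreal_mult) auto
        finally show ?thesis .
      qed
      finally show "(\<integral>\<^sup>+om. ennreal \<bar>?g om u\<bar> \<partial>Q) \<le> ennreal (1 + Cl (of_real E)) + ennreal (4 / s\<^sup>2 * e powr s) * ennreal (\<bar>u\<bar> powr s)" .
    qed
    also have "... = ennreal (1 + Cl (of_real E)) + ennreal (4 / s\<^sup>2 * e powr s) * (\<integral>\<^sup>+u. ennreal (\<bar>u\<bar> powr s) \<partial>cauchy)"
      by (subst nn_integral_add) (auto simp: nn_integral_cmult C.emeasure_space_1[simplified])
    also have "... < \<infinity>" using cauchy_moment[OF s_pos s_lt1] by (simp add: ennreal_mult_less_top)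
    finally show "(\<integral>\<^sup>+p. ennreal (norm (case p of (om, u) => ?g om u)) \<partial>(Q \<Otimes>\<^sub>M cauchy)) < \<infinity>" .
  qed
  show "integrable cauchy (%u. fL n (of_real (E + e * u)))"
    unfolding fL_def using QC.integrable_snd[OF i] by simp
  have "fL n (Complex E e) = (\<integral>om. \<integral>u. ?g om u \<partial>cauchy \<partial>Q)"
    by (simp only: fL_def poisson_lng(2)[OF e])
  also have "... = (\<integral>u. \<integral>om. ?g om u \<partial>Q \<partial>cauchy)"
    using QC.Fubini_integral[OF i] by simp
  finally show "fL n (Complex E e) = (\<integral>u. fL n (of_real (E + e * u)) \<partial>cauchy)"
    by (simp only: fL_def)
qed

text \<open>The Poisson average splits into three parts: energies in I near E, where equicontinuity
  acts; energies outside I, of small Cauchy mass; and distant energies, where the growth bound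
  \<open>Cl_line\<close> times e^s is small. No part refers to n, so one e serves all
  layers.\<close>

lemma fL_boundary:
  assumes eq: "\<forall>\<epsilon>>0. \<exists>\<delta>>0. \<forall>n. \<forall>E'\<in>I. \<bar>E' - E\<bar> < \<delta> --> \<bar>fL n (of_real E') - fL n (of_real E)\<bar> < \<epsilon>"
    and dens: "\<forall>\<epsilon>>0. \<forall>\<delta>>0. \<exists>e. 0 < e \<and> e < \<delta> \<and> measure cauchy {u. E + e * u \<notin> I} < \<epsilon>"
    and I [measurable]: "I \<in> sets borel" and ep: "0 < \<epsilon>"
  shows "\<exists>e. 0 < e \<and> e < 1 \<and> (\<forall>n. \<bar>fL n (Complex E e) - fL n (of_real E)\<bar> \<le> \<epsilon>)"
proof -
  interpret C: prob_space cauchy by (rule prob_space_cauchy)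
  obtain \<delta> where de: "0 < \<delta>" and eqd: "\<And>n E'. E' \<in> I ==> \<bar>E' - E\<bar> < \<delta> ==> \<bar>fL n (of_real E') - fL n (of_real E)\<bar> < \<epsilon> / 4"
    using eq ep by (metis divide_pos_pos zero_less_numeral)
  define m where "m = (\<integral>u. \<bar>u\<bar> powr s \<partial>cauchy)"
  \<comment> \<open>\<open>a0\<close> bounds the difference of two means up to growth in |e u|^s. In
    \<open>a1\<close> the term \<open>a0 / \<delta> powr s\<close> absorbs \<open>a0\<close> once |e
    u| is at least \<delta>, and \<open>e0\<close> makes the resulting tail contribution at most a
    quarter of \<epsilon>.\<close>
  define a0 where "a0 = 2 + 2 * Cl (of_real E)"
  define a1 where "a1 = a0 / \<delta> powr s + 4 / s\<^sup>2"
  define e0 where "e0 = (\<epsilon> / (4 * (a1 * m + 1))) powr (1 / s)"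
  have a0: "2 \<le> a0" using Cl_nonneg[of "of_real E"] by (simp add: a0_def)
  have a1: "0 \<le> a1" using a0 by (simp add: a1_def)
  have m: "0 \<le> m" unfolding m_def by (rule integral_nonneg_AE) simp
  have am: "0 < a1 * m + 1" using a1 m by (simp add: add_nonneg_pos)
  have e0: "0 < e0" using ep am by (simp add: e0_def)
  obtain e where e: "0 < e" "e < min 1 e0" and me: "measure cauchy {u. E + e * u \<notin> I} < \<epsilon> / (4 * a0)"
    using dens[rule_format, of "\<epsilon> / (4 * a0)" "min 1 e0"] ep a0 e0 by auto
  have "e powr s \<le> e0 powr s" using e s_pos by (intro powr_mono2) auto
  also have "e0 powr s = \<epsilon> / (4 * (a1 * m + 1))" using s_pos ep am by (simp add: e0_def powr_powr)
  finally have es: "e powr s \<le> \<epsilon> / (4 * (a1 * m + 1))" .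
  have "a1 * m * e powr s \<le> (a1 * m + 1) * (\<epsilon> / (4 * (a1 * m + 1)))"
    using es a1 m am by (intro mult_mono) auto
  also have "... = \<epsilon> / 4"
  proof -
    have "k * (\<epsilon> / (4 * k)) = \<epsilon> / 4" if "0 < k" for k using that by (simp add: field_simps)
    then show ?thesis using am by blast
  qed
  finally have small: "a1 * m * e powr s \<le> \<epsilon> / 4" .
  let ?B = "{u. E + e * u \<notin> I}"
  have pt: "\<bar>fL n (of_real (E + e * u)) - fL n (of_real E)\<bar> \<le> \<epsilon> / 4 + a0 * indicator ?B u + a1 * e powr s * \<bar>u\<bar> powr s" for n u
  proof -
    have eu: "\<bar>e * u\<bar> powr s = e powr s * \<bar>u\<bar> powr s" using e by (simp add: abs_mult powr_mult)
    have bd: "\<bar>fL n (of_real (E + e * u)) - fL n (of_real E)\<bar> \<le> a0 + 4 / s\<^sup>2 * (e powr s * \<bar>u\<bar> powr s)"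
      using abs_fL_le[of n "of_real (E + e * u)"] abs_fL_le[of n "of_real E"] Cl_line[of E "e * u"]
      unfolding eu a0_def by linarith
    have nn: "0 \<le> 4 / s\<^sup>2 * (e powr s * \<bar>u\<bar> powr s)" "0 \<le> a0 / \<delta> powr s * (e powr s * \<bar>u\<bar> powr s)" using a0 by auto
    have a1e: "a1 * e powr s * \<bar>u\<bar> powr s = a0 / \<delta> powr s * (e powr s * \<bar>u\<bar> powr s) + 4 / s\<^sup>2 * (e powr s * \<bar>u\<bar> powr s)"
      by (simp add: a1_def ring_distribs mult.assoc)
    show ?thesis
    proof (cases "u \<in> ?B")
      case True
      then have "a0 * indicator ?B u = a0" by simp
      then show ?thesis using bd nn a1e ep by linarith
    next
      case False
      then have uI: "E + e * u \<in> I" by simp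
      then have B0': "a0 * indicator ?B u = 0" by simp
      show ?thesis
      proof (cases "\<bar>e * u\<bar> < \<delta>")
        case True
        then have "\<bar>fL n (of_real (E + e * u)) - fL n (of_real E)\<bar> < \<epsilon> / 4" using eqd[OF uI, of n] by simp
        then show ?thesis using nn a1e B0' by linarith
      next
        case F2: False
        have "\<delta> powr s \<le> \<bar>e * u\<bar> powr s" using F2 de s_pos by (intro powr_mono2) auto
        then have "1 \<le> e powr s * \<bar>u\<bar> powr s / \<delta> powr s" unfolding eu using de by simp
        then have "a0 * 1 \<le> a0 * (e powr s * \<bar>u\<bar> powr s / \<delta> powr s)" using a0 by (intro mult_left_mono) auto
        then have "a0 \<le> a0 / \<delta> powr s * (e powr s * \<bar>u\<bar> powr s)" by simp
        then show ?thesis using bd a1e ep B0' by linarith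
      qed
    qed
  qed
  have "\<bar>fL n (Complex E e) - fL n (of_real E)\<bar> \<le> \<epsilon>" for n
  proof -
    have i: "integrable cauchy (%u. fL n (of_real (E + e * u)))" by (rule fL_poisson(1)[OF e(1)])
    have iB: "integrable cauchy (%u. indicator ?B u :: real)"
      by (rule integrable_real_indicator) (auto simp: C.emeasure_eq_measure)
    have "fL n (Complex E e) - fL n (of_real E) = (\<integral>u. fL n (of_real (E + e * u)) - fL n (of_real E) \<partial>cauchy)"
      using i by (simp add: fL_poisson(2)[OF e(1)] C.prob_space[simplified] del: of_real_add of_real_mult)
    also have "\<bar>...\<bar> \<le> (\<integral>u. \<bar>fL n (of_real (E + e * u)) - fL n (of_real E)\<bar> \<partial>cauchy)"
      by (rule integral_abs_bound)
    also have "... \<le> (\<integral>u. \<epsilon> / 4 + a0 * indicator ?B u + a1 * e powr s * \<bar>u\<bar> powr s \<partial>cauchy)"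
      using i iB cauchy_s_integrable
      by (intro integral_mono pt integrable_abs Bochner_Integration.integrable_diff Bochner_Integration.integrable_add integrable_mult_right C.integrable_const) auto
    also have "... = \<epsilon> / 4 + a0 * measure cauchy ?B + a1 * e powr s * m"
      using iB cauchy_s_integrable by (simp add: C.prob_space[simplified] m_def)
    also have "... \<le> \<epsilon> / 4 + \<epsilon> / 4 + \<epsilon> / 4"
    proof -
      have "a0 * measure cauchy ?B \<le> a0 * (\<epsilon> / (4 * a0))" using me a0 by (intro mult_left_mono) auto
      also have "... = \<epsilon> / 4" using a0 by simp
      finally show ?thesis using small by (simp add: mult_ac)
    qed
    finally show ?thesis using ep by simp
  qed
  then show ?thesis using e by auto
qed

text \<open>The gap c is uniform over the half disc around 0 containing E and E + i e for e below 1,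
  so e may be chosen in terms of c. Half of the gap is spent on the passage to the axis.\<close>

lemma lyapunov_real:
  assumes eq: "\<forall>\<epsilon>>0. \<exists>\<delta>>0. \<forall>n. \<forall>E'\<in>I. \<bar>E' - E\<bar> < \<delta> --> \<bar>fL n (of_real E') - fL n (of_real E)\<bar> < \<epsilon>"
    and dens: "\<forall>\<epsilon>>0. \<forall>\<delta>>0. \<exists>e. 0 < e \<and> e < \<delta> \<and> measure cauchy {u. E + e * u \<notin> I} < \<epsilon>"
    and I: "I \<in> sets borel"
  shows "\<exists>\<gamma>>0. \<exists>C. \<forall>N. (\<Sum>n<N. fL n (of_real E)) \<le> C - real N * (ln (real K) / 2 + \<gamma>)"
proof -
  have "\<exists>c>0. \<forall>z. 0 < Im z --> norm z \<le> \<bar>E\<bar> + 1 -->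
    (\<exists>C. \<forall>N. (\<Sum>n<N. fL (Suc n) z) \<le> C - real N * (ln (real K) / 2 + c))"
    by (rule lyapunov_complex) simp
  then obtain c where c: "0 < c" and cz: "\<forall>z. 0 < Im z --> norm z \<le> \<bar>E\<bar> + 1 -->
    (\<exists>C. \<forall>N. (\<Sum>n<N. fL (Suc n) z) \<le> C - real N * (ln (real K) / 2 + c))"
    by (elim exE conjE) (rule that)
  have c2: "0 < c / 2" using c by simp
  have "\<exists>e>0. e < 1 \<and> (\<forall>n. \<bar>fL n (Complex E e) - fL n (of_real E)\<bar> \<le> c / 2)"
    by (rule fL_boundary[OF eq dens I c2])
  then obtain e where e: "0 < e" "e < 1" and ap: "\<forall>n. \<bar>fL n (Complex E e) - fL n (of_real E)\<bar> \<le> c / 2"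
    by (elim exE conjE) (rule that)
  have "norm (Complex E e) \<le> \<bar>Re (Complex E e)\<bar> + \<bar>Im (Complex E e)\<bar>" by (rule cmod_le)
  then have "norm (Complex E e) \<le> \<bar>E\<bar> + 1" using e by simp
  then have "\<exists>C. \<forall>N. (\<Sum>n<N. fL (Suc n) (Complex E e)) \<le> C - real N * (ln (real K) / 2 + c)"
    using cz[rule_format, of "Complex E e"] e(1) by (simp only: complex.sel)
  then obtain C where C: "\<forall>N. (\<Sum>n<N. fL (Suc n) (Complex E e)) \<le> C - real N * (ln (real K) / 2 + c)"
    by (elim exE) (rule that)
  have S: "(\<Sum>n<N. fL (Suc n) (of_real E)) \<le> C - real N * (ln (real K) / 2 + c / 2)" for N
  proof -
    have "fL (Suc n) (of_real E) \<le> fL (Suc n) (Complex E e) + c / 2" for n using ap[rule_format, of "Suc n"] by linarith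
    then have "(\<Sum>n<N. fL (Suc n) (of_real E)) \<le> (\<Sum>n<N. fL (Suc n) (Complex E e) + c / 2)" by (intro sum_mono)
    also have "... = (\<Sum>n<N. fL (Suc n) (Complex E e)) + real N * (c / 2)" by (simp add: sum.distrib)
    finally show ?thesis using C[rule_format, of N] by (simp add: algebra_simps)
  qed
  \<comment> \<open>The complex bound starts at layer 1; the layer 0 term and the one lost factor
    \<open>h\<close> are put into the constant.\<close>
  define h where "h = ln (real K) / 2 + c / 2"
  have h: "0 \<le> h" using K2 c by (simp add: h_def)
  have "(\<Sum>n<N. fL n (of_real E)) \<le> (\<bar>fL 0 (of_real E)\<bar> + \<bar>C\<bar> + h) - real N * h" for N
  proof (cases N)
    case 0
    then show ?thesis using h by simp
  next
    case (Suc M)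
    have "(\<Sum>n<N. fL n (of_real E)) = fL 0 (of_real E) + (\<Sum>n<M. fL (Suc n) (of_real E))"
      unfolding Suc by (rule sum.lessThan_Suc_shift)
    then show ?thesis using S[of M] unfolding Suc h_def[symmetric] by (simp add: algebra_simps)
  qed
  then have "\<forall>N. (\<Sum>n<N. fL n (of_real E)) \<le> (\<bar>fL 0 (of_real E)\<bar> + \<bar>C\<bar> + h) - real N * (ln (real K) / 2 + c / 2)"
    unfolding h_def by (rule allI)
  then have "\<exists>C. \<forall>N. (\<Sum>n<N. fL n (of_real E)) \<le> C - real N * (ln (real K) / 2 + c / 2)" by (rule exI)
  show ?thesis by (rule exI, rule conjI[OF c2], fact)
qed

end

section \<open>Fluctuations and decay of the products along a path\<close>

lemma desc_chain:
  "m \<le> n ==> canopy_model.desc K (k + m) (j div K ^ m) \<subseteq> canopy_model.desc K (k + n) (j div K ^ n)"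
  if "canopy_model K \<rho> M s"
proof (induction n)
  case (Suc n)
  interpret canopy_model K b \<rho> M s by (rule that)
  show ?case
  proof (cases "m = Suc n")
    case False
    then have "desc (k + m) (j div K ^ m) \<subseteq> desc (k + n) (j div K ^ n)" using Suc by simp
    also have "... \<subseteq> desc (Suc (k + n)) ((j div K ^ n) div K)" by (rule desc_parent)
    also have "(j div K ^ n) div K = j div K ^ Suc n" by (simp add: div_mult2_eq mult.commute[of K])
    finally show ?thesis by simp
  qed simp
qed simp

text \<open>The continuants of the path: their value is the inverse of the product of the Green functions, and they are affine in each coefficient, which isolates the dependence on one block of sites.\<close>

fun qq :: "(nat => real) => nat => real" where
  "qq a 0 = a 0"
| "qq a (Suc 0) = a 1 * a 0 - 1"
| "qq a (Suc (Suc d)) = a (Suc (Suc d)) * qq a (Suc d) - qq a d"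

lemma qq_cong: "(\<And>i. i \<le> n ==> a i = a' i) ==> qq a n = qq a' n"
  by (induction a n rule: qq.induct) auto

lemma qq_affine:
  "qq (a(m := t)) n = qq (a(m := 0)) n + t * (qq (a(m := 1)) n - qq (a(m := 0)) n)"
proof (induction a n rule: qq.induct)
  case (1 a)
  then show ?case by auto
next
  case (2 a)
  then show ?case by (auto simp: algebra_simps)
next
  case (3 a d)
  show ?case
  proof (cases "m = Suc (Suc d)")
    case True
    have q: "qq (a(Suc (Suc d) := x)) (Suc d) = qq a (Suc d)" "qq (a(Suc (Suc d) := x)) d = qq a d" for x
      by (rule qq_cong, simp)+
    show ?thesis unfolding True qq.simps q fun_upd_same by (simp add: algebra_simps)
  next
    case False
    define p where "p = qq (a(m := 0)) (Suc d)"
    define q where "q = qq (a(m := 1)) (Suc d)"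
    define p' where "p' = qq (a(m := 0)) d"
    define q' where "q' = qq (a(m := 1)) d"
    have "qq (a(m := t)) (Suc d) = p + t * (q - p)" "qq (a(m := t)) d = p' + t * (q' - p')"
      using 3 by (simp_all only: p_def q_def p'_def q'_def)
    then have "qq (a(m := t)) (Suc (Suc d)) = a (Suc (Suc d)) * (p + t * (q - p)) - (p' + t * (q' - p'))"
      using False by simp
    moreover have "qq (a(m := 0)) (Suc (Suc d)) = a (Suc (Suc d)) * p - p'"
      "qq (a(m := 1)) (Suc (Suc d)) = a (Suc (Suc d)) * q - q'"
      using False by (simp_all add: p_def q_def p'_def q'_def)
    ultimately show ?thesis by (simp only:) (simp add: algebra_simps)
  qed
qed

lemma powr_half_le: "0 \<le> x ==> 0 < r ==> x powr r \<le> 1 + x powr (2 * r)" for x r :: real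
proof -
  assume "0 \<le> x" "0 < r"
  have "x powr (2 * r) = (x powr r)\<^sup>2"
    by (simp add: power2_eq_square powr_add[symmetric])
  moreover have "y \<le> 1 + y\<^sup>2" for y :: real
  proof -
    have "0 \<le> (y - 1)\<^sup>2" by simp
    then have "0 \<le> y\<^sup>2 - 2 * y + 1" by (simp add: power2_diff)
    moreover have "0 \<le> y\<^sup>2" by simp
    ultimately show ?thesis by linarith
  qed
  ultimately show ?thesis by simp
qed

text \<open>The centre subtracted from the logarithm does not involve a. With g = \<alpha> /
  \<beta>, what remains is the logarithm of t = |a + g| / (1 + |g|). This is at most 1 + |a|, and
  its reciprocal is at most (1 + |a|) / |a + g| + 1, uniformly in g. The product in the reciprocal
  is split into squares, which doubles the exponent r.\<close>

lemma ln_affine_bound: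
  fixes \<alpha> \<beta> a r :: real
  assumes r: "0 < r" "r \<le> 1" and b: "\<beta> \<noteq> 0" and ag: "a + \<alpha> / \<beta> \<noteq> 0"
  shows "(ln \<bar>\<alpha> + a * \<beta>\<bar> - (ln \<bar>\<beta>\<bar> + ln (1 + \<bar>\<alpha> / \<beta>\<bar>)))\<^sup>2
    \<le> 4 / r\<^sup>2 * (5 + 3 * \<bar>a\<bar> powr (2 * r) + \<bar>a + \<alpha> / \<beta>\<bar> powr (- (2 * r)))"
proof -
  define g where "g = \<alpha> / \<beta>"
  define x where "x = \<bar>a + g\<bar>"
  define t where "t = x / (1 + \<bar>g\<bar>)"
  have x: "0 < x" using ag by (simp add: x_def g_def)
  have g1: "0 < 1 + \<bar>g\<bar>" by (simp add: add_pos_nonneg)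
  have t: "0 < t" using x g1 by (simp add: t_def)
  have "\<alpha> + a * \<beta> = \<beta> * (a + g)" using b by (simp add: g_def field_simps)
  then have "ln \<bar>\<alpha> + a * \<beta>\<bar> = ln \<bar>\<beta>\<bar> + ln x" using b x by (simp add: abs_mult x_def ln_mult)
  then have eq: "ln \<bar>\<alpha> + a * \<beta>\<bar> - (ln \<bar>\<beta>\<bar> + ln (1 + \<bar>\<alpha> / \<beta>\<bar>)) = ln t"
    using x g1 unfolding t_def g_def[symmetric] by (simp add: ln_div)
  have "t \<le> 1 + \<bar>a\<bar>"
  proof -
    have "x \<le> \<bar>a\<bar> + \<bar>g\<bar>" unfolding x_def by (rule abs_triangle_ineq)
    also have "... \<le> (1 + \<bar>a\<bar>) * (1 + \<bar>g\<bar>)" by (simp add: algebra_simps)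
    finally show ?thesis unfolding t_def using g1 by (simp add: pos_divide_le_eq)
  qed
  then have "t powr r \<le> (1 + \<bar>a\<bar>) powr r" using t r by (intro powr_mono2) auto
  also have "... \<le> 1 powr r + \<bar>a\<bar> powr r" using r by (intro powr_add_le) auto
  finally have t1: "t powr r \<le> 1 + \<bar>a\<bar> powr r" by simp
  have "inverse t = (1 + \<bar>g\<bar>) / x" by (simp add: t_def)
  also have "... \<le> (1 + \<bar>a\<bar> + x) / x"
  proof (rule divide_right_mono)
    have "\<bar>g\<bar> \<le> \<bar>a\<bar> + x" unfolding x_def by linarith
    then show "1 + \<bar>g\<bar> \<le> 1 + \<bar>a\<bar> + x" by simp
  qed (use x in simp)
  also have "... = (1 + \<bar>a\<bar>) * inverse x + 1" using x by (simp add: field_simps)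
  finally have it: "inverse t \<le> (1 + \<bar>a\<bar>) * inverse x + 1" .
  have "inverse t powr r \<le> ((1 + \<bar>a\<bar>) * inverse x + 1) powr r"
    using it t r by (intro powr_mono2) auto
  also have "... \<le> ((1 + \<bar>a\<bar>) * inverse x) powr r + 1 powr r"
    using r x by (intro powr_add_le) auto
  also have "((1 + \<bar>a\<bar>) * inverse x) powr r = (1 + \<bar>a\<bar>) powr r * inverse x powr r"
    using x by (simp add: powr_mult)
  also have "... \<le> (1 + \<bar>a\<bar> powr r) * inverse x powr r"
    using powr_add_le[of 1 "\<bar>a\<bar>" r] r by (intro mult_right_mono) auto
  also have "... \<le> (1 + \<bar>a\<bar> powr r)\<^sup>2 / 2 + (inverse x powr r)\<^sup>2 / 2"
  proof -
    have "u * v \<le> u\<^sup>2 / 2 + v\<^sup>2 / 2" for u v :: real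
      using sum_squares_bound[of u v] by simp
    then show ?thesis .
  qed
  also have "(1 + \<bar>a\<bar> powr r)\<^sup>2 \<le> 2 + 2 * \<bar>a\<bar> powr (2 * r)"
  proof -
    have "(1 + u)\<^sup>2 \<le> 2 + 2 * u\<^sup>2" for u :: real
      using zero_le_power2[of "u - 1"] by (simp add: power2_eq_square algebra_simps)
    moreover have "(\<bar>a\<bar> powr r)\<^sup>2 = \<bar>a\<bar> powr (2 * r)"
      by (simp add: power2_eq_square powr_add[symmetric])
    ultimately show ?thesis by metis
  qed
  also have "(inverse x powr r)\<^sup>2 = x powr (- (2 * r))"
  proof -
    have "inverse x powr r = x powr (- r)" using x by (simp add: powr_minus inverse_powr)
    then have "(inverse x powr r)\<^sup>2 = x powr (- r) * x powr (- r)" by (simp only: power2_eq_square)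
    also have "... = x powr (- r + - r)" by (simp only: powr_add)
    finally show ?thesis by simp
  qed
  finally have t2: "inverse t powr r \<le> (2 + 2 * \<bar>a\<bar> powr (2 * r)) / 2 + x powr (- (2 * r)) / 2 + 1"
    by simp
  have ah: "\<bar>a\<bar> powr r \<le> 1 + \<bar>a\<bar> powr (2 * r)" using r by (intro powr_half_le) auto
  have xp: "0 \<le> x powr (- (2 * r))" by simp
  have "(ln t)\<^sup>2 \<le> 4 / r\<^sup>2 * (t powr r + inverse t powr r)"
    using t r by (intro ln_sq_le) auto
  also have "... \<le> 4 / r\<^sup>2 * (5 + 3 * \<bar>a\<bar> powr (2 * r) + x powr (- (2 * r)))"
  proof (rule mult_left_mono)
    have "(2 + 2 * \<bar>a\<bar> powr (2 * r)) / 2 = 1 + \<bar>a\<bar> powr (2 * r)" by simp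
    then show "t powr r + inverse t powr r \<le> 5 + 3 * \<bar>a\<bar> powr (2 * r) + x powr (- (2 * r))"
      using t1 t2 ah xp powr_ge_zero[of "\<bar>a\<bar>" "2 * r"] by linarith
  qed (use r in simp)
  finally show ?thesis unfolding eq x_def g_def .
qed

context canopy_model
begin

definition gp :: "(cvert => real) => real => nat => nat => nat => real" where
  "gp om E k j d = gam om E (k + d) (j div K ^ d)"

text \<open>The coefficient of the continued fraction along the path: the reciprocal of
  \<open>gp\<close> with the term of the path child taken out, so that it depends on one block of
  sites only.\<close>

definition av :: "(cvert => real) => real => nat => nat => nat => real" where
  "av om E k j d = om (k + d, j div K ^ d) - E -
     (case d of 0 => cs om E k j | Suc i => sib om E (k + i) (j div K ^ i))"

text \<open>The sites that join the subtree when the path climbs by one layer. They carry the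
  coefficient \<open>av\<close> with the same index and no other.\<close>

definition Jb :: "nat => nat => nat => cvert set" where
  "Jb k j d = desc (k + d) (j div K ^ d) - (case d of 0 => {} | Suc i => desc (k + i) (j div K ^ i))"

lemma div_K_Suc: "j div K ^ d div K = j div K ^ Suc d"
  by (simp add: div_mult2_eq mult.commute[of K])

lemma inv_gp_0: "inverse (gp om E k j 0) = av om E k j 0"
  by (simp add: gp_def av_def gam_eq)

lemma inv_gp_Suc: "inverse (gp om E k j (Suc d)) = av om E k j (Suc d) - gp om E k j d"
proof -
  have "inverse (gp om E k j (Suc d)) = om (k + Suc d, j div K ^ Suc d) - E - cs om E (Suc (k + d)) (j div K ^ d div K)"
    unfolding gp_def gam_eq div_K_Suc by simp
  then show ?thesis unfolding cs_parent by (simp add: av_def gp_def)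
qed

text \<open>If the continuant of index d is that of index d - 1 divided by the Green function at
  step d, the three-term recursion becomes multiplication by the next coefficient minus that Green
  function, which is the next reciprocal.\<close>

lemma qq_gp:
  assumes "\<And>n j. gam om E n j \<noteq> 0"
  shows "qq (av om E k j) d = (\<Prod>i\<le>d. inverse (gp om E k j i))"
proof -
  have nz: "gp om E k j i \<noteq> 0" for i using assms by (simp add: gp_def)
  have "qq (av om E k j) d = (\<Prod>i\<le>d. inverse (gp om E k j i)) \<and>
    qq (av om E k j) (Suc d) = (\<Prod>i\<le>Suc d. inverse (gp om E k j i))"
  proof (induction d)
    case 0
    have a1: "av om E k j (Suc 0) = inverse (gp om E k j (Suc 0)) + gp om E k j 0"
      using inv_gp_Suc[of om E k j 0] by simp
    show ?case using nz[of 0] by (simp add: a1 inv_gp_0[symmetric] distrib_right)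
  next
    case (Suc d)
    have "qq (av om E k j) (Suc (Suc d)) = qq (av om E k j) (Suc d) * (av om E k j (Suc (Suc d)) - gp om E k j (Suc d))"
      using Suc nz[of "Suc d"] by (simp add: algebra_simps)
    also have "... = qq (av om E k j) (Suc d) * inverse (gp om E k j (Suc (Suc d)))"
      by (simp only: inv_gp_Suc)
    also have "... = (\<Prod>i\<le>Suc (Suc d). inverse (gp om E k j i))"
      using Suc by (simp only: prod.atMost_Suc[of _ "Suc d"])
    finally show ?case using Suc by simp
  qed
  then show ?thesis ..
qed

lemma Jb_disjoint:
  assumes "m \<noteq> m'" shows "Jb k j m \<inter> Jb k j m' = {}"
proof -
  have *: "Jb k j m \<inter> Jb k j m' = {}" if mm: "m < m'" for m m'
  proof -
    obtain i where i: "m' = Suc i" using mm by (cases m') auto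
    have "Jb k j m \<subseteq> desc (k + m) (j div K ^ m)" by (auto simp: Jb_def)
    also have "... \<subseteq> desc (k + i) (j div K ^ i)"
      using mm i by (intro desc_chain[OF canopy_model_axioms]) simp
    finally show ?thesis by (auto simp: Jb_def i)
  qed
  show ?thesis using *[of m m'] *[of m' m] assms by (cases "m < m'") auto
qed

lemma xv_Jb: "(k + d, j div K ^ d) \<in> Jb k j d"
  by (cases d) (auto simp: Jb_def desc_self parent_notin_desc)

lemma av_cong:
  assumes "\<And>v. v \<in> Jb k j d ==> om v = om' v"
  shows "av om E k j d = av om' E k j d"
proof -
  have 1: "om (k + d, j div K ^ d) = om' (k + d, j div K ^ d)" by (rule assms) (rule xv_Jb)
  show ?thesis
  proof (cases d)
    case 0
    have "cs om E k j = cs om' E k j" by (rule cs_cong, rule assms) (auto simp: Jb_def 0)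
    then show ?thesis using 1 by (simp add: av_def 0)
  next
    case (Suc i)
    have "sib om E (k + i) (j div K ^ i) = sib om' E (k + i) (j div K ^ i)"
      by (rule sib_cong, rule assms) (auto simp: Jb_def Suc div_K_Suc)
    then show ?thesis using 1 by (simp add: av_def Suc)
  qed
qed

lemma av_mrg: "d \<noteq> m ==> av (mrg (Jb k j m) om om') E k j d = av om E k j d"
  by (rule av_cong) (use Jb_disjoint[of d m k j] in \<open>auto simp: mrg_def\<close>)

lemma av_upd: "d \<noteq> m ==> av (fun_upd om (k + m, j div K ^ m) v) E k j d = av om E k j d"
  by (rule av_cong) (use Jb_disjoint[of d m k j] xv_Jb[of k m j] in auto)

lemma av_measurable [measurable]: "(%om. av om E k j d) \<in> borel_measurable Q"
  by (cases d) (auto simp: av_def)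

lemma qq_measurable:
  "(\<And>i. (%x. f x i) \<in> borel_measurable N) ==> (%x. qq (f x) n) \<in> borel_measurable N"
proof (induction n rule: less_induct)
  case (less n)
  show ?case
  proof (cases n)
    case 0
    then show ?thesis using less.prems by simp
  next
    case (Suc n')
    then show ?thesis using less.prems less.IH by (cases n') simp_all
  qed
qed

text \<open>The right-hand side of \<open>ln_affine_bound\<close> at r = s / 2, so that the doubled
  exponent is s, with the moments filled in.\<close>

definition Cv :: "real => real" where
  "Cv E = 4 / (s / 2)\<^sup>2 * (5 + 3 * (B0 + \<bar>E\<bar> powr s + A s) + A s)"

lemma Cv_nonneg: "0 \<le> Cv E"
  using A_pos[OF s_lt1] B0_nonneg by (simp add: Cv_def)

lemma av_moment: "(\<integral>\<^sup>+om. ennreal (\<bar>av om E k j d\<bar> powr s) \<partial>Q) \<le> ennreal (B0 + \<bar>E\<bar> powr s + A s)"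
proof -
  \<comment> \<open>The coefficient is regained from two Green functions on the path; for d = 0 the
    truncated \<open>d - 1\<close> only adds a nonnegative term.\<close>
  have le: "\<bar>av om E k j d\<bar> powr s \<le> norm (inverse (gam om (complex_of_real E) (k + d) (j div K ^ d))) powr s
     + norm (gam om (complex_of_real E) (k + (d - 1)) (j div K ^ (d - 1))) powr s" for om
  proof -
    have "\<bar>av om E k j d\<bar> \<le> \<bar>inverse (gp om E k j d)\<bar> + \<bar>gp om E k j (d - 1)\<bar>"
      using inv_gp_0[of om E k j] inv_gp_Suc[of om E k j "d - 1"] by (cases d) (auto intro: abs_triangle_ineq4)
    then have "\<bar>av om E k j d\<bar> powr s \<le> (\<bar>inverse (gp om E k j d)\<bar> + \<bar>gp om E k j (d - 1)\<bar>) powr s"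
      using s_pos by (intro powr_mono2) auto
    also have "... \<le> \<bar>inverse (gp om E k j d)\<bar> powr s + \<bar>gp om E k j (d - 1)\<bar> powr s"
      using s_pos s_lt1 by (intro powr_add_le) auto
    finally show ?thesis by (simp add: gp_def of_real_gam norm_inverse)
  qed
  have "(\<integral>\<^sup>+om. ennreal (\<bar>av om E k j d\<bar> powr s) \<partial>Q) \<le>
    (\<integral>\<^sup>+om. ennreal (norm (inverse (gam om (complex_of_real E) (k + d) (j div K ^ d))) powr s)
     + ennreal (norm (gam om (complex_of_real E) (k + (d - 1)) (j div K ^ (d - 1))) powr s) \<partial>Q)"
    using ennreal_leI[OF le] by (intro nn_integral_mono) (simp add: ennreal_plus)
  also have "... = (\<integral>\<^sup>+om. ennreal (norm (inverse (gam om (complex_of_real E) (k + d) (j div K ^ d))) powr s) \<partial>Q)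
     + (\<integral>\<^sup>+om. ennreal (norm (gam om (complex_of_real E) (k + (d - 1)) (j div K ^ (d - 1))) powr s) \<partial>Q)"
    by (rule nn_integral_add) measurable
  also have "... \<le> ennreal (B0 + norm (complex_of_real E) powr s) + ennreal (A s)"
    by (intro add_mono gam_inverse_moment gam_moment s_pos s_lt1)
  also have "... = ennreal (B0 + \<bar>E\<bar> powr s + A s)"
    using B0_nonneg A_pos[OF s_lt1] by (simp flip: ennreal_plus)
  finally show ?thesis .
qed

text \<open>Resampling one block changes a single coefficient, in which the continuant is affine
  with coefficients \<alpha> and \<beta> from the other blocks. Both values are compared with a
  centre c that the resampling does not affect, and both deviations have the same law. The singular
  moment of a + \<alpha> / \<beta> is finite by integrating over the path site alone, so the bound
  depends neither on n nor on m.\<close>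

lemma DJ_chain: "DJ (Jb k j m) (%om. ln \<bar>qq (av om E k j) n\<bar>) \<le> ennreal (4 * Cv E)"
proof -
  let ?f = "%om. ln \<bar>qq (av om E k j) n\<bar>" and ?x = "(k + m, j div K ^ m)"
  define \<alpha> where "\<alpha> om = qq ((av om E k j)(m := 0)) n" for om
  define \<beta> where "\<beta> om = qq ((av om E k j)(m := 1)) n - \<alpha> om" for om
  \<comment> \<open>When \<beta> vanishes the logarithm does not depend on the block, and c equals
    it.\<close>
  define c where "c om = (if \<beta> om = 0 then ln \<bar>\<alpha> om\<bar> else ln \<bar>\<beta> om\<bar> + ln (1 + \<bar>\<alpha> om / \<beta> om\<bar>))" for om
  have am [measurable]: "\<alpha> \<in> borel_measurable Q"
    unfolding \<alpha>_def[abs_def] by (rule qq_measurable) (simp add: fun_upd_def)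
  have bm [measurable]: "\<beta> \<in> borel_measurable Q"
    unfolding \<beta>_def[abs_def] by (intro borel_measurable_diff am qq_measurable) (simp add: fun_upd_def)
  have fm [measurable]: "?f \<in> borel_measurable Q"
  proof -
    have "(%om. qq (av om E k j) n) \<in> borel_measurable Q" by (rule qq_measurable) simp
    then show ?thesis by measurable
  qed
  have cm [measurable]: "c \<in> borel_measurable Q" unfolding c_def[abs_def] by measurable
  have upd_eq: "(av om1 E k j)(m := t) = (av om2 E k j)(m := t)" if "\<And>d. d \<noteq> m ==> av om1 E k j d = av om2 E k j d" for om1 om2 t
    using that by (auto simp: fun_eq_iff)
  have am1: "(av (mrg (Jb k j m) om om') E k j)(m := t) = (av om E k j)(m := t)" for om om' t
    by (rule upd_eq) (rule av_mrg)
  have am2: "(av (fun_upd om ?x v) E k j)(m := t) = (av om E k j)(m := t)" for om v t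
    by (rule upd_eq) (rule av_upd)
  have a_mrg: "\<alpha> (mrg (Jb k j m) om om') = \<alpha> om" for om om' by (simp only: \<alpha>_def am1)
  have b_mrg: "\<beta> (mrg (Jb k j m) om om') = \<beta> om" for om om' by (simp only: \<beta>_def a_mrg am1)
  note ab_mrg = a_mrg b_mrg
  have a_upd: "\<alpha> (fun_upd om ?x v) = \<alpha> om" for om v by (simp only: \<alpha>_def am2)
  have b_upd: "\<beta> (fun_upd om ?x v) = \<beta> om" for om v by (simp only: \<beta>_def a_upd am2)
  note ab_upd = a_upd b_upd
  have c_mrg: "c (mrg (Jb k j m) om om') = c om" for om om' by (simp add: c_def ab_mrg)
  have q_eq: "qq (av om E k j) n = \<alpha> om + av om E k j m * \<beta> om" for om
    using qq_affine[of "av om E k j" m "av om E k j m" n] by (simp add: \<alpha>_def \<beta>_def)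
  \<comment> \<open>Chosen such that a + \<alpha> / \<beta> is the potential at the path site minus
    a quantity free of that potential.\<close>
  define h where "h om = complex_of_real (E + (case m of 0 => cs om E k j | Suc i => sib om E (k + i) (j div K ^ i)) - \<alpha> om / \<beta> om)" for om
  have hm [measurable]: "h \<in> borel_measurable Q"
    unfolding h_def[abs_def] by (cases m) (simp_all del: of_real_add of_real_diff)
  have h_upd: "h (fun_upd om ?x v) = h om" for om v
  proof (cases m)
    case 0
    then show ?thesis using ab_upd[of om v] by (simp add: h_def cs_upd)
  next
    case (Suc i)
    have "sib (fun_upd om ?x v) E (k + i) (j div K ^ i) = sib om E (k + i) (j div K ^ i)"
      using sib_upd[of om "k + i" "j div K ^ i" v E] unfolding div_K_Suc Suc by simp
    then show ?thesis using ab_upd[of om v] by (simp add: h_def Suc)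
  qed
  have h_eq: "of_real (om ?x) - h om = complex_of_real (av om E k j m + \<alpha> om / \<beta> om)" for om
    unfolding h_def of_real_diff[symmetric] by (intro arg_cong[of _ _ of_real]) (simp add: av_def)
  have AE_n: "AE om in Q. av om E k j m + \<alpha> om / \<beta> om \<noteq> 0"
  proof -
    have "AE om in Q. of_real (om ?x) - h om \<noteq> 0" by (rule AE_site_neq[OF hm h_upd])
    then show ?thesis unfolding h_eq by (simp only: of_real_eq_0_iff)
  qed
  have fmom: "(\<integral>\<^sup>+om. ennreal (\<bar>av om E k j m + \<alpha> om / \<beta> om\<bar> powr (- s)) \<partial>Q) \<le> ennreal (A s)"
  proof -
    have "(\<integral>\<^sup>+om. ennreal (norm (inverse (of_real (om ?x) - h om)) powr s) \<partial>Q) \<le> ennreal (A s)"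
      by (rule fractional_moment[OF s_pos s_lt1 hm h_upd])
    then show ?thesis unfolding h_eq by (simp only: norm_inverse norm_of_real inverse_powr powr_minus abs_ge_zero)
  qed
  define X where "X = (\<integral>\<^sup>+om. ennreal ((?f om - c om)\<^sup>2) \<partial>Q)"
  have X: "X \<le> ennreal (Cv E)"
  proof -
    let ?C = "4 / (s / 2)\<^sup>2"
    have "X \<le> (\<integral>\<^sup>+om. ennreal ?C * (ennreal 5 + ennreal 3 * ennreal (\<bar>av om E k j m\<bar> powr s) + ennreal (\<bar>av om E k j m + \<alpha> om / \<beta> om\<bar> powr (- s))) \<partial>Q)"
      unfolding X_def
    proof (rule nn_integral_mono_AE)
      show "AE om in Q. ennreal ((?f om - c om)\<^sup>2) \<le> ennreal ?C * (ennreal 5 + ennreal 3 * ennreal (\<bar>av om E k j m\<bar> powr s) + ennreal (\<bar>av om E k j m + \<alpha> om / \<beta> om\<bar> powr (- s)))"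
        using AE_n
      proof eventually_elim
        case (elim om)
        let ?R = "?C * (5 + 3 * \<bar>av om E k j m\<bar> powr s + \<bar>av om E k j m + \<alpha> om / \<beta> om\<bar> powr (- s))"
        have "(?f om - c om)\<^sup>2 \<le> ?R"
        proof (cases "\<beta> om = 0")
          case True
          then have "?f om - c om = 0" by (simp add: q_eq c_def)
          then show ?thesis by simp
        next
          case False
          have h: "0 < s / 2" "s / 2 \<le> 1" "2 * (s / 2) = s" using s_pos s_lt1 by auto
          have "(ln \<bar>\<alpha> om + av om E k j m * \<beta> om\<bar> - (ln \<bar>\<beta> om\<bar> + ln (1 + \<bar>\<alpha> om / \<beta> om\<bar>)))\<^sup>2 \<le> ?R"
            using ln_affine_bound[OF h(1,2) False elim] unfolding h(3) by (simp only: mult.commute)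
          then show ?thesis using False by (simp only: q_eq c_def if_False)
        qed
        then have "ennreal ((?f om - c om)\<^sup>2) \<le> ennreal ?R" by (rule ennreal_leI)
        also have "ennreal ?R = ennreal ?C * ennreal (5 + 3 * \<bar>av om E k j m\<bar> powr s + \<bar>av om E k j m + \<alpha> om / \<beta> om\<bar> powr (- s))"
          by (rule ennreal_mult) auto
        also have "ennreal (5 + 3 * \<bar>av om E k j m\<bar> powr s + \<bar>av om E k j m + \<alpha> om / \<beta> om\<bar> powr (- s))
          = ennreal 5 + ennreal (3 * \<bar>av om E k j m\<bar> powr s) + ennreal (\<bar>av om E k j m + \<alpha> om / \<beta> om\<bar> powr (- s))"
          by (subst ennreal_plus, simp, simp, subst ennreal_plus) simp_all
        also have "ennreal (3 * \<bar>av om E k j m\<bar> powr s) = ennreal 3 * ennreal (\<bar>av om E k j m\<bar> powr s)"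
          by (rule ennreal_mult) auto
        finally show ?case .
      qed
    qed
    also have "... = ennreal ?C * (ennreal 5 + ennreal 3 * (\<integral>\<^sup>+om. ennreal (\<bar>av om E k j m\<bar> powr s) \<partial>Q) + (\<integral>\<^sup>+om. ennreal (\<bar>av om E k j m + \<alpha> om / \<beta> om\<bar> powr (- s)) \<partial>Q))"
      by (simp add: nn_integral_cmult nn_integral_add Q.emeasure_space_1[simplified])
    also have "... \<le> ennreal ?C * (ennreal 5 + ennreal 3 * ennreal (B0 + \<bar>E\<bar> powr s + A s) + ennreal (A s))"
      by (intro mult_left_mono add_mono av_moment fmom order_refl) auto
    also have "... = ennreal (Cv E)"
    proof -
      have nn: "0 \<le> B0 + \<bar>E\<bar> powr s + A s" "0 \<le> A s" using B0_nonneg A_pos[OF s_lt1] by auto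
      have "ennreal (Cv E) = ennreal ?C * ennreal (5 + 3 * (B0 + \<bar>E\<bar> powr s + A s) + A s)"
        unfolding Cv_def using nn by (intro ennreal_mult) auto
      also have "ennreal (5 + 3 * (B0 + \<bar>E\<bar> powr s + A s) + A s) = ennreal 5 + ennreal (3 * (B0 + \<bar>E\<bar> powr s + A s)) + ennreal (A s)"
        using nn by (subst ennreal_plus, simp, simp, subst ennreal_plus) auto
      also have "ennreal (3 * (B0 + \<bar>E\<bar> powr s + A s)) = ennreal 3 * ennreal (B0 + \<bar>E\<bar> powr s + A s)"
        using nn by (intro ennreal_mult) auto
      finally show ?thesis by simp
    qed
    finally show ?thesis .
  qed
  have "DJ (Jb k j m) ?f \<le> (\<integral>\<^sup>+om. \<integral>\<^sup>+om'. 2 * ennreal ((?f om - c om)\<^sup>2) + 2 * ennreal ((?f (mrg (Jb k j m) om om') - c (mrg (Jb k j m) om om'))\<^sup>2) \<partial>Q \<partial>Q)"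
    unfolding DJ_def c_mrg
  proof (intro nn_integral_mono)
    fix om om'
    have sq: "(x - y)\<^sup>2 \<le> 2 * (x - z)\<^sup>2 + 2 * (y - z)\<^sup>2" for x y z :: real
      using zero_le_power2[of "x + y - 2 * z"] by (simp add: power2_eq_square algebra_simps)
    have "ennreal ((?f om - ?f (mrg (Jb k j m) om om'))\<^sup>2) \<le> ennreal (2 * (?f om - c om)\<^sup>2 + 2 * (?f (mrg (Jb k j m) om om') - c om)\<^sup>2)"
      by (intro ennreal_leI sq)
    also have "... = 2 * ennreal ((?f om - c om)\<^sup>2) + 2 * ennreal ((?f (mrg (Jb k j m) om om') - c om)\<^sup>2)"
      by (subst ennreal_plus) (simp_all add: ennreal_mult)
    finally show "ennreal ((?f om - ?f (mrg (Jb k j m) om om'))\<^sup>2) \<le> 2 * ennreal ((?f om - c om)\<^sup>2) + 2 * ennreal ((?f (mrg (Jb k j m) om om') - c om)\<^sup>2)" .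
  qed
  also have "... = (\<integral>\<^sup>+om. 2 * ennreal ((?f om - c om)\<^sup>2) + (\<integral>\<^sup>+om'. 2 * ennreal ((?f (mrg (Jb k j m) om om') - c (mrg (Jb k j m) om om'))\<^sup>2) \<partial>Q) \<partial>Q)"
  proof (rule nn_integral_cong)
    fix om
    have "(%om'. mrg (Jb k j m) om om') \<in> measurable Q Q" by (rule mrg_meas2) auto
    then have "(%om'. 2 * ennreal ((?f (mrg (Jb k j m) om om') - c (mrg (Jb k j m) om om'))\<^sup>2)) \<in> borel_measurable Q"
      by (rule measurable_compose) measurable
    then show "(\<integral>\<^sup>+om'. 2 * ennreal ((?f om - c om)\<^sup>2) + 2 * ennreal ((?f (mrg (Jb k j m) om om') - c (mrg (Jb k j m) om om'))\<^sup>2) \<partial>Q)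
      = 2 * ennreal ((?f om - c om)\<^sup>2) + (\<integral>\<^sup>+om'. 2 * ennreal ((?f (mrg (Jb k j m) om om') - c (mrg (Jb k j m) om om'))\<^sup>2) \<partial>Q)"
      by (subst nn_integral_add) (simp_all add: Q.emeasure_space_1[simplified])
  qed
  also have "... = (\<integral>\<^sup>+om. 2 * ennreal ((?f om - c om)\<^sup>2) \<partial>Q) + (\<integral>\<^sup>+om. \<integral>\<^sup>+om'. 2 * ennreal ((?f (mrg (Jb k j m) om om') - c (mrg (Jb k j m) om om'))\<^sup>2) \<partial>Q \<partial>Q)"
    by (rule nn_integral_add) measurable
  also have "(\<integral>\<^sup>+om. \<integral>\<^sup>+om'. 2 * ennreal ((?f (mrg (Jb k j m) om om') - c (mrg (Jb k j m) om om'))\<^sup>2) \<partial>Q \<partial>Q) = (\<integral>\<^sup>+om. 2 * ennreal ((?f om - c om)\<^sup>2) \<partial>Q)"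
    by (rule nn_resample[symmetric]) measurable
  also have "(\<integral>\<^sup>+om. 2 * ennreal ((?f om - c om)\<^sup>2) \<partial>Q) = 2 * X"
    unfolding X_def by (rule nn_integral_cmult) measurable
  also have "2 * X + 2 * X = 4 * X" by (simp flip: distrib_right)
  also have "... \<le> 4 * ennreal (Cv E)" by (intro mult_left_mono X) auto
  also have "... = ennreal (4 * Cv E)" using Cv_nonneg by (simp add: ennreal_mult)
  finally show ?thesis .
qed

definition Sn :: "(cvert => real) => real => nat => nat => nat => real" where
  "Sn om E k j n = (\<Sum>i\<le>n. lng om (of_real E) (k + i) (j div K ^ i))"

lemma Sn_measurable [measurable]: "(%om. Sn om E k j n) \<in> borel_measurable Q"
  by (simp add: Sn_def)

lemma Sn_sq_integrable: "integrable Q (%om. (Sn om E k j n)\<^sup>2)"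
proof (rule Bochner_Integration.integrable_bound)
  show "integrable Q (%om. (\<Sum>i\<le>n. 1\<^sup>2) * (\<Sum>i\<le>n. (lng om (of_real E) (k + i) (j div K ^ i))\<^sup>2))"
    by (intro integrable_mult_right Bochner_Integration.integrable_sum integrable_lng_sq)
  show "AE om in Q. norm ((Sn om E k j n)\<^sup>2) \<le> norm ((\<Sum>i\<le>n. 1\<^sup>2) * (\<Sum>i\<le>n. (lng om (of_real E) (k + i) (j div K ^ i))\<^sup>2))"
  proof (rule AE_I2)
    fix om
    have "(\<Sum>i\<le>n. 1 * lng om (of_real E) (k + i) (j div K ^ i))\<^sup>2 \<le> (\<Sum>i\<le>n. 1\<^sup>2) * (\<Sum>i\<le>n. (lng om (of_real E) (k + i) (j div K ^ i))\<^sup>2)"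
      by (rule Cauchy_Schwarz_ineq_sum)
    then have "(Sn om E k j n)\<^sup>2 \<le> (\<Sum>i\<le>n. 1\<^sup>2) * (\<Sum>i\<le>n. (lng om (of_real E) (k + i) (j div K ^ i))\<^sup>2)"
      by (simp only: Sn_def mult_1)
    also have "... \<le> \<bar>(\<Sum>i\<le>n. 1\<^sup>2) * (\<Sum>i\<le>n. (lng om (of_real E) (k + i) (j div K ^ i))\<^sup>2)\<bar>" by (rule abs_ge_self)
    finally show "norm ((Sn om E k j n)\<^sup>2) \<le> norm ((\<Sum>i\<le>n. 1\<^sup>2) * (\<Sum>i\<le>n. (lng om (of_real E) (k + i) (j div K ^ i))\<^sup>2))"
      by (simp only: real_norm_def abs_power2)
  qed
qed measurable

lemma Sn_qq: "AE om in Q. ln \<bar>qq (av om E k j) n\<bar> = - Sn om E k j n"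
  using AE_gam_real_neq[of E]
proof eventually_elim
  case (elim om)
  then have nz: "gp om E k j i \<noteq> 0" for i by (simp add: gp_def)
  have "\<bar>qq (av om E k j) n\<bar> = (\<Prod>i\<le>n. \<bar>inverse (gp om E k j i)\<bar>)"
    using qq_gp[of om E k j n] elim by (simp add: abs_prod)
  then have "ln \<bar>qq (av om E k j) n\<bar> = (\<Sum>i\<le>n. ln \<bar>inverse (gp om E k j i)\<bar>)"
    using nz by (simp add: ln_prod)
  also have "... = (\<Sum>i\<le>n. - lng om (of_real E) (k + i) (j div K ^ i))"
    using nz by (intro sum.cong refl) (simp add: lng_def of_real_gam gp_def ln_inverse)
  finally show ?case by (simp add: Sn_def sum_negf)
qed

lemma Sn_mean: "(\<integral>om. Sn om E k j n \<partial>Q) = (\<Sum>i\<le>n. fL (k + i) (of_real E))"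
  unfolding Sn_def by (subst Bochner_Integration.integral_sum) (auto simp: fL_eq intro: integrable_lng)

text \<open>The summands are strongly dependent, since each Green function on the path contains all
  earlier ones, but as a function of disjoint blocks the sum has bounded influences. Hence a
  variance linear in n.\<close>

lemma Sn_variance: "Q.variance (%om. Sn om E k j n) \<le> real (Suc n) * (2 * Cv E)"
proof -
  let ?f = "%om. ln \<bar>qq (av om E k j) n\<bar>"
  have fm [measurable]: "?f \<in> borel_measurable Q"
  proof -
    have "(%om. qq (av om E k j) n) \<in> borel_measurable Q" by (rule qq_measurable) simp
    then show ?thesis by measurable
  qed
  have f2: "integrable Q (%om. (?f om)\<^sup>2)"
  proof (rule integrable_cong_AE_imp[OF Sn_sq_integrable[of E k j n]])
    show "AE om in Q. (Sn om E k j n)\<^sup>2 = (?f om)\<^sup>2"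
      using Sn_qq[of E k j n] by eventually_elim simp
  qed measurable
  have i1: "integrable Q (%om. Sn om E k j n)"
    by (rule integrable_of_sq[OF Q.finite_measure_axioms _ Sn_sq_integrable]) simp
  have e1: "(\<integral>om. ?f om \<partial>Q) = - (\<integral>om. Sn om E k j n \<partial>Q)"
  proof -
    have "(\<integral>om. ?f om \<partial>Q) = (\<integral>om. - Sn om E k j n \<partial>Q)"
      by (rule integral_cong_AE) (use Sn_qq[of E k j n] in auto)
    then show ?thesis by simp
  qed
  have e2: "(\<integral>om. (?f om)\<^sup>2 \<partial>Q) = (\<integral>om. (Sn om E k j n)\<^sup>2 \<partial>Q)"
  proof (rule integral_cong_AE)
    show "AE om in Q. (?f om)\<^sup>2 = (Sn om E k j n)\<^sup>2" using Sn_qq[of E k j n] by eventually_elim simp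
  qed measurable
  have "ennreal (Q.variance (%om. Sn om E k j n)) = ennreal ((\<integral>om. (?f om)\<^sup>2 \<partial>Q) - (\<integral>om. ?f om \<partial>Q)\<^sup>2)"
    unfolding e1 e2 by (subst Q.variance_eq[OF i1 Sn_sq_integrable]) simp
  also have "... \<le> (\<Sum>m<Suc n. ennreal (1/2) * DJ (Jb k j m) ?f)"
  proof (rule efron_stein[OF fm f2])
    show "\<forall>om om'. (\<forall>m<Suc n. \<forall>v\<in>Jb k j m. om v = om' v) --> ?f om = ?f om'"
    proof (intro allI impI)
      fix om om' :: "cvert => real" assume eq: "\<forall>m<Suc n. \<forall>v\<in>Jb k j m. om v = om' v"
      have "qq (av om E k j) n = qq (av om' E k j) n"
        by (rule qq_cong, rule av_cong) (use eq in \<open>auto simp: less_Suc_eq_le\<close>)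
      then show "?f om = ?f om'" by simp
    qed
  qed (rule Jb_disjoint)
  also have "... \<le> (\<Sum>m<Suc n. ennreal (1/2) * ennreal (4 * Cv E))"
    by (intro sum_mono mult_left_mono DJ_chain) auto
  also have "... = ennreal (real (Suc n) * (2 * Cv E))"
  proof -
    have "ennreal (1/2) * ennreal (4 * Cv E) = ennreal (2 * Cv E)"
      using ennreal_mult'[of "1/2" "4 * Cv E"] by simp
    then show ?thesis
      by (simp only: sum_constant card_lessThan ennreal_of_nat_eq_real_of_nat) (rule ennreal_mult'[symmetric], simp)
  qed
  finally show ?thesis using Cv_nonneg[of E] by (subst (asm) ennreal_le_iff) auto
qed

text \<open>Borel-Cantelli with the thresholds (i + 1)^2 for the s-th power of the modulus, whose
  reciprocals are summable. Only upper bounds on single factors are needed, to fill the gaps between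
  sampled times.\<close>

lemma AE_lng_le: "AE om in Q. \<forall>\<^sub>F i in sequentially. lng om (of_real E) (k + i) (j div K ^ i) \<le> 2 / s * ln (real i + 1)"
proof -
  define f where "f i om = cmod (gam om (of_real E) (k + i) (j div K ^ i)) powr s" for i om
  define B where "B i = {om \<in> space Q. 1 \<le> ennreal (1 / (real i + 1)\<^sup>2) * ennreal (f i om)}" for i
  have fm [measurable]: "f i \<in> borel_measurable Q" for i unfolding f_def by measurable
  have Bm: "B i \<in> sets Q" for i unfolding B_def by measurable
  have mB: "measure Q (B i) \<le> A s * (1 / (real i + 1)\<^sup>2)" for i
  proof -
    have "emeasure Q (B i) \<le> ennreal (1 / (real i + 1)\<^sup>2) * (\<integral>\<^sup>+om. ennreal (f i om) * indicator (space Q) om \<partial>Q)"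
      unfolding B_def by (rule nn_integral_Markov_inequality) measurable
    also have "(\<integral>\<^sup>+om. ennreal (f i om) * indicator (space Q) om \<partial>Q) = (\<integral>\<^sup>+om. ennreal (f i om) \<partial>Q)"
      by (intro nn_integral_cong) simp
    also have "... \<le> ennreal (A s)" unfolding f_def by (rule gam_moment[OF s_pos s_lt1])
    finally have "emeasure Q (B i) \<le> ennreal (1 / (real i + 1)\<^sup>2) * ennreal (A s)" by (simp add: mult_left_mono)
    also have "... = ennreal (A s * (1 / (real i + 1)\<^sup>2))"
      using A_pos[OF s_lt1] by (subst ennreal_mult[symmetric]) (auto simp: mult.commute)
    finally show ?thesis
      using A_pos[OF s_lt1] by (simp add: Q.emeasure_eq_measure)
  qed
  have "summable (%i. 1 / (real i + 1)\<^sup>2)" using sums_summable[OF inverse_squares_sums] by (simp add: add.commute)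
  then have "summable (%i. A s * (1 / (real i + 1)\<^sup>2))" by (rule summable_mult)
  then have "summable (%i. measure Q (B i))"
    by (rule summable_comparison_test'[where N = 0]) (use mB in auto)
  then have "AE om in Q. \<forall>\<^sub>F i in sequentially. om \<in> space Q - B i"
    by (intro borel_cantelli_AE1 Bm) (auto simp: Q.emeasure_eq_measure)
  then show ?thesis
  proof eventually_elim
    case (elim om)
    then show ?case
    proof eventually_elim
      case (elim i)
      let ?g = "cmod (gam om (of_real E) (k + i) (j div K ^ i))"
      have p: "0 < (real i + 1)\<^sup>2" by simp
      have "\<not> 1 \<le> ennreal (1 / (real i + 1)\<^sup>2) * ennreal (f i om)" using elim by (simp add: B_def)
      also have "ennreal (1 / (real i + 1)\<^sup>2) * ennreal (f i om) = ennreal (1 / (real i + 1)\<^sup>2 * f i om)"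
        by (rule ennreal_mult[symmetric]) (auto simp: f_def)
      finally have "1 / (real i + 1)\<^sup>2 * f i om < 1" by (simp add: not_le)
      then have fl: "?g powr s < (real i + 1)\<^sup>2" using p by (simp add: field_simps f_def)
      show ?case
      proof (cases "?g = 0")
        case True
        then show ?thesis using s_pos by (simp add: lng_def)
      next
        case False
        then have "ln (?g powr s) < ln ((real i + 1)\<^sup>2)" using fl by (subst ln_less_cancel_iff) auto
        then have "s * ln ?g < 2 * ln (real i + 1)" using False by (simp add: ln_powr ln_realpow)
        then show ?thesis using s_pos by (simp add: lng_def field_simps)
      qed
    qed
  qed
qed

text \<open>A variance linear in n gives Chebyshev probabilities of order 1/n, which are not
  summable. Along the squares they are, and between two consecutive squares there are at most 2 sqrt
  n further factors, each contributing at most a multiple of ln n.\<close>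

lemma decay_Sn:
  assumes g: "0 < \<gamma>" and C: "\<forall>N. (\<Sum>n<N. fL n (of_real E)) \<le> C - real N * (h + \<gamma>)" and h: "0 \<le> h"
  shows "AE om in Q. \<forall>\<^sub>F n in sequentially. Sn om E k j n \<le> - real n * (h + \<gamma> / 2)"
proof -
  let ?\<mu> = "%n. \<integral>om. Sn om E k j n \<partial>Q"
  define C' where "C' = C - (\<Sum>n<k. fL n (of_real E))"
  have mean: "?\<mu> n \<le> C' - real n * (h + \<gamma>)" for n
  proof -
    have "(\<Sum>i<k + Suc n. fL i (of_real E)) = (\<Sum>i<k. fL i (of_real E)) + (\<Sum>i<Suc n. fL (k + i) (of_real E))"
    proof (induction n)
      case (Suc n)
      then show ?case by (simp add: algebra_simps)
    qed simp
    then have "?\<mu> n \<le> C' - real (k + Suc n) * (h + \<gamma>)"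
      using C[rule_format, of "k + Suc n"] by (simp add: Sn_mean C'_def lessThan_Suc_atMost)
    also have "... \<le> C' - real n * (h + \<gamma>)" using g h by (intro diff_left_mono mult_right_mono) auto
    finally show ?thesis .
  qed
  \<comment> \<open>The shift by 1 avoids a vanishing sample index in the Chebyshev bound.\<close>
  define q where "q m = (m + 1)\<^sup>2" for m :: nat
  define B where "B m = {om \<in> space Q. \<gamma> / 4 * real (q m) \<le> \<bar>Sn om E k j (q m) - ?\<mu> (q m)\<bar>}" for m
  have Bm: "B m \<in> sets Q" for m unfolding B_def by measurable
  have mB: "measure Q (B m) \<le> 64 * Cv E / \<gamma>\<^sup>2 * (1 / (real m + 1)\<^sup>2)" for m
  proof -
    have q1: "1 \<le> real (q m)" and qp: "0 < real (q m)" by (auto simp: q_def)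
    have "measure Q (B m) \<le> Q.variance (%om. Sn om E k j (q m)) / (\<gamma> / 4 * real (q m))\<^sup>2"
      unfolding B_def by (rule Q.Chebyshev_inequality) (use g qp Sn_sq_integrable in auto)
    also have "... \<le> (real (Suc (q m)) * (2 * Cv E)) / (\<gamma> / 4 * real (q m))\<^sup>2"
      by (intro divide_right_mono Sn_variance) simp
    also have "... \<le> (2 * real (q m) * (2 * Cv E)) / (\<gamma> / 4 * real (q m))\<^sup>2"
      using q1 Cv_nonneg by (intro divide_right_mono mult_right_mono) auto
    also have "... = 64 * Cv E / \<gamma>\<^sup>2 * (1 / real (q m))"
      using qp g by (simp add: field_simps power2_eq_square)
    finally show ?thesis by (simp add: q_def add.commute)
  qed
  have "summable (%i. 1 / (real i + 1)\<^sup>2)" using sums_summable[OF inverse_squares_sums] by (simp add: add.commute)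
  then have "summable (%i. 64 * Cv E / \<gamma>\<^sup>2 * (1 / (real i + 1)\<^sup>2))" by (rule summable_mult)
  then have "summable (%i. measure Q (B i))"
    by (rule summable_comparison_test'[where N = 0]) (use mB in auto)
  then have "AE om in Q. \<forall>\<^sub>F m in sequentially. om \<in> space Q - B m"
    by (intro borel_cantelli_AE1 Bm) (auto simp: Q.emeasure_eq_measure)
  then show ?thesis using AE_lng_le[of E k j]
  proof eventually_elim
    case (elim om)
    obtain m0 where m0: "\<And>m. m0 \<le> m ==> om \<notin> B m"
      using elim(1) by (auto simp: eventually_sequentially)
    obtain i0 where i0: "\<And>i. i0 \<le> i ==> lng om (of_real E) (k + i) (j div K ^ i) \<le> 2 / s * ln (real i + 1)"
      using elim(2) by (auto simp: eventually_sequentially)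
    \<comment> \<open>A quarter of \<gamma> went into the Chebyshev deviation; another quarter
      absorbs the constant, the rounding to the last square and the factors after it.\<close>
    have "\<forall>\<^sub>F n in sequentially. \<bar>C'\<bar> + 2 * sqrt (real n) * (h + 3 / 4 * \<gamma>) + 2 * sqrt (real n) * (2 / s * ln (real n + 1)) \<le> real n * (\<gamma> / 4)"
      using g h s_pos by real_asymp
    moreover have "\<forall>\<^sub>F n in sequentially. (m0 + 1)\<^sup>2 \<le> n \<and> (i0 + 1)\<^sup>2 \<le> n"
      by (intro eventually_conj eventually_ge_at_top)
    ultimately show ?case
    proof eventually_elim
      case (elim n)
      define m where "m = nat \<lfloor>sqrt (real n)\<rfloor>"
      have m1: "real m \<le> sqrt (real n)" by (simp add: m_def)
      have m2: "sqrt (real n) < real m + 1" by (simp add: m_def)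
      have "(real m)\<^sup>2 \<le> (sqrt (real n))\<^sup>2" using m1 by (intro power_mono) auto
      then have "real (m\<^sup>2) \<le> real n" by simp
      then have m3: "m\<^sup>2 \<le> n" by (simp only: of_nat_le_iff)
      have "(sqrt (real n))\<^sup>2 < (real m + 1)\<^sup>2" using m2 by (intro power_strict_mono) auto
      then have "real n < real ((m + 1)\<^sup>2)" by (simp add: algebra_simps)
      then have "n < (m + 1)\<^sup>2" by (simp only: of_nat_less_iff)
      then have m4: "n \<le> m\<^sup>2 + 2 * m" by (simp add: power2_eq_square)
      have ge: "x + 1 \<le> m" if "(x + 1)\<^sup>2 \<le> n" for x
      proof -
        have "real ((x + 1)\<^sup>2) \<le> real n" using that by (simp only: of_nat_le_iff)
        then have "real (x + 1) \<le> sqrt (real n)" by (intro real_le_rsqrt) simp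
        then have "real (x + 1) < real m + 1" using m2 by linarith
        then show ?thesis by linarith
      qed
      have mm: "m0 + 1 \<le> m" "i0 + 1 \<le> m" using ge[of m0] ge[of i0] elim(2) by blast+
      have "m \<le> m\<^sup>2" by (simp add: power2_eq_square)
      then have im: "i0 \<le> m\<^sup>2" using mm by linarith
      have qm: "q (m - 1) = m\<^sup>2" using mm by (simp add: q_def)
      have "om \<notin> B (m - 1)" using mm by (intro m0) simp
      then have "\<bar>Sn om E k j (m\<^sup>2) - ?\<mu> (m\<^sup>2)\<bar> < \<gamma> / 4 * real (m\<^sup>2)"
        unfolding B_def qm by simp
      then have s1: "Sn om E k j (m\<^sup>2) \<le> C' - real (m\<^sup>2) * (h + \<gamma>) + \<gamma> / 4 * real (m\<^sup>2)"
        using mean[of "m\<^sup>2"] by linarith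
      let ?L = "2 / s * ln (real n + 1)"
      have L: "0 \<le> ?L" using s_pos by simp
      have un: "{..n} = {..m\<^sup>2} \<union> {m\<^sup>2<..n}" using m3 by auto
      have "Sn om E k j n = Sn om E k j (m\<^sup>2) + (\<Sum>i\<in>{m\<^sup>2<..n}. lng om (of_real E) (k + i) (j div K ^ i))"
        unfolding Sn_def un by (rule sum.union_disjoint) auto
      also have "... \<le> Sn om E k j (m\<^sup>2) + (\<Sum>i\<in>{m\<^sup>2<..n}. ?L)"
      proof (intro add_left_mono sum_mono)
        fix i assume i: "i \<in> {m\<^sup>2<..n}"
        then have "lng om (of_real E) (k + i) (j div K ^ i) \<le> 2 / s * ln (real i + 1)" using im by (intro i0) auto
        also have "... \<le> ?L" using i s_pos by (intro mult_left_mono) auto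
        finally show "lng om (of_real E) (k + i) (j div K ^ i) \<le> ?L" .
      qed
      also have "(\<Sum>i\<in>{m\<^sup>2<..n}. ?L) = real (n - m\<^sup>2) * ?L" by simp
      also have "real (n - m\<^sup>2) * ?L \<le> (2 * sqrt (real n)) * ?L"
      proof (rule mult_right_mono[OF _ L])
        have "real (n - m\<^sup>2) \<le> real (2 * m)" using m4 by (intro of_nat_mono) simp
        then show "real (n - m\<^sup>2) \<le> 2 * sqrt (real n)" using m1 by simp
      qed
      finally have s2: "Sn om E k j n \<le> Sn om E k j (m\<^sup>2) + 2 * sqrt (real n) * ?L" by simp
      have "real n \<le> real (m\<^sup>2 + 2 * m)" using m4 by (simp only: of_nat_le_iff)
      then have "real n - 2 * sqrt (real n) \<le> real (m\<^sup>2)" using m1 by simp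
      then have s3: "(real n - 2 * sqrt (real n)) * (h + 3 / 4 * \<gamma>) \<le> real (m\<^sup>2) * (h + 3 / 4 * \<gamma>)"
        using g h by (intro mult_right_mono) auto
      have "C' \<le> \<bar>C'\<bar>" by simp
      moreover define H where "H = h + 3 / 4 * \<gamma>"
      define X where "X = 2 * sqrt (real n) * ?L"
      have "C' - real (m\<^sup>2) * (h + \<gamma>) + \<gamma> / 4 * real (m\<^sup>2) = C' - real (m\<^sup>2) * H" by (simp add: H_def algebra_simps)
      moreover have "(real n - 2 * sqrt (real n)) * H = real n * H - 2 * sqrt (real n) * H" by (simp add: algebra_simps)
      moreover have "real n * H - real n * (\<gamma> / 4) = real n * (h + \<gamma> / 2)" by (simp add: H_def algebra_simps)
      moreover have "- real n * (h + \<gamma> / 2) = - (real n * (h + \<gamma> / 2))" by simp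
      ultimately show ?case using s1 s2 s3 elim(1) unfolding X_def[symmetric] H_def[symmetric] by linarith
    qed
  qed
qed

lemma decay:
  assumes g: "0 < \<gamma>" and C: "\<forall>N. (\<Sum>n<N. fL n (of_real E)) \<le> C - real N * (h + \<gamma>)" and h: "0 \<le> h"
  shows "AE om in Q. \<forall>\<^sub>F n in sequentially. \<bar>\<Prod>i\<le>n. gp om E k j i\<bar> \<le> exp (- real n * (h + \<gamma> / 2))"
  using decay_Sn[OF assms, of k j] AE_gam_real_neq[of E]
proof eventually_elim
  case (elim om)
  from elim(1) show ?case
  proof eventually_elim
    case (elim n)
    have nz: "gp om E k j i \<noteq> 0" for i using \<open>\<forall>n j. gam om E n j \<noteq> 0\<close> by (simp add: gp_def)
    have "\<bar>\<Prod>i\<le>n. gp om E k j i\<bar> = (\<Prod>i\<le>n. exp (lng om (of_real E) (k + i) (j div K ^ i)))"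
      unfolding abs_prod
    proof (rule prod.cong[OF refl])
      fix i
      show "\<bar>gp om E k j i\<bar> = exp (lng om (of_real E) (k + i) (j div K ^ i))"
        using nz[of i] by (simp add: lng_def of_real_gam gp_def)
    qed
    also have "... = exp (Sn om E k j n)" by (simp add: Sn_def exp_sum)
    also have "... \<le> exp (- real n * (h + \<gamma> / 2))" using elim by simp
    finally show ?case .
  qed
qed

end

section \<open>Derivative of the finite-volume Green function along the path\<close>

text \<open>Here G i stands for the subtree Green function at the i-th vertex of the path. Then
  \<open>pF\<close> is the expansion of the finite-volume Green function at the lowest vertex,
  \<open>dP\<close> is the derivative of the product of the first factors, and \<open>dF\<close>
  that of \<open>pF\<close>, with dG for the derivative of G.\<close>

primrec pF :: "(nat => real) => nat => real" where
  "pF G 0 = G 0"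
| "pF G (Suc n) = pF G n + (\<Prod>i\<le>n. G i)\<^sup>2 * G (Suc n)"

primrec dP :: "(nat => real) => (nat => real) => nat => real" where
  "dP G dG 0 = dG 0"
| "dP G dG (Suc n) = dP G dG n * G (Suc n) + (\<Prod>i\<le>n. G i) * dG (Suc n)"

primrec dF :: "(nat => real) => (nat => real) => nat => real" where
  "dF G dG 0 = dG 0"
| "dF G dG (Suc n) = dF G dG n + 2 * (\<Prod>i\<le>n. G i) * dP G dG n * G (Suc n) + (\<Prod>i\<le>n. G i)\<^sup>2 * dG (Suc n)"

text \<open>\<open>pF\<close> grows at the upper end of the path, whereas \<open>gF_Suc\<close>
  attaches a vertex at the lower end. This lemma and the next two reconcile the two
  directions.\<close>

lemma pF_shift: "pF G (Suc n) = G 0 + (G 0)\<^sup>2 * pF (%i. G (Suc i)) n"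
proof (induction n)
  case (Suc n)
  have "pF G (Suc (Suc n)) = pF G (Suc n) + (\<Prod>i\<le>Suc n. G i)\<^sup>2 * G (Suc (Suc n))" by (rule pF.simps(2))
  also have "... = G 0 + (G 0)\<^sup>2 * pF (%i. G (Suc i)) n + (G 0 * (\<Prod>i\<le>n. G (Suc i)))\<^sup>2 * G (Suc (Suc n))"
    unfolding Suc prod.atMost_Suc_shift by simp
  finally show ?case by (simp add: algebra_simps power_mult_distrib)
qed simp

lemma dP_shift: "dP G dG (Suc n) = dG 0 * (\<Prod>i\<le>n. G (Suc i)) + G 0 * dP (%i. G (Suc i)) (%i. dG (Suc i)) n"
proof (induction n)
  case (Suc n)
  have "dP G dG (Suc (Suc n)) = dP G dG (Suc n) * G (Suc (Suc n)) + (\<Prod>i\<le>Suc n. G i) * dG (Suc (Suc n))" by (rule dP.simps(2))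
  also have "... = (dG 0 * (\<Prod>i\<le>n. G (Suc i)) + G 0 * dP (%i. G (Suc i)) (%i. dG (Suc i)) n) * G (Suc (Suc n))
      + (G 0 * (\<Prod>i\<le>n. G (Suc i))) * dG (Suc (Suc n))"
    unfolding Suc prod.atMost_Suc_shift by simp
  finally show ?case by (simp add: algebra_simps)
qed simp

lemma dF_shift: "dF G dG (Suc n) = dG 0 + 2 * G 0 * dG 0 * pF (%i. G (Suc i)) n
   + (G 0)\<^sup>2 * dF (%i. G (Suc i)) (%i. dG (Suc i)) n"
proof (induction n)
  case (Suc n)
  let ?G = "%i. G (Suc i)" and ?d = "%i. dG (Suc i)"
  have "dF G dG (Suc (Suc n)) = dF G dG (Suc n) + 2 * (\<Prod>i\<le>Suc n. G i) * dP G dG (Suc n) * G (Suc (Suc n))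
      + (\<Prod>i\<le>Suc n. G i)\<^sup>2 * dG (Suc (Suc n))" by (rule dF.simps(2))
  also have "... = (dG 0 + 2 * G 0 * dG 0 * pF ?G n + (G 0)\<^sup>2 * dF ?G ?d n)
      + 2 * (G 0 * (\<Prod>i\<le>n. G (Suc i))) * (dG 0 * (\<Prod>i\<le>n. G (Suc i)) + G 0 * dP ?G ?d n) * G (Suc (Suc n))
      + (G 0 * (\<Prod>i\<le>n. G (Suc i)))\<^sup>2 * dG (Suc (Suc n))"
    unfolding Suc dP_shift prod.atMost_Suc_shift by simp
  finally show ?case by (simp add: algebra_simps power2_eq_square)
qed (simp add: algebra_simps)

text \<open>A Cauchy-Schwarz inequality in disguise: up to sign, the three quantities are entries of
  the squared finite-volume resolvent at the two ends of the path. The induction only needs the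
  hypothesis \<open>r\<close>, by which dG dominates the contribution of the path child.\<close>

lemma dP_sq_le:
  assumes d: "\<And>n. 0 \<le> dG n" and r: "\<And>n. (G (Suc n))\<^sup>2 * dG n \<le> dG (Suc n)"
  shows "0 \<le> dF G dG n \<and> (dP G dG n)\<^sup>2 \<le> dF G dG n * dG n"
proof (induction n)
  case 0
  show ?case using d by (simp add: power2_eq_square)
next
  case (Suc n)
  define P where "P = (\<Prod>i\<le>n. G i)"
  define f p g g1 d1 where "f = dF G dG n" and "p = dP G dG n" and "g = dG n" and "g1 = G (Suc n)" and "d1 = dG (Suc n)"
  have IH: "0 \<le> f" "p\<^sup>2 \<le> f * g" using Suc by (auto simp: f_def p_def g_def)
  have d1: "g1\<^sup>2 * g \<le> d1" "0 \<le> d1" using r d by (auto simp: g1_def g_def d1_def)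
  have "g1\<^sup>2 * p\<^sup>2 \<le> g1\<^sup>2 * (f * g)" using IH by (intro mult_left_mono) auto
  also have "... = f * (g1\<^sup>2 * g)" by simp
  also have "... \<le> f * d1" using IH d1 by (intro mult_left_mono) auto
  finally have key: "g1\<^sup>2 * p\<^sup>2 \<le> f * d1" .
  have F: "dF G dG (Suc n) = f + 2 * P * p * g1 + P\<^sup>2 * d1" by (simp add: P_def f_def p_def g1_def d1_def)
  have Q: "dP G dG (Suc n) = p * g1 + P * d1" by (simp add: P_def p_def g1_def d1_def)
  have c2: "(p * g1 + P * d1)\<^sup>2 \<le> (f + 2 * P * p * g1 + P\<^sup>2 * d1) * d1"
    using key by (simp add: power2_eq_square algebra_simps)
  have c1: "0 \<le> f + 2 * P * p * g1 + P\<^sup>2 * d1"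
  proof (cases "d1 = 0")
    case True
    then have "g1 * p = 0" using key by (simp add: power_mult_distrib[symmetric])
    then show ?thesis using IH True by auto
  next
    case False
    then have "0 < d1" using d1 by simp
    moreover have "0 \<le> (f + 2 * P * p * g1 + P\<^sup>2 * d1) * d1" using c2 zero_le_power2 order_trans by blast
    ultimately show ?thesis by (simp add: zero_le_mult_iff)
  qed
  show ?case unfolding F Q using c1 c2 by (simp add: d1_def)
qed

text \<open>Square roots behave like norms: by \<open>dP_sq_le\<close> the mixed term is covered by
  the product of the roots, and the remaining increments are simply added. Bounding them is then a
  matter of summability, with no compounding factor from \<open>dF\<close> itself.\<close>

lemma sqrt_dF_le:
  assumes d: "\<And>n. 0 \<le> dG n" and r: "\<And>n. (G (Suc n))\<^sup>2 * dG n \<le> dG (Suc n)"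
  shows "sqrt (dF G dG (Suc n)) \<le> sqrt (dF G dG n) + (\<bar>\<Prod>i\<le>Suc n. G i\<bar> * sqrt (dG n) + \<bar>\<Prod>i\<le>n. G i\<bar> * sqrt (dG (Suc n)))"
proof -
  define P where "P = (\<Prod>i\<le>n. G i)"
  define f p g g1 d1 where "f = dF G dG n" and "p = dP G dG n" and "g = dG n" and "g1 = G (Suc n)" and "d1 = dG (Suc n)"
  have IH: "0 \<le> f" "p\<^sup>2 \<le> f * g" using dP_sq_le[of dG G n, OF assms] by (auto simp: f_def p_def g_def)
  have nn: "0 \<le> g" "0 \<le> d1" using d by (auto simp: g_def d1_def)
  have "sqrt (p\<^sup>2) \<le> sqrt (f * g)" by (rule real_sqrt_le_mono[OF IH(2)])
  then have p: "\<bar>p\<bar> \<le> sqrt f * sqrt g" by (simp only: real_sqrt_abs real_sqrt_mult)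
  let ?u = "\<bar>P * g1\<bar> * sqrt g" and ?v = "\<bar>P\<bar> * sqrt d1"
  have uv: "0 \<le> ?u" "0 \<le> ?v" using nn by auto
  have "2 * P * p * g1 \<le> \<bar>2 * P * p * g1\<bar>" by simp
  also have "... = 2 * \<bar>P * g1\<bar> * \<bar>p\<bar>" by (simp add: abs_mult)
  also have "... \<le> 2 * \<bar>P * g1\<bar> * (sqrt f * sqrt g)" using p by (intro mult_left_mono) auto
  finally have "f + 2 * P * p * g1 + P\<^sup>2 * d1 \<le> (sqrt f)\<^sup>2 + 2 * sqrt f * ?u + ?v\<^sup>2"
    using IH nn by (simp add: power_mult_distrib algebra_simps)
  also have "... \<le> (sqrt f + (?u + ?v))\<^sup>2"
  proof -
    have *: "a\<^sup>2 + 2 * a * u + v\<^sup>2 \<le> (a + (u + v))\<^sup>2" if "0 \<le> a" "0 \<le> u" "0 \<le> v" for a u v :: real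
      using mult_nonneg_nonneg[OF that(1,3)] mult_nonneg_nonneg[OF that(2,3)] by (simp add: power2_eq_square algebra_simps)
    show ?thesis by (rule *) (use uv IH in auto)
  qed
  finally have "sqrt (f + 2 * P * p * g1 + P\<^sup>2 * d1) \<le> sqrt f + (?u + ?v)"
    using uv IH by (intro real_le_lsqrt) auto
  then show ?thesis by (simp add: P_def f_def p_def g_def g1_def d1_def)
qed

context canopy_model
begin

text \<open>Attaching the subtree at (n, j) to the rest of the volume: the Green function is g + g^2
  G, with G the finite-volume Green function at the parent. The second identity is its energy
  derivative, derived algebraically.\<close>

lemma gF_Suc:
  fixes E :: real
  assumes 1: "gam om E n j \<noteq> 0" and 2: "up om E (Suc d) n j \<noteq> 0" and 3: "gF om E d (Suc n) (j div K) \<noteq> 0"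
  shows "gF om E (Suc d) n j = gam om E n j + (gam om E n j)\<^sup>2 * gF om E d (Suc n) (j div K)" (is ?A)
    and "(gF om E (Suc d) n j)\<^sup>2 * dh om E (Suc d) n j = dgam om E n j + 2 * gam om E n j * dgam om E n j * gF om E d (Suc n) (j div K)
      + (gam om E n j)\<^sup>2 * ((gF om E d (Suc n) (j div K))\<^sup>2 * dh om E d (Suc n) (j div K))" (is ?B)
proof -
  define g a G U where "g = gam om E n j" and "a = om (Suc n, j div K) - E - (sib om E n j + up om E d (Suc n) (j div K))"
    and "G = gF om E d (Suc n) (j div K)" and "U = up om E (Suc d) n j"
  have U: "U = inverse a" by (simp add: U_def a_def)
  have a: "a \<noteq> 0" using 2 U by (auto simp: U_def)
  have g: "g \<noteq> 0" using 1 by (simp add: g_def)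
  have G: "G = inverse (a - g)"
    unfolding G_def gF_def cs_parent a_def g_def by (simp add: algebra_simps)
  have ag: "a - g \<noteq> 0" using 3 G by (auto simp: G_def)
  have "inverse g = om (n, j) - E - cs om E n j" unfolding g_def gam_eq by simp
  then have F: "gF om E (Suc d) n j = inverse (inverse g - U)"
    unfolding gF_def U_def by (simp add: algebra_simps)
  have F2: "gF om E (Suc d) n j = g * (1 + g * G)" unfolding F U G using a g ag by (simp add: field_simps)
  have FU: "gF om E (Suc d) n j * U = g * G" unfolding F U G using a g ag by (simp add: field_simps)
  show ?A using F2 by (simp add: g_def G_def algebra_simps power2_eq_square)
  define q where "q = 1 + (dsib om E n j + dup om E d (Suc n) (j div K))"
  have d1: "dgam om E n j = g\<^sup>2 * (1 + dcs om E n j)" unfolding g_def by (rule dgam_eq)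
  have "dh om E (Suc d) n j = (1 + dcs om E n j) + U\<^sup>2 * q" by (simp add: dh_def q_def U_def)
  then have "(gF om E (Suc d) n j)\<^sup>2 * dh om E (Suc d) n j = (gF om E (Suc d) n j)\<^sup>2 * (1 + dcs om E n j) + (gF om E (Suc d) n j * U)\<^sup>2 * q"
    by (simp add: algebra_simps power_mult_distrib)
  also have "... = g\<^sup>2 * (1 + dcs om E n j) * (1 + g * G)\<^sup>2 + g\<^sup>2 * G\<^sup>2 * q"
    unfolding FU unfolding F2 by (simp add: power_mult_distrib)
  also have "... = dgam om E n j * (1 + g * G)\<^sup>2 + g\<^sup>2 * G\<^sup>2 * q" unfolding d1 ..
  finally have L: "(gF om E (Suc d) n j)\<^sup>2 * dh om E (Suc d) n j = dgam om E n j * (1 + g * G)\<^sup>2 + g\<^sup>2 * G\<^sup>2 * q" .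
  have R: "dh om E d (Suc n) (j div K) = dgam om E n j + q"
    by (simp add: dh_def dcs_parent q_def)
  show ?B unfolding L R G_def[symmetric] g_def[symmetric] by (simp add: algebra_simps power2_eq_square)
qed

text \<open>Energies at which no reciprocal in the recursions takes its default value, so that the
  algebraic identities may be divided freely.\<close>

definition reg :: "(cvert => real) => real => bool" where
  "reg om E \<longleftrightarrow> (\<forall>n j. gam om E n j \<noteq> 0) \<and> (\<forall>d n j. up om E (Suc d) n j \<noteq> 0) \<and> (\<forall>d n j. gF om E d n j \<noteq> 0)"

lemma gp_shift: "gp om E k j (Suc i) = gp om E (Suc k) (j div K) i"
  by (simp add: gp_def div_mult2_eq)

lemma pF_gF:
  assumes "reg om E"
  shows "gF om E d k j = pF (gp om E k j) d \<and>
    (gF om E d k j)\<^sup>2 * dh om E d k j = dF (gp om E k j) (%i. dgam om E (k + i) (j div K ^ i)) d"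
proof (induction d arbitrary: k j)
  case 0
  show ?case by (simp add: gF_0 gp_def dh_def dgam_eq)
next
  case (Suc d)
  have s: "(%i. gp om E k j (Suc i)) = gp om E (Suc k) (j div K)"
    "(%i. dgam om E (k + Suc i) (j div K ^ Suc i)) = (%i. dgam om E (Suc k + i) (j div K div K ^ i))"
    by (simp_all add: gp_shift fun_eq_iff div_mult2_eq)
  have nz: "gam om E k j \<noteq> 0" "up om E (Suc d) k j \<noteq> 0" "gF om E d (Suc k) (j div K) \<noteq> 0"
    using assms by (auto simp: reg_def simp del: up.simps)
  note IH = Suc[of "Suc k" "j div K"]
  have g0: "gp om E k j 0 = gam om E k j" "dgam om E (k + 0) (j div K ^ 0) = dgam om E k j" by (simp_all add: gp_def)
  show ?case
  proof
    show "gF om E (Suc d) k j = pF (gp om E k j) (Suc d)"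
      unfolding pF_shift s g0 gF_Suc(1)[OF nz] unfolding conjunct1[OF IH] ..
    show "(gF om E (Suc d) k j)\<^sup>2 * dh om E (Suc d) k j = dF (gp om E k j) (%i. dgam om E (k + i) (j div K ^ i)) (Suc d)"
      unfolding dF_shift s g0 gF_Suc(2)[OF nz] unfolding conjunct2[OF IH] unfolding conjunct1[OF IH] ..
  qed
qed

text \<open>The increments of the square root are products along the path, of size exp (-n (ln K / 2
  + g)), times square roots of subtree derivatives, of size exp (n (ln K + g) / 2). The factors
  K^(n/2) cancel and a geometric series with ratio exp (-g/2) is left.\<close>

lemma dF_bounded:
  assumes rg: "reg om E" and g: "0 < g"
    and P: "\<forall>\<^sub>F n in sequentially. \<bar>\<Prod>i\<le>n. gp om E k j i\<bar> \<le> exp (- real n * (ln (real K) / 2 + g))"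
    and D: "\<forall>\<^sub>F n in sequentially. dgam om E (k + n) (j div K ^ n) \<le> exp (real n * (ln (real K) + g))"
  shows "\<exists>R. \<forall>d. (gF om E d k j)\<^sup>2 * dh om E d k j \<le> R"
proof -
  define G dG where "G = gp om E k j" and "dG = (%i. dgam om E (k + i) (j div K ^ i))"
  define h where "h = ln (real K)"
  have d: "0 \<le> dG n" for n by (simp add: dG_def dgam_nonneg)
  have r: "(G (Suc n))\<^sup>2 * dG n \<le> dG (Suc n)" for n
  proof -
    have "dG (Suc n) = (G (Suc n))\<^sup>2 * (1 + dcs om E (Suc (k + n)) (j div K ^ n div K))"
      by (simp add: G_def dG_def gp_def dgam_eq div_K_Suc)
    then show ?thesis unfolding dcs_parent
      using d[of n] dsib_nonneg[of om E "k + n" "j div K ^ n"] by (simp add: dG_def mult_left_mono)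
  qed
  define e where "e n = \<bar>\<Prod>i\<le>Suc n. G i\<bar> * sqrt (dG n) + \<bar>\<Prod>i\<le>n. G i\<bar> * sqrt (dG (Suc n))" for n
  have e0: "0 \<le> e n" for n using d by (simp add: e_def)
  define C where "C = exp (h / 2 + g) + exp ((h + g) / 2)"
  have "\<forall>\<^sub>F n in sequentially. norm (e n) \<le> C * exp (- (g / 2)) ^ n"
  proof -
    have a1: "\<forall>\<^sub>F n in sequentially. \<bar>\<Prod>i\<le>n. G i\<bar> \<le> exp (- real n * (h / 2 + g))" using P by (simp add: G_def h_def)
    have a2: "\<forall>\<^sub>F n in sequentially. dG n \<le> exp (real n * (h + g))" using D by (simp add: dG_def h_def)
    have a3: "\<forall>\<^sub>F n in sequentially. \<bar>\<Prod>i\<le>Suc n. G i\<bar> \<le> exp (- real (Suc n) * (h / 2 + g))"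
      using a1 by (rule eventually_sequentially_Suc[THEN iffD2])
    have a4: "\<forall>\<^sub>F n in sequentially. dG (Suc n) \<le> exp (real (Suc n) * (h + g))"
      using a2 by (rule eventually_sequentially_Suc[THEN iffD2])
    from a1 a2 a3 a4 show ?thesis
    proof eventually_elim
      case (elim n)
      have sq: "sqrt (exp x) = exp (x / 2)" for x :: real
        by (rule real_sqrt_unique) (simp_all add: power2_eq_square exp_add[symmetric])
      have s1: "sqrt (dG n) \<le> exp (real n * (h + g) / 2)" using elim(2) by (metis real_sqrt_le_mono sq)
      have s2: "sqrt (dG (Suc n)) \<le> exp (real (Suc n) * (h + g) / 2)" using elim(4) by (metis real_sqrt_le_mono sq)
      have "norm (e n) \<le> exp (- real (Suc n) * (h / 2 + g)) * exp (real n * (h + g) / 2) + exp (- real n * (h / 2 + g)) * exp (real (Suc n) * (h + g) / 2)"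
        unfolding real_norm_def abs_of_nonneg[OF e0[of n]] unfolding e_def
        by (intro add_mono mult_mono elim s1 s2 exp_ge_zero real_sqrt_ge_zero d)
      also have "... = exp (- (h / 2 + g)) * exp (real n * (- (g / 2))) + exp ((h + g) / 2) * exp (real n * (- (g / 2)))"
        by (simp add: exp_add[symmetric] algebra_simps add_divide_distrib diff_divide_distrib)
      also have "... \<le> exp (h / 2 + g) * exp (real n * (- (g / 2))) + exp ((h + g) / 2) * exp (real n * (- (g / 2)))"
        using g K2 by (intro add_right_mono mult_right_mono) (auto simp: h_def)
      also have "... = C * exp (- (g / 2)) ^ n"
        unfolding C_def exp_of_nat_mult by (simp add: distrib_right)
      finally show ?case .
    qed
  qed
  moreover have "summable (%n. C * exp (- (g / 2)) ^ n)"
    using g by (intro summable_mult summable_geometric) simp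
  ultimately have sm: "summable e" by (rule summable_comparison_test_ev)
  have "sqrt (dF G dG n) \<le> sqrt (dF G dG 0) + (\<Sum>i<n. e i)" for n
  proof (induction n)
    case (Suc n)
    have "sqrt (dF G dG (Suc n)) \<le> sqrt (dF G dG n) + e n"
      unfolding e_def by (rule sqrt_dF_le) (rule d, rule r)
    then show ?case using Suc by simp
  qed simp
  moreover have "(\<Sum>i<n. e i) \<le> suminf e" for n by (rule sum_le_suminf[OF sm]) (auto intro: e0)
  ultimately have sb: "sqrt (dF G dG n) \<le> sqrt (dF G dG 0) + suminf e" for n by (meson add_left_mono order_trans)
  have "dF G dG n \<le> (sqrt (dF G dG 0) + suminf e)\<^sup>2" for n
  proof -
    have f0: "0 \<le> dF G dG n" using dP_sq_le[of dG G n, OF d r] by simp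
    have "(sqrt (dF G dG n))\<^sup>2 \<le> (sqrt (dF G dG 0) + suminf e)\<^sup>2" by (rule power_mono[OF sb]) (simp add: f0)
    then show ?thesis using f0 by simp
  qed
  then have "\<forall>n. dF G dG n \<le> (sqrt (dF G dG 0) + suminf e)\<^sup>2" by (rule allI)
  then show ?thesis unfolding conjunct2[OF pF_gF[OF rg]] G_def[symmetric] dG_def[symmetric] by (rule exI)
qed

end

section \<open>Growth of subtree derivatives at almost every energy\<close>

text \<open>The bound x^r <= 1 + x at x = N w. Summed over at most N weights of total mass 1 it
  yields 2 N^(1-r), the value for equal weights up to a factor 2.\<close>

lemma powr_young:
  fixes w N r :: real
  assumes "0 \<le> w" "0 < N" "0 < r" "r \<le> 1"
  shows "w powr r \<le> N powr (1 - r) * (w + 1 / N)"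
proof -
  have x: "x powr r \<le> 1 + x" if "0 \<le> x" for x :: real
  proof (cases "x \<le> 1")
    case True
    then have "x powr r \<le> 1" using that assms by (intro powr_le1) auto
    then show ?thesis using that by simp
  next
    case False
    then have "x powr r \<le> x powr 1" using assms by (intro powr_mono) auto
    then show ?thesis using False by simp
  qed
  have "w powr r = N powr (- r) * (N * w) powr r"
    using assms by (simp add: powr_mult powr_minus field_simps)
  also have "... \<le> N powr (- r) * (1 + N * w)"
    using assms by (intro mult_left_mono x) auto
  also have "... = N powr (- r) * N * (w + 1 / N)" using assms by (simp add: field_simps)
  also have "N powr (- r) * N = N powr (1 - r)"
    using assms powr_add[of N "- r" 1] by simp
  finally show ?thesis .
qed

lemma pole_measurable: "(%E. ennreal (\<bar>t - E\<bar> powr c) * indicator {-l..l} E) \<in> borel_measurable lborel"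
  for t c l :: real
  by measurable

lemma nn_integral_pole:
  fixes r l t :: real
  assumes r: "0 < r" "r < 1" and l: "0 \<le> l"
  shows "(\<integral>\<^sup>+E. ennreal (\<bar>t - E\<bar> powr (- r)) * indicator {-l..l} E \<partial>lborel) \<le> ennreal (2 * l + 2 / (1 - r))"
proof -
  let ?f = "%u. ennreal (indicator {-1..1} u * \<bar>u\<bar> powr (-r))"
  have "(\<integral>\<^sup>+E. ennreal (\<bar>t - E\<bar> powr (- r)) * indicator {-l..l} E \<partial>lborel) \<le> (\<integral>\<^sup>+E. indicator {-l..l} E + ?f (- t + 1 * E) \<partial>lborel)"
  proof (rule nn_integral_mono)
    fix E :: real
    have "ennreal (\<bar>t - E\<bar> powr (- r)) \<le> ennreal (1 + indicator {-1..1} (E - t) * \<bar>E - t\<bar> powr (- r))"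
      using abs_powr_neg_le[OF r(1), of "E - t"] by (intro ennreal_leI) (simp add: abs_minus_commute)
    also have "... = 1 + ?f (- t + 1 * E)" by (simp add: algebra_simps)
    finally show "ennreal (\<bar>t - E\<bar> powr (- r)) * indicator {-l..l} E \<le> indicator {-l..l} E + ?f (- t + 1 * E)"
      by (simp split: split_indicator)
  qed
  also have "... = (\<integral>\<^sup>+E. indicator {-l..l} E \<partial>lborel) + (\<integral>\<^sup>+E. ?f (- t + 1 * E) \<partial>lborel)"
    by (rule nn_integral_add) measurable
  also have "(\<integral>\<^sup>+E. indicator {-l..l} E \<partial>lborel) = ennreal (2 * l)" using l by simp
  also have "(\<integral>\<^sup>+E. ?f (- t + 1 * E) \<partial>lborel) = ennreal (2 / (1 - r))"
    using nn_integral_real_affine[of ?f 1 "- t"] nn_integral_abs_powr_unit[OF r] by simp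
  also have "ennreal (2 * l) + ennreal (2 / (1 - r)) = ennreal (2 * l + 2 / (1 - r))"
    using r l by (intro ennreal_plus[symmetric]) auto
  finally show ?thesis .
qed

context canopy_model
begin

text \<open>The derivative is a sum of double poles with at most K^(n+1) weights of total mass 1. An
  exponent below 1/2 makes each pole integrable, and subadditivity with \<open>powr_young\<close>
  handles the sum. No randomness is involved.\<close>

lemma dgam_powr_integral:
  fixes r l :: real
  assumes r: "0 < r" "r < 1 / 2" and l: "0 \<le> l"
  shows "(\<integral>\<^sup>+E. ennreal (dgam om E n j powr r) * indicator {-l..l} E \<partial>lborel)
    \<le> ennreal (2 * (real K ^ Suc n) powr (1 - r) * (2 * l + 2 / (1 - 2 * r)))"
proof -
  obtain La w X where R: "rat (%z. gam om z n j) (%E. dgam om E n j) La w X" and card: "Suc (card La) \<le> K ^ Suc n" and w1: "(\<Sum>t\<in>La. w t) = 1"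
    using rat_gam'[of om n j] by blast
  have fin: "finite La" "finite X" and wp: "\<And>t. t \<in> La ==> 0 < w t" and d: "\<And>E. E \<notin> X ==> dgam om E n j = dstj La w E"
    using R by (auto simp: rat_def)
  define N where "N = real K ^ Suc n"
  have N: "0 < N" using K2 by (simp add: N_def)
  have cN: "real (card La) \<le> N"
  proof -
    have "real (card La) \<le> real (K ^ Suc n)" using card by (intro of_nat_mono) simp
    then show ?thesis by (simp add: N_def)
  qed
  let ?c = "2 * l + 2 / (1 - 2 * r)"
  have c0: "0 \<le> ?c" using r l by simp
  have pm: "(%E. ennreal (\<bar>t - E\<bar> powr (- (2 * r))) * indicator {-l..l} E) \<in> borel_measurable lborel" for t
    by (rule pole_measurable)
  have nX: "AE E in lborel. E \<notin> X"
    using fin by (intro AE_not_in) (simp add: finite_imp_null_set_lborel)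
  have "(\<integral>\<^sup>+E. ennreal (dgam om E n j powr r) * indicator {-l..l} E \<partial>lborel)
     \<le> (\<integral>\<^sup>+E. (\<Sum>t\<in>La. ennreal (w t powr r) * (ennreal (\<bar>t - E\<bar> powr (- (2 * r))) * indicator {-l..l} E)) \<partial>lborel)"
  proof (rule nn_integral_mono_AE)
    show "AE E in lborel. ennreal (dgam om E n j powr r) * indicator {-l..l} E \<le> (\<Sum>t\<in>La. ennreal (w t powr r) * (ennreal (\<bar>t - E\<bar> powr (- (2 * r))) * indicator {-l..l} E))"
      using nX
    proof eventually_elim
      case (elim E)
      have "dgam om E n j powr r = (\<Sum>t\<in>La. w t / (t - E)\<^sup>2) powr r" by (simp add: d[OF elim] dstj_def)
      also have "... \<le> (\<Sum>t\<in>La. (w t / (t - E)\<^sup>2) powr r)"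
        using fin wp r by (intro powr_sum_le) (auto simp: less_imp_le)
      also have "... = (\<Sum>t\<in>La. w t powr r * \<bar>t - E\<bar> powr (- (2 * r)))"
      proof (rule sum.cong[OF refl])
        fix t assume t: "t \<in> La"
        have "t - E \<noteq> 0" using t elim R by (auto simp: rat_def)
        then have "(t - E)\<^sup>2 = \<bar>t - E\<bar> powr 2" by simp
        then have "((t - E)\<^sup>2) powr r = \<bar>t - E\<bar> powr (2 * r)" by (simp only: powr_powr)
        moreover have "(w t / (t - E)\<^sup>2) powr r = w t powr r / ((t - E)\<^sup>2) powr r"
          by (rule powr_divide)
        ultimately show "(w t / (t - E)\<^sup>2) powr r = w t powr r * \<bar>t - E\<bar> powr (- (2 * r))"
          by (simp only: powr_minus divide_inverse)
      qed
      finally have "ennreal (dgam om E n j powr r) \<le> ennreal (\<Sum>t\<in>La. w t powr r * \<bar>t - E\<bar> powr (- (2 * r)))"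
        by (rule ennreal_leI)
      also have "... = (\<Sum>t\<in>La. ennreal (w t powr r) * ennreal (\<bar>t - E\<bar> powr (- (2 * r))))"
        by (subst sum_ennreal[symmetric]) (auto simp: ennreal_mult)
      finally have "ennreal (dgam om E n j powr r) * indicator {-l..l} E \<le> (\<Sum>t\<in>La. ennreal (w t powr r) * ennreal (\<bar>t - E\<bar> powr (- (2 * r)))) * indicator {-l..l} E"
        by (rule mult_right_mono) simp
      then show ?case by (simp add: sum_distrib_right mult.assoc)
    qed
  qed
  also have "... = (\<Sum>t\<in>La. \<integral>\<^sup>+E. ennreal (w t powr r) * (ennreal (\<bar>t - E\<bar> powr (- (2 * r))) * indicator {-l..l} E) \<partial>lborel)"
    by (rule nn_integral_sum) (rule borel_measurable_times_ennreal[OF borel_measurable_const pm])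
  also have "... = (\<Sum>t\<in>La. ennreal (w t powr r) * (\<integral>\<^sup>+E. ennreal (\<bar>t - E\<bar> powr (- (2 * r))) * indicator {-l..l} E \<partial>lborel))"
    by (rule sum.cong[OF refl], rule nn_integral_cmult, rule pm)
  also have "... \<le> (\<Sum>t\<in>La. ennreal (w t powr r) * ennreal ?c)"
    using r l by (intro sum_mono mult_left_mono nn_integral_pole) auto
  also have "... = ennreal (\<Sum>t\<in>La. w t powr r * ?c)"
    using c0 by (subst sum_ennreal[symmetric]) (auto simp: ennreal_mult)
  also have "... \<le> ennreal (2 * N powr (1 - r) * ?c)"
  proof (rule ennreal_leI)
    have "(\<Sum>t\<in>La. w t powr r) \<le> (\<Sum>t\<in>La. N powr (1 - r) * (w t + 1 / N))"
      using wp r N by (intro sum_mono powr_young) (auto simp: less_imp_le)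
    also have "... = N powr (1 - r) * (1 + real (card La) / N)"
      by (simp add: sum_distrib_left[symmetric] sum.distrib w1)
    also have "... \<le> N powr (1 - r) * 2" using cN N by (intro mult_left_mono) auto
    finally have "(\<Sum>t\<in>La. w t powr r) * ?c \<le> (N powr (1 - r) * 2) * ?c" by (rule mult_right_mono[OF _ c0])
    then show "(\<Sum>t\<in>La. w t powr r * ?c) \<le> 2 * N powr (1 - r) * ?c" by (simp add: sum_distrib_right mult_ac)
  qed
  finally show ?thesis by (simp only: N_def)
qed

text \<open>Markov and Borel-Cantelli in the energy variable, for a fixed potential. As r approaches
  1/2 the integral grows like K^(n/2) while the threshold enters with the power 1/2, so the growth
  rate ln K is just reached.\<close>

lemma AE_dgam_growth:
  assumes e: "0 < \<epsilon>"
  shows "AE E in lborel. \<forall>\<^sub>F n in sequentially. dgam om E (k + n) (j div K ^ n) \<le> exp (real n * (ln (real K) + \<epsilon>))"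
proof -
  define L where "L = ln (real K)"
  have L: "0 < L" using K2 by (simp add: L_def)
  \<comment> \<open>Solves (1 - r) L - r (L + \<epsilon>) = - \<epsilon> / 4, which is the
    exponential rate of the bad sets.\<close>
  define r where "r = (L + \<epsilon> / 4) / (2 * L + \<epsilon>)"
  have r: "0 < r" "r < 1 / 2" using L e by (auto simp: r_def field_simps)
  have rr: "(1 - r) * L - r * (L + \<epsilon>) = - (\<epsilon> / 4)"
  proof -
    have "r * (2 * L + \<epsilon>) = L + \<epsilon> / 4" using L e by (simp add: r_def)
    then show ?thesis by (simp add: algebra_simps)
  qed
  have [measurable]: "(%E. dgam om E n j) \<in> borel_measurable lborel" for n j
    by (rule dgam_measurable) auto
  have "AE E in lborel. E \<in> {- real l..real l} --> (\<forall>\<^sub>F n in sequentially. dgam om E (k + n) (j div K ^ n) \<le> exp (real n * (L + \<epsilon>)))" for l :: nat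
  proof -
    define c where "c n = exp (real n * (r * (L + \<epsilon>)))" for n
    have c0: "0 < c n" for n by (simp add: c_def)
    define B where "B n = {E \<in> {- real l..real l}. 1 \<le> ennreal (1 / c n) * ennreal (dgam om E (k + n) (j div K ^ n) powr r)}" for n
    have Bm [measurable]: "B n \<in> sets lborel" for n unfolding B_def by measurable
    define C where "C = 2 * (2 * real l + 2 / (1 - 2 * r)) * exp (real (Suc k) * L * (1 - r))"
    have C0: "0 \<le> C" using r by (auto simp: C_def)
    have mB: "emeasure lborel (B n) \<le> ennreal (C * exp (- (\<epsilon> / 4)) ^ n)" for n
    proof -
      have "emeasure lborel (B n) \<le> ennreal (1 / c n) * (\<integral>\<^sup>+E. ennreal (dgam om E (k + n) (j div K ^ n) powr r) * indicator {- real l..real l} E \<partial>lborel)"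
        unfolding B_def by (rule nn_integral_Markov_inequality) measurable
      also have "... \<le> ennreal (1 / c n) * ennreal (2 * (real K ^ Suc (k + n)) powr (1 - r) * (2 * real l + 2 / (1 - 2 * r)))"
        by (intro mult_left_mono dgam_powr_integral r) auto
      also have "... = ennreal (1 / c n * (2 * (real K ^ Suc (k + n)) powr (1 - r) * (2 * real l + 2 / (1 - 2 * r))))"
        using r c0[of n] by (intro ennreal_mult[symmetric]) auto
      also have "(real K ^ Suc (k + n)) powr (1 - r) = exp (real (Suc (k + n)) * L * (1 - r))"
      proof -
        have "exp L = real K" using K2 by (simp add: L_def)
        then have "real K ^ Suc (k + n) = exp (real (Suc (k + n)) * L)" by (simp only: exp_of_nat_mult)
        then show ?thesis by (simp only: exp_powr_real)
      qed
      also have "1 / c n * (2 * exp (real (Suc (k + n)) * L * (1 - r)) * (2 * real l + 2 / (1 - 2 * r)))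
        = 2 * (2 * real l + 2 / (1 - 2 * r)) * exp (real (Suc (k + n)) * L * (1 - r) - real n * (r * (L + \<epsilon>)))"
        by (simp add: c_def exp_diff)
      also have "real (Suc (k + n)) * L * (1 - r) - real n * (r * (L + \<epsilon>)) = real (Suc k) * L * (1 - r) + real n * ((1 - r) * L - r * (L + \<epsilon>))"
        by (simp add: algebra_simps)
      also have "2 * (2 * real l + 2 / (1 - 2 * r)) * exp (real (Suc k) * L * (1 - r) + real n * ((1 - r) * L - r * (L + \<epsilon>))) = C * exp (- (\<epsilon> / 4)) ^ n"
        unfolding rr exp_add C_def exp_of_nat_mult by (simp only: mult.assoc)
      finally show ?thesis .
    qed
    have fB: "emeasure lborel (B n) < \<infinity>" for n
      using mB[of n] ennreal_less_top[of "C * exp (- (\<epsilon> / 4)) ^ n"] by (simp add: le_less_trans)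
    have "summable (%n. measure lborel (B n))"
    proof (rule summable_comparison_test')
      show "summable (%n. C * exp (- (\<epsilon> / 4)) ^ n)" using e by (intro summable_mult summable_geometric) simp
      show "norm (measure lborel (B n)) \<le> C * exp (- (\<epsilon> / 4)) ^ n" for n
        using mB[of n] fB[of n] C0 by (simp add: emeasure_eq_ennreal_measure)
    qed
    then have "AE E in lborel. \<forall>\<^sub>F n in sequentially. E \<in> space lborel - B n"
      by (intro borel_cantelli_AE1 Bm fB)
    then show ?thesis
    proof eventually_elim
      case (elim E)
      show ?case
      proof
        assume E: "E \<in> {- real l..real l}"
        from elim show "\<forall>\<^sub>F n in sequentially. dgam om E (k + n) (j div K ^ n) \<le> exp (real n * (L + \<epsilon>))"
        proof eventually_elim
          case (elim n)
          let ?d = "dgam om E (k + n) (j div K ^ n)"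
          have "\<not> 1 \<le> ennreal (1 / c n) * ennreal (?d powr r)" using elim E by (simp add: B_def)
          also have "ennreal (1 / c n) * ennreal (?d powr r) = ennreal (1 / c n * ?d powr r)"
            using c0[of n] by (intro ennreal_mult[symmetric]) auto
          finally have "1 / c n * ?d powr r < 1" by (simp add: not_le)
          then have "?d powr r < c n" using c0[of n] by (simp add: field_simps)
          also have "c n = exp (real n * (L + \<epsilon>)) powr r" by (simp add: c_def powr_def mult_ac)
          finally have "?d powr r < exp (real n * (L + \<epsilon>)) powr r" .
          then show ?case using r(1) dgam_nonneg[of om E "k + n" "j div K ^ n"]
            by (meson exp_ge_zero less_imp_le not_less powr_mono2)
        qed
      qed
    qed
  qed
  then have "AE E in lborel. \<forall>l::nat. E \<in> {- real l..real l} --> (\<forall>\<^sub>F n in sequentially. dgam om E (k + n) (j div K ^ n) \<le> exp (real n * (L + \<epsilon>)))"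
    unfolding AE_all_countable by blast
  then show ?thesis
  proof eventually_elim
    case (elim E)
    obtain l :: nat where "\<bar>E\<bar> \<le> real l" using real_arch_simple by blast
    then show ?case using elim[rule_format, of l] by (simp add: L_def abs_le_iff)
  qed
qed

lemma AE_reg: "AE E in lborel. reg om E"
proof -
  have 1: "AE E in lborel. gam om (E::real) n j \<noteq> 0" for n j
  proof -
    obtain La w X where R: "rat (%z. gam om z n j) (%E. dgam om E n j) La w X" "\<forall>z::complex. z \<notin> of_real ` X --> gam om z n j \<noteq> 0"
      using rat_gam'[of om n j] by blast
    have nX: "AE E in lborel. E \<notin> X"
      using R(1) by (intro AE_not_in) (simp add: rat_def finite_imp_null_set_lborel)
    have nz: "gam om (E::real) n j \<noteq> 0" if "E \<notin> X" for E
    proof -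
      have "of_real E \<notin> complex_of_real ` X" using that by auto
      from R(2)[rule_format, OF this] show ?thesis by (simp add: of_real_gam)
    qed
    show ?thesis by (rule eventually_mono[OF nX nz])
  qed
  have 2: "AE E in lborel. up om (E::real) (Suc d) n j \<noteq> 0" for d n j
  proof -
    obtain La w X where R: "rat (%z. up om z (Suc d) n j) (%E. dup om E (Suc d) n j) La w X" "\<forall>z::complex. z \<notin> of_real ` X --> up om z (Suc d) n j \<noteq> 0"
      using rat_up[of om "Suc d" n j] by blast
    have nX: "AE E in lborel. E \<notin> X"
      using R(1) by (intro AE_not_in) (simp add: rat_def finite_imp_null_set_lborel)
    have nz: "up om (E::real) (Suc d) n j \<noteq> 0" if "E \<notin> X" for E
    proof -
      have "of_real E \<notin> complex_of_real ` X" using that by auto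
      from R(2)[rule_format, OF this] show ?thesis by (simp only: of_real_up of_real_eq_0_iff) simp
    qed
    show ?thesis by (rule eventually_mono[OF nX nz])
  qed
  have 3: "AE E in lborel. gF om (E::real) d n j \<noteq> 0" for d n j
  proof -
    obtain La w X where R: "rat (%z. gF om z d n j) (%E. (gF om E d n j)\<^sup>2 * dh om E d n j) La w X" "\<forall>z::complex. z \<notin> of_real ` X --> gF om z d n j \<noteq> 0"
      using rat_gF[of om d n j] by blast
    have nX: "AE E in lborel. E \<notin> X"
      using R(1) by (intro AE_not_in) (simp add: rat_def finite_imp_null_set_lborel)
    have nz: "gF om (E::real) d n j \<noteq> 0" if "E \<notin> X" for E
    proof -
      have "of_real E \<notin> complex_of_real ` X" using that by auto
      from R(2)[rule_format, OF this] show ?thesis by (simp only: of_real_gF of_real_eq_0_iff) simp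
    qed
    show ?thesis by (rule eventually_mono[OF nX nz])
  qed
  show ?thesis unfolding reg_def by (intro AE_conjI AE_all_countable[THEN iffD2] allI 1 2 3)
qed

text \<open>The excess rate depends on the energy; letting it range over the numbers 1 / (q + 1)
  makes the quantifier countable and the event jointly measurable.\<close>

definition decays :: "(cvert => real) => real => nat => nat => bool" where
  "decays om E k j \<longleftrightarrow> (\<exists>q::nat. \<forall>\<^sub>F n in sequentially. \<bar>\<Prod>i\<le>n. gp om E k j i\<bar> \<le> exp (- real n * (ln (real K) / 2 + 1 / (real q + 1))))"

text \<open>The decay holds at each good energy for almost every potential, the growth bound for
  each potential at almost every energy. Fubini brings the first into the order of the
  second.\<close>

lemma AE_bounded_dF:
  assumes I [measurable]: "I \<in> sets borel"
    and L: "AE E in lborel. E \<in> I --> (\<exists>\<gamma>>0. \<exists>C. \<forall>N. (\<Sum>n<N. fL n (of_real E)) \<le> C - real N * (ln (real K) / 2 + \<gamma>))"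
  shows "AE om in Q. AE E in lborel. E \<in> I --> (\<exists>R. \<forall>d. (gF om E d k j)\<^sup>2 * dh om E d k j \<le> R)"
proof -
  have "AE E in lborel. AE om in Q. E \<in> I --> decays om E k j"
    using L
  proof eventually_elim
    case (elim E)
    show ?case
    proof (cases "E \<in> I")
      case True
      from elim True have "\<exists>\<gamma>>0. \<exists>C. \<forall>N. (\<Sum>n<N. fL n (of_real E)) \<le> C - real N * (ln (real K) / 2 + \<gamma>)" by (rule mp)
      then obtain \<gamma> C where g: "0 < \<gamma>" and C: "\<forall>N. (\<Sum>n<N. fL n (of_real E)) \<le> C - real N * (ln (real K) / 2 + \<gamma>)"
        by (elim exE conjE) (rule that)
      obtain q :: nat where q: "1 / (real q + 1) < \<gamma> / 2" using g nat_approx_posE[of "\<gamma> / 2"] by (metis add.commute half_gt_zero of_nat_Suc)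
      have "AE om in Q. \<forall>\<^sub>F n in sequentially. \<bar>\<Prod>i\<le>n. gp om E k j i\<bar> \<le> exp (- real n * (ln (real K) / 2 + \<gamma> / 2))"
        by (rule decay[OF g C]) (use K2 in simp)
      then show ?thesis
      proof eventually_elim
        case (elim om)
        then have "\<forall>\<^sub>F n in sequentially. \<bar>\<Prod>i\<le>n. gp om E k j i\<bar> \<le> exp (- real n * (ln (real K) / 2 + 1 / (real q + 1)))"
        proof eventually_elim
          case (elim n)
          have "real n * (ln (real K) / 2 + 1 / (real q + 1)) \<le> real n * (ln (real K) / 2 + \<gamma> / 2)"
            using q by (intro mult_left_mono) auto
          then have "exp (- real n * (ln (real K) / 2 + \<gamma> / 2)) \<le> exp (- real n * (ln (real K) / 2 + 1 / (real q + 1)))" by simp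
          then show ?case using elim by (rule order_trans[rotated])
        qed
        then have "decays om E k j" unfolding decays_def by (rule exI)
        then show ?case by (rule impI)
      qed
    next
      case False
      then show ?thesis by simp
    qed
  qed
  moreover have "{p \<in> space (lborel \<Otimes>\<^sub>M Q). fst p \<in> I --> decays (snd p) (fst p) k j} \<in> sets (lborel \<Otimes>\<^sub>M Q)"
    unfolding decays_def eventually_sequentially gp_def by measurable
  ultimately have "AE om in Q. AE E in lborel. E \<in> I --> decays om E k j"
    using LQ.AE_commute[of "%E om. E \<in> I --> decays om E k j"] by blast
  then show ?thesis
  proof eventually_elim
    case (elim om)
    have "AE E in lborel. \<forall>q::nat. \<forall>\<^sub>F n in sequentially. dgam om E (k + n) (j div K ^ n) \<le> exp (real n * (ln (real K) + 1 / (real q + 1)))"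
      unfolding AE_all_countable by (intro allI AE_dgam_growth) simp
    with elim AE_reg[of om] show ?case
    proof eventually_elim
      case (elim E)
      show ?case
      proof
        assume "E \<in> I"
        with elim(1) obtain q :: nat where "\<forall>\<^sub>F n in sequentially. \<bar>\<Prod>i\<le>n. gp om E k j i\<bar> \<le> exp (- real n * (ln (real K) / 2 + 1 / (real q + 1)))"
          unfolding decays_def by (elim impE exE)
        moreover have "0 < 1 / (real q + 1)" by simp
        ultimately show "\<exists>R. \<forall>d. (gF om E d k j)\<^sup>2 * dh om E d k j \<le> R"
          using elim(2) elim(3)[rule_format, of q] by (intro dF_bounded)
      qed
    qed
  qed
qed


section \<open>The resolvent equation on the infinite canopy\<close>

lemma gam_cnj: "gam om (cnj z) n j = cnj (gam om z n j)"
  by (induction n arbitrary: j) (simp_all add: complex_cnj_inverse)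

lemma cs_cnj: "cs om (cnj z) n j = cnj (cs om z n j)"
  by (cases n) (simp_all add: cs_def gam_cnj)

lemma sib_cnj: "sib om (cnj z) n j = cnj (sib om z n j)"
  by (simp add: sib_def gam_cnj)

lemma up_cnj: "up om (cnj z) d n j = cnj (up om z d n j)"
  by (induction d arbitrary: n j) (simp_all add: sib_cnj)

lemma im_sib: "0 < Im z ==> 0 \<le> Im (sib om z n j)"
  by (simp add: sib_def sum_nonneg im_gam_cs(1) less_imp_le)

lemma im_up: "0 < Im z ==> 0 \<le> Im (up om z d n j)"
proof (induction d arbitrary: n j)
  case (Suc d)
  have "0 \<le> Im (inverse u)" if "Im u \<le> 0" for u :: complex
    using that by (simp add: Im_inverse divide_nonpos_nonneg)
  then show ?case using Suc im_sib[OF Suc.prems, of om n j] by simp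
qed simp

text \<open>In the upper half plane all self-energies have nonnegative imaginary part, so they only
  add to that of z and every denominator is at least |Im z|. Conjugation transfers this to the lower
  half plane.\<close>

lemma den_bounds:
  assumes z: "Im z \<noteq> 0"
  shows "\<bar>Im z\<bar> \<le> norm (of_real c - z - cs om z n j)"
    "\<bar>Im z\<bar> \<le> norm (of_real c - z - (sib om z n j + up om z d n' j'))"
    "\<bar>Im z\<bar> \<le> norm (of_real c - z - (cs om z n j + up om z d n' j'))"
    "0 \<le> Im (up om z d n j) * Im z"
proof -
  have p: "\<bar>Im z\<bar> \<le> norm (of_real c - z - cs om z n j) \<and>
    \<bar>Im z\<bar> \<le> norm (of_real c - z - (sib om z n j + up om z d n' j')) \<and>
    \<bar>Im z\<bar> \<le> norm (of_real c - z - (cs om z n j + up om z d n' j')) \<and>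
    0 \<le> Im (up om z d n j) * Im z" if z: "0 < Im z" for z
  proof -
    have n: "\<bar>Im z\<bar> \<le> norm (of_real c - z - w)" if "0 \<le> Im w" for w
    proof -
      have "\<bar>Im z\<bar> \<le> \<bar>Im (of_real c - z - w)\<bar>" using z that by simp
      also have "... \<le> norm (of_real c - z - w)" by (rule abs_Im_le_cmod)
      finally show ?thesis .
    qed
    show ?thesis
      using im_gam_cs(2)[OF z, of om n j] im_sib[OF z, of om n j] im_up[OF z, of om d n' j'] im_up[OF z, of om d n j] z
      by (intro conjI n) auto
  qed
  have "\<bar>Im z\<bar> \<le> norm (of_real c - z - cs om z n j) \<and>
    \<bar>Im z\<bar> \<le> norm (of_real c - z - (sib om z n j + up om z d n' j')) \<and>
    \<bar>Im z\<bar> \<le> norm (of_real c - z - (cs om z n j + up om z d n' j')) \<and>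
    0 \<le> Im (up om z d n j) * Im z"
  proof (cases "0 < Im z")
    case False
    then have "0 < Im (cnj z)" using z by simp
    note q = p[OF this]
    have e: "of_real c - cnj z - cnj w = cnj (of_real c - z - w)" for w by simp
    show ?thesis using q unfolding cs_cnj sib_cnj up_cnj complex_cnj_add[symmetric] e complex_mod_cnj by simp
  qed (rule p)
  then show "\<bar>Im z\<bar> \<le> norm (of_real c - z - cs om z n j)"
    "\<bar>Im z\<bar> \<le> norm (of_real c - z - (sib om z n j + up om z d n' j'))"
    "\<bar>Im z\<bar> \<le> norm (of_real c - z - (cs om z n j + up om z d n' j'))"
    "0 \<le> Im (up om z d n j) * Im z" by blast+
qed

lemma norm_inverse_den: "Im z \<noteq> 0 ==> \<bar>Im z\<bar> \<le> norm u ==> norm (inverse u) \<le> 1 / \<bar>Im z\<bar>" for u :: complex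
  by (simp add: norm_inverse inverse_eq_divide norm_divide frac_le)

lemma norm_up_le: "Im z \<noteq> 0 ==> norm (up om z d n j) \<le> 1 / \<bar>Im z\<bar>"
  by (cases d) (simp_all add: norm_inverse_den den_bounds(2))

lemma gam_nz: "Im z \<noteq> 0 ==> gam om z n j \<noteq> 0"
  using den_bounds(1)[of z "om (n, j)" om n j] by (auto simp: gam_eq)

text \<open>Convergence of the single sequence of Green functions at (k, j) forces the upward Green
  functions at all ancestors to converge, because each Schur relation can be solved for the next
  one. The limits do not vanish since the reciprocals stay bounded.\<close>

lemma up_limits:
  fixes z :: complex
  assumes z: "Im z \<noteq> 0" and r: "filterlim r at_top sequentially" and F: "(%i. gF om z (r i) k j) \<longlonglongrightarrow> g"
  shows "\<exists>V. g \<noteq> 0 \<and> (of_real (om (k, j)) - z - cs om z k j - V 0) * g = 1 \<and>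
    (\<forall>m. V m \<noteq> 0 \<and> (of_real (om (k + Suc m, j div K ^ Suc m)) - z - sib om z (k + m) (j div K ^ m) - V (Suc m)) * V m = 1 \<and>
      0 \<le> Im (V m) * Im z)"
proof -
  have lim_nz: "l \<noteq> 0" if f: "f \<longlonglongrightarrow> l" and e: "\<forall>\<^sub>F i in sequentially. norm (inverse (f i)) \<le> N \<and> f i \<noteq> 0" for f :: "nat => complex" and l N
  proof
    assume "l = 0"
    define N' where "N' = \<bar>N\<bar> + 1"
    have N': "0 < N'" by (simp add: N'_def)
    have "(%i. norm (f i)) \<longlonglongrightarrow> 0" using tendsto_norm[OF f] \<open>l = 0\<close> by simp
    then have "\<forall>\<^sub>F i in sequentially. norm (f i) < 1 / N'" using N' by (intro order_tendstoD(2)) auto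
    with e have "\<forall>\<^sub>F i in sequentially. False"
    proof eventually_elim
      case (elim i)
      have "1 = norm (inverse (f i)) * norm (f i)" using elim by (simp add: norm_inverse)
      also have "... \<le> N * norm (f i)" using elim by (intro mult_right_mono) auto
      also have "... \<le> N' * norm (f i)" by (intro mult_right_mono) (auto simp: N'_def)
      also have "... < 1" using elim N' by (simp add: field_simps)
      finally show ?case by simp
    qed
    then show False by simp
  qed
  \<comment> \<open>The Schur relations solved outward, starting from the reciprocal of the limit
    g.\<close>
  define V where "V = rec_nat (of_real (om (k, j)) - z - cs om z k j - inverse g)
    (%m v. of_real (om (k + Suc m, j div K ^ Suc m)) - z - sib om z (k + m) (j div K ^ m) - inverse v)"
  have V0: "V 0 = of_real (om (k, j)) - z - cs om z k j - inverse g" by (simp add: V_def)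
  have VS: "V (Suc m) = of_real (om (k + Suc m, j div K ^ Suc m)) - z - sib om z (k + m) (j div K ^ m) - inverse (V m)" for m
    by (simp add: V_def)
  have gnz: "g \<noteq> 0"
  proof (rule lim_nz[OF F always_eventually], intro allI conjI)
    fix i
    let ?d = "of_real (om (k, j)) - z - (cs om z k j + up om z (r i) k j)"
    have "?d \<noteq> 0" using den_bounds(3)[OF z, of "om (k, j)" om k j "r i" k j] z by auto
    then show "gF om z (r i) k j \<noteq> 0" by (simp add: gF_def)
    have "norm (inverse (gF om z (r i) k j)) = norm ((of_real (om (k, j)) - z - cs om z k j) - up om z (r i) k j)"
      by (simp add: gF_def algebra_simps)
    also have "... \<le> norm (of_real (om (k, j)) - z - cs om z k j) + norm (up om z (r i) k j)" by (rule norm_triangle_ineq4)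
    finally show "norm (inverse (gF om z (r i) k j)) \<le> norm (of_real (om (k, j)) - z - cs om z k j) + 1 / \<bar>Im z\<bar>"
      using norm_up_le[OF z, of om "r i" k j] by linarith
  qed
  define dn where "dn m = of_real (om (k + Suc m, j div K ^ Suc m)) - z - sib om z (k + m) (j div K ^ m)" for m
  have upS: "inverse (up om z (r i - m) (k + m) (j div K ^ m)) = dn m - up om z (r i - Suc m) (k + Suc m) (j div K ^ Suc m)"
    "up om z (r i - m) (k + m) (j div K ^ m) \<noteq> 0" if "Suc m \<le> r i" for i m
  proof -
    have e: "r i - m = Suc (r i - Suc m)" using that by simp
    let ?d = "of_real (om (Suc (k + m), j div K ^ m div K)) - z - (sib om z (k + m) (j div K ^ m) + up om z (r i - Suc m) (Suc (k + m)) (j div K ^ m div K))"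
    have u: "up om z (r i - m) (k + m) (j div K ^ m) = inverse ?d" unfolding e by simp
    have "?d \<noteq> 0" using den_bounds(2)[OF z] z by (metis abs_le_zero_iff norm_zero)
    then show "up om z (r i - m) (k + m) (j div K ^ m) \<noteq> 0" unfolding u by simp
    show "inverse (up om z (r i - m) (k + m) (j div K ^ m)) = dn m - up om z (r i - Suc m) (k + Suc m) (j div K ^ Suc m)"
      unfolding u inverse_inverse_eq dn_def div_K_Suc by simp
  qed
  have ev: "\<forall>\<^sub>F i in sequentially. Suc m \<le> r i" for m
    using r by (simp add: filterlim_at_top)
  have nz: "V m \<noteq> 0" if l: "(%i. up om z (r i - m) (k + m) (j div K ^ m)) \<longlonglongrightarrow> V m" for m
  proof (rule lim_nz[OF l])
    show "\<forall>\<^sub>F i in sequentially. norm (inverse (up om z (r i - m) (k + m) (j div K ^ m))) \<le> norm (dn m) + 1 / \<bar>Im z\<bar> \<and> up om z (r i - m) (k + m) (j div K ^ m) \<noteq> 0"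
      using ev[of m]
    proof eventually_elim
      case (elim i)
      have "norm (dn m - up om z (r i - Suc m) (k + Suc m) (j div K ^ Suc m)) \<le> norm (dn m) + norm (up om z (r i - Suc m) (k + Suc m) (j div K ^ Suc m))"
        by (rule norm_triangle_ineq4)
      then show ?case using upS[OF elim] norm_up_le[OF z, of om "r i - Suc m" "k + Suc m" "j div K ^ Suc m"] by simp
    qed
  qed
  have upl: "(%i. up om z (r i - m) (k + m) (j div K ^ m)) \<longlonglongrightarrow> V m" for m
  proof (induction m)
    case 0
    have "(%i. of_real (om (k, j)) - z - cs om z k j - inverse (gF om z (r i) k j)) \<longlonglongrightarrow> V 0"
      unfolding V0 by (intro tendsto_intros F gnz)
    then show ?case by (simp add: gF_def)
  next
    case (Suc m)
    have "(%i. dn m - inverse (up om z (r i - m) (k + m) (j div K ^ m))) \<longlonglongrightarrow> V (Suc m)"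
      unfolding VS dn_def[symmetric] by (intro tendsto_intros Suc nz[OF Suc])
    moreover have "\<forall>\<^sub>F i in sequentially. dn m - inverse (up om z (r i - m) (k + m) (j div K ^ m)) = up om z (r i - Suc m) (k + Suc m) (j div K ^ Suc m)"
      using ev[of m] by eventually_elim (simp only: upS(1) diff_diff_eq2 add_diff_cancel_left')
    ultimately show ?case by (rule Lim_transform_eventually)
  qed
  have im: "0 \<le> Im (V m) * Im z" for m
    by (rule tendsto_lowerbound[OF tendsto_mult[OF tendsto_Im[OF upl] tendsto_const]]) (use den_bounds(4)[OF z] in auto)
  show ?thesis
  proof (intro exI[of _ V] conjI allI)
    show "(of_real (om (k, j)) - z - cs om z k j - V 0) * g = 1" using gnz by (simp add: V0)
    show "(of_real (om (k + Suc m, j div K ^ Suc m)) - z - sib om z (k + m) (j div K ^ m) - V (Suc m)) * V m = 1" for m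
      using nz[OF upl, of m] unfolding VS by simp
  qed (rule gnz nz[OF upl] im)+
qed

lemma desc_Suc: "desc (Suc n) i = insert (Suc n, i) (\<Union>c<K. desc n (K * i + c))"
proof
  show "desc (Suc n) i \<subseteq> insert (Suc n, i) (\<Union>c<K. desc n (K * i + c))"
  proof
    fix v assume v: "v \<in> desc (Suc n) i"
    obtain m y where my: "v = (m, y)" by (cases v)
    show "v \<in> insert (Suc n, i) (\<Union>c<K. desc n (K * i + c))"
    proof (cases "m = Suc n")
      case True
      then show ?thesis using v my by (simp add: desc_def)
    next
      case False
      then have mn: "m \<le> n" using v my by (simp add: desc_def)
      let ?Y = "y div K ^ (n - m)"
      have "?Y div K = i" using v my mn by (simp add: desc_def Suc_diff_le div_mult2_eq mult.commute[of K])
      then have "?Y = K * i + ?Y mod K" using mult_div_mod_eq[of K ?Y] by simp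
      moreover have "?Y mod K < K" by simp
      ultimately show ?thesis using mn my by (auto simp: desc_def)
    qed
  qed
  show "insert (Suc n, i) (\<Union>c<K. desc n (K * i + c)) \<subseteq> desc (Suc n) i"
    using desc_child desc_self by auto
qed

primrec energy :: "(cvert => complex) => nat => nat => real" where
  "energy \<phi> 0 = (%i. (cmod (\<phi> (0, i)))\<^sup>2)"
| "energy \<phi> (Suc n) = (%i. (cmod (\<phi> (Suc n, i)))\<^sup>2 + (\<Sum>c<K. energy \<phi> n (K * i + c)))"

lemma energy_desc: "finite (desc n i) \<and> (\<Sum>v\<in>desc n i. (cmod (\<phi> v))\<^sup>2) = energy \<phi> n i"
proof (induction n arbitrary: i)
  case 0
  have "desc 0 i = {(0, i)}" by (auto simp: desc_def)
  then show ?case by simp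
next
  case (Suc n)
  have f: "finite (\<Union>c<K. desc n (K * i + c))" using Suc by auto
  have nin: "(Suc n, i) \<notin> (\<Union>c<K. desc n (K * i + c))" using parent_notin_desc by auto
  have "(\<Sum>v\<in>(\<Union>c<K. desc n (K * i + c)). (cmod (\<phi> v))\<^sup>2) = (\<Sum>c<K. \<Sum>v\<in>desc n (K * i + c). (cmod (\<phi> v))\<^sup>2)"
    by (rule sum.UNION_disjoint) (use Suc desc_disjoint in auto)
  then show ?case using f nin Suc unfolding desc_Suc by (simp add: sum.insert)
qed

lemma energy_nonneg: "0 \<le> energy \<phi> n i"
  using energy_desc[of n i \<phi>] by (metis sum_nonneg zero_le_power2)

lemma sum_desc_delta:
  "(\<Sum>c<K. if x \<in> desc n (K * i + c) then B else 0) = (if x \<in> desc (Suc n) i \<and> x \<noteq> (Suc n, i) then B else (0::real))"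
proof (cases "x \<in> desc (Suc n) i \<and> x \<noteq> (Suc n, i)")
  case True
  then obtain c0 where c0: "c0 < K" "x \<in> desc n (K * i + c0)" unfolding desc_Suc by auto
  have "(\<Sum>c<K. if x \<in> desc n (K * i + c) then B else 0) = (\<Sum>c<K. if c = c0 then B else 0)"
  proof (intro sum.cong refl if_cong)
    fix c
    show "(x \<in> desc n (K * i + c)) = (c = c0)" using c0 desc_disjoint[of "K * i + c" "K * i + c0" n] by auto
  qed
  then show ?thesis using True c0 by simp
next
  case False
  have "x \<notin> desc n (K * i + c)" if "c < K" for c
  proof
    assume "x \<in> desc n (K * i + c)"
    then show False using False that parent_notin_desc[of n i "K * i + c"] unfolding desc_Suc by auto
  qed
  then show ?thesis using False by auto
qed

text \<open>Green's identity for a subtree: it is joined to the rest by one edge only, so the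
  current through that edge equals Im z times the squared norm inside, plus the source if it lies
  inside.\<close>

lemma flux:
  assumes eq: "\<And>v. canopy_H K b om \<phi> v - z * \<phi> v = (if v = x then a else 0)"
  shows "Im (cnj (\<phi> (n, i)) * \<phi> (Suc n, i div K)) = Im z * energy \<phi> n i + (if x \<in> desc n i then Im (cnj (\<phi> x) * a) else 0)"
proof (induction n arbitrary: i)
  case 0
  let ?p = "\<phi> (0, i)"
  have e: "\<phi> (Suc 0, i div K) = (if (0, i) = x then a else 0) - of_real (om (0, i) + b) * ?p + z * ?p"
    using eq[of "(0, i)"] by (simp add: canopy_H_def algebra_simps)
  have "cnj ?p * \<phi> (Suc 0, i div K) = cnj ?p * (if (0, i) = x then a else 0) - of_real (om (0, i) + b) * (?p * cnj ?p) + z * (?p * cnj ?p)"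
    unfolding e by (simp only: algebra_simps)
  then have "Im (cnj ?p * \<phi> (Suc 0, i div K)) = Im (cnj ?p * (if (0, i) = x then a else 0)) + Im z * (cmod ?p)\<^sup>2"
    unfolding complex_norm_square[symmetric] by simp
  then show ?case by (auto simp: desc_def)
next
  case (Suc n)
  let ?p = "\<phi> (Suc n, i)"
  let ?S = "\<Sum>c<K. \<phi> (n, K * i + c)"
  have e: "\<phi> (Suc (Suc n), i div K) = (if (Suc n, i) = x then a else 0) - ?S - of_real (om (Suc n, i)) * ?p + z * ?p"
    using eq[of "(Suc n, i)"] by (simp add: canopy_H_def algebra_simps)
  have "cnj ?p * \<phi> (Suc (Suc n), i div K) = cnj ?p * (if (Suc n, i) = x then a else 0) - cnj ?p * ?S - of_real (om (Suc n, i)) * (?p * cnj ?p) + z * (?p * cnj ?p)"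
    unfolding e by (simp only: algebra_simps)
  then have 1: "Im (cnj ?p * \<phi> (Suc (Suc n), i div K)) = Im (cnj ?p * (if (Suc n, i) = x then a else 0)) - Im (cnj ?p * ?S) + Im z * (cmod ?p)\<^sup>2"
    unfolding complex_norm_square[symmetric] by simp
  have "Im (cnj ?p * ?S) = (\<Sum>c<K. Im (cnj ?p * \<phi> (n, K * i + c)))" unfolding sum_distrib_left Im_sum ..
  also have "... = (\<Sum>c<K. - (Im z * energy \<phi> n (K * i + c) + (if x \<in> desc n (K * i + c) then Im (cnj (\<phi> x) * a) else 0)))"
  proof (intro sum.cong refl)
    fix c assume "c \<in> {..<K}"
    then have "(K * i + c) div K = i" by simp
    then have "Im (cnj (\<phi> (n, K * i + c)) * ?p) = Im z * energy \<phi> n (K * i + c) + (if x \<in> desc n (K * i + c) then Im (cnj (\<phi> x) * a) else 0)"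
      using Suc[of "K * i + c"] by simp
    moreover have "Im (cnj u * w) = - Im (cnj w * u)" for u w by simp
    ultimately show "Im (cnj ?p * \<phi> (n, K * i + c)) = - (Im z * energy \<phi> n (K * i + c) + (if x \<in> desc n (K * i + c) then Im (cnj (\<phi> x) * a) else 0))"
      by metis
  qed
  also have "... = - (Im z * (\<Sum>c<K. energy \<phi> n (K * i + c)) + (if x \<in> desc (Suc n) i \<and> x \<noteq> (Suc n, i) then Im (cnj (\<phi> x) * a) else 0))"
    unfolding sum_negf sum.distrib sum_distrib_left[symmetric] sum_desc_delta ..
  finally show ?case unfolding 1 using desc_self[of "Suc n" i] by (auto simp: distrib_left)
qed

lemma energy_mono: "energy \<phi> n i \<le> energy \<phi> (Suc n) (i div K)"
proof -
  have "energy \<phi> n i = energy \<phi> n (K * (i div K) + i mod K)" by simp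
  also have "... \<le> (\<Sum>c<K. energy \<phi> n (K * (i div K) + c))"
    by (rule member_le_sum) (auto simp: energy_nonneg)
  also have "... \<le> energy \<phi> (Suc n) (i div K)" by simp
  finally show ?thesis .
qed

text \<open>Without a source the current through the top edge is Im z times the energy below. That
  energy can only increase towards the ancestors, whereas for a square summable function the values
  along the path, and with them the current, tend to 0.\<close>

lemma l2_unique:
  assumes z: "Im z \<noteq> 0" and l: "l2 \<phi>" and eq: "\<And>v. canopy_H K b om \<phi> v = z * \<phi> v"
  shows "\<phi> (k, j) = 0"
proof -
  let ?v = "%m. (k + m, j div K ^ m)"
  let ?f = "%v. (cmod (\<phi> v))\<^sup>2"
  have sm: "?f summable_on UNIV" using l by (simp add: l2_def)
  have bd: "(\<Sum>m<N. ?f (?v m)) \<le> infsum ?f UNIV" for N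
  proof -
    have "(\<Sum>m<N. ?f (?v m)) = sum ?f (?v ` {..<N})" by (subst sum.reindex) (auto simp: inj_on_def)
    also have "... \<le> infsum ?f UNIV" by (rule finite_sum_le_infsum[OF sm]) auto
    finally show ?thesis .
  qed
  have "summable (%m. ?f (?v m))" by (rule summableI_nonneg_bounded[OF _ bd]) simp
  then have t0: "(%m. ?f (?v m)) \<longlonglongrightarrow> 0" by (rule summable_LIMSEQ_zero)
  have e0: "energy \<phi> k j \<le> energy \<phi> (k + m) (j div K ^ m)" for m
  proof (induction m)
    case (Suc m)
    then show ?case using energy_mono[of \<phi> "k + m" "j div K ^ m"] unfolding div_K_Suc by simp
  qed simp
  have "\<bar>Im z\<bar> * energy \<phi> k j \<le> (?f (?v m) + ?f (?v (Suc m))) / 2" for m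
  proof -
    have "Im (cnj (\<phi> (?v m)) * \<phi> (?v (Suc m))) = Im z * energy \<phi> (k + m) (j div K ^ m)"
      using flux[of om \<phi> z "(0, 0)" 0 "k + m" "j div K ^ m"] eq unfolding div_K_Suc by simp
    then have "\<bar>Im z\<bar> * energy \<phi> (k + m) (j div K ^ m) = \<bar>Im (cnj (\<phi> (?v m)) * \<phi> (?v (Suc m)))\<bar>"
      using energy_nonneg[of \<phi> "k + m" "j div K ^ m"] by (simp add: abs_mult)
    also have "... \<le> cmod (cnj (\<phi> (?v m)) * \<phi> (?v (Suc m)))" by (rule abs_Im_le_cmod)
    also have "... = cmod (\<phi> (?v m)) * cmod (\<phi> (?v (Suc m)))" by (simp add: norm_mult)
    also have "... \<le> (?f (?v m) + ?f (?v (Suc m))) / 2"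
      using zero_le_power2[of "cmod (\<phi> (?v m)) - cmod (\<phi> (?v (Suc m)))"] by (simp add: power2_eq_square algebra_simps)
    finally have "\<bar>Im z\<bar> * energy \<phi> (k + m) (j div K ^ m) \<le> (?f (?v m) + ?f (?v (Suc m))) / 2" .
    moreover have "\<bar>Im z\<bar> * energy \<phi> k j \<le> \<bar>Im z\<bar> * energy \<phi> (k + m) (j div K ^ m)" by (intro mult_left_mono e0) simp
    ultimately show ?thesis by linarith
  qed
  then have lb: "\<exists>N. \<forall>m\<ge>N. \<bar>Im z\<bar> * energy \<phi> k j \<le> (?f (?v m) + ?f (?v (Suc m))) / 2" by blast
  have "(%m. (?f (?v m) + ?f (?v (Suc m))) / 2) \<longlonglongrightarrow> (0 + 0) / 2"
    by (intro tendsto_intros t0 LIMSEQ_Suc[OF t0]) simp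
  then have "\<bar>Im z\<bar> * energy \<phi> k j \<le> (0 + 0) / 2" by (rule LIMSEQ_le_const[OF _ lb])
  then have "energy \<phi> k j = 0" using z energy_nonneg[of \<phi> k j] by (simp add: mult_le_0_iff)
  moreover have "?f (k, j) \<le> energy \<phi> k j" by (cases k) (simp_all add: sum_nonneg energy_nonneg)
  ultimately show ?thesis by simp
qed

lemma div_power_eq_0: "x div K ^ t = 0" if "x \<le> t" for x t :: nat
proof -
  have "x < 2 ^ x" by (rule less_exp)
  also have "... \<le> K ^ x" using K2 by (intro power_mono) auto
  also have "... \<le> K ^ t" using that K2 by (intro power_increasing) auto
  finally show ?thesis by simp
qed

text \<open>Repeated division by K takes every index to 0, so any two vertices have a common
  ancestor and the subtrees along one path fill the canopy.\<close>

lemma desc_exhausts: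
  assumes "finite F"
  shows "\<exists>m. F \<subseteq> desc (k + m) (j div K ^ m)"
proof -
  have mono: "desc (k + m) (j div K ^ m) \<subseteq> desc (k + n) (j div K ^ n)" if "m \<le> n" for m n
    by (rule desc_chain[OF canopy_model_axioms that])
  have one: "\<exists>m. v \<in> desc (k + m) (j div K ^ m)" for v
  proof (cases v)
    case (Pair n i)
    have "v \<in> desc (k + (n + i + j)) (j div K ^ (n + i + j))"
      by (simp add: Pair desc_def div_power_eq_0)
    then show ?thesis by blast
  qed
  show ?thesis using assms
  proof (induction F rule: finite_induct)
    case (insert v F)
    obtain m m' where m: "F \<subseteq> desc (k + m) (j div K ^ m)" "v \<in> desc (k + m') (j div K ^ m')"
      using insert.IH one[of v] by blast
    have "insert v F \<subseteq> desc (k + max m m') (j div K ^ max m m')"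
      using m mono[of m "max m m'"] mono[of m' "max m m'"] by auto
    then show ?case by blast
  qed simp
qed

text \<open>The solution is prescribed along the path of ancestors by the factors - V m, and in
  every side branch it is the parent value times minus the subtree Green function. Since Im (V m)
  has the sign of Im z, the flux identity bounds the energy of every subtree on the path by |Im g| /
  |Im z|, which yields square summability.\<close>

lemma l2_exists:
  fixes z :: complex
  assumes z: "Im z \<noteq> 0" and g: "(of_real (om (k, j)) - z - cs om z k j - V 0) * g = 1"
    and V: "\<And>m. (of_real (om (k + Suc m, j div K ^ Suc m)) - z - sib om z (k + m) (j div K ^ m) - V (Suc m)) * V m = 1"
    and im: "\<And>m. 0 \<le> Im (V m) * Im z"
  shows "\<exists>\<psi>. l2 \<psi> \<and> (\<forall>v. canopy_H K b om \<psi> v - z * \<psi> v = (if v = (k, j) then 1 else 0)) \<and> g = \<psi> (k, j)"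
proof -
  define p where "p = rec_nat g (%m x. - V m * x)"
  have p0: "p 0 = g" and pS: "p (Suc m) = - V m * p m" for m by (simp_all add: p_def)
  define on where "on n i \<longleftrightarrow> k \<le> n \<and> i = j div K ^ (n - k)" for n i
  \<comment> \<open>A value off the path refers to the parent, so the recursion climbs until it
    meets the path. The additional argument f bounds the number of steps; \<open>stab\<close> shows
    that the value no longer depends on it once it is large, and k + j + i steps always
    suffice.\<close>
  define q where "q = rec_nat (%n i. 0) (%f qf n i. if on n i then p (n - k) else - gam om z n i * qf (Suc n) (i div K))"
  have qS: "q (Suc f) n i = (if on n i then p (n - k) else - gam om z n i * q f (Suc n) (i div K))" for f n i
    by (simp add: q_def)
  have stab: "q f n i = q (Suc t) n i" if "on (n + t) (i div K ^ t)" "t < f" for t f n i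
    using that
  proof (induction t arbitrary: f n i)
    case 0
    obtain f' where "f = Suc f'" using 0 by (cases f) auto
    then show ?case using 0 by (simp add: qS)
  next
    case (Suc t)
    obtain f' where f': "f = Suc f'" using Suc by (cases f) auto
    have "q f' (Suc n) (i div K) = q (Suc t) (Suc n) (i div K)"
      by (rule Suc.IH) (use Suc.prems f' in \<open>auto simp: div_mult2_eq\<close>)
    then show ?case unfolding f' qS[of f'] qS[of "Suc t"] by simp
  qed
  have far: "on (n + (k + j + i)) (i div K ^ (k + j + i))" for n i
    unfolding on_def by (simp add: div_power_eq_0)
  define \<psi> where "\<psi> v = q (Suc (k + j + snd v)) (fst v) (snd v)" for v
  have psi_q: "q f n i = \<psi> (n, i)" if "k + j + i < f" for f n i
    unfolding \<psi>_def fst_conv snd_conv by (rule stab[OF far that])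
  have psi: "\<psi> (n, i) = (if on n i then p (n - k) else - gam om z n i * \<psi> (Suc n, i div K))" for n i
  proof -
    have "\<psi> (n, i) = q (Suc (Suc (k + j + i))) n i" by (rule psi_q[symmetric]) simp
    also have "... = (if on n i then p (n - k) else - gam om z n i * q (Suc (k + j + i)) (Suc n) (i div K))" by (rule qS)
    also have "q (Suc (k + j + i)) (Suc n) (i div K) = \<psi> (Suc n, i div K)"
      by (rule psi_q) (simp add: le_imp_less_Suc)
    finally show ?thesis .
  qed
  have on_path: "\<psi> (k + m, j div K ^ m) = p m" for m by (subst psi) (simp add: on_def)
  have par: "\<psi> (Suc (k + m), j div K ^ m div K) = - V m * p m" for m
    using on_path[of "Suc m"] unfolding div_K_Suc by (simp add: pS)
  \<comment> \<open>Children and boundary term together, in accordance with \<open>cs\<close>, so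
    that side branches need no case for the outermost layer.\<close>
  define ch where "ch n i = (if n = 0 then 0 else (\<Sum>c<K. \<psi> (n - 1, K * i + c))) + of_real (if n = 0 then b else 0) * \<psi> (n, i)" for n i
  have H: "canopy_H K b om \<psi> (n, i) - z * \<psi> (n, i) = \<psi> (Suc n, i div K) + ch n i + (of_real (om (n, i)) - z) * \<psi> (n, i)" for n i
    by (simp add: canopy_H_def ch_def algebra_simps)
  have ch_off: "ch n i = - cs om z n i * \<psi> (n, i)" if off: "\<And>m c. n = Suc m ==> c < K ==> \<not> on m (K * i + c)" for n i
  proof (cases n)
    case 0
    then show ?thesis by (simp add: ch_def)
  next
    case (Suc m)
    have "(\<Sum>c<K. \<psi> (m, K * i + c)) = (\<Sum>c<K. - gam om z m (K * i + c) * \<psi> (Suc m, i))"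
      by (intro sum.cong refl, subst psi) (use off Suc in auto)
    then show ?thesis unfolding Suc cs_Suc by (simp add: ch_def sum_distrib_right sum_negf)
  qed
  have eq: "canopy_H K b om \<psi> v - z * \<psi> v = (if v = (k, j) then 1 else 0)" for v
  proof (cases v)
    case (Pair n i)
    consider (off) "\<not> on n i" | (root) "n = k" "i = j" | (path) m where "n = Suc (k + m)" "i = j div K ^ m div K"
    proof (cases "on n i")
      case True
      then have k: "k \<le> n" "i = j div K ^ (n - k)" by (auto simp: on_def)
      show ?thesis
      proof (cases "n - k")
        case 0
        then show ?thesis using k root by simp
      next
        case (Suc m)
        then show ?thesis using k path[of m] unfolding div_K_Suc by simp
      qed
    qed
    then show ?thesis
    proof cases
      case off
      have c: "\<not> on m (K * i + c)" if "n = Suc m" "c < K" for m c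
      proof
        assume o: "on m (K * i + c)"
        then have "k \<le> m" "(K * i + c) div K = j div K ^ (m - k) div K" by (auto simp: on_def)
        then have "on n i" using that by (simp add: on_def Suc_diff_le div_mult2_eq mult.commute[of K])
        then show False using off by simp
      qed
      have "gam om z n i * (of_real (om (n, i)) - z - cs om z n i) = 1"
        using gam_nz[OF z, of om n i] unfolding gam_eq by auto
      moreover have "x + d * (- g * x) = x - (g * d) * x" for x d g :: complex by (simp add: algebra_simps)
      ultimately have "\<psi> (Suc n, i div K) + (of_real (om (n, i)) - z - cs om z n i) * (- gam om z n i * \<psi> (Suc n, i div K)) = 0"
        by (simp only: mult_1 diff_self)
      moreover have "\<psi> (n, i) = - gam om z n i * \<psi> (Suc n, i div K)" using off by (subst psi) simp
      ultimately have "\<psi> (Suc n, i div K) + (of_real (om (n, i)) - z - cs om z n i) * \<psi> (n, i) = 0" by simp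
      moreover have "v \<noteq> (k, j)" using off Pair by (auto simp: on_def)
      moreover have "ch n i = - cs om z n i * \<psi> (n, i)" by (rule ch_off) (rule c)
      ultimately show ?thesis unfolding Pair H using Pair by (simp add: algebra_simps)
    next
      case root
      have c: "\<not> on m (K * i + c)" if "n = Suc m" "c < K" for m c using that root by (simp add: on_def)
      have e: "\<psi> (n, i) = g" "\<psi> (Suc n, i div K) = - V 0 * g" using on_path[of 0] par[of 0] root p0 by simp_all
      have "ch n i = - cs om z n i * \<psi> (n, i)" by (rule ch_off) (rule c)
      then have chv: "ch n i = - cs om z n i * g" unfolding e .
      show ?thesis unfolding Pair H unfolding chv e using root g by (simp add: algebra_simps)
    next
      case path
      define y where "y = j div K ^ m"
      have i: "i = y div K" and n: "n = Suc (k + m)" using path by (simp_all add: y_def)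
      have pn: "\<psi> (Suc (k + m), y div K) = - V m * p m" using par[of m] by (simp add: y_def)
      have "ch n i = (\<Sum>c<K. \<psi> (k + m, K * (y div K) + c))" by (simp add: ch_def n i)
      also have "... = \<psi> (k + m, K * (y div K) + y mod K) + (\<Sum>c\<in>{..<K} - {y mod K}. \<psi> (k + m, K * (y div K) + c))"
        by (rule sum.remove) auto
      also have "\<psi> (k + m, K * (y div K) + y mod K) = p m" using on_path[of m] by (simp add: y_def)
      also have "(\<Sum>c\<in>{..<K} - {y mod K}. \<psi> (k + m, K * (y div K) + c)) = (\<Sum>c\<in>{..<K} - {y mod K}. - gam om z (k + m) (K * (y div K) + c) * \<psi> (Suc (k + m), y div K))"
      proof (intro sum.cong refl)
        fix c assume c: "c \<in> {..<K} - {y mod K}"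
        have "K * (y div K) + c \<noteq> y" using c by (metis DiffE add_left_cancel mult_div_mod_eq singletonI)
        then have "\<not> on (k + m) (K * (y div K) + c)" by (simp add: on_def y_def)
        then show "\<psi> (k + m, K * (y div K) + c) = - gam om z (k + m) (K * (y div K) + c) * \<psi> (Suc (k + m), y div K)"
          using c by (subst psi) simp
      qed
      also have "... = - sib om z (k + m) y * \<psi> (Suc (k + m), y div K)"
        by (simp add: sib_def sum_distrib_right sum_negf)
      finally have chn: "ch n i = p m + - sib om z (k + m) y * (- V m * p m)" unfolding pn .
      have pp: "\<psi> (Suc n, i div K) = - V (Suc m) * (- V m * p m)" using par[of "Suc m"] unfolding n i y_def div_K_Suc pS[symmetric] by simp
      have Vm: "(of_real (om (Suc (k + m), y div K)) - z - sib om z (k + m) y - V (Suc m)) * V m = 1"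
        using V[of m] unfolding div_K_Suc[symmetric] y_def by simp
      have "\<psi> (Suc n, i div K) + ch n i + (of_real (om (n, i)) - z) * \<psi> (n, i)
        = p m - ((of_real (om (Suc (k + m), y div K)) - z - sib om z (k + m) y - V (Suc m)) * V m) * p m"
        unfolding pp chn unfolding n i pn by (simp add: algebra_simps)
      also have "... = 0" unfolding Vm by simp
      finally show ?thesis unfolding Pair H using n by simp
    qed
  qed
  \<comment> \<open>The source enters as Im (cnj g) = - Im g; multiplying by Im z makes the term
    with V m favourable for either sign of Im z.\<close>
  have bd: "energy \<psi> (k + m) (j div K ^ m) \<le> \<bar>Im g\<bar> / \<bar>Im z\<bar>" for m
  proof -
    have "(k, j) \<in> desc (k + m) (j div K ^ m)" by (simp add: desc_def)
    then have a: "Im (cnj (p m) * (- V m * p m)) = Im z * energy \<psi> (k + m) (j div K ^ m) + Im (cnj g)"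
      using flux[of om \<psi> z "(k, j)" 1 "k + m" "j div K ^ m", OF eq] on_path[of m] on_path[of 0] par[of m] p0 by simp
    have b': "cnj (p m) * (- V m * p m) = - (V m * (p m * cnj (p m)))" by simp
    have c: "Im (- (V m * (p m * cnj (p m)))) = - Im (V m) * (cmod (p m))\<^sup>2"
      unfolding complex_norm_square[symmetric] by simp
    have e: "Im z * energy \<psi> (k + m) (j div K ^ m) = Im g - Im (V m) * (cmod (p m))\<^sup>2"
      using a unfolding b' c by simp
    have "(Im z)\<^sup>2 * energy \<psi> (k + m) (j div K ^ m) = Im z * (Im z * energy \<psi> (k + m) (j div K ^ m))"
      by (simp only: power2_eq_square mult.assoc)
    also have "... = Im z * Im g - (Im (V m) * Im z) * (cmod (p m))\<^sup>2"
      unfolding e by (simp add: algebra_simps)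
    also have "... \<le> Im z * Im g" using im[of m] by simp
    also have "... \<le> \<bar>Im z\<bar> * \<bar>Im g\<bar>" by (metis abs_ge_self abs_mult)
    finally have "\<bar>Im z\<bar> * (\<bar>Im z\<bar> * energy \<psi> (k + m) (j div K ^ m)) \<le> \<bar>Im z\<bar> * \<bar>Im g\<bar>"
      by (simp add: power2_eq_square)
    then have "\<bar>Im z\<bar> * energy \<psi> (k + m) (j div K ^ m) \<le> \<bar>Im g\<bar>" using z by simp
    then show ?thesis using z by (simp add: field_simps)
  qed
  have "l2 \<psi>" unfolding l2_def
  proof (rule nonneg_bdd_above_summable_on)
    show "bdd_above (sum (%v. (cmod (\<psi> v))\<^sup>2) ` {F. F \<subseteq> UNIV \<and> finite F})"
    proof (rule bdd_aboveI2)
      fix F :: "cvert set" assume "F \<in> {F. F \<subseteq> UNIV \<and> finite F}"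
      then obtain m where m: "F \<subseteq> desc (k + m) (j div K ^ m)" using desc_exhausts[of F k j] by auto
      have "(\<Sum>v\<in>F. (cmod (\<psi> v))\<^sup>2) \<le> (\<Sum>v\<in>desc (k + m) (j div K ^ m). (cmod (\<psi> v))\<^sup>2)"
        by (rule sum_mono2) (use energy_desc m in auto)
      also have "... = energy \<psi> (k + m) (j div K ^ m)" using energy_desc by blast
      finally show "(\<Sum>v\<in>F. (cmod (\<psi> v))\<^sup>2) \<le> \<bar>Im g\<bar> / \<bar>Im z\<bar>" using bd[of m] by linarith
    qed
  qed simp
  then show ?thesis using eq on_path[of 0] p0 by (intro exI[of _ \<psi>]) simp
qed

text \<open>Existence and uniqueness of the square summable solution determine the definite
  description. A limit along any subsequence of volumes is enough, so no convergence of the full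
  sequence has to be shown.\<close>

lemma canopy_green_limit:
  fixes z :: complex
  assumes z: "Im z \<noteq> 0" and r: "filterlim r at_top sequentially" and F: "(%i. gF om z (r i) k j) \<longlonglongrightarrow> g"
  shows "canopy_green K b om (k, j) z = g"
proof -
  let ?P = "%g. \<exists>\<psi>. l2 \<psi> \<and> (\<forall>v. canopy_H K b om \<psi> v - z * \<psi> v = (if v = (k, j) then 1 else 0)) \<and> g = \<psi> (k, j)"
  have ex: "?P g"
    using up_limits[OF z r F] by (elim exE conjE) (rule l2_exists[OF z], assumption, blast, blast)
  moreover have "g1 = g2" if 1: "?P g1" and 2: "?P g2" for g1 g2
  proof -
    obtain \<psi>1 where a: "l2 \<psi>1" "\<forall>v. canopy_H K b om \<psi>1 v - z * \<psi>1 v = (if v = (k, j) then 1 else 0)" "g1 = \<psi>1 (k, j)" using 1 by blast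
    obtain \<psi>2 where c: "l2 \<psi>2" "\<forall>v. canopy_H K b om \<psi>2 v - z * \<psi>2 v = (if v = (k, j) then 1 else 0)" "g2 = \<psi>2 (k, j)" using 2 by blast
    have "l2 (%v. \<psi>1 v - \<psi>2 v)" unfolding l2_def
    proof (rule summable_on_comparison_test)
      show "(%v. 2 * (cmod (\<psi>1 v))\<^sup>2 + 2 * (cmod (\<psi>2 v))\<^sup>2) summable_on UNIV"
        using a(1) c(1) unfolding l2_def by (intro summable_on_add summable_on_cmult_right)
      show "(cmod (\<psi>1 v - \<psi>2 v))\<^sup>2 \<le> 2 * (cmod (\<psi>1 v))\<^sup>2 + 2 * (cmod (\<psi>2 v))\<^sup>2" for v
      proof -
        have "(cmod (\<psi>1 v - \<psi>2 v))\<^sup>2 \<le> (cmod (\<psi>1 v) + cmod (\<psi>2 v))\<^sup>2" by (intro power_mono norm_triangle_ineq4) simp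
        also have "... \<le> 2 * (cmod (\<psi>1 v))\<^sup>2 + 2 * (cmod (\<psi>2 v))\<^sup>2"
          using zero_le_power2[of "cmod (\<psi>1 v) - cmod (\<psi>2 v)"] by (simp add: power2_eq_square algebra_simps)
        finally show ?thesis .
      qed
    qed simp
    moreover have "canopy_H K b om (%v. \<psi>1 v - \<psi>2 v) v = z * (\<psi>1 v - \<psi>2 v)" for v
    proof -
      have "canopy_H K b om (%v. \<psi>1 v - \<psi>2 v) v = canopy_H K b om \<psi>1 v - canopy_H K b om \<psi>2 v"
        by (simp add: canopy_H_def sum_subtractf algebra_simps)
      then show ?thesis using a(2)[rule_format, of v] c(2)[rule_format, of v] by (simp add: algebra_simps)
    qed
    ultimately have "\<psi>1 (k, j) - \<psi>2 (k, j) = 0" by (rule l2_unique[OF z])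
    then show ?thesis using a c by simp
  qed
  ultimately show ?thesis unfolding canopy_green_def by (intro the_equality) blast+
qed

end

section \<open>Averaging over one site and the mass of small atoms\<close>

text \<open>The Poisson kernel of the upper half plane, that is, the Cauchy density with centre a
  and scale y.\<close>

definition pk :: "real => real => real => real" where
  "pk y a v = y / ((v - a)\<^sup>2 + y\<^sup>2) / pi"

lemma pk_nonneg: "0 < y ==> 0 \<le> pk y a v"
  by (simp add: pk_def)

lemma pk_measurable [measurable]: "pk y a \<in> borel_measurable borel"
  unfolding pk_def[abs_def] by measurable

lemma pk_ind_measurable: "(%E. ennreal (pk e t E) * indicator {a..c} E) \<in> borel_measurable lborel"
  by measurable

lemma pk_interval:
  assumes y: "0 < y" and r: "0 \<le> r"
  shows "(\<integral>\<^sup>+v. ennreal (pk y a v) * indicator {a - r..a + r} v \<partial>lborel) = ennreal (2 / pi * arctan (r / y))"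
proof -
  let ?F = "%v. arctan ((v - a) / y) / pi"
  have "(\<integral>\<^sup>+v. ennreal (pk y a v) * indicator {a - r..a + r} v \<partial>lborel) = ennreal (?F (a + r) - ?F (a - r))"
  proof (rule nn_integral_FTC_Icc)
    fix v
    have p: "0 < (v - a)\<^sup>2 + y\<^sup>2" using y by (simp add: add_nonneg_pos)
    have "inverse (1 + ((v - a) / y)\<^sup>2) * (1 / y) / pi = pk y a v"
    proof -
      have "1 + ((v - a) / y)\<^sup>2 = ((v - a)\<^sup>2 + y\<^sup>2) / y\<^sup>2" using y by (simp add: power_divide add_divide_distrib)
      then show ?thesis using y by (simp add: pk_def power2_eq_square)
    qed
    moreover have "(?F has_field_derivative inverse (1 + ((v - a) / y)\<^sup>2) * (1 / y) / pi) (at v)"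
      using y by (auto intro!: derivative_eq_intros)
    ultimately show "DERIV ?F v :> pk y a v" by simp
    show "0 \<le> pk y a v" by (rule pk_nonneg[OF y])
  qed (use r in auto)
  also have "?F (a + r) - ?F (a - r) = 2 / pi * arctan (r / y)"
    by (simp add: arctan_minus field_simps)
  finally show ?thesis .
qed

lemma pk_le_1:
  assumes y: "0 < y"
  shows "(\<integral>\<^sup>+v. ennreal (pk y a v) \<partial>lborel) \<le> 1"
proof -
  let ?f = "%n v. ennreal (pk y a v) * indicator {a - real n..a + real n} v"
  have "(\<integral>\<^sup>+v. ennreal (pk y a v) \<partial>lborel) = (\<integral>\<^sup>+v. liminf (%n. ?f n v) \<partial>lborel)"
  proof (rule nn_integral_cong)
    fix v
    obtain n0 :: nat where n0: "\<bar>v - a\<bar> \<le> real n0" using real_arch_simple by blast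
    have "\<forall>\<^sub>F n in sequentially. ennreal (pk y a v) = ?f n v"
      unfolding eventually_sequentially
    proof (intro exI[of _ n0] allI impI)
      fix n assume "n0 \<le> n"
      then have "v \<in> {a - real n..a + real n}" using n0 by (auto simp: abs_le_iff)
      then show "ennreal (pk y a v) = ?f n v" by simp
    qed
    then have "(%n. ?f n v) \<longlonglongrightarrow> ennreal (pk y a v)" by (rule Lim_transform_eventually[OF tendsto_const])
    then show "ennreal (pk y a v) = liminf (%n. ?f n v)" by (intro lim_imp_Liminf[symmetric]) auto
  qed
  also have "... \<le> liminf (%n. \<integral>\<^sup>+v. ?f n v \<partial>lborel)" by (rule nn_integral_liminf) measurable
  also have "... \<le> limsup (%n. \<integral>\<^sup>+v. ?f n v \<partial>lborel)" by (rule Liminf_le_Limsup) simp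
  also have "... \<le> 1"
  proof (intro Limsup_bounded always_eventually allI)
    fix n
    have "2 / pi * arctan (real n / y) \<le> 2 / pi * (pi / 2)"
      using arctan_ubound[of "real n / y"] by (intro mult_left_mono) auto
    then show "(\<integral>\<^sup>+v. ?f n v \<partial>lborel) \<le> 1"
      unfolding pk_interval[OF y of_nat_0_le_iff] by (simp add: ennreal_le_1)
  qed
  finally show ?thesis .
qed

context canopy_model
begin

lemma dgam_cong:
  "(\<And>v. v \<in> desc n j ==> om v = om' v) ==> dgam om E n j = dgam om' E n j"
proof (induction n arbitrary: j)
  case 0
  have "gam om E 0 j = gam om' E 0 j" by (rule gam_cong) (rule 0)
  then show ?case by (simp only: dgam.simps)
next
  case (Suc n)
  have d: "dgam om E n (K * j + i) = dgam om' E n (K * j + i)" if "i < K" for i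
    by (rule Suc.IH, rule Suc.prems) (use desc_child[OF that] in auto)
  have e: "(\<Sum>i<K. dgam om E n (K * j + i)) = (\<Sum>i<K. dgam om' E n (K * j + i))"
    by (rule sum.cong[OF refl], rule d) simp
  have g: "gam om E (Suc n) j = gam om' E (Suc n) j" by (rule gam_cong) (rule Suc.prems)
  show ?case unfolding dgam.simps e g ..
qed

lemma dcs_upd: "dcs (fun_upd om (n, j) v) E n j = dcs om E n j"
proof (cases n)
  case (Suc m)
  have "dgam (fun_upd om (Suc m, j) v) E m (K * j + i) = dgam om E m (K * j + i)" for i
    by (rule dgam_cong) (auto simp: desc_def)
  then show ?thesis by (simp add: Suc dcs_def)
qed (simp add: dcs_def)

lemma dup_cong:
  "(\<And>v. v \<notin> desc n j ==> om v = om' v) ==> dup om E d n j = dup om' E d n j"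
proof (induction d arbitrary: n j)
  case (Suc d)
  have "dup om E d (Suc n) (j div K) = dup om' E d (Suc n) (j div K)"
    by (rule Suc.IH, rule Suc.prems) (use desc_parent in auto)
  moreover have "up om E (Suc d) n j = up om' E (Suc d) n j"
    by (rule up_cong) (rule Suc.prems)
  moreover have "dsib om E n j = dsib om' E n j"
    unfolding dsib_def
  proof (intro sum.cong refl dgam_cong)
    fix i v assume i: "i \<in> {..<K} - {j mod K}" and v: "v \<in> desc n (K * (j div K) + i)"
    have "K * (j div K) + i \<noteq> j"
      using i by (metis DiffE add_left_cancel mult_div_mod_eq singletonI)
    with v have "v \<notin> desc n j" using desc_disjoint[of "K * (j div K) + i" j n] by blast
    then show "om v = om' v" by (rule Suc.prems)
  qed
  ultimately show ?case by (simp only: dup.simps)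
qed simp

lemma dh_upd: "dh (fun_upd om (n, j) v) E d n j = dh om E d n j"
proof -
  have "dup (fun_upd om (n, j) v) E d n j = dup om E d n j"
    by (rule dup_cong) (use desc_self in auto)
  then show ?thesis by (simp add: dh_def dcs_upd)
qed

text \<open>As m grows this bounds from above the mass of the atoms in U of mass less than delta.\<close>

definition Rm :: "real set => real => nat => nat => nat => (cvert => real) => nat => ennreal" where
  "Rm U \<delta> d k j om m = (\<integral>\<^sup>+E. (if E \<in> U \<and> 1 / \<delta> < dh om E d k j
     then ennreal (Im (gF om (of_real E + of_real (1 / (real m + 1)) * \<i>) d k j) / pi) else 0) \<partial>lborel)"

lemma Rm_joint_measurable:
  assumes [measurable]: "U \<in> sets borel"
  shows "(%(om, E). if E \<in> U \<and> 1 / \<delta> < dh om E d k j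
     then ennreal (Im (gF om (of_real E + of_real e * \<i>) d k j) / pi) else 0) \<in> borel_measurable (Q \<Otimes>\<^sub>M lborel)"
  by measurable

lemma Rm_measurable: "U \<in> sets borel ==> (%om. Rm U \<delta> d k j om m) \<in> borel_measurable Q"
  unfolding Rm_def by (rule lborel.borel_measurable_nn_integral[OF Rm_joint_measurable])

text \<open>As a function of the potential at (k, j), the integrand is a Poisson kernel, of total
  mass at most 1, and the density is at most M. The condition on \<open>dh\<close> does not see this
  potential and stays outside. The resulting bound does not contain m, so it survives the limit to
  the real axis.\<close>

lemma Rm_mean:
  assumes U: "U \<in> sets borel"
  shows "(\<integral>\<^sup>+om. Rm U \<delta> d k j om m \<partial>Q) \<le> ennreal M * (\<integral>\<^sup>+E. \<integral>\<^sup>+om. (if E \<in> U \<and> 1 / \<delta> < dh om E d k j then 1 else 0) \<partial>Q \<partial>lborel)"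
proof -
  note U[measurable]
  let ?z = "%E. complex_of_real E + of_real (1 / (real m + 1)) * \<i>"
  let ?f = "%om E. if E \<in> U \<and> 1 / \<delta> < dh om E d k j then ennreal (Im (gF om (?z E) d k j) / pi) else 0"
  let ?i = "%om E. if E \<in> U \<and> 1 / \<delta> < dh om E d k j then 1 else (0::ennreal)"
  have "(\<integral>\<^sup>+om. Rm U \<delta> d k j om m \<partial>Q) = (\<integral>\<^sup>+E. \<integral>\<^sup>+om. ?f om E \<partial>Q \<partial>lborel)"
    unfolding Rm_def by (rule QL.Fubini'[symmetric]) (rule Rm_joint_measurable[OF U])
  also have "... \<le> (\<integral>\<^sup>+E. ennreal M * (\<integral>\<^sup>+om. ?i om E \<partial>Q) \<partial>lborel)"
  proof (rule nn_integral_mono)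
    fix E
    have fm: "(%om. ?f om E) \<in> borel_measurable Q" by measurable
    have im: "(%om. ?i om E) \<in> borel_measurable Q" by measurable
    define c where "c om = ?z E + (cs om (?z E) k j + up om (?z E) d k j)" for om
    have z: "0 < Im (?z E)" by simp
    have c: "0 < Im (c om)" for om
      using z im_gam_cs(2)[OF z, of om k j] im_up[OF z, of om d k j] unfolding c_def plus_complex.sel by linarith
    have g: "Im (gF (fun_upd om (k, j) v) (?z E) d k j) / pi = pk (Im (c om)) (Re (c om)) v" for om v
    proof -
      have "gF (fun_upd om (k, j) v) (?z E) d k j = inverse (of_real v - c om)"
        by (simp add: gF_def c_def cs_upd up_upd diff_diff_eq)
      also have "Im ... = Im (c om) / ((v - Re (c om))\<^sup>2 + (Im (c om))\<^sup>2)"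
        by (simp add: Im_inverse)
      finally show ?thesis by (simp add: pk_def)
    qed
    have "(\<integral>\<^sup>+om. ?f om E \<partial>Q) = (\<integral>\<^sup>+om. \<integral>\<^sup>+v. ?f (fun_upd om (k, j) v) E \<partial>D \<partial>Q)"
      by (rule nn_resample1[OF fm])
    also have "... = (\<integral>\<^sup>+om. \<integral>\<^sup>+v. ?i om E * ennreal (pk (Im (c om)) (Re (c om)) v) \<partial>D \<partial>Q)"
      unfolding dh_upd g by (intro nn_integral_cong) simp
    also have "... \<le> (\<integral>\<^sup>+om. ennreal M * ?i om E \<partial>Q)"
    proof (rule nn_integral_mono)
      fix om
      have "(\<integral>\<^sup>+v. ?i om E * ennreal (pk (Im (c om)) (Re (c om)) v) \<partial>D) = ?i om E * (\<integral>\<^sup>+v. ennreal (pk (Im (c om)) (Re (c om)) v) \<partial>D)"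
        by (rule nn_integral_cmult) simp
      also have "(\<integral>\<^sup>+v. ennreal (pk (Im (c om)) (Re (c om)) v) \<partial>D) \<le> ennreal M * (\<integral>\<^sup>+v. ennreal (pk (Im (c om)) (Re (c om)) v) \<partial>lborel)"
        by (rule nn_D_le) measurable
      also have "... \<le> ennreal M * 1" by (intro mult_left_mono pk_le_1 c) simp
      finally show "(\<integral>\<^sup>+v. ?i om E * ennreal (pk (Im (c om)) (Re (c om)) v) \<partial>D) \<le> ennreal M * ?i om E"
        by (simp add: mult.commute mult_left_mono)
    qed
    also have "... = ennreal M * (\<integral>\<^sup>+om. ?i om E \<partial>Q)" by (rule nn_integral_cmult[OF im])
    finally show "(\<integral>\<^sup>+om. ?f om E \<partial>Q) \<le> ennreal M * (\<integral>\<^sup>+om. ?i om E \<partial>Q)" .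
  qed
  also have "... = ennreal M * (\<integral>\<^sup>+E. \<integral>\<^sup>+om. ?i om E \<partial>Q \<partial>lborel)"
  proof (rule nn_integral_cmult)
    have "(%(E, om). ?i om E) \<in> borel_measurable (lborel \<Otimes>\<^sub>M Q)" by measurable
    then show "(%E. \<integral>\<^sup>+om. ?i om E \<partial>Q) \<in> borel_measurable lborel" by (rule Q.borel_measurable_nn_integral)
  qed
  finally show ?thesis .
qed

text \<open>An atom lighter than \<delta> has 1 + dstj above 1/\<delta>, and by continuity this
  persists in an interval around it, inside U. There the integrand of \<open>Rm\<close> dominates
  the Poisson kernel of the atom, whose mass in a fixed interval tends to 1 as the scale
  shrinks.\<close>

lemma small_atoms_le:
  assumes U: "open U" and de: "0 < \<delta>" and R: "rat (%z. gF om z d k j) dg La' w' X'" and fin: "finite La" and w: "\<forall>t\<in>La. 0 < w t"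
    and w': "\<forall>t\<in>La'. t \<notin> La \<and> w' t = 1 / (1 + dstj La w t)" and dh: "\<forall>E. E \<notin> X' --> dh om E d k j = 1 + dstj La w E"
  shows "ennreal (\<Sum>t\<in>{t\<in>La'. t \<in> U \<and> w' t < \<delta>}. w' t) \<le> liminf (Rm U \<delta> d k j om)"
proof -
  define S where "S = {t\<in>La'. t \<in> U \<and> w' t < \<delta>}"
  have fin': "finite La'" "finite X'" and wp: "\<And>t. t \<in> La' ==> 0 < w' t" and gs: "\<And>z. z \<notin> of_real ` X' ==> gF om z d k j = stj La' w' z"
    using R by (auto simp: rat_def)
  have fS: "finite S" "S \<subseteq> La'" using fin' by (auto simp: S_def)
  have "\<exists>r>0. \<forall>E. \<bar>E - t\<bar> \<le> r --> E \<in> U \<and> 1 / \<delta> < 1 + dstj La w E" if t: "t \<in> S" for t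
  proof -
    have tL: "t \<notin> La" "w' t = 1 / (1 + dstj La w t)" "w' t < \<delta>" "t \<in> U" using t w' by (auto simp: S_def)
    have p: "0 < 1 + dstj La w t" using dstj_nonneg[of La w t] w by (simp add: add_pos_nonneg less_imp_le)
    have "1 = w' t * (1 + dstj La w t)" using p by (simp add: tL(2))
    also have "... < \<delta> * (1 + dstj La w t)" by (rule mult_strict_right_mono[OF tL(3) p])
    finally have lt: "1 / \<delta> < 1 + dstj La w t" using de by (simp add: field_simps)
    have "isCont (dstj La w) t" unfolding dstj_def[abs_def]
      by (intro continuous_intros) (use tL in auto)
    then have "(dstj La w \<longlongrightarrow> dstj La w t) (nhds t)" by (simp add: isCont_def tendsto_at_iff_tendsto_nhds)
    then have "((%E. 1 + dstj La w E) \<longlongrightarrow> 1 + dstj La w t) (nhds t)"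
      by (intro tendsto_add tendsto_const)
    then have "\<forall>\<^sub>F E in nhds t. 1 / \<delta> < 1 + dstj La w E" using lt by (rule order_tendstoD(1))
    moreover have "\<forall>\<^sub>F E in nhds t. E \<in> U" by (rule eventually_nhds_in_open[OF U tL(4)])
    ultimately have "\<forall>\<^sub>F E in nhds t. E \<in> U \<and> 1 / \<delta> < 1 + dstj La w E" by (rule eventually_conj[rotated])
    then obtain e where e: "0 < e" "\<And>E. dist E t < e ==> E \<in> U \<and> 1 / \<delta> < 1 + dstj La w E"
      unfolding eventually_nhds_metric by blast
    show ?thesis by (rule exI[of _ "e / 2"]) (use e in \<open>auto simp: dist_real_def\<close>)
  qed
  then obtain r where r: "\<And>t. t \<in> S ==> 0 < r t" "\<And>t E. t \<in> S ==> \<bar>E - t\<bar> \<le> r t ==> E \<in> U \<and> 1 / \<delta> < 1 + dstj La w E"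
    by metis
  have nX: "AE E in lborel. E \<notin> X'"
    using fin' by (intro AE_not_in) (simp add: finite_imp_null_set_lborel)
  have lower: "ennreal (\<Sum>t\<in>S. w' t * (2 / pi * arctan (r t * (real m + 1)))) \<le> Rm U \<delta> d k j om m" for m
  proof -
    define e where "e = 1 / (real m + 1)"
    have e: "0 < e" by (simp add: e_def)
    have "ennreal (\<Sum>t\<in>S. w' t * (2 / pi * arctan (r t * (real m + 1)))) = (\<Sum>t\<in>S. ennreal (w' t) * ennreal (2 / pi * arctan (r t / e)))"
    proof -
      have nn: "0 \<le> 2 / pi * arctan (r t * (real m + 1))" if "t \<in> S" for t
        using r(1)[OF that] by (simp add: less_imp_le zero_le_arctan_iff)
      have ws: "0 \<le> w' t" if "t \<in> S" for t using wp[of t] fS that by auto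
      have "ennreal (\<Sum>t\<in>S. w' t * (2 / pi * arctan (r t * (real m + 1)))) = (\<Sum>t\<in>S. ennreal (w' t * (2 / pi * arctan (r t * (real m + 1)))))"
        by (rule sum_ennreal[symmetric], rule mult_nonneg_nonneg[OF ws nn])
      also have "... = (\<Sum>t\<in>S. ennreal (w' t) * ennreal (2 / pi * arctan (r t / e)))"
      proof (rule sum.cong[OF refl])
        fix t assume t: "t \<in> S"
        have "r t / e = r t * (real m + 1)" by (simp add: e_def)
        then show "ennreal (w' t * (2 / pi * arctan (r t * (real m + 1)))) = ennreal (w' t) * ennreal (2 / pi * arctan (r t / e))"
          using ennreal_mult[OF ws[OF t] nn[OF t]] by (simp only:)
      qed
      finally show ?thesis .
    qed
    also have "... = (\<Sum>t\<in>S. ennreal (w' t) * (\<integral>\<^sup>+E. ennreal (pk e t E) * indicator {t - r t..t + r t} E \<partial>lborel))"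
      by (intro sum.cong refl arg_cong[where f = "(*) _"] pk_interval[symmetric] e less_imp_le r(1))
    also have "... = (\<Sum>t\<in>S. \<integral>\<^sup>+E. ennreal (w' t) * (ennreal (pk e t E) * indicator {t - r t..t + r t} E) \<partial>lborel)"
      by (rule sum.cong[OF refl], rule nn_integral_cmult[symmetric], rule pk_ind_measurable)
    also have "... = (\<integral>\<^sup>+E. (\<Sum>t\<in>S. ennreal (w' t) * (ennreal (pk e t E) * indicator {t - r t..t + r t} E)) \<partial>lborel)"
      by (rule nn_integral_sum[symmetric]) (rule borel_measurable_times_ennreal[OF borel_measurable_const pk_ind_measurable])
    also have "... \<le> Rm U \<delta> d k j om m" unfolding Rm_def e_def[symmetric]
    proof (rule nn_integral_mono_AE)
      show "AE E in lborel. (\<Sum>t\<in>S. ennreal (w' t) * (ennreal (pk e t E) * indicator {t - r t..t + r t} E))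
        \<le> (if E \<in> U \<and> 1 / \<delta> < dh om E d k j then ennreal (Im (gF om (of_real E + of_real e * \<i>) d k j) / pi) else 0)"
        using nX
      proof eventually_elim
        case (elim E)
        show ?case
        proof (cases "E \<in> U \<and> 1 / \<delta> < dh om E d k j")
          case True
          have "of_real E + of_real e * \<i> \<notin> complex_of_real ` X'" using e by (auto simp: complex_eq_iff)
          then have "gF om (of_real E + of_real e * \<i>) d k j = stj La' w' (of_real E + of_real e * \<i>)" by (rule gs)
          then have "Im (gF om (of_real E + of_real e * \<i>) d k j) / pi = e * (\<Sum>t\<in>La'. w' t / (cmod (of_real t - (of_real E + of_real e * \<i>)))\<^sup>2) / pi"
            by (simp add: Im_stj)
          also have "... = (\<Sum>t\<in>La'. w' t * pk e t E)"
            by (simp add: pk_def sum_distrib_left sum_divide_distrib cmod_power2 power2_commute mult_ac)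
          finally have I: "Im (gF om (of_real E + of_real e * \<i>) d k j) / pi = (\<Sum>t\<in>La'. w' t * pk e t E)" .
          have "(\<Sum>t\<in>S. ennreal (w' t) * (ennreal (pk e t E) * indicator {t - r t..t + r t} E)) \<le> (\<Sum>t\<in>S. ennreal (w' t * pk e t E))"
          proof (rule sum_mono)
            fix t assume "t \<in> S"
            then have "0 \<le> w' t" using wp fS by (auto simp: less_imp_le)
            then show "ennreal (w' t) * (ennreal (pk e t E) * indicator {t - r t..t + r t} E) \<le> ennreal (w' t * pk e t E)"
              using pk_nonneg[OF e] by (auto simp: ennreal_mult split: split_indicator)
          qed
          also have "... = ennreal (\<Sum>t\<in>S. w' t * pk e t E)"
            by (rule sum_ennreal) (use wp fS pk_nonneg[OF e] in \<open>auto simp: less_imp_le subset_iff\<close>)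
          also have "... \<le> ennreal (\<Sum>t\<in>La'. w' t * pk e t E)"
            by (intro ennreal_leI sum_mono2) (use wp fS fin' pk_nonneg[OF e] in \<open>auto simp: less_imp_le\<close>)
          finally show ?thesis using True I by simp
        next
          case False
          have "E \<notin> {t - r t..t + r t}" if t: "t \<in> S" for t
          proof
            assume "E \<in> {t - r t..t + r t}"
            then have "\<bar>E - t\<bar> \<le> r t" by (simp add: abs_le_iff)
            from r(2)[OF t this] show False using False dh elim by auto
          qed
          then show ?thesis using False by auto
        qed
      qed
    qed
    finally show ?thesis .
  qed
  have "(%m. \<Sum>t\<in>S. w' t * (2 / pi * arctan (r t * (real m + 1)))) \<longlonglongrightarrow> (\<Sum>t\<in>S. w' t)"
  proof (rule tendsto_sum)
    fix t assume "t \<in> S"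
    then have "0 < r t" by (rule r(1))
    then have "(%m. 2 / pi * arctan (r t * (real m + 1))) \<longlonglongrightarrow> 1" by real_asymp
    from tendsto_mult[OF tendsto_const this, of "w' t"]
    show "(%m. w' t * (2 / pi * arctan (r t * (real m + 1)))) \<longlonglongrightarrow> w' t" by simp
  qed
  then have "(%m. ennreal (\<Sum>t\<in>S. w' t * (2 / pi * arctan (r t * (real m + 1))))) \<longlonglongrightarrow> ennreal (\<Sum>t\<in>S. w' t)"
    by (rule tendsto_ennrealI)
  then have "ennreal (\<Sum>t\<in>S. w' t) = liminf (%m. ennreal (\<Sum>t\<in>S. w' t * (2 / pi * arctan (r t * (real m + 1)))))"
    by (intro lim_imp_Liminf[symmetric]) auto
  also have "... \<le> liminf (Rm U \<delta> d k j om)" by (intro Liminf_mono always_eventually allI lower)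
  finally show ?thesis by (simp only: S_def)
qed

text \<open>If \<open>dh\<close> is large while its product with the squared Green function is
  bounded, the Green function must be small, and the inverse moment makes that unlikely uniformly in
  d. The product is bounded uniformly in d off a set of small measure, because its supremum over d
  is almost everywhere finite.\<close>

lemma dh_tight:
  assumes I [measurable]: "I \<in> sets borel"
    and bd: "AE om in Q. AE E in lborel. E \<in> I --> (\<exists>R. \<forall>d. (gF om E d k j)\<^sup>2 * dh om E d k j \<le> R)"
    and e: "0 < \<epsilon>" and l: "0 \<le> l"
  shows "\<exists>\<delta>>0. \<forall>d. (\<integral>\<^sup>+E. \<integral>\<^sup>+om. (if E \<in> I \<inter> {-l..l} \<and> 1 / \<delta> < dh om E d k j then 1 else 0) \<partial>Q \<partial>lborel) \<le> ennreal \<epsilon>"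
proof -
  define B where "B n p \<longleftrightarrow> snd p \<in> I \<inter> {-l..l} \<and> (\<exists>d. real n < (gF (fst p) (snd p) d k j)\<^sup>2 * dh (fst p) (snd p) d k j)" for n and p :: "(cvert => real) \<times> real"
  have Bm [measurable]: "Measurable.pred (Q \<Otimes>\<^sub>M lborel) (B n)" for n
    unfolding B_def[abs_def] by measurable
  let ?u = "%n p. if B n p then 1 else (0::ennreal)"
  let ?w = "%p :: (cvert => real) \<times> real. indicator {-l..l} (snd p) :: ennreal"
  have um: "?u n \<in> borel_measurable (Q \<Otimes>\<^sub>M lborel)" for n by measurable
  have wm: "?w \<in> borel_measurable (Q \<Otimes>\<^sub>M lborel)" by measurable
  have "(%n. \<integral>\<^sup>+p. ?u n p \<partial>(Q \<Otimes>\<^sub>M lborel)) \<longlonglongrightarrow> (\<integral>\<^sup>+p. 0 \<partial>(Q \<Otimes>\<^sub>M (lborel :: real measure)))"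
  proof (rule nn_integral_dominated_convergence[where w = ?w])
    have "(\<integral>\<^sup>+p. ?w p \<partial>(Q \<Otimes>\<^sub>M lborel)) = (\<integral>\<^sup>+E. \<integral>\<^sup>+om. indicator {-l..l} E \<partial>Q \<partial>lborel)"
      by (subst QL.nn_integral_snd[symmetric, OF wm]) simp
    also have "... = (\<integral>\<^sup>+E. indicator {-l..l} E \<partial>lborel)"
      by (simp add: Q.emeasure_space_1[simplified])
    also have "... < \<infinity>" using l by simp
    finally show "(\<integral>\<^sup>+p. ?w p \<partial>(Q \<Otimes>\<^sub>M lborel)) < \<infinity>" .
    show "AE p in Q \<Otimes>\<^sub>M lborel. ?u n p \<le> ?w p" for n
      by (rule AE_I2) (simp add: B_def)
    define C where "C p \<longleftrightarrow> (snd p \<in> I --> (\<exists>R::nat. \<forall>d. (gF (fst p) (snd p) d k j)\<^sup>2 * dh (fst p) (snd p) d k j \<le> real R))" for p :: "(cvert => real) \<times> real"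
    have Cm: "Measurable.pred (Q \<Otimes>\<^sub>M lborel) C" unfolding C_def[abs_def] by measurable
    have "AE om in Q. AE E in lborel. C (om, E)"
      using bd
    proof eventually_elim
      case (elim om)
      then show ?case
      proof eventually_elim
        case (elim E)
        show ?case unfolding C_def fst_conv snd_conv
        proof
          assume "E \<in> I"
          with elim obtain R where R: "\<forall>d. (gF om E d k j)\<^sup>2 * dh om E d k j \<le> R" by blast
          obtain n :: nat where "R \<le> real n" using real_arch_simple by blast
          then show "\<exists>R::nat. \<forall>d. (gF om E d k j)\<^sup>2 * dh om E d k j \<le> real R"
            using R by (intro exI[of _ n]) (auto intro: order_trans)
        qed
      qed
    qed
    then have "AE p in Q \<Otimes>\<^sub>M lborel. C p"
      using Cm by (intro QL.AE_pair_measure) (auto simp: pred_def)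
    then show "AE p in Q \<Otimes>\<^sub>M lborel. (%n. ?u n p) \<longlonglongrightarrow> 0"
    proof eventually_elim
      case (elim p)
      show ?case
      proof (cases "snd p \<in> I")
        case True
        then obtain R :: nat where R: "\<forall>d. (gF (fst p) (snd p) d k j)\<^sup>2 * dh (fst p) (snd p) d k j \<le> real R"
          using elim by (auto simp: C_def)
        have "\<forall>\<^sub>F n in sequentially. 0 = ?u n p"
          unfolding eventually_sequentially
        proof (intro exI[of _ R] allI impI)
          fix n assume n: "R \<le> n"
          have "\<not> B n p"
          proof
            assume "B n p"
            then obtain d where "real n < (gF (fst p) (snd p) d k j)\<^sup>2 * dh (fst p) (snd p) d k j" by (auto simp: B_def)
            then show False using R[rule_format, of d] n by simp
          qed
          then show "0 = ?u n p" by simp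
        qed
        then show ?thesis by (rule Lim_transform_eventually[OF tendsto_const])
      qed (simp add: B_def)
    qed
  qed (use um wm in auto)
  then have "(%n. \<integral>\<^sup>+p. ?u n p \<partial>(Q \<Otimes>\<^sub>M lborel)) \<longlonglongrightarrow> 0" by simp
  then have "\<forall>\<^sub>F n in sequentially. (\<integral>\<^sup>+p. ?u n p \<partial>(Q \<Otimes>\<^sub>M lborel)) < ennreal (\<epsilon> / 2)"
    by (rule order_tendstoD(2)) (use e in simp)
  then obtain n where n: "0 < n" "(\<integral>\<^sup>+p. ?u n p \<partial>(Q \<Otimes>\<^sub>M lborel)) < ennreal (\<epsilon> / 2)"
    unfolding eventually_sequentially by (metis le_add1 le_add2 zero_less_Suc plus_1_eq_Suc less_le_trans)
  define H where "H = (B0 + l powr s) * (2 * l)"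
  have H: "0 \<le> H" using B0_nonneg l by (simp add: H_def)
  \<comment> \<open>Half of \<epsilon> is left for the inverse moment, whose integral over the
    energy window is at most H.\<close>
  define c where "c = \<epsilon> / (2 * (H + 1))"
  have c: "0 < c" "c * H \<le> \<epsilon> / 2"
  proof -
    show "0 < c" using e H by (simp add: c_def)
    have "c * (H + 1) = \<epsilon> / 2" using H by (simp add: c_def field_simps)
    then show "c * H \<le> \<epsilon> / 2" using \<open>0 < c\<close> by (simp add: distrib_left)
  qed
  \<comment> \<open>With \<open>real n * \<delta> = c powr (2 / s)\<close>, the two conditions on
    \<open>dh\<close> and the product force the s-th power of the Green function's modulus to be at
    most c.\<close>
  define \<delta> where "\<delta> = c powr (2 / s) / real n"
  have de: "0 < \<delta>" using c n by (simp add: \<delta>_def)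
  have nd: "real n * \<delta> = c powr (2 / s)" using n by (simp add: \<delta>_def)
  show ?thesis
  proof (intro exI[of _ \<delta>] conjI allI de)
    fix d
    define X where "X p \<longleftrightarrow> snd p \<in> I \<inter> {-l..l} \<and> 1 / \<delta> < dh (fst p) (snd p) d k j" for p :: "(cvert => real) \<times> real"
    let ?x = "%p. if X p then 1 else (0::ennreal)"
    let ?h = "%p :: (cvert => real) \<times> real. ennreal (norm (inverse (gF (fst p) (complex_of_real (snd p)) d k j)) powr s) * indicator {-l..l} (snd p)"
    have xm: "?x \<in> borel_measurable (Q \<Otimes>\<^sub>M lborel)" unfolding X_def by measurable
    have hm: "?h \<in> borel_measurable (Q \<Otimes>\<^sub>M lborel)" by measurable
    have "(\<integral>\<^sup>+E. \<integral>\<^sup>+om. (if E \<in> I \<inter> {-l..l} \<and> 1 / \<delta> < dh om E d k j then 1 else 0) \<partial>Q \<partial>lborel) = (\<integral>\<^sup>+E. \<integral>\<^sup>+om. ?x (om, E) \<partial>Q \<partial>lborel)"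
      by (simp only: X_def fst_conv snd_conv)
    also have "... = (\<integral>\<^sup>+p. ?x p \<partial>(Q \<Otimes>\<^sub>M lborel))" by (rule QL.nn_integral_snd[OF xm])
    also have "... \<le> (\<integral>\<^sup>+p. ?u n p + ennreal c * ?h p \<partial>(Q \<Otimes>\<^sub>M lborel))"
    proof (rule nn_integral_mono_AE)
      have "AE om in Q. AE E in lborel. gF (fst (om, E)) (snd (om, E::real)) d k j \<noteq> 0"
      proof (rule AE_I2)
        fix om
        show "AE E in lborel. gF (fst (om, E)) (snd (om, E::real)) d k j \<noteq> 0"
          using AE_reg[of om] by eventually_elim (simp add: reg_def)
      qed
      then have "AE p in Q \<Otimes>\<^sub>M lborel. gF (fst p) (snd p :: real) d k j \<noteq> 0"
        by (intro QL.AE_pair_measure) measurable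
      then show "AE p in Q \<Otimes>\<^sub>M lborel. ?x p \<le> ?u n p + ennreal c * ?h p"
      proof eventually_elim
        case (elim p)
        show ?case
        proof (cases "X p \<and> \<not> B n p")
          case True
          let ?g = "gF (fst p) (snd p) d k j"
          have E: "snd p \<in> {-l..l}" "1 / \<delta> < dh (fst p) (snd p) d k j" "?g\<^sup>2 * dh (fst p) (snd p) d k j \<le> real n"
            using True by (auto simp: X_def B_def not_less)
          have "?g\<^sup>2 * (1 / \<delta>) \<le> ?g\<^sup>2 * dh (fst p) (snd p) d k j" using E by (intro mult_left_mono) auto
          then have "?g\<^sup>2 * (1 / \<delta>) \<le> real n" using E by linarith
          then have "?g\<^sup>2 \<le> c powr (2 / s)" using de unfolding nd[symmetric] by (simp add: field_simps)
          then have "(?g\<^sup>2) powr (s / 2) \<le> (c powr (2 / s)) powr (s / 2)" using s_pos by (intro powr_mono2) auto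
          moreover have "(c powr (2 / s)) powr (s / 2) = c" using s_pos c by (simp add: powr_powr)
          moreover have "(?g\<^sup>2) powr (s / 2) = \<bar>?g\<bar> powr s"
          proof -
            have "?g\<^sup>2 = \<bar>?g\<bar> powr 2" using elim by simp
            then show ?thesis by (simp only: powr_powr) simp
          qed
          ultimately have gc: "\<bar>?g\<bar> powr s \<le> c" by simp
          have gp: "0 < \<bar>?g\<bar> powr s" using elim by simp
          have "norm (inverse (gF (fst p) (complex_of_real (snd p)) d k j)) powr s = inverse (\<bar>?g\<bar> powr s)"
            by (simp add: of_real_gF norm_inverse inverse_powr)
          moreover have "1 \<le> c * inverse (\<bar>?g\<bar> powr s)"
            using gc gp by (simp add: divide_inverse[symmetric])
          ultimately have "1 \<le> c * norm (inverse (gF (fst p) (complex_of_real (snd p)) d k j)) powr s"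
            by (simp only:)
          then have "ennreal 1 \<le> ennreal (c * norm (inverse (gF (fst p) (complex_of_real (snd p)) d k j)) powr s)" by (rule ennreal_leI)
          also have "... = ennreal c * ennreal (norm (inverse (gF (fst p) (complex_of_real (snd p)) d k j)) powr s)"
            using c by (intro ennreal_mult) auto
          also have "... = ennreal c * ?h p" using E by simp
          finally show ?thesis using True by simp
        next
          case False
          then show ?thesis by auto
        qed
      qed
    qed
    also have "... = (\<integral>\<^sup>+p. ?u n p \<partial>(Q \<Otimes>\<^sub>M lborel)) + ennreal c * (\<integral>\<^sup>+p. ?h p \<partial>(Q \<Otimes>\<^sub>M lborel))"
      by (subst nn_integral_add[OF um borel_measurable_times_ennreal[OF borel_measurable_const hm]], subst nn_integral_cmult[OF hm]) (rule refl)
    also have "(\<integral>\<^sup>+p. ?h p \<partial>(Q \<Otimes>\<^sub>M lborel)) \<le> ennreal H"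
    proof -
      have "(\<integral>\<^sup>+p. ?h p \<partial>(Q \<Otimes>\<^sub>M lborel)) = (\<integral>\<^sup>+E. \<integral>\<^sup>+om. ?h (om, E) \<partial>Q \<partial>lborel)"
        by (rule QL.nn_integral_snd[OF hm, symmetric])
      also have "... \<le> (\<integral>\<^sup>+E. ennreal (B0 + l powr s) * indicator {-l..l} E \<partial>lborel)"
      proof (rule nn_integral_mono)
        fix E :: real
        show "(\<integral>\<^sup>+om. ?h (om, E) \<partial>Q) \<le> ennreal (B0 + l powr s) * indicator {-l..l} E"
        proof (cases "E \<in> {-l..l}")
          case True
          then have "\<bar>E\<bar> \<le> l" by (simp add: abs_le_iff)
          then have "\<bar>E\<bar> powr s \<le> l powr s" using s_pos by (intro powr_mono2) auto
          then have "ennreal (B0 + norm (complex_of_real E) powr s) \<le> ennreal (B0 + l powr s)" by (intro ennreal_leI) simp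
          then show ?thesis using gF_inverse_moment[of "complex_of_real E" d k j] True by simp
        qed simp
      qed
      also have "... = ennreal (B0 + l powr s) * ennreal (2 * l)"
        using l by (subst nn_integral_cmult) auto
      also have "... = ennreal H" unfolding H_def using B0_nonneg l by (intro ennreal_mult[symmetric]) auto
      finally show ?thesis .
    qed
    then have "(\<integral>\<^sup>+p. ?u n p \<partial>(Q \<Otimes>\<^sub>M lborel)) + ennreal c * (\<integral>\<^sup>+p. ?h p \<partial>(Q \<Otimes>\<^sub>M lborel)) \<le> ennreal (\<epsilon> / 2) + ennreal c * ennreal H"
      by (intro add_mono mult_left_mono less_imp_le[OF n(2)]) auto
    also have "ennreal c * ennreal H = ennreal (c * H)" using c H by (intro ennreal_mult[symmetric]) auto
    also have "... \<le> ennreal (\<epsilon> / 2)" by (rule ennreal_leI[OF c(2)])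
    also have "ennreal (\<epsilon> / 2) + ennreal (\<epsilon> / 2) = ennreal \<epsilon>" using e by (simp flip: ennreal_plus)
    finally show "(\<integral>\<^sup>+E. \<integral>\<^sup>+om. (if E \<in> I \<inter> {-l..l} \<and> 1 / \<delta> < dh om E d k j then 1 else 0) \<partial>Q \<partial>lborel) \<le> ennreal \<epsilon>"
      by (simp add: add_left_mono)
  qed
qed

text \<open>The mean mass of small atoms is made of order 4^(-l) for the l-th window, so that even
  with weights 2^l the sum over l has a finite mean. Fatou over the volumes then gives, for almost
  every potential, one finite R and infinitely many volumes that obey all the bounds at once; a
  single volume sequence for all l is needed later.\<close>

lemma small_atoms:
  assumes I [measurable]: "I \<in> sets borel"
    and bd: "AE om in Q. AE E in lborel. E \<in> I --> (\<exists>R. \<forall>d. (gF om E d k j)\<^sup>2 * dh om E d k j \<le> R)"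
  shows "\<exists>U \<delta>. (\<forall>l. open (U l) \<and> 0 < \<delta> l \<and> I \<inter> {-real l..real l} \<subseteq> U l) \<and>
    (AE om in Q. \<exists>R\<ge>0. \<exists>\<^sub>F d in sequentially. \<forall>l. liminf (Rm (U l) (\<delta> l) d k j om) \<le> ennreal (R / 2 ^ l))"
proof -
  define P where "P l U \<delta> \<longleftrightarrow> open U \<and> 0 < \<delta> \<and> I \<inter> {-real l..real l} \<subseteq> U \<and>
    (\<forall>d. (\<integral>\<^sup>+E. \<integral>\<^sup>+om. (if E \<in> U \<and> 1 / \<delta> < dh om E d k j then 1 else 0) \<partial>Q \<partial>lborel) \<le> ennreal (2 / 4 ^ l))"
    for l :: nat and U \<delta>
  have "\<exists>U \<delta>. P l U \<delta>" for l
  proof -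
    let ?S = "I \<inter> {-real l..real l}"
    have "?S \<in> sets lebesgue" by (rule sets_completionI_sets) simp
    then obtain T where T: "open T" "?S \<subseteq> T" "T - ?S \<in> lmeasurable" "emeasure lebesgue (T - ?S) < ennreal (1 / 4 ^ l)"
      by (rule sets_lebesgue_outer_open[of _ "1 / 4 ^ l"]) auto
    \<comment> \<open>The passage to weak limits works with open sets, so the Borel set I is
      enclosed in an open one at a cost of 4^(-l) in measure; on the excess the trivial bound 1 is
      used. The window is bounded so that \<open>dh_tight\<close> applies.\<close>
    define U where "U = T \<inter> {-(real l + 1)<..<real l + 1}"
    have U: "open U" "?S \<subseteq> U" using T by (auto simp: U_def)
    obtain \<delta> where d: "0 < \<delta>" "\<And>d. (\<integral>\<^sup>+E. \<integral>\<^sup>+om. (if E \<in> I \<inter> {-(real l + 1)..real l + 1} \<and> 1 / \<delta> < dh om E d k j then 1 else 0) \<partial>Q \<partial>lborel) \<le> ennreal (1 / 4 ^ l)"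
      using dh_tight[OF I bd, of "1 / 4 ^ l" "real l + 1"] by auto
    have Tm: "T - ?S \<in> sets borel" using T(1) by simp
    have "(\<integral>\<^sup>+E. \<integral>\<^sup>+om. (if E \<in> U \<and> 1 / \<delta> < dh om E d k j then 1 else 0) \<partial>Q \<partial>lborel) \<le> ennreal (2 / 4 ^ l)" for d
    proof -
      let ?J = "%E. \<integral>\<^sup>+om. (if E \<in> I \<inter> {-(real l + 1)..real l + 1} \<and> 1 / \<delta> < dh om E d k j then 1 else 0) \<partial>Q"
      have Jm: "?J \<in> borel_measurable lborel"
      proof -
        have "(%(E, om). (if E \<in> I \<inter> {-(real l + 1)..real l + 1} \<and> 1 / \<delta> < dh om E d k j then 1 else (0::ennreal))) \<in> borel_measurable (lborel \<Otimes>\<^sub>M Q)"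
          by measurable
        then show ?thesis by (rule Q.borel_measurable_nn_integral)
      qed
      have "(\<integral>\<^sup>+E. \<integral>\<^sup>+om. (if E \<in> U \<and> 1 / \<delta> < dh om E d k j then 1 else 0) \<partial>Q \<partial>lborel) \<le> (\<integral>\<^sup>+E. indicator (T - ?S) E + ?J E \<partial>lborel)"
      proof (rule nn_integral_mono)
        fix E
        show "(\<integral>\<^sup>+om. (if E \<in> U \<and> 1 / \<delta> < dh om E d k j then 1 else 0) \<partial>Q) \<le> indicator (T - ?S) E + ?J E"
        proof (cases "E \<in> U")
          case True
          show ?thesis
          proof (cases "E \<in> I")
            case True
            then have "(\<integral>\<^sup>+om. (if E \<in> U \<and> 1 / \<delta> < dh om E d k j then 1 else 0) \<partial>Q) \<le> ?J E"
              using \<open>E \<in> U\<close> by (intro nn_integral_mono) (auto simp: U_def)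
            then show ?thesis by (rule order_trans) simp
          next
            case False
            have "(\<integral>\<^sup>+om. (if E \<in> U \<and> 1 / \<delta> < dh om E d k j then 1 else 0) \<partial>Q) \<le> (\<integral>\<^sup>+om. 1 \<partial>Q)"
              by (intro nn_integral_mono) auto
            also have "... = 1" by (simp add: Q.emeasure_space_1[simplified])
            also have "1 = indicator (T - ?S) E" using False \<open>E \<in> U\<close> by (simp add: U_def)
            finally show ?thesis by (rule order_trans) simp
          qed
        qed simp
      qed
      also have "... = emeasure lborel (T - ?S) + (\<integral>\<^sup>+E. ?J E \<partial>lborel)"
        by (subst nn_integral_add[OF _ Jm]) (use Tm in auto)
      also have "... \<le> ennreal (1 / 4 ^ l) + ennreal (1 / 4 ^ l)"
      proof (intro add_mono d(2))
        have "emeasure lebesgue (T - ?S) = emeasure lborel (T - ?S)" using Tm by simp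
        then show "emeasure lborel (T - ?S) \<le> ennreal (1 / 4 ^ l)" using T(4) by simp
      qed
      also have "... = ennreal (2 / 4 ^ l)" by (simp flip: ennreal_plus)
      finally show ?thesis .
    qed
    then have "P l U \<delta>" unfolding P_def using U d(1) by (intro conjI allI)
    then show ?thesis by blast
  qed
  then obtain U \<delta> where P: "\<And>l. P l (U l) (\<delta> l)" by metis
  have U: "open (U l)" and de: "0 < \<delta> l" and IU: "I \<inter> {-real l..real l} \<subseteq> U l"
    and Ub: "(\<integral>\<^sup>+E. \<integral>\<^sup>+om. (if E \<in> U l \<and> 1 / \<delta> l < dh om E d k j then 1 else 0) \<partial>Q \<partial>lborel) \<le> ennreal (2 / 4 ^ l)" for l d
    using P[of l] unfolding P_def by blast+
  have Us: "U l \<in> sets borel" for l using U by simp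
  let ?L = "%l d om. liminf (Rm (U l) (\<delta> l) d k j om)"
  have Lm: "?L l d \<in> borel_measurable Q" for l d
    by (rule borel_measurable_liminf) (rule Rm_measurable[OF Us])
  have Lb: "(\<integral>\<^sup>+om. ?L l d om \<partial>Q) \<le> ennreal (M * (2 / 4 ^ l))" for l d
  proof -
    have "(\<integral>\<^sup>+om. ?L l d om \<partial>Q) \<le> liminf (%m. \<integral>\<^sup>+om. Rm (U l) (\<delta> l) d k j om m \<partial>Q)"
      by (rule nn_integral_liminf) (rule Rm_measurable[OF Us])
    also have "... \<le> limsup (%m. \<integral>\<^sup>+om. Rm (U l) (\<delta> l) d k j om m \<partial>Q)" by (rule Liminf_le_Limsup) simp
    also have "... \<le> ennreal M * ennreal (2 / 4 ^ l)"
      by (intro Limsup_bounded always_eventually allI order_trans[OF Rm_mean[OF Us] mult_left_mono[OF Ub]]) simp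
    also have "... = ennreal (M * (2 / 4 ^ l))" using M_nonneg by (intro ennreal_mult[symmetric]) auto
    finally show ?thesis .
  qed
  define T where "T d om = (\<Sum>l. ennreal (2 ^ l) * ?L l d om)" for d om
  have Tm: "T d \<in> borel_measurable Q" for d
    unfolding T_def[abs_def] by (rule borel_measurable_suminf_order) (intro borel_measurable_times_ennreal borel_measurable_const Lm)
  have Tb: "(\<integral>\<^sup>+om. T d om \<partial>Q) \<le> ennreal (4 * M)" for d
  proof -
    have "(\<integral>\<^sup>+om. T d om \<partial>Q) = (\<Sum>l. \<integral>\<^sup>+om. ennreal (2 ^ l) * ?L l d om \<partial>Q)"
      unfolding T_def by (rule nn_integral_suminf) (intro borel_measurable_times_ennreal borel_measurable_const Lm)
    also have "... \<le> (\<Sum>l. ennreal (2 * M * (1 / 2) ^ l))"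
    proof (rule suminf_le)
      fix l
      have "(\<integral>\<^sup>+om. ennreal (2 ^ l) * ?L l d om \<partial>Q) = ennreal (2 ^ l) * (\<integral>\<^sup>+om. ?L l d om \<partial>Q)" by (rule nn_integral_cmult[OF Lm])
      also have "... \<le> ennreal (2 ^ l) * ennreal (M * (2 / 4 ^ l))" by (intro mult_left_mono Lb) simp
      also have "... = ennreal (2 ^ l * (M * (2 / 4 ^ l)))" using M_nonneg by (intro ennreal_mult[symmetric]) auto
      also have "2 ^ l * (M * (2 / 4 ^ l)) = 2 * M * (1 / 2) ^ l"
      proof -
        have "(4::real) ^ l = 2 ^ l * 2 ^ l" by (simp flip: power_mult_distrib)
        then show ?thesis by (simp add: power_divide)
      qed
      finally show "(\<integral>\<^sup>+om. ennreal (2 ^ l) * ?L l d om \<partial>Q) \<le> ennreal (2 * M * (1 / 2) ^ l)" .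
    qed auto
    also have "... = ennreal (4 * M)"
    proof (rule suminf_ennreal_eq)
      have "(%l. (1 / 2) ^ l :: real) sums 2" using geometric_sums[of "1 / 2 :: real"] by simp
      from sums_mult[OF this, of "2 * M"] show "(%l. 2 * M * (1 / 2) ^ l) sums (4 * M)" by simp
    qed (use M_nonneg in auto)
    finally show ?thesis .
  qed
  have "(\<integral>\<^sup>+om. liminf (%d. T d om) \<partial>Q) \<le> liminf (%d. \<integral>\<^sup>+om. T d om \<partial>Q)" by (rule nn_integral_liminf[OF Tm])
  also have "... \<le> limsup (%d. \<integral>\<^sup>+om. T d om \<partial>Q)" by (rule Liminf_le_Limsup) simp
  also have "... \<le> ennreal (4 * M)" by (intro Limsup_bounded always_eventually allI Tb)
  finally have "(\<integral>\<^sup>+om. liminf (%d. T d om) \<partial>Q) \<noteq> \<infinity>" by (auto simp: top_unique)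
  then have "AE om in Q. liminf (%d. T d om) \<noteq> \<infinity>"
    by (intro nn_integral_PInf_AE borel_measurable_liminf Tm)
  then have "AE om in Q. \<exists>R\<ge>0. \<exists>\<^sub>F d in sequentially. \<forall>l. ?L l d om \<le> ennreal (R / 2 ^ l)"
  proof eventually_elim
    case (elim om)
    obtain R0 where R0: "0 \<le> R0" "liminf (%d. T d om) = ennreal R0"
      using elim by (cases "liminf (%d. T d om)") auto
    define R where "R = R0 + 1"
    have R: "0 \<le> R" "liminf (%d. T d om) < ennreal R" using R0 by (auto simp: R_def ennreal_less_iff)
    \<comment> \<open>A lower limit below \<open>R\<close> only gives infinitely many volumes,
      whence the subsequence taken in the final step.\<close>
    have fr: "\<exists>\<^sub>F d in sequentially. T d om < ennreal R"
    proof (rule ccontr)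
      assume "\<not> (\<exists>\<^sub>F d in sequentially. T d om < ennreal R)"
      then have "\<forall>\<^sub>F d in sequentially. ennreal R \<le> T d om" by (simp add: not_frequently not_less)
      then have "ennreal R \<le> liminf (%d. T d om)" by (rule Liminf_bounded)
      then show False using R by simp
    qed
    have "\<exists>\<^sub>F d in sequentially. \<forall>l. ?L l d om \<le> ennreal (R / 2 ^ l)"
      using fr
    proof (rule frequently_elim1)
      fix d assume d: "T d om < ennreal R"
      show "\<forall>l. ?L l d om \<le> ennreal (R / 2 ^ l)"
      proof
        fix l
        have "ennreal (2 ^ l) * ?L l d om = (\<Sum>l\<in>{l}. ennreal (2 ^ l) * ?L l d om)" by simp
        also have "... \<le> T d om" unfolding T_def by (rule sum_le_suminf) auto
        finally have "ennreal (2 ^ l) * ?L l d om \<le> ennreal R" using d by simp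
        then have "ennreal (1 / 2 ^ l) * (ennreal (2 ^ l) * ?L l d om) \<le> ennreal (1 / 2 ^ l) * ennreal R" by (rule mult_left_mono) simp
        also have "ennreal (1 / 2 ^ l) * ennreal R = ennreal (1 / 2 ^ l * R)" using R by (intro ennreal_mult[symmetric]) auto
        also have "ennreal (1 / 2 ^ l) * (ennreal (2 ^ l) * ?L l d om) = ?L l d om"
          unfolding mult.assoc[symmetric] by (subst ennreal_mult[symmetric]) auto
        finally show "?L l d om \<le> ennreal (R / 2 ^ l)" by simp
      qed
    qed
    then show ?case using R by blast
  qed
  then show ?thesis using U de IU by blast
qed

end

section \<open>Weak limits of atomic measures\<close>

text \<open>A point measure lives on the finite set La with its power set; the image under the
  identity turns it into a Borel measure on the line.\<close>

definition atm :: "real set => (real => real) => real measure" where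
  "atm La w = distr (point_measure La (%t. ennreal (w t))) borel (%x. x)"

lemma sets_atm [simp]: "sets (atm La w) = sets borel" by (simp add: atm_def)

lemma atm_id: "(%x. x) \<in> measurable (point_measure La f) (borel :: real measure)"
  by (rule measurableI) (auto simp: sets_point_measure space_point_measure)

lemma measure_atm:
  assumes fin: "finite La" and w: "\<And>t. t \<in> La ==> 0 \<le> w t" and A: "A \<in> sets borel"
  shows "measure (atm La w) A = (\<Sum>t\<in>La \<inter> A. w t)" "emeasure (atm La w) A = ennreal (\<Sum>t\<in>La \<inter> A. w t)"
proof -
  have "emeasure (atm La w) A = emeasure (point_measure La (%t. ennreal (w t))) (La \<inter> A)"
    unfolding atm_def by (subst emeasure_distr[OF atm_id A]) (simp add: space_point_measure Int_commute)
  also have "... = (\<Sum>t\<in>La \<inter> A. ennreal (w t))" using fin by (intro emeasure_point_measure_finite) auto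
  also have "... = ennreal (\<Sum>t\<in>La \<inter> A. w t)" by (rule sum_ennreal) (use w in auto)
  finally show e: "emeasure (atm La w) A = ennreal (\<Sum>t\<in>La \<inter> A. w t)" .
  show "measure (atm La w) A = (\<Sum>t\<in>La \<inter> A. w t)"
    unfolding measure_def e by (rule enn2real_ennreal) (use w in \<open>auto intro: sum_nonneg\<close>)
qed

lemma integral_atm:
  fixes f :: "real => 'a::{banach, second_countable_topology}"
  assumes "finite La" "\<And>t. t \<in> La ==> 0 \<le> w t" "f \<in> borel_measurable borel"
  shows "(\<integral>t. f t \<partial>atm La w) = (\<Sum>t\<in>La. w t *\<^sub>R f t)"
  unfolding atm_def by (subst integral_distr[OF atm_id assms(3)]) (use assms in \<open>simp add: lebesgue_integral_point_measure_finite\<close>)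

lemma real_distribution_atm:
  assumes "finite La" "\<And>t. t \<in> La ==> 0 \<le> w t" "(\<Sum>t\<in>La. w t) = 1"
  shows "real_distribution (atm La w)"
proof -
  have "prob_space (atm La w)"
    by (rule prob_spaceI) (use measure_atm(2)[OF assms(1,2), where A = UNIV] assms(3) in \<open>simp add: atm_def\<close>)
  then show ?thesis by (simp add: real_distribution_def real_distribution_axioms_def atm_def)
qed

text \<open>For a probability measure, 1 - y Im F(i y) is the integral of t^2 / (t^2 + y^2), which
  is at least 1/2 where |t| is at least y.\<close>

lemma atm_tail:
  assumes fin: "finite La" and w: "\<And>t. t \<in> La ==> 0 \<le> w t" and w1: "(\<Sum>t\<in>La. w t) = 1" and y: "0 < y"
  shows "(\<Sum>t\<in>La \<inter> {t. y \<le> \<bar>t\<bar>}. w t) \<le> 2 * (1 - y * Im (stj La w (Complex 0 y)))"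
proof -
  have p: "0 < t\<^sup>2 + y\<^sup>2" for t using y by (simp add: add_nonneg_pos)
  have "1 - y * Im (stj La w (Complex 0 y)) = (\<Sum>t\<in>La. w t) - (\<Sum>t\<in>La. w t * (y\<^sup>2 / (t\<^sup>2 + y\<^sup>2)))"
  proof -
    have "(cmod (of_real t - Complex 0 y))\<^sup>2 = t\<^sup>2 + y\<^sup>2" for t by (simp add: cmod_power2)
    then show ?thesis by (simp only: Im_stj w1) (simp add: sum_distrib_left power2_eq_square mult_ac)
  qed
  also have "... = (\<Sum>t\<in>La. w t * (t\<^sup>2 / (t\<^sup>2 + y\<^sup>2)))"
    unfolding sum_subtractf[symmetric]
  proof (rule sum.cong[OF refl])
    fix t
    have "1 - y\<^sup>2 / (t\<^sup>2 + y\<^sup>2) = t\<^sup>2 / (t\<^sup>2 + y\<^sup>2)" using p[of t] y by (simp add: diff_eq_eq add_divide_distrib[symmetric])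
    then show "w t - w t * (y\<^sup>2 / (t\<^sup>2 + y\<^sup>2)) = w t * (t\<^sup>2 / (t\<^sup>2 + y\<^sup>2))"
      by (metis mult.right_neutral right_diff_distrib)
  qed
  finally have e: "1 - y * Im (stj La w (Complex 0 y)) = (\<Sum>t\<in>La. w t * (t\<^sup>2 / (t\<^sup>2 + y\<^sup>2)))" .
  have "(\<Sum>t\<in>La \<inter> {t. y \<le> \<bar>t\<bar>}. w t) \<le> (\<Sum>t\<in>La \<inter> {t. y \<le> \<bar>t\<bar>}. 2 * (w t * (t\<^sup>2 / (t\<^sup>2 + y\<^sup>2))))"
  proof (rule sum_mono)
    fix t assume t: "t \<in> La \<inter> {t. y \<le> \<bar>t\<bar>}"
    then have "y\<^sup>2 \<le> \<bar>t\<bar>\<^sup>2" using y by (intro power_mono) auto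
    then have "1 \<le> 2 * (t\<^sup>2 / (t\<^sup>2 + y\<^sup>2))" using p[of t] by (simp add: field_simps)
    then have "w t * 1 \<le> w t * (2 * (t\<^sup>2 / (t\<^sup>2 + y\<^sup>2)))" using w t by (intro mult_left_mono) auto
    then show "w t \<le> 2 * (w t * (t\<^sup>2 / (t\<^sup>2 + y\<^sup>2)))" by (metis mult.left_commute mult.right_neutral)
  qed
  also have "... \<le> (\<Sum>t\<in>La. 2 * (w t * (t\<^sup>2 / (t\<^sup>2 + y\<^sup>2))))"
    by (rule sum_mono2) (use fin w in auto)
  finally show ?thesis unfolding e sum_distrib_left .
qed

lemma frontier_balls_null:
  fixes M :: "real measure"
  assumes "finite T" "finite_measure M" "sets M = sets borel" "\<And>t. t \<in> T ==> measure M {t - r t} = 0 \<and> measure M {t + r t} = 0 \<and> 0 < r t"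
  shows "emeasure M (frontier (\<Union>t\<in>T. ball t (r t))) = 0"
proof -
  interpret finite_measure M by fact
  have "frontier (\<Union>t\<in>T. ball t (r t)) \<subseteq> (\<Union>t\<in>T. {t - r t, t + r t})"
    using assms(1,4)
  proof (induction T rule: finite_induct)
    case (insert a T)
    have fb: "frontier (ball a (r a)) \<subseteq> {a - r a, a + r a}"
      using insert.prems[of a] by (subst frontier_ball) (auto simp: dist_real_def)
    have "frontier (\<Union>t\<in>insert a T. ball t (r t)) \<subseteq> frontier (ball a (r a)) \<union> frontier (\<Union>t\<in>T. ball t (r t))"
      using frontier_Un_subset[of "ball a (r a)" "\<Union>t\<in>T. ball t (r t)"] by simp
    also have "... \<subseteq> {a - r a, a + r a} \<union> (\<Union>t\<in>T. {t - r t, t + r t})" using fb insert by blast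
    finally show ?case by simp
  qed simp
  moreover have n: "(\<Union>t\<in>T. {t - r t, t + r t}) \<in> null_sets M"
  proof (rule null_sets.finite_UN[OF assms(1)])
    fix t assume t: "t \<in> T"
    have "{t - r t} \<in> null_sets M" "{t + r t} \<in> null_sets M"
      using assms(4)[OF t] assms(3) by (auto simp: null_sets_def emeasure_eq_measure)
    then have "{t - r t} \<union> {t + r t} \<in> null_sets M" by (rule null_sets.Un)
    then show "{t - r t, t + r t} \<in> null_sets M" by (simp add: insert_commute)
  qed
  ultimately have "emeasure M (frontier (\<Union>t\<in>T. ball t (r t))) \<le> emeasure M (\<Union>t\<in>T. {t - r t, t + r t})"
    by (intro emeasure_mono null_setsD2)
  then show ?thesis unfolding null_setsD1[OF n] by simp
qed

text \<open>Continuity from above gives small balls of small mass; among their radii, only countably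
  many put an atom at an endpoint. Balls with uncharged boundary are continuity sets for weak
  convergence.\<close>

lemma non_atomic_ball:
  fixes M :: "real measure"
  assumes "finite_measure M" "sets M = sets borel" and t: "measure M {t} = 0" and V: "open V" "t \<in> V" and d: "0 < \<delta>"
  shows "\<exists>r>0. ball t r \<subseteq> V \<and> measure M (ball t r) < \<delta> \<and> measure M {t - r} = 0 \<and> measure M {t + r} = 0"
proof -
  interpret finite_measure M by fact
  obtain r0 where r0: "0 < r0" "ball t r0 \<subseteq> V" using V openE by blast
  have "(%n. measure M (ball t (1 / real (Suc n)))) \<longlonglongrightarrow> measure M (\<Inter>n. ball t (1 / real (Suc n)))"
  proof (rule finite_Lim_measure_decseq)
    show "decseq (%n. ball t (1 / real (Suc n)))"
      by (rule decseq_SucI) (auto simp: frac_le intro!: subset_ball)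
    show "range (%n. ball t (1 / real (Suc n))) \<subseteq> sets M" unfolding assms(2) by (intro image_subsetI borel_open open_ball)
  qed
  moreover have "(\<Inter>n. ball t (1 / real (Suc n))) = {t}"
  proof -
    have "x = t" if x: "\<And>n. \<bar>t - x\<bar> < 1 / real (Suc n)" for x
    proof (rule ccontr)
      assume "x \<noteq> t"
      then obtain n where "1 / real (Suc n) < \<bar>t - x\<bar>" using nat_approx_posE[of "\<bar>t - x\<bar>"] by auto
      then show False using x[of n] by simp
    qed
    then show ?thesis by (auto simp: dist_real_def)
  qed
  ultimately have "(%n. measure M (ball t (1 / real (Suc n)))) \<longlonglongrightarrow> 0" using t by simp
  then have "\<forall>\<^sub>F n in sequentially. measure M (ball t (1 / real (Suc n))) < \<delta>" using d by (rule order_tendstoD(2))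
  then obtain n where n: "measure M (ball t (1 / real (Suc n))) < \<delta>" by (auto simp: eventually_sequentially)
  define r1 where "r1 = min r0 (1 / real (Suc n))"
  have r1: "0 < r1" using r0 by (simp add: r1_def)
  have c: "countable {x. measure M {x} \<noteq> 0}" by (rule countable_support)
  have "countable ((%x. t - x) ` {x. measure M {x} \<noteq> 0} \<union> (%x. x - t) ` {x. measure M {x} \<noteq> 0})" using c by auto
  then obtain r where r: "r \<in> {0<..<r1}" "r \<notin> (%x. t - x) ` {x. measure M {x} \<noteq> 0} \<union> (%x. x - t) ` {x. measure M {x} \<noteq> 0}"
    using open_minus_countable[of "(%x. t - x) ` {x. measure M {x} \<noteq> 0} \<union> (%x. x - t) ` {x. measure M {x} \<noteq> 0}" "{0<..<r1}"] r1 by auto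
  have 1: "measure M {t - r} = 0"
  proof (rule ccontr)
    assume "measure M {t - r} \<noteq> 0"
    then have "t - (t - r) \<in> (%x. t - x) ` {x. measure M {x} \<noteq> 0}" by (intro imageI) simp
    then show False using r by simp
  qed
  have 2: "measure M {t + r} = 0"
  proof (rule ccontr)
    assume "measure M {t + r} \<noteq> 0"
    then have "(t + r) - t \<in> (%x. x - t) ` {x. measure M {x} \<noteq> 0}" by (intro imageI) simp
    then show False using r by simp
  qed
  have "ball t r \<subseteq> ball t (1 / real (Suc n))" "ball t r \<subseteq> ball t r0" using r by (auto simp: r1_def)
  moreover then have "measure M (ball t r) \<le> measure M (ball t (1 / real (Suc n)))"
    by (intro finite_measure_mono) (use assms(2) in auto)
  ultimately show ?thesis using 1 2 r n r0 by (intro exI[of _ r]) auto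
qed

text \<open>A point that is not an atom of the limit has a ball of limit mass below \<delta>. Along
  the sequence the ball eventually has mass below \<delta> too, so all atoms in it are light and are
  counted by \<open>small\<close>. Finitely many balls cover a compact set, and inner regularity
  extends the bound to the whole non-atomic part of U.\<close>

lemma small_atoms_limit:
  fixes \<mu> :: "nat => real measure" and N :: "real measure"
  assumes fin: "\<And>i. finite (La i)" and w: "\<And>i t. t \<in> La i ==> 0 \<le> w i t" and w1: "\<And>i. (\<Sum>t\<in>La i. w i t) = 1"
    and N: "real_distribution N" and wc: "weak_conv_m (%i. atm (La i) (w i)) N"
    and U: "open U" and d: "0 < \<delta>" and small: "\<And>i. (\<Sum>t\<in>{t\<in>La i. t \<in> U \<and> w i t < \<delta>}. w i t) \<le> R"
  shows "emeasure N (U - {t. measure N {t} \<noteq> 0}) \<le> ennreal R"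
proof -
  interpret N: real_distribution N by (rule N)
  have cs: "countable {t. measure N {t} \<noteq> 0}" by (rule N.countable_support)
  have rd: "real_distribution (atm (La i) (w i))" for i by (rule real_distribution_atm[OF fin w w1])
  have Bs: "U - {t. measure N {t} \<noteq> 0} \<in> sets borel"
    using U cs by (intro sets.Diff) (auto intro: countable_imp_null_set_lborel sets.countable)
  have "emeasure N C \<le> ennreal R" if C: "C \<subseteq> U - {t. measure N {t} \<noteq> 0}" "compact C" for C
  proof -
    have "\<forall>t\<in>C. \<exists>r>0. ball t r \<subseteq> U \<and> measure N (ball t r) < \<delta> \<and> measure N {t - r} = 0 \<and> measure N {t + r} = 0"
    proof
      fix t assume "t \<in> C"
      then show "\<exists>r>0. ball t r \<subseteq> U \<and> measure N (ball t r) < \<delta> \<and> measure N {t - r} = 0 \<and> measure N {t + r} = 0"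
        using C by (intro non_atomic_ball[OF N.finite_measure_axioms _ _ U _ d]) auto
    qed
    then obtain r where r: "\<And>t. t \<in> C ==> 0 < r t" "\<And>t. t \<in> C ==> ball t (r t) \<subseteq> U" "\<And>t. t \<in> C ==> measure N (ball t (r t)) < \<delta>"
      "\<And>t. t \<in> C ==> measure N {t - r t} = 0" "\<And>t. t \<in> C ==> measure N {t + r t} = 0" by metis
    obtain T where T: "T \<subseteq> C" "finite T" "C \<subseteq> (\<Union>t\<in>T. ball t (r t))"
      by (rule compactE_image[OF C(2), of C "%t. ball t (r t)"]) (use r(1) in auto)
    define V where "V = (\<Union>t\<in>T. ball t (r t))"
    have Vm: "V \<in> sets borel" by (intro borel_open) (auto simp: V_def)
    have conv: "(%i. measure (atm (La i) (w i)) A) \<longlonglongrightarrow> measure N A" if "A \<in> sets borel" "emeasure N (frontier A) = 0" for A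
      by (rule weak_conv_imp_continuity_set_conv[OF rd N wc that])
    have cV: "(%i. measure (atm (La i) (w i)) V) \<longlonglongrightarrow> measure N V"
      by (rule conv[OF Vm]) (unfold V_def, rule frontier_balls_null, use T r N.finite_measure_axioms in auto)
    have "\<forall>\<^sub>F i in sequentially. measure (atm (La i) (w i)) (ball t (r t)) < \<delta>" if t: "t \<in> T" for t
    proof -
      have "emeasure N (frontier (\<Union>t\<in>{t}. ball t (r t))) = 0"
        by (rule frontier_balls_null) (use T r t N.finite_measure_axioms in auto)
      then have "(%i. measure (atm (La i) (w i)) (ball t (r t))) \<longlonglongrightarrow> measure N (ball t (r t))"
        by (intro conv) auto
      then show ?thesis by (rule order_tendstoD(2)) (use T t r in auto)
    qed
    then have ev: "\<forall>\<^sub>F i in sequentially. \<forall>t\<in>T. measure (atm (La i) (w i)) (ball t (r t)) < \<delta>"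
      using T(2) by (simp add: eventually_ball_finite_distrib)
    have "\<forall>\<^sub>F i in sequentially. measure (atm (La i) (w i)) V \<le> R"
      using ev
    proof eventually_elim
      case (elim i)
      have "measure (atm (La i) (w i)) V = (\<Sum>t\<in>La i \<inter> V. w i t)" by (rule measure_atm(1)[OF fin w Vm])
      also have "... \<le> (\<Sum>t\<in>{t\<in>La i. t \<in> U \<and> w i t < \<delta>}. w i t)"
      proof (rule sum_mono2)
        show "La i \<inter> V \<subseteq> {t \<in> La i. t \<in> U \<and> w i t < \<delta>}"
        proof
          fix t assume t: "t \<in> La i \<inter> V"
          then obtain a where a: "a \<in> T" "t \<in> ball a (r a)" by (auto simp: V_def)
          have "w i t \<le> (\<Sum>t\<in>La i \<inter> ball a (r a). w i t)"
            by (rule member_le_sum) (use t a fin w in auto)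
          also have "... = measure (atm (La i) (w i)) (ball a (r a))" by (rule measure_atm(1)[OF fin w, symmetric]) auto
          also have "... < \<delta>" using elim a by auto
          finally have wt: "w i t < \<delta>" .
          have "ball a (r a) \<subseteq> U" by (rule r(2)) (use a T in auto)
          then show "t \<in> {t \<in> La i. t \<in> U \<and> w i t < \<delta>}" using wt t a by auto
        qed
      qed (use fin w in auto)
      also have "... \<le> R" by (rule small)
      finally show ?case .
    qed
    then have "measure N V \<le> R" by (intro tendsto_upperbound[OF cV]) auto
    moreover have "emeasure N C \<le> emeasure N V" using T(3) Vm by (intro emeasure_mono) (auto simp: V_def)
    ultimately show ?thesis by (simp add: N.emeasure_eq_measure order_trans ennreal_leI)
  qed
  then have "(SUP C\<in>{C. C \<subseteq> U - {t. measure N {t} \<noteq> 0} \<and> compact C}. emeasure N C) \<le> ennreal R"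
    by (intro SUP_least) auto
  moreover have "emeasure N (U - {t. measure N {t} \<noteq> 0}) = (SUP C\<in>{C. C \<subseteq> U - {t. measure N {t} \<noteq> 0} \<and> compact C}. emeasure N C)"
    by (rule inner_regular) (use Bs N.emeasure_finite in auto)
  ultimately show ?thesis by simp
qed

text \<open>The bound \<open>tl\<close> gives tightness, hence a weak limit N of a subsequence. Off
  the real axis the Borel kernel is bounded and continuous, so the transforms converge. The
  exceptional set S consists of the atoms of N.\<close>

lemma helly_atoms:
  fixes La :: "nat => real set" and w :: "nat => real => real"
  assumes fin: "\<And>i. finite (La i)" and w: "\<And>i t. t \<in> La i ==> 0 \<le> w i t" and w1: "\<And>i. (\<Sum>t\<in>La i. w i t) = 1"
    and tl: "\<And>i y. 1 \<le> y ==> 1 - y * Im (stj (La i) (w i) (Complex 0 y)) \<le> C / y"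
    and U: "\<And>l. open (U l)" and d: "\<And>l. 0 < \<delta> l" and I: "\<And>l::nat. I \<inter> {-real l..real l} \<subseteq> U l"
    and small: "\<And>i l. (\<Sum>t\<in>{t\<in>La i. t \<in> U l \<and> w i t < \<delta> l}. w i t) \<le> R / 2 ^ l" and Im: "I \<in> sets borel"
  shows "\<exists>\<mu> r. strict_mono (r :: nat => nat) \<and> finite_measure \<mu> \<and> sets \<mu> = sets borel \<and>
    (\<forall>z. Im z \<noteq> 0 --> (%i. stj (La (r i)) (w (r i)) z) \<longlonglongrightarrow> (\<integral>E. 1 / (complex_of_real E - z) \<partial>\<mu>)) \<and>
    (\<exists>S. countable S \<and> emeasure \<mu> (I - S) = 0)"
proof -
  let ?m = "%i. atm (La i) (w i)"
  have rd: "real_distribution (?m i)" for i by (rule real_distribution_atm[OF fin w w1])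
  have tight: "tight ?m"
    unfolding tight_def
  proof (intro conjI allI impI)
    fix \<epsilon> :: real assume e: "0 < \<epsilon>"
    \<comment> \<open>Beyond this y the tail bound 2 C / y is below \<epsilon>; C may be negative,
      hence the absolute value.\<close>
    define y where "y = 1 + 2 * \<bar>C\<bar> / \<epsilon>"
    have y: "1 \<le> y" using e by (simp add: y_def)
    have ye: "2 * (C / y) < \<epsilon>"
    proof -
      have "\<epsilon> * y = \<epsilon> + 2 * \<bar>C\<bar>" using e by (simp add: y_def distrib_left)
      then have "2 * C < \<epsilon> * y" using e abs_ge_self[of C] by linarith
      then show ?thesis using y by (simp add: field_simps)
    qed
    have "1 - \<epsilon> < measure (?m i) {- (y + 1)<..y + 1}" for i
    proof -
      have "1 = (\<Sum>t\<in>La i. w i t)" by (simp add: w1)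
      also have "La i = (La i \<inter> {t. y \<le> \<bar>t\<bar>}) \<union> (La i \<inter> {t. \<bar>t\<bar> < y})" by auto
      also have "(\<Sum>t\<in>.... w i t) = (\<Sum>t\<in>La i \<inter> {t. y \<le> \<bar>t\<bar>}. w i t) + (\<Sum>t\<in>La i \<inter> {t. \<bar>t\<bar> < y}. w i t)"
        by (rule sum.union_disjoint) (use fin in auto)
      also have "(\<Sum>t\<in>La i \<inter> {t. y \<le> \<bar>t\<bar>}. w i t) \<le> 2 * (1 - y * Im (stj (La i) (w i) (Complex 0 y)))"
        by (rule atm_tail[OF fin w w1]) (use y in auto)
      also have "... \<le> 2 * (C / y)" by (intro mult_left_mono tl y) simp
      also have "(\<Sum>t\<in>La i \<inter> {t. \<bar>t\<bar> < y}. w i t) \<le> (\<Sum>t\<in>La i \<inter> {- (y + 1)<..y + 1}. w i t)"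
        by (rule sum_mono2) (use fin w in auto)
      also have "... = measure (?m i) {- (y + 1)<..y + 1}" by (rule measure_atm(1)[OF fin w, symmetric]) auto
      finally show ?thesis using ye by simp
    qed
    then show "\<exists>a b. a < b \<and> (\<forall>n. 1 - \<epsilon> < measure (?m n) {a<..b})"
      using y by (intro exI[of _ "- (y + 1)"] exI[of _ "y + 1"]) auto
  qed (rule rd)
  obtain r N where r: "strict_mono (r :: nat => nat)" and N: "real_distribution N" and wc: "weak_conv_m (?m \<circ> id \<circ> r) N"
    using tight_imp_convergent_subsubsequence[OF tight, of id] by (auto simp: strict_mono_def)
  interpret N: real_distribution N by (rule N)
  have wc': "weak_conv_m (%i. ?m (r i)) N" using wc by (simp add: comp_def)
  let ?S = "{t. measure N {t} \<noteq> 0}"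
  have stl: "(%i. stj (La (r i)) (w (r i)) z) \<longlonglongrightarrow> (\<integral>E. 1 / (complex_of_real E - z) \<partial>N)" if z: "Im z \<noteq> 0" for z
  proof -
    have nz: "complex_of_real x - z \<noteq> 0" for x using z by (auto simp: complex_eq_iff)
    have "(%i. (\<integral>E. 1 / (complex_of_real E - z) \<partial>?m (r i))) \<longlonglongrightarrow> (\<integral>E. 1 / (complex_of_real E - z) \<partial>N)"
    proof (rule weak_conv_imp_integral_bdd_continuous_conv[OF rd N wc'])
      show "isCont (%E. 1 / (complex_of_real E - z)) x" for x by (intro continuous_intros nz)
      show "norm (1 / (complex_of_real x - z)) \<le> 1 / \<bar>Im z\<bar>" for x
        using abs_Im_le_cmod[of "complex_of_real x - z"] z by (simp add: norm_divide frac_le)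
    qed
    moreover have "(\<integral>E. 1 / (complex_of_real E - z) \<partial>?m i) = stj (La i) (w i) z" for i
    proof -
      have "(%E. 1 / (complex_of_real E - z)) \<in> borel_measurable borel"
        by (intro borel_measurable_continuous_onI continuous_intros) (use nz in auto)
      from integral_atm[OF fin w this, of i] show ?thesis
        by (simp add: stj_def scaleR_conv_of_real)
    qed
    ultimately show ?thesis by simp
  qed
  have cs: "countable ?S" by (rule N.countable_support)
  have R0: "0 \<le> R"
  proof -
    have "0 \<le> (\<Sum>t\<in>{t\<in>La 0. t \<in> U 0 \<and> w 0 t < \<delta> 0}. w 0 t)" by (rule sum_nonneg) (use w in auto)
    also have "... \<le> R / 2 ^ 0" by (rule small)
    finally show ?thesis by simp
  qed
  have Sm: "?S \<in> sets borel" using cs by (rule sets.countable[rotated]) auto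
  have ul: "emeasure N (U l - ?S) \<le> ennreal (R / 2 ^ l)" for l
    by (rule small_atoms_limit[OF fin w w1 N wc' U d small])
  have "I \<inter> {-real l..real l} - ?S \<in> null_sets N" for l :: nat
  proof -
    \<comment> \<open>A fixed window lies in every later open set, so its non-atomic part is bounded
      by R / 2^l' for all large l' and has measure 0.\<close>
    have "emeasure N (I \<inter> {-real l..real l} - ?S) \<le> ennreal (R * (1 / 2) ^ l')" if "l \<le> l'" for l'
    proof -
      have "I \<inter> {-real l..real l} - ?S \<subseteq> U l' - ?S" using I[of l'] that by auto
      then have "emeasure N (I \<inter> {-real l..real l} - ?S) \<le> emeasure N (U l' - ?S)"
        by (rule emeasure_mono) (use U[of l'] Sm in auto)
      then show ?thesis using ul[of l'] by (simp add: power_divide)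
    qed
    then have ev: "\<forall>\<^sub>F l' in sequentially. emeasure N (I \<inter> {-real l..real l} - ?S) \<le> ennreal (R * (1 / 2) ^ l')"
      by (auto simp: eventually_sequentially)
    have "(%l'. R * (1 / 2) ^ l') \<longlonglongrightarrow> R * 0" by (intro tendsto_intros LIMSEQ_power_zero) simp
    then have "(%l'. ennreal (R * (1 / 2) ^ l')) \<longlonglongrightarrow> ennreal (R * 0)" by (rule tendsto_ennrealI)
    then have "emeasure N (I \<inter> {-real l..real l} - ?S) \<le> ennreal (R * 0)"
      using ev by (rule tendsto_lowerbound) simp
    then show ?thesis using Im Sm by (auto simp: null_sets_def)
  qed
  then have "(\<Union>l::nat. I \<inter> {-real l..real l} - ?S) \<in> null_sets N" by (intro null_sets_UN) auto
  also have "(\<Union>l::nat. I \<inter> {-real l..real l} - ?S) = I - ?S"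
  proof -
    have "\<exists>l::nat. - real l \<le> x \<and> x \<le> real l" for x
    proof -
      obtain l :: nat where "\<bar>x\<bar> \<le> real l" using real_arch_simple by blast
      then show ?thesis by (intro exI[of _ l]) linarith
    qed
    then show ?thesis by auto
  qed
  finally have "emeasure N (I - ?S) = 0" by auto
  then show ?thesis using r N.finite_measure_axioms stl cs
    by (intro exI[of _ N] exI[of _ r] conjI) auto
qed

section \<open>The canopy spectral measure\<close>

context canopy_model
begin

definition good_atoms :: "nat => nat => (cvert => real) => nat => real set => (real => real) => bool" where
  "good_atoms k j om d L w \<longleftrightarrow> finite L \<and> (\<forall>t\<in>L. 0 \<le> w t) \<and> (\<Sum>t\<in>L. w t) = 1 \<and>
    (\<forall>z. Im z \<noteq> 0 --> gF om z d k j = stj L w z) \<and>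
    (\<forall>U \<delta>. open U --> 0 < \<delta> --> ennreal (\<Sum>t\<in>{t\<in>L. t \<in> U \<and> w t < \<delta>}. w t) \<le> liminf (Rm U \<delta> d k j om))"

lemma good_atoms_exist: "\<exists>L w. good_atoms k j om d L w"
proof -
  obtain La w La' w' X' where R: "rat (%z. gF om z d k j) (%E. (gF om E d k j)\<^sup>2 * dh om E d k j) La' w' X'"
    and w1: "(\<Sum>t\<in>La'. w' t) = 1" and fin: "finite La" and wp: "\<forall>t\<in>La. 0 < w t"
    and w': "\<forall>t\<in>La'. t \<notin> La \<and> w' t = 1 / (1 + dstj La w t)" and dh: "\<forall>E. E \<notin> X' --> dh om E d k j = 1 + dstj La w E"
    using rat_gF[of om d k j] by (elim exE conjE) (rule that)
  have "gF om z d k j = stj La' w' z" if "Im z \<noteq> 0" for z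
  proof -
    have "z \<notin> of_real ` X'" using that by auto
    then show ?thesis using R by (simp add: rat_def)
  qed
  moreover have "finite La'" "\<forall>t\<in>La'. 0 \<le> w' t" using R by (auto simp: rat_def less_imp_le)
  ultimately have "good_atoms k j om d La' w'"
    unfolding good_atoms_def using w1 small_atoms_le[OF _ _ R fin wp w' dh] by (intro conjI allI impI) auto
  then show ?thesis by blast
qed

text \<open>On the imaginary axis 1 + z F equals F times the potential minus the self-energy. For y
  at least 1 the self-energies are bounded by constants and |F| by 1/y, so the estimate is uniform
  in the volume and involves the potential only at (k, j).\<close>

lemma gF_tail:
  assumes y: "1 \<le> y"
  shows "1 - y * Im (gF om (Complex 0 y) d k j) \<le> (\<bar>om (k, j)\<bar> + \<bar>b\<bar> + real K + 1) / y"
proof -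
  let ?z = "Complex 0 y"
  let ?S = "cs om ?z k j + up om ?z d k j"
  let ?F = "gF om ?z d k j"
  have z: "Im ?z \<noteq> 0" "0 < Im ?z" using y by auto
  have dn: "\<bar>Im ?z\<bar> \<le> norm (of_real (om (k, j)) - ?z - ?S)" by (rule den_bounds(3)[OF z(1)])
  have nz: "of_real (om (k, j)) - ?z - ?S \<noteq> 0" using dn z by auto
  have F: "?F * (of_real (om (k, j)) - ?z - ?S) = 1" using nz by (simp add: gF_def)
  have nF: "norm ?F \<le> 1 / y" unfolding gF_def using norm_inverse_den[OF z(1) dn] y by simp
  have gl: "norm (gam om ?z m i) \<le> 1" for m i
  proof -
    have "norm (gam om ?z m i) \<le> 1 / Im ?z" by (rule norm_gam_le[OF z(2)])
    also have "... \<le> 1" using y by simp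
    finally show ?thesis .
  qed
  have ncs: "norm (cs om ?z k j) \<le> \<bar>b\<bar> + real K"
  proof (cases k)
    case 0
    then show ?thesis by simp
  next
    case (Suc m)
    have "norm (cs om ?z k j) \<le> (\<Sum>i<K. norm (gam om ?z m (K * j + i)))" unfolding Suc cs_Suc by (rule norm_sum)
    also have "... \<le> (\<Sum>i<K. 1)" by (intro sum_mono gl)
    finally show ?thesis by simp
  qed
  have nup: "norm (up om ?z d k j) \<le> 1"
  proof -
    have "norm (up om ?z d k j) \<le> 1 / \<bar>Im ?z\<bar>" by (rule norm_up_le[OF z(1)])
    also have "... \<le> 1" using y by simp
    finally show ?thesis .
  qed
  have "1 + ?z * ?F = ?F * (of_real (om (k, j)) - ?S)"
    using F by (simp add: algebra_simps)
  \<comment> \<open>With z = i y, the real part of 1 + z F is 1 - y Im F.\<close>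
  then have "Re (1 + ?z * ?F) \<le> norm (?F * (of_real (om (k, j)) - ?S))" by (metis complex_Re_le_cmod)
  also have "... = norm ?F * norm (of_real (om (k, j)) - ?S)" by (rule norm_mult)
  also have "... \<le> (1 / y) * (\<bar>om (k, j)\<bar> + \<bar>b\<bar> + real K + 1)"
  proof (rule mult_mono[OF nF])
    have "norm (of_real (om (k, j)) - ?S) \<le> norm (complex_of_real (om (k, j))) + norm ?S" by (rule norm_triangle_ineq4)
    also have "norm ?S \<le> norm (cs om ?z k j) + norm (up om ?z d k j)" by (rule norm_triangle_ineq)
    finally show "norm (of_real (om (k, j)) - ?S) \<le> \<bar>om (k, j)\<bar> + \<bar>b\<bar> + real K + 1" using ncs nup by simp
  qed (use y in auto)
  finally show ?thesis by simp
qed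

text \<open>Two extractions: r runs through volumes in which the light atoms obey all bounds, q
  makes their measures converge weakly. The limit has the canopy Green function as its Borel
  transform by \<open>canopy_green_limit\<close>, which accepts any sequence of growing
  volumes.\<close>

lemma pure_point_at:
  assumes I: "I \<in> sets borel"
    and bd: "AE om in Q. AE E in lborel. E \<in> I --> (\<exists>R. \<forall>d. (gF om E d k j)\<^sup>2 * dh om E d k j \<le> R)"
  shows "AE om in Q. \<exists>\<mu>. finite_measure \<mu> \<and> sets \<mu> = sets borel \<and>
        (\<forall>z. Im z \<noteq> 0 --> canopy_green K b om (k, j) z = (\<integral>E. 1 / (complex_of_real E - z) \<partial>\<mu>)) \<and>
        (\<exists>S. countable S \<and> emeasure \<mu> (I - S) = 0)"
proof -
  obtain U \<delta> where U: "\<forall>l. open (U l) \<and> 0 < \<delta> l \<and> I \<inter> {-real l..real l} \<subseteq> U l"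
    and ae: "AE om in Q. \<exists>R\<ge>0. \<exists>\<^sub>F d in sequentially. \<forall>l. liminf (Rm (U l) (\<delta> l) d k j om) \<le> ennreal (R / 2 ^ l)"
    using small_atoms[OF I bd] by (elim exE conjE) (rule that)
  show ?thesis using ae
  proof eventually_elim
    case (elim om)
    then obtain R where R: "0 \<le> R" and fr: "\<exists>\<^sub>F d in sequentially. \<forall>l. liminf (Rm (U l) (\<delta> l) d k j om) \<le> ennreal (R / 2 ^ l)"
      by (elim exE conjE) (rule that)
    have "infinite {d. \<forall>l. liminf (Rm (U l) (\<delta> l) d k j om) \<le> ennreal (R / 2 ^ l)}"
      using fr unfolding cofinite_eq_sequentially[symmetric] frequently_cofinite .
    then obtain r :: "nat => nat" where r: "strict_mono r" and rl: "\<And>i. r i \<in> {d. \<forall>l. liminf (Rm (U l) (\<delta> l) d k j om) \<le> ennreal (R / 2 ^ l)}"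
      using infinite_enumerate by blast
    obtain L W where G: "\<And>d. good_atoms k j om d (L d) (W d)" using good_atoms_exist[of k j om] by metis
    have "\<exists>\<mu> q. strict_mono (q :: nat => nat) \<and> finite_measure \<mu> \<and> sets \<mu> = sets borel \<and>
      (\<forall>z. Im z \<noteq> 0 --> (%i. stj (L (r (q i))) (W (r (q i))) z) \<longlonglongrightarrow> (\<integral>E. 1 / (complex_of_real E - z) \<partial>\<mu>)) \<and>
      (\<exists>S. countable S \<and> emeasure \<mu> (I - S) = 0)"
    proof (rule helly_atoms[of "%i. L (r i)" "%i. W (r i)" "\<bar>om (k, j)\<bar> + \<bar>b\<bar> + real K + 1" U \<delta> I R])
      show "finite (L (r i))" "(\<Sum>t\<in>L (r i). W (r i) t) = 1" for i using G[of "r i"] by (simp_all add: good_atoms_def)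
      show "0 \<le> W (r i) t" if "t \<in> L (r i)" for i t using G[of "r i"] that by (simp add: good_atoms_def)
      show "1 - y * Im (stj (L (r i)) (W (r i)) (Complex 0 y)) \<le> (\<bar>om (k, j)\<bar> + \<bar>b\<bar> + real K + 1) / y" if y: "1 \<le> y" for i y
      proof -
        have "gF om (Complex 0 y) (r i) k j = stj (L (r i)) (W (r i)) (Complex 0 y)"
          using G[of "r i"] y by (simp add: good_atoms_def)
        then show ?thesis using gF_tail[OF y, of om "r i" k j] by simp
      qed
      show "open (U l)" "0 < \<delta> l" "I \<inter> {-real l..real l} \<subseteq> U l" for l using U by blast+
      show "(\<Sum>t\<in>{t\<in>L (r i). t \<in> U l \<and> W (r i) t < \<delta> l}. W (r i) t) \<le> R / 2 ^ l" for i l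
      proof -
        have "ennreal (\<Sum>t\<in>{t\<in>L (r i). t \<in> U l \<and> W (r i) t < \<delta> l}. W (r i) t) \<le> liminf (Rm (U l) (\<delta> l) (r i) k j om)"
          using G[of "r i"] U unfolding good_atoms_def by blast
        also have "... \<le> ennreal (R / 2 ^ l)" using rl[of i] by blast
        finally show ?thesis using R by (subst (asm) ennreal_le_iff) auto
      qed
      show "I \<in> sets borel" by (rule I)
    qed
    then obtain \<mu> q where H: "strict_mono (q :: nat => nat) \<and> finite_measure \<mu> \<and> sets \<mu> = sets borel \<and>
      (\<forall>z. Im z \<noteq> 0 --> (%i. stj (L (r (q i))) (W (r (q i))) z) \<longlonglongrightarrow> (\<integral>E. 1 / (complex_of_real E - z) \<partial>\<mu>)) \<and>
      (\<exists>S. countable S \<and> emeasure \<mu> (I - S) = 0)"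
      by (elim exE) (rule that)
    note q = conjunct1[OF H] and H1 = conjunct2[OF H]
    note mu1 = conjunct1[OF H1] and H2 = conjunct2[OF H1]
    note mu2 = conjunct1[OF H2] and H3 = conjunct2[OF H2]
    note lim = conjunct1[OF H3] and S = conjunct2[OF H3]
    have "canopy_green K b om (k, j) z = (\<integral>E. 1 / (complex_of_real E - z) \<partial>\<mu>)" if z: "Im z \<noteq> 0" for z
    proof (rule canopy_green_limit[OF z])
      show "filterlim (%i. r (q i)) at_top sequentially"
        using filterlim_subseq[OF strict_mono_o[OF r q]] by (simp add: comp_def)
      have "gF om z d k j = stj (L d) (W d) z" for d using G[of d] z by (simp add: good_atoms_def)
      then show "(%i. gF om z (r (q i)) k j) \<longlonglongrightarrow> (\<integral>E. 1 / (complex_of_real E - z) \<partial>\<mu>)"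
        using lim z by simp
    qed
    then show ?case using mu1 mu2 S by (intro exI[of _ \<mu>]) blast
  qed
qed

lemma canopy_pure_point:
  assumes I: "I \<in> sets borel"
    and A2: "\<forall>E\<in>I. \<forall>\<epsilon>>0. \<exists>\<delta>>0. \<forall>L::nat. \<forall>E'\<in>I.
               \<bar>E' - E\<bar> < \<delta> --> \<bar>tree_avg_log K L b \<rho> E' - tree_avg_log K L b \<rho> E\<bar> < \<epsilon>"
  shows "AE om in Q. canopy_pure_point_in K b om I"
proof -
  have "AE E in lborel. E \<in> I --> (\<exists>\<gamma>>0. \<exists>C. \<forall>N. (\<Sum>n<N. fL n (of_real E)) \<le> C - real N * (ln (real K) / 2 + \<gamma>))"
    using cauchy_density_points[OF I]
  proof eventually_elim
    case (elim E)
    show ?case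
    proof
      assume E: "E \<in> I"
      show "\<exists>\<gamma>>0. \<exists>C. \<forall>N. (\<Sum>n<N. fL n (of_real E)) \<le> C - real N * (ln (real K) / 2 + \<gamma>)"
      proof (rule lyapunov_real[OF _ _ I])
        show "\<forall>\<epsilon>>0. \<exists>\<delta>>0. \<forall>n. \<forall>E'\<in>I. \<bar>E' - E\<bar> < \<delta> --> \<bar>fL n (of_real E') - fL n (of_real E)\<bar> < \<epsilon>"
          using bspec[OF A2 E] unfolding tree_avg_log_eq .
        show "\<forall>\<epsilon>>0. \<forall>\<delta>>0. \<exists>e. 0 < e \<and> e < \<delta> \<and> measure cauchy {u. E + e * u \<notin> I} < \<epsilon>"
          using elim E by (rule mp)
      qed
    qed
  qed
  then have "AE om in Q. \<exists>\<mu>. finite_measure \<mu> \<and> sets \<mu> = sets borel \<and>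
        (\<forall>z. Im z \<noteq> 0 --> canopy_green K b om x z = (\<integral>E. 1 / (complex_of_real E - z) \<partial>\<mu>)) \<and>
        (\<exists>S. countable S \<and> emeasure \<mu> (I - S) = 0)" for x
    using pure_point_at[OF I AE_bounded_dF[OF I], of "fst x" "snd x"] by simp
  then show ?thesis unfolding canopy_pure_point_in_def AE_all_countable by blast
qed

end

theorem theorem1p3:
  fixes K :: nat and b :: real and \<rho> :: "real \<Rightarrow> real" and I :: "real set"
  assumes K: "K \<ge> 2"
    and A1_meas: "\<rho> \<in> borel_measurable borel"
    and A1_nonneg: "\<forall>w. 0 \<le> \<rho> w"
    and A1_prob: "(\<integral>\<^sup>+ w. ennreal (\<rho> w) \<partial>lborel) = 1"
    and A1_bounded: "bounded (range \<rho>)"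
    and A1_moment: "\<exists>\<tau>>0. integrable lborel (\<lambda>w. \<bar>w\<bar> powr \<tau> * \<rho> w)"
    and I_borel: "I \<in> sets borel"
    and A2: "\<forall>E\<in>I. \<forall>\<epsilon>>0. \<exists>\<delta>>0. \<forall>L::nat. \<forall>E'\<in>I.
               \<bar>E' - E\<bar> < \<delta> \<longrightarrow> \<bar>tree_avg_log K L b \<rho> E' - tree_avg_log K L b \<rho> E\<bar> < \<epsilon>"
  shows "AE \<omega> in canopy_prob \<rho>. canopy_pure_point_in K b \<omega> I"
proof -
  obtain \<tau> where t: "0 < \<tau>" and ti: "integrable lborel (%w. \<bar>w\<bar> powr \<tau> * \<rho> w)" using A1_moment by blast
  obtain M where M: "\<And>w. \<bar>\<rho> w\<bar> \<le> M" using A1_bounded by (auto simp: bounded_iff)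
  \<comment> \<open>A moment of order \<tau> controls all smaller ones. The exponent is lowered to
    at most 1/2 so that it can be used for inverse powers as well.\<close>
  define s where "s = min \<tau> (1 / 2)"
  have s: "0 < s" "s \<le> 1 / 2" "s \<le> \<tau>" using t by (auto simp: s_def)
  note A1_meas[measurable]
  have "(\<integral>\<^sup>+w. ennreal (\<bar>w\<bar> powr s) \<partial>site_dist \<rho>) = (\<integral>\<^sup>+w. ennreal (\<rho> w) * ennreal (\<bar>w\<bar> powr s) \<partial>lborel)"
    unfolding site_dist_def by (rule nn_integral_density) measurable
  also have "... \<le> (\<integral>\<^sup>+w. ennreal (\<rho> w) + ennreal (norm (\<bar>w\<bar> powr \<tau> * \<rho> w)) \<partial>lborel)"
  proof (rule nn_integral_mono)
    fix w
    have r: "0 \<le> \<rho> w" using A1_nonneg by simp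
    have "\<bar>w\<bar> powr s \<le> 1 + \<bar>w\<bar> powr \<tau>"
    proof (cases "\<bar>w\<bar> \<le> 1")
      case True
      then have "\<bar>w\<bar> powr s \<le> 1" using s by (intro powr_le1) auto
      then show ?thesis by (simp add: add_increasing2)
    next
      case False
      then have "\<bar>w\<bar> powr s \<le> \<bar>w\<bar> powr \<tau>" using s by (intro powr_mono) auto
      then show ?thesis by simp
    qed
    then have "\<rho> w * \<bar>w\<bar> powr s \<le> \<rho> w * (1 + \<bar>w\<bar> powr \<tau>)" using r by (rule mult_left_mono)
    then have "ennreal (\<rho> w * \<bar>w\<bar> powr s) \<le> ennreal (\<rho> w + \<bar>w\<bar> powr \<tau> * \<rho> w)"
      by (intro ennreal_leI) (simp add: algebra_simps)
    also have "... = ennreal (\<rho> w) + ennreal (\<bar>w\<bar> powr \<tau> * \<rho> w)" using r by (intro ennreal_plus) auto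
    also have "\<bar>w\<bar> powr \<tau> * \<rho> w = norm (\<bar>w\<bar> powr \<tau> * \<rho> w)" using r by simp
    finally show "ennreal (\<rho> w) * ennreal (\<bar>w\<bar> powr s) \<le> ennreal (\<rho> w) + ennreal (norm (\<bar>w\<bar> powr \<tau> * \<rho> w))"
      using r by (simp add: ennreal_mult)
  qed
  also have "... = 1 + (\<integral>\<^sup>+w. ennreal (norm (\<bar>w\<bar> powr \<tau> * \<rho> w)) \<partial>lborel)"
    by (subst nn_integral_add) (auto simp: A1_prob)
  also have "... < \<infinity>" using ti by (simp add: integrable_iff_bounded ennreal_add_eq_top less_top)
  finally have sm: "(\<integral>\<^sup>+w. ennreal (\<bar>w\<bar> powr s) \<partial>site_dist \<rho>) < \<infinity>" .
  interpret canopy_model K b \<rho> M s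
    by unfold_locales (use K A1_nonneg A1_prob M s sm in \<open>auto intro: order_trans[OF abs_ge_self]\<close>)
  show ?thesis by (rule canopy_pure_point[OF I_borel A2])
qed

end
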